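(* Let $m$ be a positive integer and let $b:[0,\infty)\to\mathbb{R}$ satisfy conditions (A1), (A2), (A3) recalled in the context, with principal part $\mu$ and oscillating part $\sigma=b-\mu$. Suppose there exist a positive, strictly increasing, continuous function $\Theta$ on $[0,\infty)$ and a positive, monotone, continuous function $\Xi$ on $[0,\infty)$ such that $$\int_t^\infty\left|\int_s^\infty\sigma(\tau)\,d\tau\right|ds\le\frac{1}{\Theta(t)}\quad(t\ge 0),$$ $$\left|\frac{d^k}{dt^k}b(t)\right|\le \Xi(t)^{k+1}\quad(t\ge0,\ k=0,\ldots,m),$$ $$\sup_{t\ge0}\left\{\frac{\Xi(t)}{\Theta(t)}\right\}<\infty$$ and $$\sup_{t\ge0}\left\{\Theta(t)^{-m}\int_0^t\Xi(s)^{m+1}\,ds\right\}<\infty .$$ Then there exists a constant $C>0$ (independent of $t$ and of the initial data) such that for every $(u_0,u_1)\in H^1(\mathbb{R}^n)\times L^2(\mathbb{R}^n)$ the solution $u$ of the Cauchy problem $$\left(\partial_t^2-\Delta+b(t)\partial_t\right)u(t,x)=0\ \text{ in }(0,\infty)\times\mathbb{R}^n,\qquad u(0,x)=u_0(x),\quad \partial_tu(0,x)=u_1(x)$$ satisfies $$E(t;u)\le C\left(E(0;u)+\|u_0\|^2\right)\exp\left(-\int_0^t\mu(s)\,ds\right)\quad\text{for all }t\ge0 .$$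
   Context: $\|\cdot\|$ is the $L^2(\mathbb{R}^n)$ norm, and the total energy is $E(t;u)=\frac12\left(\|\nabla u(t,\cdot)\|^2+\|\partial_tu(t,\cdot)\|^2\right)$. The solution is the usual energy solution $u\in C([0,\infty);H^1)\cap C^1([0,\infty);L^2)$. Conditions on $b$: (A1) There exist $T\ge0$ and a function $\mu$ on $[0,\infty)$ with $\sup_{t\ge T}\{(1+t)\mu(t)\}=:\mu_0<1$, $\mu(t)>0$ and $\mu'(t)<0$ for all $t\ge T$, such that the (improper) integral $\int_0^\infty(b(t)-\mu(t))\,dt$ converges. The function $\mu$ is called the principal part of $b$. (A2) The oscillating part $\sigma(t):=b(t)-\mu(t)$ satisfies $\int_0^\infty\left|\int_s^\infty\sigma(\tau)\,d\tau\right|ds<\infty$. (A3) $b\in C^m([0,\infty))$. *)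

theory Defs
  imports "HOL-Analysis.Analysis"
begin

section \<open>The Lebesgue and Sobolev spaces on \<open>\<real>\<^sup>n\<close>\<close>

text \<open>
  Elements of the function spaces are represented by Borel functions on \<^typ>\<open>real ^ 'n\<close>; every
  class of almost everywhere equal Lebesgue measurable functions contains such a representative.
  Functions are complex valued, real valued ones being a special case.
\<close>

definition L2 :: "((real ^ 'n) \<Rightarrow> complex) set" where
  "L2 = {f \<in> borel_measurable lborel. integrable lborel (\<lambda>x. (cmod (f x))\<^sup>2)}"

definition L2_inner :: "((real ^ 'n) \<Rightarrow> complex) \<Rightarrow> ((real ^ 'n) \<Rightarrow> complex) \<Rightarrow> complex" where
  "L2_inner f g = (LINT x|lborel. f x * cnj (g x))"

definition L2_norm :: "((real ^ 'n) \<Rightarrow> complex) \<Rightarrow> real" where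
  "L2_norm f = sqrt (LINT x|lborel. (cmod (f x))\<^sup>2)"

definition partial_deriv :: "'n \<Rightarrow> ((real ^ 'n) \<Rightarrow> real) \<Rightarrow> (real ^ 'n) \<Rightarrow> real" where
  "partial_deriv i \<phi> x = deriv (\<lambda>h. \<phi> (x + h *\<^sub>R axis i 1)) 0"

primrec iter_partial_deriv :: "'n list \<Rightarrow> ((real ^ 'n) \<Rightarrow> real) \<Rightarrow> (real ^ 'n) \<Rightarrow> real" where
  "iter_partial_deriv [] \<phi> = \<phi>"
| "iter_partial_deriv (i # is) \<phi> = partial_deriv i (iter_partial_deriv is \<phi>)"

text \<open>\<open>C\<^sub>c\<^sup>\<infinity>(\<real>\<^sup>n)\<close>: differentiability of every iterated partial derivative also gives their
  continuity.\<close>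

definition test_function :: "((real ^ 'n) \<Rightarrow> real) \<Rightarrow> bool" where
  "test_function \<phi> \<longleftrightarrow>
     (\<forall>is x. iter_partial_deriv is \<phi> differentiable (at x)) \<and> compact (closure {x. \<phi> x \<noteq> 0})"

definition has_weak_partial ::
    "((real ^ 'n) \<Rightarrow> complex) \<Rightarrow> 'n \<Rightarrow> ((real ^ 'n) \<Rightarrow> complex) \<Rightarrow> bool" where
  "has_weak_partial f i g \<longleftrightarrow>
     (\<forall>\<phi>. test_function \<phi> \<longrightarrow>
       (LINT x|lborel. partial_deriv i \<phi> x *\<^sub>R f x) = - (LINT x|lborel. \<phi> x *\<^sub>R g x))"

definition H1 :: "((real ^ 'n) \<Rightarrow> complex) set" where
  "H1 = {f \<in> L2. \<forall>i. \<exists>g\<in>L2. has_weak_partial f i g}"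

text \<open>Weak derivatives are unique up to null sets, so the choice made here is irrelevant
  (for arguments in \<^const>\<open>H1\<close>); likewise for \<open>time_deriv\<close> below.\<close>

definition weak_partial :: "'n \<Rightarrow> ((real ^ 'n) \<Rightarrow> complex) \<Rightarrow> (real ^ 'n) \<Rightarrow> complex" where
  "weak_partial i f = (SOME g. g \<in> L2 \<and> has_weak_partial f i g)"

section \<open>Energy solutions\<close>

definition L2_continuous :: "(real \<Rightarrow> (real ^ 'n) \<Rightarrow> complex) \<Rightarrow> bool" where
  "L2_continuous f \<longleftrightarrow> (\<forall>t\<ge>0. f t \<in> L2) \<and>
     (\<forall>t\<ge>0. ((\<lambda>s. L2_norm (\<lambda>x. f s x - f t x)) \<longlongrightarrow> 0) (at t within {0..}))"

text \<open>Continuity for the norm given by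
  \<open>\<parallel>f\<parallel>\<^sub>H\<^sub>1\<^sup>2 = \<parallel>f\<parallel>\<^sup>2 + (\<Sum>i. \<parallel>\<partial>\<^sub>i f\<parallel>\<^sup>2)\<close>.\<close>

definition H1_continuous :: "(real \<Rightarrow> (real ^ 'n) \<Rightarrow> complex) \<Rightarrow> bool" where
  "H1_continuous u \<longleftrightarrow> (\<forall>t\<ge>0. u t \<in> H1) \<and> L2_continuous u \<and>
     (\<forall>i. L2_continuous (\<lambda>t. weak_partial i (u t)))"

definition has_time_deriv ::
    "(real \<Rightarrow> (real ^ 'n) \<Rightarrow> complex) \<Rightarrow> ((real ^ 'n) \<Rightarrow> complex) \<Rightarrow> real \<Rightarrow> bool" where
  "has_time_deriv u w t \<longleftrightarrow>
     ((\<lambda>s. L2_norm (\<lambda>x. (u s x - u t x) /\<^sub>R (s - t) - w x)) \<longlongrightarrow> 0) (at t within {0..})"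

definition time_deriv :: "(real \<Rightarrow> (real ^ 'n) \<Rightarrow> complex) \<Rightarrow> real \<Rightarrow> (real ^ 'n) \<Rightarrow> complex" where
  "time_deriv u t = (SOME w. w \<in> L2 \<and> has_time_deriv u w t)"

definition L2_C1 :: "(real \<Rightarrow> (real ^ 'n) \<Rightarrow> complex) \<Rightarrow> bool" where
  "L2_C1 u \<longleftrightarrow> (\<forall>t\<ge>0. u t \<in> L2) \<and> (\<forall>t\<ge>0. \<exists>w\<in>L2. has_time_deriv u w t) \<and>
     L2_continuous (time_deriv u)"

text \<open>The equation \<open>\<partial>\<^sub>t\<^sup>2u - \<Delta>u + b(t)\<partial>\<^sub>tu = 0\<close> is understood in \<open>H\<^sup>-\<^sup>1\<close>, the dual of \<open>H\<^sup>1\<close>, at each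
  time \<open>t > 0\<close>: tested with \<open>v \<in> H\<^sup>1\<close> it reads
  \<open>d/dt \<langle>\<partial>\<^sub>tu, v\<rangle> = - \<langle>\<nabla>u, \<nabla>v\<rangle> - b(t) \<langle>\<partial>\<^sub>tu, v\<rangle>\<close>.  For \<open>u\<close> of the regularity required and continuous
  \<open>b\<close> this is equivalent to the equation in the sense of distributions on \<open>(0,\<infinity>) \<times> \<real>\<^sup>n\<close>.\<close>

definition energy_solution ::
    "(real \<Rightarrow> real) \<Rightarrow> ((real ^ 'n) \<Rightarrow> complex) \<Rightarrow> ((real ^ 'n) \<Rightarrow> complex) \<Rightarrow>
     (real \<Rightarrow> (real ^ 'n) \<Rightarrow> complex) \<Rightarrow> bool" where
  "energy_solution b u0 u1 u \<longleftrightarrow>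
     H1_continuous u \<and> L2_C1 u \<and>
     (AE x in lborel. u 0 x = u0 x) \<and> (AE x in lborel. time_deriv u 0 x = u1 x) \<and>
     (\<forall>v\<in>H1. \<forall>t>0.
       ((\<lambda>s. L2_inner (time_deriv u s) v) has_vector_derivative
          (- (\<Sum>i\<in>UNIV. L2_inner (weak_partial i (u t)) (weak_partial i v))
           - b t *\<^sub>R L2_inner (time_deriv u t) v)) (at t))"

definition energy :: "(real \<Rightarrow> (real ^ 'n) \<Rightarrow> complex) \<Rightarrow> real \<Rightarrow> real" where
  "energy u t = 1 / 2 * ((\<Sum>i\<in>UNIV. (L2_norm (weak_partial i (u t)))\<^sup>2) + (L2_norm (time_deriv u t))\<^sup>2)"

section \<open>Conditions on the coefficient\<close>

text \<open>Functions on \<open>[0,\<infinity>)\<close> are total functions of which only the values on \<open>{0..}\<close> are used;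
  derivatives at \<open>0\<close> are one-sided.\<close>

primrec nth_deriv :: "nat \<Rightarrow> (real \<Rightarrow> real) \<Rightarrow> real \<Rightarrow> real" where
  "nth_deriv 0 f = f"
| "nth_deriv (Suc k) f = (\<lambda>t. vector_derivative (nth_deriv k f) (at t within {0..}))"

definition C_m :: "nat \<Rightarrow> (real \<Rightarrow> real) \<Rightarrow> bool" where
  "C_m m f \<longleftrightarrow>
     (\<forall>k<m. \<forall>t\<ge>0. nth_deriv k f differentiable (at t within {0..})) \<and>
     continuous_on {0..} (nth_deriv m f)"

text \<open>Henstock-Kurzweil integrability on an unbounded interval \<open>{s..}\<close> is exactly convergence of the
  improper integral: \<open>f\<close> is integrable on each \<open>{s..R}\<close> and \<open>integral {s..R} f\<close> converges as
  \<open>R \<longrightarrow> \<infinity>\<close>, the limit being \<open>integral {s..} f\<close>.  Absolute convergence is not implied.\<close>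

definition principal_part :: "(real \<Rightarrow> real) \<Rightarrow> (real \<Rightarrow> real) \<Rightarrow> bool" where
  "principal_part b \<mu> \<longleftrightarrow>
     (\<exists>T\<ge>0.
       bdd_above ((\<lambda>t. (1 + t) * \<mu> t) ` {T..}) \<and> (SUP t\<in>{T..}. (1 + t) * \<mu> t) < 1 \<and>
       (\<forall>t\<ge>T. \<mu> t > 0) \<and>
       (\<forall>t\<ge>T. \<exists>d<0. (\<mu> has_real_derivative d) (at t within {0..}))) \<and>
     (\<lambda>t. b t - \<mu> t) integrable_on {0..}"

definition abs_tail :: "(real \<Rightarrow> real) \<Rightarrow> real \<Rightarrow> real" where
  "abs_tail \<sigma> s = \<bar>integral {s..} \<sigma>\<bar>"

end

theory Submission
  imports Defs "HOL-Computational_Algebra.Polynomial"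
begin

text \<open>
  An oscillator \<open>v'' + b v' + l\<^sup>2 v = e\<close> of frequency \<open>l\<close> is estimated with a different modified
  energy in each of three zones.  As long as \<open>l (1 + t) \<le> 1\<close>, which requires small \<open>l\<close>, one compares
  with the solutions for \<open>l = 0\<close>.  As long as \<open>\<Theta>(t)\<close> is small compared with \<open>l\<close>, \<open>m\<close> steps of the WKB
  iteration solve the Riccati equation up to a relative error of size \<open>\<Xi>\<^sup>m\<^sup>+\<^sup>1 l\<^sup>-\<^sup>m\<close>, which has
  bounded integral.  At all later times the factor \<open>exp (- \<integral>\<^sub>t\<^sup>\<infinity> \<sigma>)\<close> removes the oscillating part of
  \<open>b\<close> from the energy; the remaining error \<open>l |\<integral>\<^sub>t\<^sup>\<infinity> \<sigma>|\<close> has an integral of size \<open>l / \<Theta>\<close>, which is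
  bounded there.  The constants do not depend on \<open>l\<close>.

  The reduction of the wave equation to oscillators avoids the Fourier transform.  After mollification in
  \<open>x\<close> the operator \<open>- \<Delta>\<close> is replaced by its difference analogue, a bounded positive operator \<open>\<Lambda> H\<close> with
  \<open>0 \<le> H \<le> 1\<close>.  The Bernstein polynomials \<open>B\<^sub>k\<close> of degree \<open>n\<close> give positive semi-definite forms
  \<open>\<langle>B\<^sub>k(H) x, y\<rangle>\<close> which sum up to the inner product, and with respect to the \<open>k\<close>-th form the solution is an
  oscillator with \<open>l\<^sup>2 = \<Lambda> k / n\<close> up to an error \<open>e\<close>.  The variance of the Bernstein polynomials makes
  these errors vanish as \<open>n \<rightarrow> \<infinity>\<close>; finally the mesh and the mollifier are sent to zero.
\<close>

section \<open>The oscillator equation\<close>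

text \<open>The Bernstein cells only imitate a spectral decomposition, so every estimate must
  tolerate an error e. Its accumulated size \<open>N\<close> enters linearly, with a factor that may
  grow with t but depends on neither l nor the operator. The errors vanish at fixed t, so only the
  factor of the initial energy has to be uniform in t. The zones see nothing of the space but a, c,
  d and \<open>c\<^sup>2 \<le> a * d\<close>; this is why semi-definite forms are enough.

  For l = 0 the second solution is the integral of exp(- \<integral> b), comparable with that of
  exp(- \<integral> \<mu>). The bound (1 + t) \<mu> <= \<mu>0 < 1 makes (1 + t) exp(- \<integral>
  \<mu>) grow at least at the rate (1 - \<mu>0) exp(- \<integral> \<mu>) and so dominate this
  solution. While l (1 + t) <= 1, the potential energy then decays as required, at the price of
  |v(0)|^2 without a factor l^2; hence ||u_0||^2 in the result. The same bound gives \<mu>(t) <= l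
  as soon as l (1 + t) >= 1, which keeps the modified energy of the last zone comparable with the
  true one.\<close>

lemma nonincreasing_on_Icc:
  fixes g g' :: "real \<Rightarrow> real"
  assumes "s \<le> t"
    and dg: "\<And>x. x \<in> {s..t} \<Longrightarrow> (g has_real_derivative g' x) (at x within {s..t})"
    and neg: "\<And>x. x \<in> {s..t} \<Longrightarrow> g' x \<le> 0"
  shows "g t \<le> g s"
proof (rule DERIV_nonpos_imp_decreasing_open[OF \<open>s \<le> t\<close>])
  fix x assume "s < x" "x < t"
  then have "x \<in> {s..t}" and at: "at x within {s..t} = at x" by (auto intro: at_within_Icc_at)
  then show "\<exists>y. (g has_real_derivative y) (at x) \<and> y \<le> 0"
    using dg[OF \<open>x \<in> {s..t}\<close>] neg[OF \<open>x \<in> {s..t}\<close>] by (metis at)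
next
  show "continuous_on {s..t} g" using dg by (rule DERIV_continuous_on)
qed

lemma nondecreasing_on_Icc:
  fixes g g' :: "real \<Rightarrow> real"
  assumes "s \<le> t"
    and "\<And>x. x \<in> {s..t} \<Longrightarrow> (g has_real_derivative g' x) (at x within {s..t})"
    and "\<And>x. x \<in> {s..t} \<Longrightarrow> 0 \<le> g' x"
  shows "g s \<le> g t"
  using nonincreasing_on_Icc[of s t "\<lambda>x. - g x" "\<lambda>x. - g' x"] assms
  by (auto intro!: derivative_eq_intros)

text \<open>The integrating factor \<open>exp (\<phi> t - \<phi> x)\<close> is kept exactly for the
  initial value, while the perturbation only sees its upper bound \<open>exp B\<close>; so the first
  term retains the full decay even if \<open>\<phi>\<close> is not monotone. The perturbation is
  given through a primitive \<open>N\<close>, and no integral of \<open>\<eta>\<close> has to be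
  formed.\<close>

lemma gronwall_perturbed:
  fixes g g' \<phi> \<phi>' N \<eta> :: "real \<Rightarrow> real"
  assumes "s \<le> t"
    and dg: "\<And>x. x \<in> {s..t} \<Longrightarrow> (g has_real_derivative g' x) (at x within {s..t})"
    and d\<phi>: "\<And>x. x \<in> {s..t} \<Longrightarrow> (\<phi> has_real_derivative \<phi>' x) (at x within {s..t})"
    and dN: "\<And>x. x \<in> {s..t} \<Longrightarrow> (N has_real_derivative \<eta> x) (at x within {s..t})"
    and le: "\<And>x. x \<in> {s..t} \<Longrightarrow> g' x \<le> \<phi>' x * g x + k * \<eta> x"
    and B: "\<And>x. x \<in> {s..t} \<Longrightarrow> \<phi> t - \<phi> x \<le> B"
    and \<eta>: "\<And>x. x \<in> {s..t} \<Longrightarrow> 0 \<le> \<eta> x" and "0 \<le> k"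
  shows "g t \<le> exp (\<phi> t - \<phi> s) * g s + k * exp B * (N t - N s)"
proof -
  let ?h = "\<lambda>x. exp (\<phi> t - \<phi> x) * g x - k * exp B * N x"
  let ?h' = "\<lambda>x. exp (\<phi> t - \<phi> x) * (- \<phi>' x) * g x + g' x * exp (\<phi> t - \<phi> x) - k * exp B * \<eta> x"
  have dh: "(?h has_real_derivative ?h' x) (at x within {s..t})" if "x \<in> {s..t}" for x
    by (auto intro!: derivative_eq_intros dg[OF that] d\<phi>[OF that] dN[OF that] simp: algebra_simps)
  have neg: "?h' x \<le> 0" if x: "x \<in> {s..t}" for x
  proof -
    have "?h' x = exp (\<phi> t - \<phi> x) * (g' x - \<phi>' x * g x) - k * exp B * \<eta> x"
      by (simp add: algebra_simps)
    also have "\<dots> \<le> exp (\<phi> t - \<phi> x) * (k * \<eta> x) - k * exp B * \<eta> x"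
      using le[OF x] by (intro diff_right_mono mult_left_mono) auto
    also have "\<dots> \<le> exp B * (k * \<eta> x) - k * exp B * \<eta> x"
      using B[OF x] \<eta>[OF x] \<open>0 \<le> k\<close> by (intro diff_right_mono mult_right_mono) auto
    finally show ?thesis by simp
  qed
  from nonincreasing_on_Icc[OF \<open>s \<le> t\<close> dh neg] have "?h t \<le> ?h s" .
  then show ?thesis by (simp add: algebra_simps)
qed

text \<open>Young's inequality for a mixed term, without square roots of \<open>a\<close> and
  \<open>d\<close>; the weight \<open>k\<close> balances the two squares.\<close>

lemma two_mult_le_of_square_le:
  fixes a c d k :: real
  assumes "c\<^sup>2 \<le> a * d" "0 \<le> a" "0 \<le> d" "0 \<le> k"
  shows "2 * k * \<bar>c\<bar> \<le> d + k\<^sup>2 * a"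
proof -
  have "(2 * k * \<bar>c\<bar>)\<^sup>2 = 4 * k\<^sup>2 * c\<^sup>2" by (simp add: power_mult_distrib)
  also have "\<dots> \<le> 4 * k\<^sup>2 * (a * d)" using assms(1) by (intro mult_left_mono) auto
  also have "\<dots> \<le> (d + k\<^sup>2 * a)\<^sup>2"
    using zero_le_power2[of "d - k\<^sup>2 * a"] by (simp add: power2_eq_square algebra_simps)
  finally have "(2 * k * \<bar>c\<bar>)\<^sup>2 \<le> (d + k\<^sup>2 * a)\<^sup>2" .
  then show ?thesis using assms by (auto intro: power2_le_imp_le)
qed

text \<open>The scalar products \<open>a = |v|\<^sup>2\<close>, \<open>c = (v,v')\<close>, \<open>d = |v'|\<^sup>2\<close> of a solution of
  \<open>v'' + b v' + l\<^sup>2 v = e\<close> with values in a space with a semi-definite inner product;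
  \<open>f = (v,e)\<close> and \<open>g = (v',e)\<close>.\<close>

locale energy_triple =
  fixes b a c d f g \<eta> N :: "real \<Rightarrow> real" and l \<tau> :: real
  assumes l: "0 \<le> l" and \<tau>: "0 \<le> \<tau>"
    and da: "\<And>t. t \<in> {0..\<tau>} \<Longrightarrow> (a has_real_derivative 2 * c t) (at t within {0..\<tau>})"
    and dc: "\<And>t. t \<in> {0..\<tau>} \<Longrightarrow>
      (c has_real_derivative d t - b t * c t - l\<^sup>2 * a t + f t) (at t within {0..\<tau>})"
    and dd: "\<And>t. t \<in> {0..\<tau>} \<Longrightarrow>
      (d has_real_derivative - 2 * b t * d t - 2 * l\<^sup>2 * c t + 2 * g t) (at t within {0..\<tau>})"
    and dN: "\<And>t. t \<in> {0..\<tau>} \<Longrightarrow> (N has_real_derivative \<eta> t) (at t within {0..\<tau>})"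
    and a: "\<And>t. t \<in> {0..\<tau>} \<Longrightarrow> 0 \<le> a t" and d: "\<And>t. t \<in> {0..\<tau>} \<Longrightarrow> 0 \<le> d t"
    and cs: "\<And>t. t \<in> {0..\<tau>} \<Longrightarrow> (c t)\<^sup>2 \<le> a t * d t"
    and f: "\<And>t. t \<in> {0..\<tau>} \<Longrightarrow> (1 + l) * \<bar>f t\<bar> \<le> \<eta> t"
    and g: "\<And>t. t \<in> {0..\<tau>} \<Longrightarrow> \<bar>g t\<bar> \<le> \<eta> t"
begin

lemma \<eta>: "0 \<le> \<eta> t" if "t \<in> {0..\<tau>}"
  using g[OF that] by linarith

text \<open>The factor \<open>1 + l\<close> in the hypothesis on \<open>f\<close> covers both uses
  of (v, e): in the dissipative zone its weight does not become small with l, in the other two zones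
  it is at most of order l.\<close>

lemma f_le: "\<bar>f t\<bar> \<le> \<eta> t" and l_f_le: "l * \<bar>f t\<bar> \<le> \<eta> t" if "t \<in> {0..\<tau>}"
proof -
  have "0 \<le> l * \<bar>f t\<bar>" using l by simp
  then show "\<bar>f t\<bar> \<le> \<eta> t" "l * \<bar>f t\<bar> \<le> \<eta> t"
    using f[OF that] by (auto simp: algebra_simps)
qed

lemmas derivs = da dc dd dN

lemma derivs_sub:
  assumes "0 \<le> s" "t \<le> \<tau>" "x \<in> {s..t}"
  shows "(a has_real_derivative 2 * c x) (at x within {s..t})"
    "(c has_real_derivative d x - b x * c x - l\<^sup>2 * a x + f x) (at x within {s..t})"
    "(d has_real_derivative - 2 * b x * d x - 2 * l\<^sup>2 * c x + 2 * g x) (at x within {s..t})"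
    "(N has_real_derivative \<eta> x) (at x within {s..t})"
proof -
  have sub: "{s..t} \<subseteq> {0..\<tau>}" and x: "x \<in> {0..\<tau>}" using assms by auto
  note derivs[OF x, THEN has_field_derivative_subset, OF sub]
  then show "(a has_real_derivative 2 * c x) (at x within {s..t})"
    "(c has_real_derivative d x - b x * c x - l\<^sup>2 * a x + f x) (at x within {s..t})"
    "(d has_real_derivative - 2 * b x * d x - 2 * l\<^sup>2 * c x + 2 * g x) (at x within {s..t})"
    "(N has_real_derivative \<eta> x) (at x within {s..t})" by blast+
qed

lemma N_mono: "N s \<le> N t" if "0 \<le> s" "s \<le> t" "t \<le> \<tau>"
  using nondecreasing_on_Icc[OF \<open>s \<le> t\<close> derivs_sub(4)[OF \<open>0 \<le> s\<close> \<open>t \<le> \<tau>\<close>]] \<eta> that by auto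

text \<open>With the weight \<open>1 + l\<^sup>2\<close> the terms l^2 c cancel and only 2 c <= a +
  d remains, so the rate does not depend on l. This serves the interval [0, T], where \<mu> obeys no
  pointwise condition.\<close>

lemma crude_bound:
  assumes "0 \<le> s" "s \<le> t" "t \<le> \<tau>" and B: "\<And>x. x \<in> {s..t} \<Longrightarrow> \<bar>b x\<bar> \<le> B"
  shows "d t + (1 + l\<^sup>2) * a t \<le> exp ((2 * B + 1) * (t - s)) * (d s + (1 + l\<^sup>2) * a s + 2 * (N t - N s))"
proof -
  have "d t + (1 + l\<^sup>2) * a t \<le> exp ((2 * B + 1) * t - (2 * B + 1) * s) * (d s + (1 + l\<^sup>2) * a s)
     + 2 * exp ((2 * B + 1) * (t - s)) * (N t - N s)"
  proof (rule gronwall_perturbed[where N = N and g = "\<lambda>x. d x + (1 + l\<^sup>2) * a x" and \<phi> = "\<lambda>x. (2 * B + 1) * x" and \<phi>' = "\<lambda>x. 2 * B + 1"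
      and \<eta> = \<eta> and g' = "\<lambda>x. (- 2 * b x * d x - 2 * l\<^sup>2 * c x + 2 * g x) + (1 + l\<^sup>2) * (2 * c x)"])
    fix x assume x: "x \<in> {s..t}"
    then have x': "x \<in> {0..\<tau>}" using assms by auto
    note D = derivs_sub[OF \<open>0 \<le> s\<close> \<open>t \<le> \<tau>\<close> x]
    show "((\<lambda>x. d x + (1 + l\<^sup>2) * a x) has_real_derivative - 2 * b x * d x - 2 * l\<^sup>2 * c x + 2 * g x + (1 + l\<^sup>2) * (2 * c x))
          (at x within {s..t})"
      by (auto intro!: derivative_eq_intros D)
    have "2 * c x \<le> a x + d x"
      using two_mult_le_of_square_le[OF cs[OF x'] a[OF x'] d[OF x'], of 1] by simp
    moreover have "- 2 * b x * d x \<le> 2 * B * d x"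
      using B[OF x] d[OF x'] mult_right_mono[of "- b x" B "d x"] by (simp add: abs_le_iff)
    moreover have "0 \<le> 2 * B * ((1 + l\<^sup>2) * a x)" "0 \<le> l\<^sup>2 * a x"
      using a[OF x'] B[OF x] by (auto intro!: mult_nonneg_nonneg)
    moreover have "2 * g x \<le> 2 * \<eta> x" using g[OF x'] by linarith
    ultimately show "- 2 * b x * d x - 2 * l\<^sup>2 * c x + 2 * g x + (1 + l\<^sup>2) * (2 * c x)
         \<le> (2 * B + 1) * (d x + (1 + l\<^sup>2) * a x) + 2 * \<eta> x"
      by (simp add: algebra_simps)
    show "(N has_real_derivative \<eta> x) (at x within {s..t})" by (rule D)
    show "0 \<le> \<eta> x" by (rule \<eta>[OF x'])
    have "0 \<le> B" using B[OF x] by linarith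
    then show "(2 * B + 1) * t - (2 * B + 1) * x \<le> (2 * B + 1) * (t - s)"
      using x mult_left_mono[of s x "2 * B + 1"] by (simp add: right_diff_distrib)
    show "((\<lambda>x. (2 * B + 1) * x) has_real_derivative 2 * B + 1) (at x within {s..t})"
      by (auto intro!: derivative_eq_intros)
  qed (use assms in auto)
  then show ?thesis by (simp add: algebra_simps)
qed

end

section \<open>Late times: removal of the oscillating part\<close>

lemma exp_minus_diff_le: "\<bar>1 - exp (- x)\<bar> \<le> exp q * \<bar>x\<bar>" if "\<bar>x\<bar> \<le> q" for x q :: real
proof -
  have "\<bar>1 - exp (- x)\<bar> \<le> exp \<bar>x\<bar> * \<bar>x\<bar>"
  proof (cases "x \<ge> 0")
    case True
    have "1 - x \<le> exp (- x)" using exp_ge_add_one_self[of "- x"] by simp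
    moreover have "x \<le> exp x * x" using True by (simp add: mult_le_cancel_right1)
    ultimately show ?thesis using True by simp
  next
    case False
    have "1 + x \<le> exp x" using exp_ge_add_one_self[of x] by simp
    then have "exp (- x) * (1 + x) \<le> exp (- x) * exp x" by (intro mult_left_mono) auto
    then show ?thesis using False by (simp add: algebra_simps exp_minus_inverse)
  qed
  also have "\<dots> \<le> exp q * \<bar>x\<bar>" using that by (intro mult_right_mono) auto
  finally show ?thesis .
qed

text \<open>For \<open>p = exp (- S)\<close> the left-hand side of the last inequality is \<open>G' + \<mu> G\<close> along an oscillator.\<close>

lemma stabilized_rate:
  fixes a c d l p q s \<mu> \<mu>' f g \<eta> :: real
  assumes l: "0 < l" and ad: "0 \<le> a" "0 \<le> d" "c\<^sup>2 \<le> a * d"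
    and \<mu>: "0 < \<mu>" "\<mu> \<le> l" "\<mu>' < 0" and p: "0 < p" "1 \<le> q * p" "p \<le> q" and q: "1 \<le> q"
    and s: "\<bar>1 - p\<bar> \<le> q * s" and fg: "l * \<bar>f\<bar> \<le> \<eta>" "\<bar>g\<bar> \<le> \<eta>"
  defines "F \<equiv> p\<^sup>2 * d + l\<^sup>2 * a"
  defines "G \<equiv> F + \<mu> * p * c"
  shows "F \<le> 2 * G" "2 * G \<le> 3 * F"
    and "- \<mu> * p\<^sup>2 * d + \<mu> * p * d + \<mu> * l\<^sup>2 * a * (1 - p) + (2 * l\<^sup>2 * (1 - p\<^sup>2) + \<mu>' * p) * c
        + 2 * p\<^sup>2 * g + \<mu> * p * f \<le> (6 * q\<^sup>2 * l * s - \<mu>' / l) * G + 3 * q\<^sup>2 * \<eta>" (is "?lhs \<le> _")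
proof -
  have pc: "2 * l * p * \<bar>c\<bar> \<le> F"
  proof -
    have "(p * c)\<^sup>2 \<le> a * (p\<^sup>2 * d)"
      using mult_left_mono[OF ad(3), of "p\<^sup>2"] by (simp add: power_mult_distrib algebra_simps)
    from two_mult_le_of_square_le[OF this] show ?thesis
      using ad p l by (simp add: F_def abs_mult mult.assoc)
  qed
  have F0: "0 \<le> F" using ad by (simp add: F_def)
  have "\<mu> * (p * \<bar>c\<bar>) \<le> l * (p * \<bar>c\<bar>)" using \<mu> p by (intro mult_right_mono) auto
  then have "2 * (\<mu> * (p * \<bar>c\<bar>)) \<le> F" using pc by simp
  then have "2 * \<bar>\<mu> * p * c\<bar> \<le> F" using \<mu> p by (simp add: abs_mult mult.assoc)
  then show FG: "F \<le> 2 * G" "2 * G \<le> 3 * F" by (auto simp: G_def abs_le_iff)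
  have s0: "0 \<le> s" using s q by (smt (verit) mult_less_0_iff zero_less_mult_iff)
  have \<eta>0: "0 \<le> \<eta>" using fg by linarith
  \<comment> \<open>Here \<mu> <= l turns the defect of replacing p by 1 into l |S|, whose integral
    is controlled by the stabilization condition.\<close>
  have m: "\<mu> * (1 - p) \<le> l * (q * s)"
  proof -
    have "\<mu> * (1 - p) \<le> \<mu> * \<bar>1 - p\<bar>" using \<mu> by (intro mult_left_mono) auto
    also have "\<dots> \<le> l * (q * s)" using s \<mu> by (intro mult_mono) auto
    finally show ?thesis .
  qed
  have t1: "- \<mu> * p\<^sup>2 * d + \<mu> * p * d \<le> l * (q\<^sup>2 * s) * (p\<^sup>2 * d)"
  proof -
    have "- \<mu> * p\<^sup>2 * d + \<mu> * p * d = \<mu> * (1 - p) * (p * d)" by (simp add: power2_eq_square algebra_simps)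
    also have "\<dots> \<le> l * (q * s) * (p * d)"
      using m ad p by (intro mult_right_mono) auto
    also have "\<dots> \<le> l * (q * s) * (q * p * (p * d))"
      using p ad l q s0 mult_right_mono[OF p(2), of "p * d"] by (intro mult_left_mono) auto
    finally show ?thesis by (simp add: power2_eq_square algebra_simps)
  qed
  have t2: "\<mu> * l\<^sup>2 * a * (1 - p) \<le> l * (q\<^sup>2 * s) * (l\<^sup>2 * a)"
  proof -
    have "\<mu> * l\<^sup>2 * a * (1 - p) = \<mu> * (1 - p) * (l\<^sup>2 * a)" by simp
    also have "\<dots> \<le> l * (q * s) * (l\<^sup>2 * a)"
      using m ad by (intro mult_right_mono) auto
    also have "\<dots> \<le> l * (q\<^sup>2 * s) * (l\<^sup>2 * a)"
      using q s0 l ad by (intro mult_right_mono mult_left_mono) (auto simp: power2_eq_square mult_le_cancel_right1)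
    finally show ?thesis .
  qed
  have t3: "2 * l\<^sup>2 * (1 - p\<^sup>2) * c \<le> l * (2 * q\<^sup>2 * s) * F"
  proof -
    have "2 * l\<^sup>2 * (1 - p\<^sup>2) * c \<le> \<bar>2 * l\<^sup>2 * (1 - p\<^sup>2) * c\<bar>" by simp
    also have "\<dots> = 2 * l\<^sup>2 * (\<bar>1 - p\<bar> * (1 + p)) * \<bar>c\<bar>"
    proof -
      have "1 - p\<^sup>2 = (1 - p) * (1 + p)" by (simp add: power2_eq_square algebra_simps)
      then have "\<bar>1 - p\<^sup>2\<bar> = \<bar>1 - p\<bar> * (1 + p)" using p by (simp add: abs_mult)
      then show ?thesis by (simp add: abs_mult)
    qed
    also have "\<dots> \<le> 2 * l\<^sup>2 * ((q * s) * (2 * q * p)) * \<bar>c\<bar>"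
    proof -
      have "p \<le> q * p" using p q by (simp add: mult_le_cancel_right1)
      then have "1 + p \<le> 2 * q * p" using p by linarith
      then show ?thesis using s s0 p q by (intro mult_right_mono mult_left_mono mult_mono) auto
    qed
    also have "\<dots> = l * (2 * q\<^sup>2 * s) * (2 * l * p * \<bar>c\<bar>)" by (simp add: power2_eq_square algebra_simps)
    also have "\<dots> \<le> l * (2 * q\<^sup>2 * s) * F" using pc l s0 by (intro mult_left_mono) auto
    finally show ?thesis .
  qed
  \<comment> \<open>This term has no sign. Since 2 l p |c| <= F, it costs the rate - \<mu>' / l, and
    because \<mu> decreases the integral of that rate is at most \<mu> / l <= 1.\<close>
  have t4: "\<mu>' * p * c \<le> - \<mu>' / l * G"
  proof -
    have "\<mu>' * (p * c) \<le> \<bar>\<mu>' * (p * c)\<bar>" by simp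
    also have "\<dots> = - \<mu>' / (2 * l) * (2 * l * p * \<bar>c\<bar>)" using \<mu> l p by (simp add: abs_mult)
    also have "\<dots> \<le> - \<mu>' / (2 * l) * F" using pc \<mu> l by (intro mult_left_mono) (auto simp: divide_nonpos_pos)
    also have "\<dots> \<le> - \<mu>' / (2 * l) * (2 * G)" using FG \<mu> l by (intro mult_left_mono) (auto simp: divide_nonpos_pos)
    finally show ?thesis by simp
  qed
  have t5: "2 * p\<^sup>2 * g + \<mu> * p * f \<le> 3 * q\<^sup>2 * \<eta>"
  proof -
    have "p\<^sup>2 * g \<le> q\<^sup>2 * \<eta>"
    proof -
      have "p\<^sup>2 * g \<le> p\<^sup>2 * \<eta>" using fg by (intro mult_left_mono) auto
      also have "\<dots> \<le> q\<^sup>2 * \<eta>" using p \<eta>0 by (intro mult_right_mono power_mono) auto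
      finally show ?thesis .
    qed
    moreover have "\<mu> * p * f \<le> q\<^sup>2 * \<eta>"
    proof -
      have "\<mu> * p * f \<le> p * (\<mu> * \<bar>f\<bar>)" using \<mu> p by (simp add: mult.left_commute mult_left_mono)
      also have "\<dots> \<le> q * (l * \<bar>f\<bar>)" using p \<mu> by (intro mult_mono) auto
      also have "\<dots> \<le> q * \<eta>" using q fg by (intro mult_left_mono) auto
      also have "\<dots> \<le> q\<^sup>2 * \<eta>" using q \<eta>0 by (intro mult_right_mono) (auto simp: power2_eq_square)
      finally show ?thesis .
    qed
    ultimately show ?thesis by simp
  qed
  have "?lhs \<le> 3 * q\<^sup>2 * l * s * F + - \<mu>' / l * G + 3 * q\<^sup>2 * \<eta>"
    using t1 t2 t3 t4 t5 unfolding F_def by (simp add: algebra_simps)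
  also have "3 * q\<^sup>2 * l * s * F \<le> 3 * q\<^sup>2 * l * s * (2 * G)"
    using FG l s0 by (intro mult_left_mono) auto
  finally show "?lhs \<le> (6 * q\<^sup>2 * l * s - \<mu>' / l) * G + 3 * q\<^sup>2 * \<eta>" by (simp add: algebra_simps)
qed

text \<open>\<open>S\<close> stands for \<open>\<integral>\<^sub>t\<^sup>\<infinity> (b - \<mu>)\<close>.\<close>

locale stabilized_damping =
  fixes T \<mu>0 S0 :: real and b \<mu> S \<Theta> :: "real \<Rightarrow> real"
  assumes T: "0 \<le> T" and \<mu>0: "0 \<le> \<mu>0" "\<mu>0 < 1"
    and b: "continuous_on {0..} b"
    and \<mu>': "\<And>t. T \<le> t \<Longrightarrow> \<exists>d<0. (\<mu> has_real_derivative d) (at t within {0..})"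
    and \<mu>_pos: "\<And>t. T \<le> t \<Longrightarrow> 0 < \<mu> t" and \<mu>_le: "\<And>t. T \<le> t \<Longrightarrow> (1 + t) * \<mu> t \<le> \<mu>0"
    and S': "\<And>t. T \<le> t \<Longrightarrow> (S has_real_derivative \<mu> t - b t) (at t within {T..})"
    and S: "\<And>t. T \<le> t \<Longrightarrow> \<bar>S t\<bar> \<le> S0"
    and \<Theta>: "\<And>t. 0 \<le> t \<Longrightarrow> 0 < \<Theta> t" "mono_on {0..} \<Theta>" "continuous_on {0..} \<Theta>"
    and tail: "\<And>s t. T \<le> s \<Longrightarrow> s \<le> t \<Longrightarrow> integral {s..t} (\<lambda>x. \<bar>S x\<bar>) \<le> 1 / \<Theta> s"
begin

definition "I t = integral {T..t} \<mu>"

lemma \<mu>_cont: "continuous_on {T..} \<mu>"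
proof -
  have "\<exists>d. (\<mu> has_real_derivative d) (at t within {T..})" if "t \<in> {T..}" for t
    using \<mu>'[of t] that T by (auto intro: has_field_derivative_subset)
  then show ?thesis by (meson DERIV_continuous continuous_on_eq_continuous_within)
qed

lemma I_deriv: "(I has_real_derivative \<mu> t) (at t within {s..u})" if "T \<le> s" "t \<in> {s..u}"
proof -
  have "((\<lambda>t. integral {T..t} \<mu>) has_real_derivative \<mu> t) (at t within {T..u})"
    using that by (intro integral_has_real_derivative continuous_on_subset[OF \<mu>_cont]) auto
  then show ?thesis unfolding I_def[abs_def] using that by (auto intro: has_field_derivative_subset)
qed

lemma I_T [simp]: "I T = 0" by (simp add: I_def)

lemma I_mono: "I s \<le> I t" if "T \<le> s" "s \<le> t"
proof (rule nondecreasing_on_Icc[OF \<open>s \<le> t\<close> I_deriv[OF \<open>T \<le> s\<close>]])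
  show "0 \<le> \<mu> x" if "x \<in> {s..t}" for x using \<mu>_pos[of x] that \<open>T \<le> s\<close> by auto
qed

lemma S_deriv: "(S has_real_derivative \<mu> t - b t) (at t within {s..u})" if "T \<le> s" "t \<in> {s..u}"
  using S'[of t] that by (auto intro: has_field_derivative_subset)

lemma S_cont: "continuous_on {T..} S"
  using S' by (intro DERIV_continuous_on) auto

lemma S0: "0 \<le> S0" using S[of T] by simp

text \<open>Since p = exp(- S) satisfies p' = (b - \<mu>) p, the curve p v' is damped by \<mu>
  alone: (p v')' = - \<mu> p v' - l^2 p v + p e. Up to errors its energy \<open>F\<close> loses 2
  \<mu> |p v'|^2, and the term \<mu> p (v, v') in \<open>G\<close> shifts half of this loss to l^2
  |v|^2, so that \<open>G\<close> as a whole decays at the rate \<mu>.\<close>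

lemma stabilized_zone:
  assumes "energy_triple b a c d f g \<eta> N l \<tau>"
    and lp: "0 < l" and st: "T \<le> s" "s \<le> t" "t \<le> \<tau>" and ls: "\<mu> s \<le> l" "l / \<Theta> s \<le> L"
  defines "q \<equiv> exp S0"
  shows "d t + l\<^sup>2 * a t \<le> 3 * q ^ 4 * exp (6 * q\<^sup>2 * L + 1) *
           (exp (I s - I t) * (d s + l\<^sup>2 * a s) + 2 * (N t - N s))"
proof -
  interpret energy_triple b a c d f g \<eta> N l \<tau> by (rule assms(1))
  have "\<forall>x\<in>{s..t}. \<exists>z. z < 0 \<and> (\<mu> has_real_derivative z) (at x within {s..t})"
  proof
    fix x assume x: "x \<in> {s..t}"
    then have "T \<le> x" using st by auto
    then obtain z where "z < 0" "(\<mu> has_real_derivative z) (at x within {0..})" using \<mu>' by blast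
    moreover have sub: "{s..t} \<subseteq> {0..}" using st T by auto
    ultimately show "\<exists>z. z < 0 \<and> (\<mu> has_real_derivative z) (at x within {s..t})"
      using has_field_derivative_subset[OF _ sub] by blast
  qed
  from bchoice[OF this] obtain \<mu>' where \<mu>': "\<And>x. x \<in> {s..t} \<Longrightarrow> \<mu>' x < 0"
      "\<And>x. x \<in> {s..t} \<Longrightarrow> (\<mu> has_real_derivative \<mu>' x) (at x within {s..t})" by blast
  have \<mu>_anti: "\<mu> x \<le> \<mu> s" if "x \<in> {s..t}" for x
  proof (rule nonincreasing_on_Icc[where g = \<mu> and g' = \<mu>'])
    fix y assume "y \<in> {s..x}"
    then have y: "y \<in> {s..t}" using that by auto
    show "(\<mu> has_real_derivative \<mu>' y) (at y within {s..x})"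
      using \<mu>'(2)[OF y] by (rule has_field_derivative_subset) (use that in auto)
    show "\<mu>' y \<le> 0" using \<mu>'(1)[OF y] by simp
  qed (use that in auto)
  define p where "p x = exp (- S x)" for x
  define J where "J x = integral {s..x} (\<lambda>x. \<bar>S x\<bar>)" for x
  define F where "F x = (p x)\<^sup>2 * d x + l\<^sup>2 * a x" for x
  define G where "G x = F x + \<mu> x * p x * c x" for x
  define G' where "G' x = - \<mu> x * G x + (- \<mu> x * (p x)\<^sup>2 * d x + \<mu> x * p x * d x + \<mu> x * l\<^sup>2 * a x * (1 - p x)
        + (2 * l\<^sup>2 * (1 - (p x)\<^sup>2) + \<mu>' x * p x) * c x + 2 * (p x)\<^sup>2 * g x + \<mu> x * p x * f x)" for x
  \<comment> \<open>Besides the decay the exponent contains a primitive of l |S| and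
    \<open>- \<mu> x / l\<close>. Both vary by a bounded amount, because l / \<Theta>(s) <= L and
    \<mu> <= l.\<close>
  define \<phi> where "\<phi> x = - I x + 6 * q\<^sup>2 * l * J x - \<mu> x / l" for x
  have q: "1 \<le> q" using S0 by (simp add: q_def)
  have p: "0 < p x" "1 \<le> q * p x" "p x \<le> q" if "x \<in> {s..t}" for x
    using S[of x] that st by (auto simp: p_def q_def exp_add[symmetric] abs_le_iff)
  have x0: "x \<in> {0..\<tau>}" if "x \<in> {s..t}" for x using that st T by auto
  have rate: "F x \<le> 2 * G x \<and> 2 * G x \<le> 3 * F x \<and>
      G' x \<le> (- \<mu> x + 6 * q\<^sup>2 * l * \<bar>S x\<bar> - \<mu>' x / l) * G x + 3 * q\<^sup>2 * \<eta> x" if x: "x \<in> {s..t}" for x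
  proof -
    note r = stabilized_rate[OF lp a[OF x0[OF x]] d[OF x0[OF x]] cs[OF x0[OF x]] \<mu>_pos[of x] _
       \<mu>'(1)[OF x] p[OF x] q _ l_f_le[OF x0[OF x]] g[OF x0[OF x]], where s = "\<bar>S x\<bar>"]
    have "\<bar>1 - p x\<bar> \<le> q * \<bar>S x\<bar>" using S[of x] x st by (auto simp: p_def q_def intro: exp_minus_diff_le)
    moreover have "\<mu> x \<le> l" "T \<le> x" using \<mu>_anti[OF x] ls x st by auto
    ultimately show ?thesis using r
      unfolding G'_def G_def F_def by (simp add: algebra_simps)
  qed
  have dG: "(G has_real_derivative G' x) (at x within {s..t})" if x: "x \<in> {s..t}" for x
  proof -
    have s0: "0 \<le> s" using st T by simp
    have dp: "(p has_real_derivative p x * (b x - \<mu> x)) (at x within {s..t})"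
      unfolding p_def[abs_def] using S_deriv[OF st(1) x] by (auto intro!: derivative_eq_intros)
    show ?thesis unfolding G_def[abs_def] F_def[abs_def]
      by (auto intro!: derivative_eq_intros dp \<mu>'(2)[OF x] derivs_sub[OF s0 st(3) x]
        simp: G'_def G_def F_def power2_eq_square algebra_simps)
  qed
  have dJ: "(J has_real_derivative \<bar>S x\<bar>) (at x within {s..t})" if x: "x \<in> {s..t}" for x
    unfolding J_def[abs_def] using x st
    by (intro integral_has_real_derivative continuous_on_rabs continuous_on_subset[OF S_cont]) auto
  have J: "0 \<le> J x" "J t - J x \<le> 1 / \<Theta> s" if x: "x \<in> {s..t}" for x
  proof -
    have int: "(\<lambda>x. \<bar>S x\<bar>) integrable_on {u..v}" if "T \<le> u" for u v
      using that by (intro integrable_continuous_real continuous_on_rabs continuous_on_subset[OF S_cont]) auto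
    show "0 \<le> J x" unfolding J_def by (intro integral_nonneg int) (use st in auto)
    then show "J t - J x \<le> 1 / \<Theta> s" unfolding J_def using tail[of s t] st by simp
  qed
  have Gt: "G t \<le> exp (\<phi> t - \<phi> s) * G s + 3 * q\<^sup>2 * exp (6 * q\<^sup>2 * L + 1) * (N t - N s)"
  proof (rule gronwall_perturbed[where g = G and g' = G' and N = N and \<eta> = \<eta> and \<phi> = \<phi> and \<phi>' = "\<lambda>x. - \<mu> x + 6 * q\<^sup>2 * l * \<bar>S x\<bar> - \<mu>' x / l"])
    fix x assume x: "x \<in> {s..t}"
    show "(\<phi> has_real_derivative - \<mu> x + 6 * q\<^sup>2 * l * \<bar>S x\<bar> - \<mu>' x / l) (at x within {s..t})"
      unfolding \<phi>_def[abs_def] using lp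
      by (auto intro!: derivative_eq_intros I_deriv dJ \<mu>'(2) x st(1))
    have "l * (J t - J x) \<le> l * (1 / \<Theta> s)" using J[OF x] lp by (intro mult_left_mono) auto
    then have "l * (J t - J x) \<le> L" using ls by simp
    then have "6 * q\<^sup>2 * (l * (J t - J x)) \<le> 6 * q\<^sup>2 * L" by (intro mult_left_mono) auto
    moreover have "\<mu> x / l \<le> 1" "0 < \<mu> t / l"
      using \<mu>_anti[OF x] ls lp \<mu>_pos[of t] st by auto
    moreover have "I x \<le> I t" using x st by (intro I_mono) auto
    ultimately show "\<phi> t - \<phi> x \<le> 6 * q\<^sup>2 * L + 1"
      unfolding \<phi>_def by (simp add: algebra_simps)
    show "(G has_real_derivative G' x) (at x within {s..t})" by (rule dG[OF x])
    show "(N has_real_derivative \<eta> x) (at x within {s..t})"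
      using derivs_sub(4)[of s t x] st T x by auto
    show "G' x \<le> (- \<mu> x + 6 * q\<^sup>2 * l * \<bar>S x\<bar> - \<mu>' x / l) * G x + 3 * q\<^sup>2 * \<eta> x"
      using rate[OF x] by simp
    show "0 \<le> \<eta> x" by (rule \<eta>[OF x0[OF x]])
  qed (use st in auto)
  have exp_le: "exp (\<phi> t - \<phi> s) \<le> exp (6 * q\<^sup>2 * L + 1) * exp (I s - I t)"
  proof -
    have s: "s \<in> {s..t}" using st by simp
    have "l * (J t - J s) \<le> l * (1 / \<Theta> s)" using J[OF s] lp by (intro mult_left_mono) auto
    then have "l * (J t - J s) \<le> L" using ls by simp
    then have "6 * q\<^sup>2 * (l * (J t - J s)) \<le> 6 * q\<^sup>2 * L" by (intro mult_left_mono) auto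
    moreover have "\<mu> s / l \<le> 1" "0 < \<mu> t / l" using ls lp \<mu>_pos[of t] st by auto
    ultimately show ?thesis unfolding \<phi>_def exp_add[symmetric] exp_le_cancel_iff by (simp add: algebra_simps)
  qed
  have "0 \<le> F s" using a[of s] d[of s] st T by (auto simp: F_def)
  then have "0 \<le> G s" using rate[of s] st by auto
  from mult_right_mono[OF exp_le this] Gt
  have "G t \<le> exp (6 * q\<^sup>2 * L + 1) * exp (I s - I t) * G s + 3 * q\<^sup>2 * exp (6 * q\<^sup>2 * L + 1) * (N t - N s)"
    by simp
  then have Gt: "G t \<le> exp (6 * q\<^sup>2 * L + 1) * (exp (I s - I t) * G s + 3 * q\<^sup>2 * (N t - N s))"
    by (simp add: algebra_simps)
  have Fle: "F s \<le> q\<^sup>2 * (d s + l\<^sup>2 * a s)"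
  proof -
    have "(p s)\<^sup>2 \<le> q\<^sup>2" "1 \<le> q\<^sup>2" using p[of s] q st by (auto intro: power_mono)
    then have "(p s)\<^sup>2 * d s \<le> q\<^sup>2 * d s" "1 * (l\<^sup>2 * a s) \<le> q\<^sup>2 * (l\<^sup>2 * a s)"
      using a[of s] d[of s] st T by (intro mult_right_mono; simp)+
    then show ?thesis by (simp add: F_def algebra_simps)
  qed
  have "d t + l\<^sup>2 * a t \<le> q\<^sup>2 * F t"
  proof -
    have "1\<^sup>2 \<le> (q * p t)\<^sup>2" "1 \<le> q\<^sup>2" using p[of t] q st by (auto intro!: power_mono)
    then have "1 * d t \<le> (q * p t)\<^sup>2 * d t" "1 * (l\<^sup>2 * a t) \<le> q\<^sup>2 * (l\<^sup>2 * a t)"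
      using a[of t] d[of t] st T by (intro mult_right_mono; simp)+
    then show ?thesis by (simp add: F_def algebra_simps power_mult_distrib)
  qed
  also have "\<dots> \<le> q\<^sup>2 * (2 * G t)" using rate[of t] st by (intro mult_left_mono) auto
  also have "\<dots> \<le> q\<^sup>2 * (2 * (exp (6 * q\<^sup>2 * L + 1) * (exp (I s - I t) * G s + 3 * q\<^sup>2 * (N t - N s))))"
    using Gt by (intro mult_left_mono) auto
  also have "\<dots> = q\<^sup>2 * (exp (6 * q\<^sup>2 * L + 1) * (exp (I s - I t) * (2 * G s) + 6 * q\<^sup>2 * (N t - N s)))"
    by (simp add: algebra_simps)
  also have "\<dots> \<le> q\<^sup>2 * (exp (6 * q\<^sup>2 * L + 1) * (exp (I s - I t) * (3 * (q\<^sup>2 * (d s + l\<^sup>2 * a s))) + 6 * q\<^sup>2 * (N t - N s)))"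
    using rate[of s] Fle st by (intro mult_left_mono add_right_mono) auto
  also have "\<dots> = 3 * q ^ 4 * exp (6 * q\<^sup>2 * L + 1) *
           (exp (I s - I t) * (d s + l\<^sup>2 * a s) + 2 * (N t - N s))"
    by (simp add: power2_eq_square power4_eq_xxxx algebra_simps)
  finally show ?thesis .
qed

end

section \<open>Low frequencies: comparison with l = 0\<close>

lemma dissipative_rate:
  fixes a c d X P \<omega> l B q \<kappa> Z f g \<eta> :: real
  assumes ad: "0 \<le> a" "0 \<le> d" "c\<^sup>2 \<le> a * d" and X: "0 < X" "0 \<le> P" and \<omega>: "0 < \<omega>" "\<omega> \<le> 1"
    and b1: "X \<le> q * B * \<omega>" and b2: "P * X \<le> q * \<kappa> * B" and b3: "P\<^sup>2 * X * \<omega> \<le> q * \<kappa>\<^sup>2 * B"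
    and Z: "X \<le> Z" "P * X \<le> Z" "1 \<le> Z" and fg: "\<bar>f\<bar> \<le> \<eta>" "\<bar>g\<bar> \<le> \<eta>"
  defines "D \<equiv> X\<^sup>2 * d" and "w \<equiv> a - 2 * P * X * c + P\<^sup>2 * X\<^sup>2 * d"
  defines "Y \<equiv> D + \<omega>\<^sup>2 * w"
  shows "0 \<le> D" "0 \<le> w" "a \<le> 2 * w + 2 * P\<^sup>2 * D"
    and "- 2 * l\<^sup>2 * X\<^sup>2 * c + 2 * X\<^sup>2 * g + \<omega>\<^sup>2 * (2 * P * X * l\<^sup>2 * (a - P * X * c) - 2 * P * X * f + 2 * P\<^sup>2 * X\<^sup>2 * g)
      \<le> l\<^sup>2 * B * (q * (1 + \<kappa>)\<^sup>2) * Y + 6 * Z\<^sup>2 * \<eta>" (is "?lhs \<le> _")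
proof -
  \<comment> \<open>\<open>D\<close> and \<open>w\<close> are the squared lengths of X v' and v - P
    X v', and \<open>k\<close> is their scalar product. The hypotheses bound X by the size of B
    \<omega> and P X, P^2 X \<omega> by the size of B; with 2 \<omega> |k| <= Y every term
    containing l is then at most of order l^2 B Y.\<close>
  define k where "k = X * c - P * X\<^sup>2 * d"
  show D0: "0 \<le> D" using ad by (simp add: D_def)
  have c2: "2 * (P * X) * \<bar>c\<bar> \<le> a + (P * X)\<^sup>2 * d"
    using two_mult_le_of_square_le[of c d a "P * X"] ad X by (simp add: mult.commute)
  have "P * X * c \<le> P * X * \<bar>c\<bar>" using X by (intro mult_left_mono) auto
  then show w0: "0 \<le> w" using c2 by (simp add: w_def power_mult_distrib)
  have k2: "k\<^sup>2 \<le> w * D"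
  proof -
    have "k\<^sup>2 = X\<^sup>2 * (c\<^sup>2 - 2 * P * X * c * d + P\<^sup>2 * X\<^sup>2 * d\<^sup>2)"
      by (simp add: k_def power2_eq_square algebra_simps)
    also have "\<dots> \<le> X\<^sup>2 * (a * d - 2 * P * X * c * d + P\<^sup>2 * X\<^sup>2 * d\<^sup>2)"
      using ad by (intro mult_left_mono) auto
    also have "\<dots> = w * D" by (simp add: w_def D_def power2_eq_square algebra_simps)
    finally show ?thesis .
  qed
  have kY: "2 * \<omega> * \<bar>k\<bar> \<le> Y"
    using two_mult_le_of_square_le[OF k2 w0 D0, of \<omega>] \<omega> by (simp add: Y_def)
  have kP: "2 * P * \<bar>k\<bar> \<le> D * P\<^sup>2 + w"
    using two_mult_le_of_square_le[of k D w P] k2 w0 D0 X by (simp add: mult.commute)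
  have "P * k \<le> P * \<bar>k\<bar>" using X by (intro mult_left_mono) auto
  moreover have "a = w + 2 * P * k + P\<^sup>2 * D" by (simp add: w_def k_def D_def power2_eq_square algebra_simps)
  ultimately show "a \<le> 2 * w + 2 * P\<^sup>2 * D" using kP by (simp add: algebra_simps)
  have Y0: "0 \<le> Y" "\<omega>\<^sup>2 * w \<le> Y" using D0 w0 by (simp_all add: Y_def)
  have "- 2 * l\<^sup>2 * X\<^sup>2 * c = 2 * l\<^sup>2 * X * (- k) - 2 * l\<^sup>2 * X * P * D"
    by (simp add: k_def D_def power2_eq_square algebra_simps)
  also have "\<dots> \<le> 2 * l\<^sup>2 * X * \<bar>k\<bar>"
  proof -
    have "2 * l\<^sup>2 * X * (- k) \<le> 2 * l\<^sup>2 * X * \<bar>k\<bar>" using X by (intro mult_left_mono) auto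
    moreover have "0 \<le> 2 * l\<^sup>2 * X * P * D" using X D0 by simp
    ultimately show ?thesis by linarith
  qed
  also have "\<dots> \<le> 2 * l\<^sup>2 * (q * B * \<omega>) * \<bar>k\<bar>" using b1 by (intro mult_right_mono mult_left_mono) auto
  also have "\<dots> = l\<^sup>2 * (q * B) * (2 * \<omega> * \<bar>k\<bar>)" by simp
  also have "\<dots> \<le> l\<^sup>2 * (q * B) * Y"
  proof -
    have "0 \<le> q * B" using b1 X \<omega> by (smt (verit) mult_neg_pos)
    then show ?thesis using mult_left_mono[OF kY, of "l\<^sup>2 * (q * B)"] by simp
  qed
  finally have t1: "- 2 * l\<^sup>2 * X\<^sup>2 * c \<le> l\<^sup>2 * (q * B) * Y" .
  have "a - P * X * c = w + P * k" by (simp add: w_def k_def power2_eq_square algebra_simps)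
  then have "\<omega>\<^sup>2 * (2 * P * X * l\<^sup>2 * (a - P * X * c)) = 2 * l\<^sup>2 * (P * X) * (\<omega>\<^sup>2 * w) + l\<^sup>2 * (P\<^sup>2 * X * \<omega>) * (2 * \<omega> * k)"
    by (simp add: power2_eq_square algebra_simps)
  also have "\<dots> \<le> 2 * l\<^sup>2 * (q * \<kappa> * B) * Y + l\<^sup>2 * (q * \<kappa>\<^sup>2 * B) * Y"
  proof (rule add_mono)
    have "0 \<le> q * \<kappa> * B" using b2 X by (smt (verit) mult_nonneg_nonneg)
    then have "(P * X) * (\<omega>\<^sup>2 * w) \<le> (q * \<kappa> * B) * Y"
      using mult_mono[OF b2 Y0(2)] w0 by simp
    then show "2 * l\<^sup>2 * (P * X) * (\<omega>\<^sup>2 * w) \<le> 2 * l\<^sup>2 * (q * \<kappa> * B) * Y"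
      using mult_left_mono[of "(P * X) * (\<omega>\<^sup>2 * w)" _ "2 * l\<^sup>2"] by (simp add: mult.assoc)
    have "2 * \<omega> * k \<le> 2 * \<omega> * \<bar>k\<bar>" using \<omega> by (intro mult_left_mono) auto
    also note kY
    finally have "l\<^sup>2 * (P\<^sup>2 * X * \<omega>) * (2 * \<omega> * k) \<le> l\<^sup>2 * (P\<^sup>2 * X * \<omega>) * Y"
      using X \<omega> by (intro mult_left_mono) auto
    also have "\<dots> \<le> l\<^sup>2 * (q * \<kappa>\<^sup>2 * B) * Y" using b3 Y0 by (intro mult_right_mono mult_left_mono) auto
    finally show "l\<^sup>2 * (P\<^sup>2 * X * \<omega>) * (2 * \<omega> * k) \<le> l\<^sup>2 * (q * \<kappa>\<^sup>2 * B) * Y" .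
  qed
  finally have t2: "\<omega>\<^sup>2 * (2 * P * X * l\<^sup>2 * (a - P * X * c)) \<le> 2 * l\<^sup>2 * (q * \<kappa> * B) * Y + l\<^sup>2 * (q * \<kappa>\<^sup>2 * B) * Y" .
  have \<eta>0: "0 \<le> \<eta>" using fg by linarith
  have XZ: "X\<^sup>2 \<le> Z\<^sup>2" "(P * X)\<^sup>2 \<le> Z\<^sup>2" "P * X \<le> Z\<^sup>2"
  proof -
    show "X\<^sup>2 \<le> Z\<^sup>2" "(P * X)\<^sup>2 \<le> Z\<^sup>2" using Z X by (intro power_mono; simp)+
    have "P * X \<le> Z * 1" using Z by simp
    also have "\<dots> \<le> Z * Z" using Z by (intro mult_left_mono) auto
    finally show "P * X \<le> Z\<^sup>2" by (simp add: power2_eq_square)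
  qed
  have t3: "2 * X\<^sup>2 * g \<le> 2 * Z\<^sup>2 * \<eta>"
  proof -
    have "X\<^sup>2 * g \<le> X\<^sup>2 * \<eta>" using fg by (intro mult_left_mono) auto
    also have "\<dots> \<le> Z\<^sup>2 * \<eta>" using XZ \<eta>0 by (intro mult_right_mono) auto
    finally show ?thesis by simp
  qed
  have t4: "\<omega>\<^sup>2 * (2 * P\<^sup>2 * X\<^sup>2 * g - 2 * P * X * f) \<le> 4 * Z\<^sup>2 * \<eta>"
  proof -
    have "(P * X)\<^sup>2 * g \<le> (P * X)\<^sup>2 * \<eta>" using fg by (intro mult_left_mono) auto
    also have "\<dots> \<le> Z\<^sup>2 * \<eta>" using XZ \<eta>0 by (intro mult_right_mono) auto
    finally have 1: "(P * X)\<^sup>2 * g \<le> Z\<^sup>2 * \<eta>" .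
    have "P * X * (- f) \<le> P * X * \<eta>" using fg X by (intro mult_left_mono) auto
    also have "\<dots> \<le> Z\<^sup>2 * \<eta>" using XZ \<eta>0 by (intro mult_right_mono) auto
    finally have 2: "P * X * (- f) \<le> Z\<^sup>2 * \<eta>" .
    have "2 * P\<^sup>2 * X\<^sup>2 * g - 2 * P * X * f \<le> 4 * Z\<^sup>2 * \<eta>" using 1 2 by (simp add: power_mult_distrib)
    then have "\<omega>\<^sup>2 * (2 * P\<^sup>2 * X\<^sup>2 * g - 2 * P * X * f) \<le> \<omega>\<^sup>2 * (4 * Z\<^sup>2 * \<eta>)" by (intro mult_left_mono) auto
    also have "\<dots> \<le> 1 * (4 * Z\<^sup>2 * \<eta>)" using \<omega> \<eta>0 by (intro mult_right_mono) (auto simp: power_le_one)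
    finally show ?thesis by simp
  qed
  have "?lhs = - 2 * l\<^sup>2 * X\<^sup>2 * c + \<omega>\<^sup>2 * (2 * P * X * l\<^sup>2 * (a - P * X * c)) + 2 * X\<^sup>2 * g
    + \<omega>\<^sup>2 * (2 * P\<^sup>2 * X\<^sup>2 * g - 2 * P * X * f)" by (simp add: algebra_simps)
  also have "\<dots> \<le> l\<^sup>2 * (q * B) * Y + (2 * l\<^sup>2 * (q * \<kappa> * B) * Y + l\<^sup>2 * (q * \<kappa>\<^sup>2 * B) * Y)
    + 2 * Z\<^sup>2 * \<eta> + 4 * Z\<^sup>2 * \<eta>"
    by (intro add_mono t1 t2 t3 t4)
  also have "\<dots> = l\<^sup>2 * B * (q * (1 + \<kappa>)\<^sup>2) * Y + 6 * Z\<^sup>2 * \<eta>"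
    by (simp add: power2_eq_square algebra_simps)
  finally show "?lhs \<le> l\<^sup>2 * B * (q * (1 + \<kappa>)\<^sup>2) * Y + 6 * Z\<^sup>2 * \<eta>" .
qed

context stabilized_damping
begin

text \<open>\<open>X v'\<close> and \<open>v - P X v'\<close> (with \<open>X' = b X\<close>, \<open>P' = 1 / X\<close>) are constant for \<open>l = 0\<close>
  and \<open>e = 0\<close>; \<open>Y\<close> is a weighted sum of their squares.\<close>

lemma dissipative_zone:
  assumes "energy_triple b a c d f g \<eta> N l \<tau>" and t: "T \<le> t" "t \<le> \<tau>" "l * (1 + t) \<le> 1"
  defines "q \<equiv> exp S0"
  defines "\<kappa> \<equiv> q / (1 - \<mu>0)"
  shows "d t + l\<^sup>2 * a t \<le> (q\<^sup>2 + 2 + 2 * \<kappa>\<^sup>2) * exp (q * (1 + \<kappa>)\<^sup>2) *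
    (q\<^sup>2 * exp (- I t) * (d T + a T) + 6 * (q * (1 + \<kappa>) * (1 + t))\<^sup>2 * (N t - N T))"
proof -
  interpret E: energy_triple b a c d f g \<eta> N l \<tau> by (rule assms(1))
  have T0: "0 \<le> t" using t T by simp
  have q1: "1 \<le> q" using S0 by (simp add: q_def)
  have \<kappa>0: "0 \<le> \<kappa>" using q1 \<mu>0 by (simp add: \<kappa>_def)
  define M where "M x = exp (I x)" for x
  define X where "X x = exp (I x - S x)" for x
  define P where "P x = integral {T..x} (\<lambda>x. inverse (X x))" for x
  \<comment> \<open>This function will dominate the second solution \<open>P\<close>; it increases
    because (1 + t) \<mu> <= \<mu>0 < 1.\<close>
  define r where "r x = (1 + x) * exp (- I x)" for x
  have xs: "T \<le> x" "x \<le> t" "0 \<le> x" "x \<in> {0..\<tau>}" if "x \<in> {T..t}" for x using that T t by auto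
  have M: "1 \<le> M x" "0 < M x" if "x \<in> {T..t}" for x using I_mono[of T x] that by (auto simp: M_def)
  have dI: "(I has_real_derivative \<mu> x) (at x within {T..t})" if "x \<in> {T..t}" for x
    using I_deriv[of T x t] that by auto
  have dX: "(X has_real_derivative b x * X x) (at x within {T..t})" if x: "x \<in> {T..t}" for x
    unfolding X_def[abs_def] using S_deriv[of T x t] dI[OF x] x by (auto intro!: derivative_eq_intros)
  have X0: "0 < X x" for x by (simp add: X_def)
  have MX: "X x \<le> q * M x" "M x \<le> q * X x" if "x \<in> {T..t}" for x
    using S[of x] that by (auto simp: X_def M_def q_def exp_add[symmetric] abs_le_iff)
  have dP: "(P has_real_derivative inverse (X x)) (at x within {T..t})" if x: "x \<in> {T..t}" for x
    unfolding P_def[abs_def]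
  proof (rule integral_has_real_derivative[OF _ x])
    have "continuous_on {T..t} X" using dX by (rule DERIV_continuous_on)
    then show "continuous_on {T..t} (\<lambda>x. inverse (X x))"
      using X0 by (intro continuous_on_inverse) (auto simp: less_imp_neq[symmetric])
  qed
  have PT: "P T = 0" by (simp add: P_def)
  have dr: "(r has_real_derivative (1 - (1 + x) * \<mu> x) * exp (- I x)) (at x within {T..t})" if x: "x \<in> {T..t}" for x
    unfolding r_def[abs_def] by (auto intro!: derivative_eq_intros dI x simp: algebra_simps)
  have sub: "(h has_real_derivative h' x) (at x within {u..v})"
    if "\<And>x. x \<in> {T..t} \<Longrightarrow> (h has_real_derivative h' x) (at x within {T..t})" "T \<le> u" "v \<le> t" "x \<in> {u..v}"
    for h h' :: "real \<Rightarrow> real" and x u v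
    using that(1)[of x] by (rule has_field_derivative_subset) (use that in auto)
  have r_mono: "r x \<le> r y" if "T \<le> x" "x \<le> y" "y \<le> t" for x y
  proof (rule nondecreasing_on_Icc[where g = r and g' = "\<lambda>x. (1 - (1 + x) * \<mu> x) * exp (- I x)"])
    fix z assume z: "z \<in> {x..y}"
    show "(r has_real_derivative (1 - (1 + z) * \<mu> z) * exp (- I z)) (at z within {x..y})"
      using sub[of r "\<lambda>x. (1 - (1 + x) * \<mu> x) * exp (- I x)", OF dr] that z by auto
    have "(1 + z) * \<mu> z \<le> 1" using \<mu>_le[of z] \<mu>0 z that by auto
    then show "0 \<le> (1 - (1 + z) * \<mu> z) * exp (- I z)" by simp
  qed (use that in auto)
  have r1: "1 \<le> r x" if "x \<in> {T..t}" for x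
    using r_mono[of T x] that T by (auto simp: r_def)
  have P0: "0 \<le> P x" if x: "x \<in> {T..t}" for x
  proof -
    have "P T \<le> P x"
    proof (rule nondecreasing_on_Icc[where g = P and g' = "\<lambda>x. inverse (X x)"])
      fix z assume z: "z \<in> {T..x}"
      show "(P has_real_derivative inverse (X z)) (at z within {T..x})"
        using sub[of P "\<lambda>x. inverse (X x)", OF dP] x z by auto
      show "0 \<le> inverse (X z)" using X0[of z] by simp
    qed (use x in auto)
    then show ?thesis using PT by simp
  qed
  \<comment> \<open>Compare derivatives: P' = 1 / X <= q exp(- I), while r' >= (1 - \<mu>0) exp(-
    I). This is the origin of \<kappa> = q / (1 - \<mu>0).\<close>
  have Pr: "P x \<le> \<kappa> * r x" if x: "x \<in> {T..t}" for x
  proof -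
    have "\<kappa> * r T - P T \<le> \<kappa> * r x - P x"
    proof (rule nondecreasing_on_Icc[where g = "\<lambda>x. \<kappa> * r x - P x" and g' = "\<lambda>x. \<kappa> * ((1 - (1 + x) * \<mu> x) * exp (- I x)) - inverse (X x)"])
      fix z assume z: "z \<in> {T..x}"
      then have zt: "z \<in> {T..t}" using x by auto
      show "((\<lambda>x. \<kappa> * r x - P x) has_real_derivative \<kappa> * ((1 - (1 + z) * \<mu> z) * exp (- I z)) - inverse (X z)) (at z within {T..x})"
      proof (rule has_field_derivative_subset)
        show "((\<lambda>x. \<kappa> * r x - P x) has_real_derivative \<kappa> * ((1 - (1 + z) * \<mu> z) * exp (- I z)) - inverse (X z)) (at z within {T..t})"
          by (auto intro!: derivative_eq_intros dr[OF zt] dP[OF zt])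
      qed (use x in auto)
      have "inverse (X z) \<le> q * exp (- I z)"
        using MX(2)[OF zt] X0[of z] by (simp add: M_def exp_minus field_simps)
      also have "\<dots> = \<kappa> * ((1 - \<mu>0) * exp (- I z))" using \<mu>0 by (simp add: \<kappa>_def)
      also have "\<dots> \<le> \<kappa> * ((1 - (1 + z) * \<mu> z) * exp (- I z))"
        using \<mu>_le[of z] z \<kappa>0 by (intro mult_left_mono mult_right_mono) auto
      finally show "0 \<le> \<kappa> * ((1 - (1 + z) * \<mu> z) * exp (- I z)) - inverse (X z)" by simp
    qed (use x in auto)
    moreover have "0 \<le> \<kappa> * r T - P T" using PT \<kappa>0 r1[of T] t by simp
    ultimately show ?thesis by simp
  qed
  have rM: "r x * M x = 1 + x" for x by (simp add: r_def M_def exp_minus_inverse mult.assoc exp_minus)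
  \<comment> \<open>The weight 1 / r is frozen at the final time, so it contributes no derivative;
    since r increases, P \<omega> <= \<kappa> still holds at all earlier times.\<close>
  define \<omega> where "\<omega> = M t / (1 + t)"
  have \<omega>r: "\<omega> * r t = 1" using T0 M[of t] t by (simp add: \<omega>_def r_def M_def exp_minus)
  have \<omega>: "0 < \<omega>" "\<omega> \<le> 1"
  proof -
    show "0 < \<omega>" using T0 by (simp add: \<omega>_def M_def)
    then show "\<omega> \<le> 1" using \<omega>r r1[of t] t mult_left_mono[of 1 "r t" \<omega>] by simp
  qed
  \<comment> \<open>A common bound of 1, X and P X on the zone. Its growth in t affects the error
    term only.\<close>
  define Z where "Z = q * (1 + \<kappa>) * (1 + t)"
  define D where "D x = (X x)\<^sup>2 * d x" for x
  define w where "w x = a x - 2 * P x * X x * c x + (P x)\<^sup>2 * (X x)\<^sup>2 * d x" for x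
  define Y where "Y x = D x + \<omega>\<^sup>2 * w x" for x
  define Y' where "Y' x = - 2 * l\<^sup>2 * (X x)\<^sup>2 * c x + 2 * (X x)\<^sup>2 * g x + \<omega>\<^sup>2 * (2 * P x * X x * l\<^sup>2 * (a x - P x * X x * c x)
    - 2 * P x * X x * f x + 2 * (P x)\<^sup>2 * (X x)\<^sup>2 * g x)" for x
  have rate: "0 \<le> D x \<and> 0 \<le> w x \<and> a x \<le> 2 * w x + 2 * (P x)\<^sup>2 * D x \<and>
      Y' x \<le> l\<^sup>2 * (1 + t) * (q * (1 + \<kappa>)\<^sup>2) * Y x + 6 * Z\<^sup>2 * \<eta> x" if x: "x \<in> {T..t}" for x
  proof -
    have M_le: "M x \<le> M t" using I_mono[of x t] x by (auto simp: M_def)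
    have b1: "X x \<le> q * (1 + t) * \<omega>"
    proof -
      have "X x \<le> q * M t" using MX[OF x] M_le q1 by (smt (verit) mult_left_mono)
      then show ?thesis using T0 by (simp add: \<omega>_def)
    qed
    have PM: "P x * M x \<le> \<kappa> * (1 + x)"
    proof -
      have "P x * M x \<le> \<kappa> * r x * M x" using Pr[OF x] M[OF x] by (intro mult_right_mono) auto
      then show ?thesis using rM[of x] by (simp add: mult.assoc)
    qed
    have "P x * X x \<le> q * \<kappa> * (1 + x)"
    proof -
      have "P x * X x \<le> P x * (q * M x)" using MX[OF x] P0[OF x] by (intro mult_left_mono) auto
      also have "\<dots> = q * (P x * M x)" by simp
      also have "\<dots> \<le> q * (\<kappa> * (1 + x))" using PM q1 by (intro mult_left_mono) auto
      finally show ?thesis by (simp add: mult.assoc)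
    qed
    also have "\<dots> \<le> q * \<kappa> * (1 + t)"
      using q1 \<kappa>0 xs[OF x] by (intro mult_left_mono) auto
    finally have b2: "P x * X x \<le> q * \<kappa> * (1 + t)" .
    have b3: "(P x)\<^sup>2 * X x * \<omega> \<le> q * \<kappa>\<^sup>2 * (1 + t)"
    proof -
      have "P x * \<omega> \<le> \<kappa>"
      proof -
        have "P x * \<omega> \<le> \<kappa> * r x * \<omega>" using Pr[OF x] \<omega> by (intro mult_right_mono) auto
        also have "\<dots> \<le> \<kappa> * r t * \<omega>" using r_mono[of x t] x \<omega> \<kappa>0 by (intro mult_right_mono mult_left_mono) auto
        also have "\<dots> = \<kappa> * (\<omega> * r t)" by simp
        finally show ?thesis unfolding \<omega>r by simp
      qed
      then have "(P x * X x) * (P x * \<omega>) \<le> (q * \<kappa> * (1 + t)) * \<kappa>"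
        using P0[OF x] \<omega> q1 \<kappa>0 T0 mult_mono[OF b2, of "P x * \<omega>" \<kappa>] by simp
      then show ?thesis by (simp add: power2_eq_square algebra_simps)
    qed
    have ZX: "X x \<le> Z"
    proof -
      note b1
      also have "q * (1 + t) * \<omega> \<le> q * (1 + t) * 1" using \<omega> q1 T0 by (intro mult_left_mono) auto
      also have "q * (1 + t) * 1 \<le> q * (1 + t) * (1 + \<kappa>)" using q1 T0 \<kappa>0 by (intro mult_left_mono) auto
      finally show ?thesis by (simp add: Z_def mult.commute mult.left_commute)
    qed
    have ZP: "P x * X x \<le> Z"
    proof -
      have "0 \<le> q * t" using q1 T0 by simp
      then show ?thesis using b2 q1 by (simp add: Z_def algebra_simps)
    qed
    have Z1: "1 \<le> Z"
      using mult_mono[of 1 "q * (1 + \<kappa>)" 1 "1 + t"] mult_mono[of 1 q 1 "1 + \<kappa>"] q1 T0 \<kappa>0 by (simp add: Z_def)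
    note r = dissipative_rate[OF E.a[OF xs(4)[OF x]] E.d[OF xs(4)[OF x]] E.cs[OF xs(4)[OF x]] X0 P0[OF x] \<omega> b1 b2 b3
        ZX ZP Z1 E.f_le[OF xs(4)[OF x]] E.g[OF xs(4)[OF x]]]
    then show ?thesis unfolding Y'_def Y_def D_def w_def by blast
  qed
  have dY: "(Y has_real_derivative Y' x) (at x within {T..t})" if x: "x \<in> {T..t}" for x
    unfolding Y_def[abs_def] D_def[abs_def] w_def[abs_def]
    using X0[of x]
    by (auto intro!: derivative_eq_intros dX[OF x] dP[OF x] E.derivs_sub[OF T t(2) x]
        simp: Y'_def power2_eq_square field_simps)
  \<comment> \<open>The rate is a constant times l^2 (1 + t) and acts during a time of at most 1 +
    t, so this bounds its total effect.\<close>
  have lB: "l\<^sup>2 * (1 + t)\<^sup>2 \<le> 1"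
    using t(3) E.l T0 by (simp add: power_mult_distrib[symmetric] power_le_one)
  have Yt: "Y t \<le> exp (q * (1 + \<kappa>)\<^sup>2) * (Y T + 6 * Z\<^sup>2 * (N t - N T))"
  proof -
    define A where "A = l\<^sup>2 * (1 + t) * (q * (1 + \<kappa>)\<^sup>2)"
    have A0: "0 \<le> A" using q1 T0 by (simp add: A_def)
    have "A * (t - x) \<le> q * (1 + \<kappa>)\<^sup>2" if "x \<in> {T..t}" for x
    proof -
      have "A * (t - x) \<le> A * (1 + t)" using A0 xs[OF that] by (intro mult_left_mono) auto
      also have "\<dots> = (l\<^sup>2 * (1 + t)\<^sup>2) * (q * (1 + \<kappa>)\<^sup>2)" by (simp add: A_def power2_eq_square algebra_simps)
      also have "\<dots> \<le> 1 * (q * (1 + \<kappa>)\<^sup>2)" using lB q1 by (intro mult_right_mono) auto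
      finally show ?thesis by simp
    qed note AB = this
    have "Y t \<le> exp (A * t - A * T) * Y T + 6 * Z\<^sup>2 * exp (q * (1 + \<kappa>)\<^sup>2) * (N t - N T)"
    proof (rule gronwall_perturbed[where g = Y and g' = Y' and N = N and \<eta> = \<eta> and \<phi> = "\<lambda>x. A * x" and \<phi>' = "\<lambda>x. A"])
      fix x assume x: "x \<in> {T..t}"
      show "(Y has_real_derivative Y' x) (at x within {T..t})" by (rule dY[OF x])
      show "((\<lambda>x. A * x) has_real_derivative A) (at x within {T..t})" by (auto intro!: derivative_eq_intros)
      show "(N has_real_derivative \<eta> x) (at x within {T..t})" using E.derivs_sub(4)[OF T t(2) x] .
      show "Y' x \<le> A * Y x + 6 * Z\<^sup>2 * \<eta> x" using rate[OF x] by (simp add: A_def)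
      show "A * t - A * x \<le> q * (1 + \<kappa>)\<^sup>2" using AB[OF x] by (simp add: algebra_simps)
      show "0 \<le> \<eta> x" by (rule E.\<eta>[OF xs(4)[OF x]])
    qed (use t in auto)
    also have "exp (A * t - A * T) * Y T \<le> exp (q * (1 + \<kappa>)\<^sup>2) * Y T"
    proof (rule mult_right_mono)
      show "exp (A * t - A * T) \<le> exp (q * (1 + \<kappa>)\<^sup>2)" using AB[of T] t by (simp add: algebra_simps)
      show "0 \<le> Y T" using rate[of T] t by (auto simp: Y_def)
    qed
    finally show ?thesis by (simp add: algebra_simps)
  qed
  have YT: "Y T \<le> q\<^sup>2 * (d T + a T)"
  proof -
    have "a T \<ge> 0" "d T \<ge> 0" using E.a[of T] E.d[of T] T t by auto
    have "(X T)\<^sup>2 \<le> q\<^sup>2" using MX(1)[of T] X0[of T] t by (intro power_mono) (auto simp: M_def)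
    moreover have "\<omega>\<^sup>2 \<le> q\<^sup>2" using \<omega> q1 by (intro power_mono) auto
    ultimately have "(X T)\<^sup>2 * d T + \<omega>\<^sup>2 * a T \<le> q\<^sup>2 * d T + q\<^sup>2 * a T"
      using \<open>a T \<ge> 0\<close> \<open>d T \<ge> 0\<close> by (intro add_mono mult_right_mono) auto
    then show ?thesis by (simp add: Y_def D_def w_def PT algebra_simps)
  qed
  have Rt: "0 \<le> D t" "0 \<le> w t" "a t \<le> 2 * w t + 2 * (P t)\<^sup>2 * D t" using rate[of t] t by auto
  have Y0: "D t \<le> Y t" "\<omega>\<^sup>2 * w t \<le> Y t" "0 \<le> Y t" using Rt by (auto simp: Y_def)
  have dt: "d t \<le> q\<^sup>2 * (exp (- I t))\<^sup>2 * Y t"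
  proof -
    have "M t \<le> q * X t" using MX[of t] t by auto
    then have "1\<^sup>2 \<le> (q * exp (- I t) * X t)\<^sup>2"
      by (intro power_mono) (auto simp: M_def exp_minus field_simps)
    then have "1 * d t \<le> (q * exp (- I t) * X t)\<^sup>2 * d t" using E.d[of t] T0 t by (intro mult_right_mono) auto
    also have "\<dots> = q\<^sup>2 * (exp (- I t))\<^sup>2 * D t" by (simp add: D_def power_mult_distrib)
    also have "\<dots> \<le> q\<^sup>2 * (exp (- I t))\<^sup>2 * Y t" using Y0 by (intro mult_left_mono) auto
    finally show ?thesis by simp
  qed
  have lr: "l\<^sup>2 * (r t)\<^sup>2 \<le> (exp (- I t))\<^sup>2"
    using mult_right_mono[OF lB, of "(exp (- I t))\<^sup>2"] by (simp add: r_def power_mult_distrib)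
  \<comment> \<open>In \<open>Y\<close> the square \<open>w\<close> carries the weight r(t)^(-2), so
    |v|^2 may be as large as r(t)^2; the zone gives l r <= exp(- I), which pays for this.\<close>
  have at: "l\<^sup>2 * a t \<le> (2 + 2 * \<kappa>\<^sup>2) * (exp (- I t))\<^sup>2 * Y t"
  proof -
    have "w t = (\<omega> * r t)\<^sup>2 * w t" by (simp add: \<omega>r)
    also have "\<dots> = (r t)\<^sup>2 * (\<omega>\<^sup>2 * w t)" by (simp add: power_mult_distrib)
    also have "\<dots> \<le> (r t)\<^sup>2 * Y t" using Y0 by (intro mult_left_mono) auto
    finally have w: "w t \<le> (r t)\<^sup>2 * Y t" .
    have "(P t)\<^sup>2 * D t \<le> (\<kappa> * r t)\<^sup>2 * Y t"
      using Pr[of t] P0[of t] t Y0 Rt by (intro mult_mono power_mono) auto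
    then have "a t \<le> (2 + 2 * \<kappa>\<^sup>2) * (r t)\<^sup>2 * Y t" using Rt w by (simp add: power_mult_distrib algebra_simps)
    then have "l\<^sup>2 * a t \<le> l\<^sup>2 * ((2 + 2 * \<kappa>\<^sup>2) * (r t)\<^sup>2 * Y t)" by (intro mult_left_mono) auto
    also have "\<dots> = (2 + 2 * \<kappa>\<^sup>2) * (l\<^sup>2 * (r t)\<^sup>2) * Y t" by simp
    also have "\<dots> \<le> (2 + 2 * \<kappa>\<^sup>2) * (exp (- I t))\<^sup>2 * Y t"
      using lr Y0 by (intro mult_right_mono mult_left_mono) auto
    finally show ?thesis .
  qed
  have e1: "0 < exp (- I t)" "exp (- I t) \<le> 1" using I_mono[of T t] t by auto
  define C where "C = (q\<^sup>2 + 2 + 2 * \<kappa>\<^sup>2) * exp (q * (1 + \<kappa>)\<^sup>2)"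
  have C0: "0 \<le> C" by (simp add: C_def)
  have "d t + l\<^sup>2 * a t \<le> (q\<^sup>2 + 2 + 2 * \<kappa>\<^sup>2) * (exp (- I t))\<^sup>2 * Y t"
    using dt at by (simp add: algebra_simps)
  \<comment> \<open>The decay obtained is the square of \<open>exp (- I t)\<close>; one factor is
    given up to match the rate of the other zones.\<close>
  also have "\<dots> \<le> (q\<^sup>2 + 2 + 2 * \<kappa>\<^sup>2) * exp (- I t) * Y t"
    using e1 Y0 by (intro mult_right_mono mult_left_mono) (auto simp: power2_eq_square mult_le_cancel_left1)
  also have "\<dots> \<le> (q\<^sup>2 + 2 + 2 * \<kappa>\<^sup>2) * exp (- I t) * (exp (q * (1 + \<kappa>)\<^sup>2) * (q\<^sup>2 * (d T + a T) + 6 * Z\<^sup>2 * (N t - N T)))"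
    using Yt YT by (intro mult_left_mono) (auto intro: order_trans)
  also have "\<dots> = C * (q\<^sup>2 * exp (- I t) * (d T + a T) + exp (- I t) * (6 * Z\<^sup>2 * (N t - N T)))"
    by (simp add: C_def algebra_simps)
  also have "\<dots> \<le> C * (q\<^sup>2 * exp (- I t) * (d T + a T) + 1 * (6 * Z\<^sup>2 * (N t - N T)))"
    using e1 E.N_mono[OF T t(1,2)] C0 by (intro mult_left_mono add_left_mono mult_right_mono) auto
  finally show ?thesis by (simp add: C_def Z_def)
qed

end

subsection \<open>Symbols and the Riccati equation\<close>

definition symbol_bound :: "(real \<Rightarrow> real) \<Rightarrow> nat \<Rightarrow> nat \<Rightarrow> (real \<Rightarrow> real \<Rightarrow> complex) \<Rightarrow> bool" where
  "symbol_bound \<Xi> p q F \<longleftrightarrow>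
     (\<exists>C\<ge>0. \<forall>l t. 0 < l \<longrightarrow> 0 \<le> t \<longrightarrow> \<Xi> t \<le> l \<longrightarrow> cmod (F l t) \<le> C * \<Xi> t ^ p / l ^ q)"

text \<open>\<open>symbol \<Xi> d p q F\<close>: \<open>\<partial>\<^sub>t\<^sup>k F = O(\<Xi>\<^sup>p\<^sup>+\<^sup>k l\<^sup>-\<^sup>q)\<close> for \<open>k \<le> d\<close>, uniformly in the zone \<open>\<Xi>(t) \<le> l\<close>.\<close>

primrec symbol :: "(real \<Rightarrow> real) \<Rightarrow> nat \<Rightarrow> nat \<Rightarrow> nat \<Rightarrow> (real \<Rightarrow> real \<Rightarrow> complex) \<Rightarrow> bool" where
  "symbol \<Xi> 0 p q F \<longleftrightarrow> symbol_bound \<Xi> p q F"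
| "symbol \<Xi> (Suc d) p q F \<longleftrightarrow> symbol_bound \<Xi> p q F \<and>
     (\<exists>G. (\<forall>l>0. \<forall>t\<ge>0. (F l has_vector_derivative G l t) (at t within {0..})) \<and> symbol \<Xi> d (Suc p) q G)"

lemma symbol_imp_bound: "symbol \<Xi> d p q F \<Longrightarrow> symbol_bound \<Xi> p q F"
  by (cases d) auto

lemma symbol_Suc_D: "symbol \<Xi> (Suc d) p q F \<Longrightarrow> symbol \<Xi> d p q F"
  by (induction d arbitrary: p F) auto

lemma symbol_mono:
  assumes "symbol \<Xi> d p q F" "e \<le> d"
  shows "symbol \<Xi> e p q F"
  using assms(2,1) by (induction rule: inc_induct) (auto simp del: symbol.simps dest: symbol_Suc_D)

lemma symbol_SucE:
  assumes "symbol \<Xi> (Suc d) p q F"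
  obtains F' where "\<And>l t. 0 < l \<Longrightarrow> 0 \<le> t \<Longrightarrow> (F l has_vector_derivative F' l t) (at t within {0..})"
    "symbol \<Xi> d (Suc p) q F'"
  using assms by auto

lemma at_within_atLeast_neq_bot: "at t within {0..} \<noteq> bot" if "0 \<le> t" for t :: real
proof -
  have "t islimpt {t..t + 1}" by (rule islimpt_Icc[THEN iffD2]) auto
  then have "t islimpt {0..}" by (rule islimpt_subset) (use that in auto)
  then show ?thesis by (simp add: trivial_limit_within)
qed

lemma symbol_cong:
  assumes "symbol \<Xi> d p q F" "\<And>l t. 0 < l \<Longrightarrow> 0 \<le> t \<Longrightarrow> F l t = G l t"
  shows "symbol \<Xi> d p q G"
proof -
  have bd: "symbol_bound \<Xi> p q G"
    using symbol_imp_bound[OF assms(1)] assms(2) by (simp add: symbol_bound_def)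
  show ?thesis
  proof (cases d)
    case 0
    with bd show ?thesis by simp
  next
    case (Suc e)
    with assms(1) obtain H where H: "\<And>l t. 0 < l \<Longrightarrow> 0 \<le> t \<Longrightarrow> (F l has_vector_derivative H l t) (at t within {0..})"
      "symbol \<Xi> e (Suc p) q H" by auto
    have "(G l has_vector_derivative H l t) (at t within {0..})" if "0 < l" "0 \<le> t" for l t
      by (rule has_vector_derivative_transform[OF _ _ H(1)]) (use that assms(2) in auto)
    with H(2) bd Suc show ?thesis by auto
  qed
qed

lemma symbol_0: "symbol \<Xi> d p q (\<lambda>l t. 0)"
proof -
  have "symbol_bound \<Xi> p q (\<lambda>l t. 0)" for p by (auto simp: symbol_bound_def intro: exI[of _ 0])
  then show ?thesis by (induction d arbitrary: p) (auto intro!: exI[of _ "\<lambda>l t. 0"])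
qed

lemma symbol_add:
  "symbol \<Xi> d p q F \<Longrightarrow> symbol \<Xi> d p q G \<Longrightarrow> symbol \<Xi> d p q (\<lambda>l t. F l t + G l t)"
proof (induction d arbitrary: p F G)
  have bd: "symbol_bound \<Xi> p q (\<lambda>l t. F l t + G l t)"
    if FG: "symbol_bound \<Xi> p q F" "symbol_bound \<Xi> p q G" for p F G
  proof -
    from FG obtain C C' where C: "0 \<le> C" "0 \<le> C'"
      "\<And>l t. 0 < l \<Longrightarrow> 0 \<le> t \<Longrightarrow> \<Xi> t \<le> l \<Longrightarrow> cmod (F l t) \<le> C * \<Xi> t ^ p / l ^ q"
      "\<And>l t. 0 < l \<Longrightarrow> 0 \<le> t \<Longrightarrow> \<Xi> t \<le> l \<Longrightarrow> cmod (G l t) \<le> C' * \<Xi> t ^ p / l ^ q"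
      unfolding symbol_bound_def by blast
    show ?thesis unfolding symbol_bound_def
    proof (intro exI[of _ "C + C'"] conjI allI impI)
      fix l t :: real assume "0 < l" "0 \<le> t" "\<Xi> t \<le> l"
      then show "cmod (F l t + G l t) \<le> (C + C') * \<Xi> t ^ p / l ^ q"
        using C(3,4)[of l t] norm_triangle_ineq[of "F l t" "G l t"] by (simp add: distrib_right add_divide_distrib)
    qed (use C in auto)
  qed
  { case 0 then show ?case using bd by simp }
  case (Suc d)
  from Suc.prems(1) obtain F' where
    "\<And>l t. 0 < l \<Longrightarrow> 0 \<le> t \<Longrightarrow> (F l has_vector_derivative F' l t) (at t within {0..})" "symbol \<Xi> d (Suc p) q F'"
    by (rule symbol_SucE) blast
  moreover from Suc.prems(2) obtain G' where
    "\<And>l t. 0 < l \<Longrightarrow> 0 \<le> t \<Longrightarrow> (G l has_vector_derivative G' l t) (at t within {0..})" "symbol \<Xi> d (Suc p) q G'"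
    by (rule symbol_SucE) blast
  ultimately show ?case using Suc.IH[of "Suc p" F' G'] Suc.prems bd[of p F G]
    by (auto intro!: exI[of _ "\<lambda>l t. F' l t + G' l t"] has_vector_derivative_add)
qed

lemma symbol_scale:
  assumes k: "\<And>l. 0 < l \<Longrightarrow> cmod (k l) \<le> K / l ^ r" and K: "0 \<le> K"
  shows "symbol \<Xi> d p q F \<Longrightarrow> symbol \<Xi> d p (q + r) (\<lambda>l t. k l * F l t)"
proof (induction d arbitrary: p F)
  have bd: "symbol_bound \<Xi> p (q + r) (\<lambda>l t. k l * F l t)" if F: "symbol_bound \<Xi> p q F" for p F
  proof -
    from F obtain C where C: "0 \<le> C"
      "\<And>l t. 0 < l \<Longrightarrow> 0 \<le> t \<Longrightarrow> \<Xi> t \<le> l \<Longrightarrow> cmod (F l t) \<le> C * \<Xi> t ^ p / l ^ q"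
      unfolding symbol_bound_def by blast
    show ?thesis unfolding symbol_bound_def
    proof (intro exI[of _ "K * C"] conjI allI impI)
      fix l t :: real assume "0 < l" "0 \<le> t" "\<Xi> t \<le> l"
      then have "cmod (k l) * cmod (F l t) \<le> (K / l ^ r) * (C * \<Xi> t ^ p / l ^ q)"
        using C(2)[of l t] k[of l] K by (intro mult_mono) auto
      then show "cmod (k l * F l t) \<le> K * C * \<Xi> t ^ p / l ^ (q + r)"
        by (simp add: norm_mult power_add mult_ac)
    qed (use C K in auto)
  qed
  { case 0 then show ?case using bd by simp }
  case (Suc d)
  then obtain F' where
    "\<And>l t. 0 < l \<Longrightarrow> 0 \<le> t \<Longrightarrow> (F l has_vector_derivative F' l t) (at t within {0..})" "symbol \<Xi> d (Suc p) q F'"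
    by (elim symbol_SucE) blast
  then show ?case using Suc.IH[of "Suc p" F'] Suc.prems bd[of p F]
    by (auto intro!: exI[of _ "\<lambda>l t. k l * F' l t"] has_vector_derivative_mult_right)
qed

lemma symbol_mult:
  assumes \<Xi>: "\<And>t. 0 \<le> t \<Longrightarrow> 0 < \<Xi> t"
  shows "symbol \<Xi> d p q F \<Longrightarrow> symbol \<Xi> d p' q' G \<Longrightarrow> symbol \<Xi> d (p + p') (q + q') (\<lambda>l t. F l t * G l t)"
proof (induction d arbitrary: p p' F G)
  have bd: "symbol_bound \<Xi> (p + p') (q + q') (\<lambda>l t. F l t * G l t)"
    if FG: "symbol_bound \<Xi> p q F" "symbol_bound \<Xi> p' q' G" for p p' F G
  proof -
    from FG obtain C C' where C: "0 \<le> C" "0 \<le> C'"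
      "\<And>l t. 0 < l \<Longrightarrow> 0 \<le> t \<Longrightarrow> \<Xi> t \<le> l \<Longrightarrow> cmod (F l t) \<le> C * \<Xi> t ^ p / l ^ q"
      "\<And>l t. 0 < l \<Longrightarrow> 0 \<le> t \<Longrightarrow> \<Xi> t \<le> l \<Longrightarrow> cmod (G l t) \<le> C' * \<Xi> t ^ p' / l ^ q'"
      unfolding symbol_bound_def by blast
    show ?thesis unfolding symbol_bound_def
    proof (intro exI[of _ "C * C'"] conjI allI impI)
      fix l t :: real assume lt: "0 < l" "0 \<le> t" "\<Xi> t \<le> l"
      then have "cmod (F l t) * cmod (G l t) \<le> (C * \<Xi> t ^ p / l ^ q) * (C' * \<Xi> t ^ p' / l ^ q')"
        using C(1,2) C(3,4)[of l t] \<Xi>[of t] by (intro mult_mono) auto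
      then show "cmod (F l t * G l t) \<le> C * C' * \<Xi> t ^ (p + p') / l ^ (q + q')"
        by (simp add: norm_mult power_add mult_ac)
    qed (use C in auto)
  qed
  { case 0 then show ?case using bd by simp }
  case (Suc d)
  from Suc.prems(1) obtain F' where F':
    "\<And>l t. 0 < l \<Longrightarrow> 0 \<le> t \<Longrightarrow> (F l has_vector_derivative F' l t) (at t within {0..})" "symbol \<Xi> d (Suc p) q F'"
    by (rule symbol_SucE) blast
  from Suc.prems(2) obtain G' where G':
    "\<And>l t. 0 < l \<Longrightarrow> 0 \<le> t \<Longrightarrow> (G l has_vector_derivative G' l t) (at t within {0..})" "symbol \<Xi> d (Suc p') q' G'"
    by (rule symbol_SucE) blast
  note * = F' G'
  have "symbol \<Xi> d (Suc (p + p')) (q + q') (\<lambda>l t. F l t * G' l t + F' l t * G l t)"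
    using Suc.IH[of p F "Suc p'" G'] Suc.IH[of "Suc p" F' p' G] symbol_Suc_D[OF Suc.prems(1)]
      symbol_Suc_D[OF Suc.prems(2)] * by (intro symbol_add) auto
  then show ?case using Suc.prems bd[of p F p' G] *
    by (auto intro!: exI[of _ "\<lambda>l t. F l t * G' l t + F' l t * G l t"] has_vector_derivative_mult)
qed

text \<open>In the zone the quotient \<Xi> / l is at most 1, so a factor of this kind may be
  dropped. This restores the order of a symbol after a Riccati step.\<close>

lemma symbol_lower:
  assumes \<Xi>: "\<And>t. 0 \<le> t \<Longrightarrow> 0 < \<Xi> t"
  shows "symbol \<Xi> d (Suc p) (Suc q) F \<Longrightarrow> symbol \<Xi> d p q F"
proof (induction d arbitrary: p F)
  have bd: "symbol_bound \<Xi> p q F" if F: "symbol_bound \<Xi> (Suc p) (Suc q) F" for p F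
  proof -
    from F obtain C where C: "0 \<le> C"
      "\<And>l t. 0 < l \<Longrightarrow> 0 \<le> t \<Longrightarrow> \<Xi> t \<le> l \<Longrightarrow> cmod (F l t) \<le> C * \<Xi> t ^ Suc p / l ^ Suc q"
      unfolding symbol_bound_def by blast
    show ?thesis unfolding symbol_bound_def
    proof (intro exI[of _ C] conjI allI impI)
      fix l t :: real assume lt: "0 < l" "0 \<le> t" "\<Xi> t \<le> l"
      have "C * \<Xi> t ^ Suc p / l ^ Suc q = (C * \<Xi> t ^ p / l ^ q) * (\<Xi> t / l)" by (simp add: mult_ac)
      also have "\<dots> \<le> (C * \<Xi> t ^ p / l ^ q) * 1" using lt \<Xi>[of t] C by (intro mult_left_mono) auto
      finally show "cmod (F l t) \<le> C * \<Xi> t ^ p / l ^ q" using C(2)[OF lt] by simp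
    qed (use C in auto)
  qed
  { case 0 then show ?case using bd by simp }
  case (Suc d)
  then show ?case using bd[of p F] by auto
qed

text \<open>\<open>symbol\<close> only asserts that some derivative exists, whereas
  \<open>riccati\<close> differentiates with \<open>vector_derivative\<close>; uniqueness of the
  one-sided derivative identifies the two.\<close>

lemma symbol_has_vector_derivative:
  assumes "symbol \<Xi> (Suc d) p q F"
  defines "F' \<equiv> \<lambda>l t. vector_derivative (F l) (at t within {0..})"
  shows "0 < l \<Longrightarrow> 0 \<le> t \<Longrightarrow> (F l has_vector_derivative F' l t) (at t within {0..})"
    and "symbol \<Xi> d (Suc p) q F'"
proof -
  from assms obtain G where
    G: "\<And>l t. 0 < l \<Longrightarrow> 0 \<le> t \<Longrightarrow> (F l has_vector_derivative G l t) (at t within {0..})" "symbol \<Xi> d (Suc p) q G"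
    by auto
  have "vector_derivative (F l) (at t within {0..}) = G l t" if "0 < l" "0 \<le> t" for l t
    by (rule vector_derivative_within[OF at_within_atLeast_neq_bot G(1)]) (use that in auto)
  then have eq: "F' l t = G l t" if "0 < l" "0 \<le> t" for l t using that by (simp add: F'_def)
  show "symbol \<Xi> d (Suc p) q F'" by (rule symbol_cong[OF G(2)]) (simp add: eq)
  show "0 < l \<Longrightarrow> 0 \<le> t \<Longrightarrow> (F l has_vector_derivative F' l t) (at t within {0..})"
    using G(1)[of l t] eq[of l t] by simp
qed

text \<open>Iterates \<open>\<psi>\<^sub>n\<close> for which \<open>\<phi> = i l + \<psi>\<^sub>n\<close> solves the Riccati equation \<open>\<phi>' + \<phi>\<^sup>2 + b \<phi> + l\<^sup>2 = 0\<close> up to the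
  error \<open>2 i l (\<psi>\<^sub>n - \<psi>\<^sub>n\<^sub>+\<^sub>1)\<close>, which gains a factor \<open>\<Xi> / l\<close> in each step.\<close>

primrec riccati :: "(real \<Rightarrow> real) \<Rightarrow> nat \<Rightarrow> real \<Rightarrow> real \<Rightarrow> complex" where
  "riccati b 0 = (\<lambda>l t. 0)"
| "riccati b (Suc n) = (\<lambda>l t. - (of_real (b t) / 2) - 1 / (2 * \<i> * of_real l) *
     (vector_derivative (riccati b n l) (at t within {0..}) + (riccati b n l t)\<^sup>2 + of_real (b t) * riccati b n l t))"

locale oscillating_damping = stabilized_damping +
  fixes m :: nat and \<Xi> :: "real \<Rightarrow> real" and K1 K2 :: real
  assumes Cm: "C_m m b"
    and \<Xi>: "\<And>t. 0 \<le> t \<Longrightarrow> 0 < \<Xi> t" "continuous_on {0..} \<Xi>"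
    and deriv_b: "\<And>t k. 0 \<le> t \<Longrightarrow> k \<le> m \<Longrightarrow> \<bar>nth_deriv k b t\<bar> \<le> \<Xi> t ^ (k + 1)"
    and \<Xi>\<Theta>: "\<And>t. 0 \<le> t \<Longrightarrow> \<Xi> t \<le> K1 * \<Theta> t"
    and int_\<Xi>: "\<And>t. 0 \<le> t \<Longrightarrow> integral {0..t} (\<lambda>s. \<Xi> s ^ (m + 1)) \<le> K2 * \<Theta> t ^ m"
begin

lemma symbol_nth_deriv: "k + d \<le> m \<Longrightarrow> symbol \<Xi> d (Suc k) 0 (\<lambda>l t. complex_of_real (nth_deriv k b t))"
proof (induction d arbitrary: k)
  have bd: "symbol_bound \<Xi> (Suc k) 0 (\<lambda>l t. complex_of_real (nth_deriv k b t))" if "k \<le> m" for k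
    using deriv_b that by (auto simp: symbol_bound_def intro!: exI[of _ 1])
  { case 0 then show ?case using bd by simp }
  case (Suc d)
  have "((\<lambda>t. complex_of_real (nth_deriv k b t)) has_vector_derivative complex_of_real (nth_deriv (Suc k) b t)) (at t within {0..})"
    if "0 \<le> t" for t
  proof -
    have "nth_deriv k b differentiable (at t within {0..})" using Cm Suc.prems that by (auto simp: C_m_def)
    then have "(nth_deriv k b has_vector_derivative nth_deriv (Suc k) b t) (at t within {0..})"
      by (simp add: vector_derivative_works)
    then show ?thesis by (rule bounded_linear.has_vector_derivative[OF bounded_linear_of_real])
  qed
  then show ?case using Suc.IH[of "Suc k"] Suc.prems bd[of k]
    by (auto intro!: exI[of _ "\<lambda>l t. complex_of_real (nth_deriv (Suc k) b t)"])
qed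

lemma symbol_b: "symbol \<Xi> m 1 0 (\<lambda>l t. complex_of_real (b t))"
  using symbol_nth_deriv[of 0 m] by simp

lemma symbol_half_b: "symbol \<Xi> m 1 0 (\<lambda>l t. - (complex_of_real (b t) / 2))"
  using symbol_scale[OF _ _ symbol_b, of "\<lambda>l. - 1 / 2" "1 / 2" 0] by simp

lemma symbol_eps: "symbol \<Xi> d p q F \<Longrightarrow> symbol \<Xi> d p (Suc q) (\<lambda>l t. - (1 / (2 * \<i> * complex_of_real l)) * F l t)"
  using symbol_scale[of "\<lambda>l. - (1 / (2 * \<i> * complex_of_real l))" "1 / 2" 1 \<Xi> d p q F]
  by (simp add: norm_mult norm_divide)

text \<open>The first iterate is - b / 2 with m derivatives, and every further iteration consumes
  one. Thus \<open>riccati b m\<close> can still be differentiated once, as is necessary for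
  inserting it into the Riccati equation.\<close>

lemma symbol_riccati: "n \<le> Suc m \<Longrightarrow> symbol \<Xi> (Suc m - n) 1 0 (riccati b n)"
proof (induction n)
  case 0
  then show ?case using symbol_0 by simp
next
  case (Suc n)
  then have r: "symbol \<Xi> (Suc (m - n)) 1 0 (riccati b n)" by (simp add: Suc_diff_le)
  have b: "symbol \<Xi> (m - n) 1 0 (\<lambda>l t. complex_of_real (b t))" by (rule symbol_mono[OF symbol_b]) simp
  have "symbol \<Xi> (m - n) 2 0 (\<lambda>l t. vector_derivative (riccati b n l) (at t within {0..})
     + riccati b n l t * riccati b n l t + complex_of_real (b t) * riccati b n l t)"
    using symbol_has_vector_derivative(2)[OF r] symbol_mult[OF \<Xi>(1) symbol_Suc_D[OF r] symbol_Suc_D[OF r]]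
      symbol_mult[OF \<Xi>(1) b symbol_Suc_D[OF r]]
    by (intro symbol_add) (auto simp: numeral_2_eq_2)
  from symbol_lower[OF \<Xi>(1), where d = "m - n" and p = 1 and q = 0] symbol_eps[OF this]
  have "symbol \<Xi> (m - n) 1 0 (\<lambda>l t. - (1 / (2 * \<i> * complex_of_real l)) * (vector_derivative (riccati b n l) (at t within {0..})
     + riccati b n l t * riccati b n l t + complex_of_real (b t) * riccati b n l t))"
    by (simp add: numeral_2_eq_2)
  from symbol_add[OF symbol_mono[OF symbol_half_b, where e = "m - n"] this]
  show ?case by (simp add: power2_eq_square diff_Suc_Suc)
qed

text \<open>Factoring the difference of squares, the differences F of consecutive iterates obey
  F_new = - (F' + F (\<psi>_new + \<psi>_old + b)) / (2 i l). Both the derivative and the bracket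
  raise the order in \<Xi> by one, so each step gains \<Xi> / l.\<close>

lemma symbol_riccati_diff:
  "n \<le> m \<Longrightarrow> symbol \<Xi> (m - n) (Suc n) n (\<lambda>l t. riccati b (Suc n) l t - riccati b n l t)"
proof (induction n)
  case 0
  have 0: "vector_derivative (\<lambda>t. 0::complex) (at t within {0..}) = 0" if "0 \<le> t" for t :: real
    by (intro vector_derivative_within at_within_atLeast_neq_bot[OF that] has_vector_derivative_const)
  have "symbol \<Xi> (m - 0) (Suc 0) 0 (\<lambda>l t. - (complex_of_real (b t) / 2))" using symbol_half_b by simp
  then show ?case by (rule symbol_cong) (simp add: 0)
next
  case (Suc n)
  define F where "F l t = riccati b (Suc n) l t - riccati b n l t" for l t
  have F: "symbol \<Xi> (Suc (m - Suc n)) (Suc n) n F"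
    using Suc by (simp add: F_def[abs_def] Suc_diff_Suc)
  have b: "symbol \<Xi> (m - Suc n) 1 0 (\<lambda>l t. complex_of_real (b t))" by (rule symbol_mono[OF symbol_b]) simp
  have r: "symbol \<Xi> (Suc (m - Suc n)) 1 0 (riccati b (Suc n))" "symbol \<Xi> (Suc (m - Suc n)) 1 0 (riccati b n)"
    using symbol_riccati[of "Suc n"] symbol_riccati[of n] Suc.prems
    by (auto intro: symbol_mono simp: Suc_diff_Suc)
  have "symbol \<Xi> (m - Suc n) 1 0 (\<lambda>l t. riccati b (Suc n) l t + riccati b n l t + complex_of_real (b t))"
    by (intro symbol_add b symbol_Suc_D[OF r(1)] symbol_Suc_D[OF r(2)])
  from symbol_mult[OF \<Xi>(1) symbol_Suc_D[OF F] this]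
  have "symbol \<Xi> (m - Suc n) (Suc (Suc n)) n (\<lambda>l t. vector_derivative (F l) (at t within {0..})
     + F l t * (riccati b (Suc n) l t + riccati b n l t + complex_of_real (b t)))"
    using symbol_has_vector_derivative(2)[OF F] by (intro symbol_add) auto
  from symbol_eps[OF this]
  show ?case
  proof (rule symbol_cong)
    fix l t :: real assume lt: "0 < l" "0 \<le> t"
    have DF: "vector_derivative (F l) (at t within {0..}) =
      vector_derivative (riccati b (Suc n) l) (at t within {0..}) - vector_derivative (riccati b n l) (at t within {0..})"
    proof (rule vector_derivative_within[OF at_within_atLeast_neq_bot[OF lt(2)]])
      show "(F l has_vector_derivative vector_derivative (riccati b (Suc n) l) (at t within {0..}) -
          vector_derivative (riccati b n l) (at t within {0..})) (at t within {0..})"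
        unfolding F_def[abs_def]
        by (intro has_vector_derivative_diff symbol_has_vector_derivative(1)[OF r(1) lt]
            symbol_has_vector_derivative(1)[OF r(2) lt])
    qed
    have "- (1 / (2 * \<i> * complex_of_real l)) * (vector_derivative (F l) (at t within {0..})
        + (riccati b (Suc n) l t - riccati b n l t) * (riccati b (Suc n) l t + riccati b n l t + complex_of_real (b t)))
      = riccati b (Suc (Suc n)) l t - riccati b (Suc n) l t"
      unfolding DF using arg_cong2[of _ _ _ _ "(-)", OF riccati.simps(2)[THEN fun_cong, THEN fun_cong, of b "Suc n" l t]
          riccati.simps(2)[THEN fun_cong, THEN fun_cong, of b n l t]]
      by (simp add: power2_eq_square algebra_simps del: riccati.simps)
    then show "- (1 / (2 * \<i> * complex_of_real l)) * (vector_derivative (F l) (at t within {0..})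
        + F l t * (riccati b (Suc n) l t + riccati b n l t + complex_of_real (b t)))
      = riccati b (Suc (Suc n)) l t - riccati b (Suc n) l t"
      by (simp only: F_def)
  qed
qed

end

section \<open>High frequencies: the Riccati transformation\<close>

lemma hyperbolic_rate:
  fixes a c d l \<alpha> \<gamma> b R1 R2 \<rho> f g \<eta> :: real
  assumes l: "0 < l" and ad: "0 \<le> a" "0 \<le> d" "c\<^sup>2 \<le> a * d"
    and \<alpha>: "\<bar>\<alpha>\<bar> \<le> l / 2" and \<gamma>: "\<bar>\<gamma> - l\<bar> \<le> l / 2" and R: "\<bar>R1\<bar> \<le> l * \<rho>" "\<bar>R2\<bar> \<le> l * \<rho>"
    and fg: "l * \<bar>f\<bar> \<le> \<eta>" "\<bar>g\<bar> \<le> \<eta>"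
  defines "Q \<equiv> d - 2 * \<alpha> * c + (\<alpha>\<^sup>2 + \<gamma>\<^sup>2) * a"
    and "\<alpha>' \<equiv> R1 - \<alpha>\<^sup>2 + \<gamma>\<^sup>2 - b * \<alpha> - l\<^sup>2" and "\<gamma>' \<equiv> R2 - 2 * \<alpha> * \<gamma> - b * \<gamma>"
  shows "0 \<le> Q" "d + l\<^sup>2 * a \<le> 6 * Q" "Q \<le> 5 * (d + l\<^sup>2 * a)"
    and "- 2 * b * d - 2 * l\<^sup>2 * c + 2 * g - 2 * \<alpha>' * c - 2 * \<alpha> * (d - b * c - l\<^sup>2 * a + f)
        + 2 * (\<alpha> * \<alpha>' + \<gamma> * \<gamma>') * a + 2 * (\<alpha>\<^sup>2 + \<gamma>\<^sup>2) * c
      \<le> (- b + \<gamma>' / \<gamma> + 8 * \<rho>) * Q + 3 * \<eta>" (is "?lhs \<le> _")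
proof -
  have \<gamma>0: "l / 2 \<le> \<gamma>" "\<gamma> \<le> 3 / 2 * l" "0 < \<gamma>" using \<gamma> l by linarith+
  have \<alpha>2: "\<alpha>\<^sup>2 \<le> l\<^sup>2 / 4" using power_mono[OF \<alpha>, of 2] by (simp add: power_divide)
  have \<gamma>2: "l\<^sup>2 / 4 \<le> \<gamma>\<^sup>2" using power_mono[OF \<gamma>0(1), of 2] l by (simp add: power_divide)
  have \<gamma>2': "\<gamma>\<^sup>2 \<le> 9 / 4 * l\<^sup>2" using power_mono[OF \<gamma>0(2), of 2] \<gamma>0 by (simp add: power_mult_distrib power_divide)
  define q where "q = d - 2 * \<alpha> * c + \<alpha>\<^sup>2 * a"
  have c2: "2 * \<bar>\<alpha>\<bar> * \<bar>c\<bar> \<le> d + \<alpha>\<^sup>2 * a"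
    using two_mult_le_of_square_le[OF ad(3,1,2), of "\<bar>\<alpha>\<bar>"] by simp
  have c3: "\<bar>2 * \<alpha> * c\<bar> \<le> d + \<alpha>\<^sup>2 * a" using c2 by (simp add: abs_mult)
  have q0: "0 \<le> q" using c3 unfolding q_def by (simp add: abs_le_iff)
  have qQ: "Q = q + \<gamma>\<^sup>2 * a" by (simp add: q_def Q_def algebra_simps)
  then show Q0: "0 \<le> Q" using q0 ad by simp
  have a\<alpha>: "\<alpha>\<^sup>2 * a \<le> l\<^sup>2 / 4 * a" "l\<^sup>2 / 4 * a \<le> \<gamma>\<^sup>2 * a" "\<gamma>\<^sup>2 * a \<le> 9 / 4 * l\<^sup>2 * a"
    using \<alpha>2 \<gamma>2 \<gamma>2' ad by (intro mult_right_mono; simp)+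
  have "d \<le> 2 * q + 2 * \<alpha>\<^sup>2 * a"
  proof -
    have "2 * \<bar>2 * \<alpha>\<bar> * \<bar>c\<bar> \<le> d + \<bar>2 * \<alpha>\<bar>\<^sup>2 * a"
      using two_mult_le_of_square_le[OF ad(3,1,2), of "\<bar>2 * \<alpha>\<bar>"] by simp
    then have "4 * \<bar>\<alpha> * c\<bar> \<le> d + 4 * \<alpha>\<^sup>2 * a" by (simp add: abs_mult power_mult_distrib)
    moreover have "\<alpha> * c \<le> \<bar>\<alpha> * c\<bar>" by simp
    ultimately show ?thesis unfolding q_def by (simp add: algebra_simps)
  qed
  then show "d + l\<^sup>2 * a \<le> 6 * Q" using a\<alpha> q0 unfolding qQ by (simp add: algebra_simps)
  show "Q \<le> 5 * (d + l\<^sup>2 * a)" using c3 a\<alpha> ad unfolding Q_def by (simp add: abs_le_iff algebra_simps)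
  have k2: "(c - \<alpha> * a)\<^sup>2 \<le> a * q"
    using ad by (simp add: q_def power2_eq_square algebra_simps)
  have kQ: "2 * \<gamma> * \<bar>c - \<alpha> * a\<bar> \<le> Q"
    using two_mult_le_of_square_le[OF k2 ad(1) q0, of \<gamma>] \<gamma>0 unfolding qQ by simp
  have \<eta>0: "0 \<le> \<eta>" using fg by linarith
  have l\<rho>: "0 \<le> l * \<rho>" using R by linarith
  \<comment> \<open>For real v, \<open>Q\<close> is |v' - \<phi> v|^2 with \<phi> = \<alpha> + i
    \<gamma>. An exact Riccati solution gives (v' - \<phi> v)' = - (b + \<phi>) (v' - \<phi> v) when
    e = 0, hence Q' = - 2 (b + \<alpha>) Q. The remaining terms are the defects R1, R2 and the
    error.\<close>
  have eq: "?lhs = - 2 * (b + \<alpha>) * Q - 2 * R1 * (c - \<alpha> * a) + 2 * \<gamma> * R2 * a + 2 * g - 2 * \<alpha> * f"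
    by (simp add: Q_def \<alpha>'_def \<gamma>'_def power2_eq_square algebra_simps)
  have 1: "- 2 * R1 * (c - \<alpha> * a) \<le> 2 * \<rho> * Q"
  proof -
    have "- 2 * R1 * (c - \<alpha> * a) \<le> 2 * (\<bar>R1\<bar> * \<bar>c - \<alpha> * a\<bar>)"
      using abs_ge_minus_self[of "R1 * (c - \<alpha> * a)"] by (simp add: abs_mult)
    also have "\<dots> \<le> 2 * ((l * \<rho>) * \<bar>c - \<alpha> * a\<bar>)" using R by (intro mult_left_mono mult_right_mono) auto
    also have "\<dots> = 2 * \<rho> * (l * \<bar>c - \<alpha> * a\<bar>)" by simp
    also have "\<dots> \<le> 2 * \<rho> * (2 * \<gamma> * \<bar>c - \<alpha> * a\<bar>)"
      using l\<rho> l \<gamma>0 by (intro mult_left_mono mult_right_mono) (auto simp: zero_le_mult_iff)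
    also have "\<dots> \<le> 2 * \<rho> * Q" using kQ l\<rho> l by (intro mult_left_mono) (auto simp: zero_le_mult_iff)
    finally show ?thesis .
  qed
  have \<rho>0: "0 \<le> \<rho>" using l\<rho> l by (simp add: zero_le_mult_iff)
  have 2: "2 * \<gamma> * R2 * a \<le> 4 * \<rho> * Q"
  proof -
    have "2 * \<gamma> * R2 * a \<le> 2 * \<gamma> * (l * \<rho>) * a" using R \<gamma>0 ad by (intro mult_left_mono mult_right_mono) auto
    also have "\<dots> \<le> 2 * \<gamma> * ((2 * \<gamma>) * \<rho>) * a" using \<gamma>0 \<rho>0 ad by (intro mult_left_mono mult_right_mono) auto
    also have "\<dots> = 4 * \<rho> * (\<gamma>\<^sup>2 * a)" by (simp add: power2_eq_square)
    also have "\<dots> \<le> 4 * \<rho> * Q" using \<rho>0 q0 unfolding qQ by (intro mult_left_mono) auto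
    finally show ?thesis .
  qed
  \<comment> \<open>The imaginary part of the equation reads \<gamma>' / \<gamma> = R2 / \<gamma> -
    2 \<alpha> - b. It replaces - 2 (b + \<alpha>) by - b + \<gamma>' / \<gamma> up to the defect,
    and the latter has the primitive ln \<gamma> - \<integral> b: half of the damping is cancelled
    and \<alpha> disappears.\<close>
  have 3: "- 2 * (b + \<alpha>) * Q \<le> (- b + \<gamma>' / \<gamma> + 2 * \<rho>) * Q"
  proof (rule mult_right_mono[OF _ Q0])
    have "- R2 \<le> 2 * \<gamma> * \<rho>" using R(2) mult_right_mono[of l "2 * \<gamma>" \<rho>] \<gamma>0 \<rho>0 by linarith
    then have "- R2 / \<gamma> \<le> 2 * \<rho>" using \<gamma>0 by (simp add: field_simps)
    then show "- 2 * (b + \<alpha>) \<le> - b + \<gamma>' / \<gamma> + 2 * \<rho>"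
      using \<gamma>0 by (simp add: \<gamma>'_def diff_divide_distrib)
  qed
  have 4: "2 * g - 2 * \<alpha> * f \<le> 3 * \<eta>"
  proof -
    have "- 2 * \<alpha> * f \<le> 2 * (\<bar>\<alpha>\<bar> * \<bar>f\<bar>)" using abs_ge_minus_self[of "\<alpha> * f"] by (simp add: abs_mult)
    also have "\<dots> \<le> 2 * (l / 2 * \<bar>f\<bar>)" using \<alpha> by (intro mult_left_mono mult_right_mono) auto
    finally show ?thesis using fg by simp
  qed
  show "?lhs \<le> (- b + \<gamma>' / \<gamma> + 8 * \<rho>) * Q + 3 * \<eta>"
    unfolding eq using 1 2 3 4 by (simp add: algebra_simps)
qed

context oscillating_damping
begin

lemma approx_riccati:
  obtains C1 C2 where "0 \<le> C1" "0 \<le> C2"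
    "\<And>l. 0 < l \<Longrightarrow> \<exists>\<phi> R. \<forall>t\<ge>0. (\<phi> has_vector_derivative R t - (\<phi> t)\<^sup>2 - of_real (b t) * \<phi> t - (of_real l)\<^sup>2) (at t within {0..}) \<and>
       (\<Xi> t \<le> l \<longrightarrow> cmod (\<phi> t - \<i> * of_real l) \<le> C1 * \<Xi> t \<and> cmod (R t) \<le> l * (C2 * \<Xi> t ^ (m + 1) / l ^ m))"
proof -
  have S: "symbol \<Xi> (Suc 0) 1 0 (riccati b m)" using symbol_riccati[of m] by simp
  from symbol_imp_bound[OF S] obtain C1 where C1: "0 \<le> C1"
    "\<And>l t. 0 < l \<Longrightarrow> 0 \<le> t \<Longrightarrow> \<Xi> t \<le> l \<Longrightarrow> cmod (riccati b m l t) \<le> C1 * \<Xi> t ^ 1 / l ^ 0"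
    unfolding symbol_bound_def by blast
  from symbol_imp_bound[OF symbol_riccati_diff[of m]] obtain C2 where C2: "0 \<le> C2"
    "\<And>l t. 0 < l \<Longrightarrow> 0 \<le> t \<Longrightarrow> \<Xi> t \<le> l \<Longrightarrow> cmod (riccati b (Suc m) l t - riccati b m l t) \<le> C2 * \<Xi> t ^ Suc m / l ^ m"
    unfolding symbol_bound_def by blast
  show thesis
  proof (rule that[of C1 "2 * C2"])
    fix l :: real assume l: "0 < l"
    define \<phi> where "\<phi> t = \<i> * of_real l + riccati b m l t" for t
    define R where "R t = - 2 * \<i> * of_real l * (riccati b (Suc m) l t - riccati b m l t)" for t
    show "\<exists>\<phi> R. \<forall>t\<ge>0. (\<phi> has_vector_derivative R t - (\<phi> t)\<^sup>2 - of_real (b t) * \<phi> t - (of_real l)\<^sup>2) (at t within {0..}) \<and>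
       (\<Xi> t \<le> l \<longrightarrow> cmod (\<phi> t - \<i> * of_real l) \<le> C1 * \<Xi> t \<and> cmod (R t) \<le> l * (2 * C2 * \<Xi> t ^ (m + 1) / l ^ m))"
    proof (rule exI[of _ \<phi>], rule exI[of _ R], intro allI impI conjI)
      fix t :: real assume t: "0 \<le> t"
      let ?D = "vector_derivative (riccati b m l) (at t within {0..})"
      have "(\<phi> has_vector_derivative ?D) (at t within {0..})"
        unfolding \<phi>_def[abs_def] using symbol_has_vector_derivative(1)[OF S l t]
        by (auto intro!: derivative_eq_intros)
      moreover have "?D = R t - (\<phi> t)\<^sup>2 - of_real (b t) * \<phi> t - (of_real l)\<^sup>2"
      proof -
        have i: "2 * \<i> * of_real l * (1 / (2 * \<i> * of_real l)) = (1::complex)" using l by simp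
        have "R t = 2 * \<i> * of_real l * (of_real (b t) / 2) + 2 * \<i> * of_real l * riccati b m l t
          + (2 * \<i> * of_real l * (1 / (2 * \<i> * of_real l))) * (?D + (riccati b m l t)\<^sup>2 + of_real (b t) * riccati b m l t)"
          unfolding R_def riccati.simps(2) by (simp add: algebra_simps)
        then show ?thesis unfolding i \<phi>_def by (simp add: power2_eq_square algebra_simps)
      qed
      ultimately show "(\<phi> has_vector_derivative R t - (\<phi> t)\<^sup>2 - of_real (b t) * \<phi> t - (of_real l)\<^sup>2) (at t within {0..})"
        by simp
      assume \<Xi>l: "\<Xi> t \<le> l"
      show "cmod (\<phi> t - \<i> * of_real l) \<le> C1 * \<Xi> t" using C1(2)[OF l t \<Xi>l] by (simp add: \<phi>_def)
      have "cmod (R t) = 2 * l * cmod (riccati b (Suc m) l t - riccati b m l t)"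
        using l by (simp add: R_def norm_mult)
      also have "\<dots> \<le> 2 * l * (C2 * \<Xi> t ^ Suc m / l ^ m)" using C2(2)[OF l t \<Xi>l] l by (intro mult_left_mono) auto
      finally show "cmod (R t) \<le> l * (2 * C2 * \<Xi> t ^ (m + 1) / l ^ m)" by (simp add: mult_ac)
    qed
  qed (use C1 C2 in auto)
qed

text \<open>The functional \<open>Q = |v' - \<phi> v|\<^sup>2\<close> is governed by \<open>b\<close> and \<open>Im \<phi>\<close> alone when \<open>\<phi>\<close> solves the Riccati
  equation exactly.\<close>

lemma hyperbolic_zone:
  obtains n C where "1 \<le> n" "0 \<le> C"
    "\<And>a c d f g \<eta> N l \<tau> t. energy_triple b a c d f g \<eta> N l \<tau> \<Longrightarrow> T \<le> t \<Longrightarrow> t \<le> \<tau> \<Longrightarrow> n * \<Theta> t \<le> l \<Longrightarrow>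
      d t + l\<^sup>2 * a t \<le> C * (exp (- I t) * (d T + l\<^sup>2 * a T) + (N t - N T))"
proof -
  obtain C1 C2 where C: "0 \<le> C1" "0 \<le> C2" and ric:
    "\<And>l. 0 < l \<Longrightarrow> \<exists>\<phi> R. \<forall>t\<ge>0. (\<phi> has_vector_derivative R t - (\<phi> t)\<^sup>2 - of_real (b t) * \<phi> t - (of_real l)\<^sup>2) (at t within {0..}) \<and>
       (\<Xi> t \<le> l \<longrightarrow> cmod (\<phi> t - \<i> * of_real l) \<le> C1 * \<Xi> t \<and> cmod (R t) \<le> l * (C2 * \<Xi> t ^ (m + 1) / l ^ m))"
    using approx_riccati by blast
  \<comment> \<open>Where n \<Theta> <= l, this choice forces \<Xi> <= l, so that the symbol bounds
    apply, and C1 \<Xi> <= l / 2, so that \<phi> stays within l / 2 of i l.\<close>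
  define n where "n = max 1 (max K1 (2 * C1 * K1))"
  have n: "1 \<le> n" "K1 \<le> n" "2 * C1 * K1 \<le> n" by (auto simp: n_def)
  \<comment> \<open>The contributions to the exponent: the variation of S, the quotient of two
    values of \<gamma> in [l / 2, 3 l / 2], and the accumulated Riccati defect.\<close>
  define B where "B = 2 * S0 + ln 3 + 8 * (C2 * K2)"
  have K2: "0 \<le> K2"
    using int_\<Xi>[of 0] zero_less_power[OF \<Theta>(1)[of 0], of m] by (auto simp: zero_le_mult_iff)
  show thesis
  proof (rule that[of n "30 * exp B"])
    fix a c d f g \<eta> N :: "real \<Rightarrow> real" and l \<tau> t :: real
    assume E: "energy_triple b a c d f g \<eta> N l \<tau>" and t: "T \<le> t" "t \<le> \<tau>" "n * \<Theta> t \<le> l"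
    interpret E: energy_triple b a c d f g \<eta> N l \<tau> by (rule E)
    have \<Theta>t: "0 < \<Theta> t" using \<Theta>(1) t T by simp
    have "1 * \<Theta> t \<le> n * \<Theta> t" using n \<Theta>t by (intro mult_right_mono) auto
    then have \<Theta>l: "\<Theta> t \<le> l" using t by simp
    then have l: "0 < l" using \<Theta>t by simp
    obtain \<phi> R where \<phi>:
      "\<And>t. 0 \<le> t \<Longrightarrow> (\<phi> has_vector_derivative R t - (\<phi> t)\<^sup>2 - of_real (b t) * \<phi> t - (of_real l)\<^sup>2) (at t within {0..})"
      "\<And>t. 0 \<le> t \<Longrightarrow> \<Xi> t \<le> l \<Longrightarrow> cmod (\<phi> t - \<i> * of_real l) \<le> C1 * \<Xi> t"
      "\<And>t. 0 \<le> t \<Longrightarrow> \<Xi> t \<le> l \<Longrightarrow> cmod (R t) \<le> l * (C2 * \<Xi> t ^ (m + 1) / l ^ m)"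
      using ric[OF l] by blast
    define \<alpha> where "\<alpha> x = Re (\<phi> x)" for x
    define \<gamma> where "\<gamma> x = Im (\<phi> x)" for x
    define \<alpha>' where "\<alpha>' x = Re (R x) - (\<alpha> x)\<^sup>2 + (\<gamma> x)\<^sup>2 - b x * \<alpha> x - l\<^sup>2" for x
    define \<gamma>' where "\<gamma>' x = Im (R x) - 2 * \<alpha> x * \<gamma> x - b x * \<gamma> x" for x
    have sub: "{T..t} \<subseteq> {0..}" using T by auto
    have xs: "T \<le> x" "x \<le> t" "0 \<le> x" "x \<in> {0..\<tau>}" if "x \<in> {T..t}" for x using that T t by auto
    have d\<alpha>: "(\<alpha> has_real_derivative \<alpha>' x) (at x within {T..t})"
      and d\<gamma>: "(\<gamma> has_real_derivative \<gamma>' x) (at x within {T..t})" if x: "x \<in> {T..t}" for x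
    proof -
      have D: "(\<phi> has_vector_derivative R x - (\<phi> x)\<^sup>2 - of_real (b x) * \<phi> x - (of_real l)\<^sup>2) (at x within {T..t})"
        by (rule has_vector_derivative_within_subset[OF \<phi>(1) sub]) (use xs[OF x] in auto)
      show "(\<alpha> has_real_derivative \<alpha>' x) (at x within {T..t})"
        using bounded_linear.has_vector_derivative[OF bounded_linear_Re D]
        by (simp add: \<alpha>_def[abs_def] \<alpha>'_def \<gamma>_def has_real_derivative_iff_has_vector_derivative power2_eq_square algebra_simps)
      show "(\<gamma> has_real_derivative \<gamma>' x) (at x within {T..t})"
        using bounded_linear.has_vector_derivative[OF bounded_linear_Im D]
        by (simp add: \<gamma>_def[abs_def] \<gamma>'_def \<alpha>_def has_real_derivative_iff_has_vector_derivative power2_eq_square algebra_simps)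
    qed
    have \<Xi>b: "\<Xi> x \<le> l" "C1 * \<Xi> x \<le> l / 2" if x: "x \<in> {T..t}" for x
    proof -
      have "\<Theta> x \<le> \<Theta> t" using \<Theta>(2) x T by (auto simp: mono_on_def)
      moreover have "0 < \<Theta> x" using \<Theta>(1) x T by auto
      ultimately have n\<Theta>: "n * \<Theta> x \<le> l" using t n mult_left_mono[of "\<Theta> x" "\<Theta> t" n] by linarith
      have "K1 * \<Theta> x \<le> n * \<Theta> x" using n \<open>0 < \<Theta> x\<close> by (intro mult_right_mono) auto
      then show "\<Xi> x \<le> l" using \<Xi>\<Theta>[of x] xs[OF x] n\<Theta> by linarith
      have "2 * (C1 * \<Xi> x) \<le> 2 * (C1 * (K1 * \<Theta> x))" using \<Xi>\<Theta>[of x] xs[OF x] C by (intro mult_left_mono) auto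
      also have "\<dots> = (2 * C1 * K1) * \<Theta> x" by simp
      also have "\<dots> \<le> n * \<Theta> x" using n \<open>0 < \<Theta> x\<close> by (intro mult_right_mono) auto
      finally show "C1 * \<Xi> x \<le> l / 2" using n\<Theta> by simp
    qed
    have \<alpha>b: "\<bar>\<alpha> x\<bar> \<le> l / 2" and \<gamma>b: "\<bar>\<gamma> x - l\<bar> \<le> l / 2" if x: "x \<in> {T..t}" for x
      using \<phi>(2)[of x] \<Xi>b[OF x] xs[OF x] abs_Re_le_cmod[of "\<phi> x - \<i> * of_real l"] abs_Im_le_cmod[of "\<phi> x - \<i> * of_real l"]
      by (auto simp: \<alpha>_def \<gamma>_def)
    have \<gamma>0: "l / 2 \<le> \<gamma> x" "\<gamma> x \<le> 3 / 2 * l" "0 < \<gamma> x" if x: "x \<in> {T..t}" for x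
      using \<gamma>b[OF x] l by linarith+
    define \<rho> where "\<rho> x = C2 * \<Xi> x ^ (m + 1) / l ^ m" for x
    define J where "J x = integral {T..x} (\<lambda>x. \<Xi> x ^ (m + 1))" for x
    define Q where "Q x = d x - 2 * \<alpha> x * c x + ((\<alpha> x)\<^sup>2 + (\<gamma> x)\<^sup>2) * a x" for x
    define Q' where "Q' x = - 2 * b x * d x - 2 * l\<^sup>2 * c x + 2 * g x - 2 * \<alpha>' x * c x - 2 * \<alpha> x * (d x - b x * c x - l\<^sup>2 * a x + f x)
        + 2 * (\<alpha> x * \<alpha>' x + \<gamma> x * \<gamma>' x) * a x + 2 * ((\<alpha> x)\<^sup>2 + (\<gamma> x)\<^sup>2) * c x" for x
    have rate: "0 \<le> Q x \<and> d x + l\<^sup>2 * a x \<le> 6 * Q x \<and> Q x \<le> 5 * (d x + l\<^sup>2 * a x) \<and>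
        Q' x \<le> (- b x + \<gamma>' x / \<gamma> x + 8 * \<rho> x) * Q x + 3 * \<eta> x" if x: "x \<in> {T..t}" for x
    proof -
      have "\<bar>Re (R x)\<bar> \<le> l * \<rho> x" "\<bar>Im (R x)\<bar> \<le> l * \<rho> x"
        using \<phi>(3)[of x] \<Xi>b[OF x] xs[OF x] abs_Re_le_cmod[of "R x"] abs_Im_le_cmod[of "R x"] by (auto simp: \<rho>_def)
      note r = hyperbolic_rate[OF l E.a[OF xs(4)[OF x]] E.d[OF xs(4)[OF x]] E.cs[OF xs(4)[OF x]] \<alpha>b[OF x] \<gamma>b[OF x] this
          E.l_f_le[OF xs(4)[OF x]] E.g[OF xs(4)[OF x]]]
      from r(1-3) r(4)[where b = "b x"] show ?thesis unfolding Q_def Q'_def \<alpha>'_def \<gamma>'_def by blast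
    qed
    have dQ: "(Q has_real_derivative Q' x) (at x within {T..t})" if x: "x \<in> {T..t}" for x
      unfolding Q_def[abs_def]
      by (auto intro!: derivative_eq_intros d\<alpha>[OF x] d\<gamma>[OF x] E.derivs_sub[OF T t(2) x]
          simp: Q'_def power2_eq_square algebra_simps)
    have \<Xi>_cont: "continuous_on {u..v} (\<lambda>x. \<Xi> x ^ (m + 1))" if "0 \<le> u" for u v
      using that by (intro continuous_on_power continuous_on_subset[OF \<Xi>(2)]) auto
    have dJ: "(J has_real_derivative \<Xi> x ^ (m + 1)) (at x within {T..t})" if x: "x \<in> {T..t}" for x
      unfolding J_def[abs_def] by (rule integral_has_real_derivative[OF \<Xi>_cont[OF T] x])
    \<comment> \<open>S - I is a primitive of - b, so the oscillating part of the damping leaves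
      only the bounded function S in the exponent.\<close>
    define \<Phi> where "\<Phi> x = S x - I x + ln (\<gamma> x) + 8 * C2 / l ^ m * J x" for x
    have d\<Phi>: "(\<Phi> has_real_derivative - b x + \<gamma>' x / \<gamma> x + 8 * \<rho> x) (at x within {T..t})" if x: "x \<in> {T..t}" for x
      unfolding \<Phi>_def[abs_def] using \<gamma>0[OF x] l
      by (auto intro!: derivative_eq_intros S_deriv[OF order_refl x] I_deriv[OF order_refl x] d\<gamma>[OF x] dJ[OF x] simp: \<rho>_def)
    have \<Phi>_le: "\<Phi> t - \<Phi> x \<le> I x - I t + B" if x: "x \<in> {T..t}" for x
    proof -
      have tt: "t \<in> {T..t}" using t by simp
      have "J t - J x \<le> K2 * l ^ m"
      proof -
        have int: "(\<lambda>x. \<Xi> x ^ (m + 1)) integrable_on {u..v}" if "0 \<le> u" for u v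
          using \<Xi>_cont[OF that] by (rule integrable_continuous_real)
        have pos: "0 \<le> \<Xi> x ^ (m + 1)" if "0 \<le> x" for x
          using \<Xi>(1)[OF that] by (intro zero_le_power) simp
        have "0 \<le> J x" unfolding J_def
          by (intro integral_nonneg int T pos) (use T in auto)
        moreover have "J t \<le> integral {0..t} (\<lambda>x. \<Xi> x ^ (m + 1))"
          unfolding J_def by (intro integral_subset_le int) (use T pos in auto)
        moreover have "integral {0..t} (\<lambda>x. \<Xi> x ^ (m + 1)) \<le> K2 * \<Theta> t ^ m" using int_\<Xi>[of t] xs[OF tt] by auto
        moreover have "K2 * \<Theta> t ^ m \<le> K2 * l ^ m" using K2 \<Theta>l \<Theta>t by (intro mult_left_mono power_mono) auto
        ultimately show ?thesis by linarith
      qed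
      then have "8 * C2 / l ^ m * (J t - J x) \<le> 8 * C2 / l ^ m * (K2 * l ^ m)"
        using C l by (intro mult_left_mono) auto
      also have "\<dots> = 8 * (C2 * K2)" using l by simp
      finally have 1: "8 * C2 / l ^ m * (J t - J x) \<le> 8 * (C2 * K2)" .
      have "ln (\<gamma> t) \<le> ln (3 * \<gamma> x)" using \<gamma>0[OF x] \<gamma>0[OF tt] by simp
      also have "\<dots> = ln 3 + ln (\<gamma> x)" using \<gamma>0[OF x] by (simp add: ln_mult)
      finally have 2: "ln (\<gamma> t) - ln (\<gamma> x) \<le> ln 3" by simp
      have "S t - S x \<le> 2 * S0" using S[of t] S[of x] xs[OF x] t by (auto simp: abs_le_iff)
      with 1 2 show ?thesis unfolding \<Phi>_def B_def right_diff_distrib by linarith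
    qed
    have "Q t \<le> exp (\<Phi> t - \<Phi> T) * Q T + 3 * exp B * (N t - N T)"
    proof (rule gronwall_perturbed[where g = Q and g' = Q' and N = N and \<eta> = \<eta> and \<phi> = \<Phi> and \<phi>' = "\<lambda>x. - b x + \<gamma>' x / \<gamma> x + 8 * \<rho> x"])
      fix x assume x: "x \<in> {T..t}"
      show "(Q has_real_derivative Q' x) (at x within {T..t})" by (rule dQ[OF x])
      show "(\<Phi> has_real_derivative - b x + \<gamma>' x / \<gamma> x + 8 * \<rho> x) (at x within {T..t})" by (rule d\<Phi>[OF x])
      show "(N has_real_derivative \<eta> x) (at x within {T..t})" using E.derivs_sub(4)[OF T t(2) x] .
      show "Q' x \<le> (- b x + \<gamma>' x / \<gamma> x + 8 * \<rho> x) * Q x + 3 * \<eta> x" using rate[OF x] by simp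
      show "\<Phi> t - \<Phi> x \<le> B" using \<Phi>_le[OF x] I_mono[of x t] x by auto
      show "0 \<le> \<eta> x" by (rule E.\<eta>[OF xs(4)[OF x]])
    qed (use t in auto)
    also have "exp (\<Phi> t - \<Phi> T) * Q T \<le> exp (- I t + B) * (5 * (d T + l\<^sup>2 * a T))"
      using \<Phi>_le[of T] rate[of T] t by (intro mult_mono) auto
    also have "exp (- I t + B) = exp (- I t) * exp B" by (rule exp_add)
    finally have "Q t \<le> exp B * (5 * (exp (- I t) * (d T + l\<^sup>2 * a T)) + 3 * (N t - N T))"
      by (simp add: algebra_simps)
    moreover have "d t + l\<^sup>2 * a t \<le> 6 * Q t" using rate[of t] t by simp
    ultimately have "d t + l\<^sup>2 * a t \<le> 6 * (exp B * (5 * (exp (- I t) * (d T + l\<^sup>2 * a T)) + 3 * (N t - N T)))"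
      by linarith
    also have "\<dots> \<le> 6 * (exp B * (5 * (exp (- I t) * (d T + l\<^sup>2 * a T)) + 5 * (N t - N T)))"
      using E.N_mono[OF T t(1,2)] by (intro mult_left_mono add_left_mono mult_right_mono) auto
    finally show "d t + l\<^sup>2 * a t \<le> 30 * exp B * (exp (- I t) * (d T + l\<^sup>2 * a T) + (N t - N T))"
      by (simp add: algebra_simps)
  qed (use n in auto)
qed

section \<open>Joining the three zones\<close>

lemma energy_estimate:
  obtains C K where "0 < C" "\<And>t. 0 \<le> K t"
    "\<And>a c d f g \<eta> N l t. energy_triple b a c d f g \<eta> N l t \<Longrightarrow>
      d t + l\<^sup>2 * a t \<le> C * exp (- I (max T t)) * (d 0 + (1 + l\<^sup>2) * a 0) + K t * (N t - N 0)"
proof -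
  obtain n0 C3 where n0: "1 \<le> n0" "0 \<le> C3" and hyp:
    "\<And>a c d f g \<eta> N l \<tau> t. energy_triple b a c d f g \<eta> N l \<tau> \<Longrightarrow> T \<le> t \<Longrightarrow> t \<le> \<tau> \<Longrightarrow> n0 * \<Theta> t \<le> l \<Longrightarrow>
      d t + l\<^sup>2 * a t \<le> C3 * (exp (- I t) * (d T + l\<^sup>2 * a T) + (N t - N T))"
    using hyperbolic_zone by blast
  \<comment> \<open>The second entry ensures l >= n \<Theta>(T) >= 1 for every frequency that starts
    in the hyperbolic zone at time T.\<close>
  define n where "n = max n0 (1 / \<Theta> T)"
  have \<Theta>T: "0 < \<Theta> T" using \<Theta>(1) T by simp
  have n: "n0 \<le> n" "1 \<le> n" "1 \<le> n * \<Theta> T"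
  proof -
    show "n0 \<le> n" "1 \<le> n" using n0 by (auto simp: n_def)
    have "1 / \<Theta> T * \<Theta> T \<le> n * \<Theta> T" using \<Theta>T by (intro mult_right_mono) (auto simp: n_def)
    then show "1 \<le> n * \<Theta> T" using \<Theta>T by simp
  qed
  define q where "q = exp S0"
  define \<kappa> where "\<kappa> = q / (1 - \<mu>0)"
  define D1 where "D1 = 3 * q ^ 4 * exp (6 * q\<^sup>2 * n + 1)"
  define C5 where "C5 = (q\<^sup>2 + 2 + 2 * \<kappa>\<^sup>2) * exp (q * (1 + \<kappa>)\<^sup>2)"
  define A where "A = 1 + C3 + C5 * q\<^sup>2"
  define k where "k t = 6 * (q * (1 + \<kappa>) * (1 + t))\<^sup>2 + 2" for t
  have q1: "1 \<le> q" using S0 by (simp add: q_def)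
  have q2: "1 \<le> q\<^sup>2" using q1 by simp
  have \<kappa>0: "0 \<le> \<kappa>" using q1 \<mu>0 by (simp add: \<kappa>_def)
  have C5: "0 \<le> C5" by (simp add: C5_def)
  have A: "1 \<le> A" "C3 \<le> A" "C5 * q\<^sup>2 \<le> A" using n0 C5 by (auto simp: A_def)
  have D1: "1 \<le> D1"
  proof -
    have "1 * 1 \<le> 3 * q ^ 4 * exp (6 * q\<^sup>2 * n + 1)"
      using one_le_power[OF q1, of 4] n q2 by (intro mult_mono) auto
    then show ?thesis by (simp add: D1_def)
  qed
  have k2: "2 \<le> k t" for t by (simp add: k_def)
  have "compact (b ` {0..T})" by (intro compact_continuous_image continuous_on_subset[OF b]) auto
  then have "bounded (b ` {0..T})" by (rule compact_imp_bounded)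
  then obtain B where B: "\<And>x. x \<in> {0..T} \<Longrightarrow> \<bar>b x\<bar> \<le> B"
    unfolding bounded_iff by (metis imageI real_norm_def)
  define A0 where "A0 = exp ((2 * B + 1) * T)"
  have B0: "0 \<le> B" using B[of 0] T by auto
  have A0: "1 \<le> A0" using B0 T by (simp add: A0_def)
  have late: "d t + l\<^sup>2 * a t \<le> D1 * A * (exp (- I t) * (d T + (1 + l\<^sup>2) * a T) + k t * (N t - N T))"
    if E: "energy_triple b a c d f g \<eta> N l t" and t: "T \<le> t" for a c d f g \<eta> N l t
  proof -
    interpret E: energy_triple b a c d f g \<eta> N l t by (rule E)
    define X where "X = d T + (1 + l\<^sup>2) * a T"
    \<comment> \<open>Times covered by the estimate of one zone starting at T; from such a time the
      stabilized zone may take over. After T at most the two factors \<open>A\<close> and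
      \<open>D1\<close> are multiplied, whatever l is.\<close>
    define reach where "reach s \<longleftrightarrow> d s + l\<^sup>2 * a s \<le> A * (exp (- I s) * X + k t * (N s - N T))" for s
    have aT: "0 \<le> a T" "0 \<le> d T" using E.a[of T] E.d[of T] T t by auto
    have X: "d T + l\<^sup>2 * a T \<le> X" "d T + a T \<le> X" "0 \<le> X" using aT by (auto simp: X_def algebra_simps)
    have k0: "0 \<le> k t" using k2[of t] by simp
    have N: "0 \<le> N s - N T" if "T \<le> s" "s \<le> t" for s using E.N_mono[OF T that] by simp
    have reach_T: "reach T"
    proof -
      have "1 * X \<le> A * X" using A X by (intro mult_right_mono) auto
      then show ?thesis using X by (simp add: reach_def)
    qed
    have reach_hyp: "reach s" if s: "T \<le> s" "s \<le> t" "n * \<Theta> s \<le> l" for s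
    proof -
      have "0 < \<Theta> s" using \<Theta>(1) s T by simp
      then have "n0 * \<Theta> s \<le> n * \<Theta> s" using n by (intro mult_right_mono) auto
      then have "d s + l\<^sup>2 * a s \<le> C3 * (exp (- I s) * (d T + l\<^sup>2 * a T) + 1 * (N s - N T))"
        using hyp[OF E s(1,2)] s by simp
      also have "\<dots> \<le> A * (exp (- I s) * X + k t * (N s - N T))"
        using A n0 X N[OF s(1,2)] k2[of t] aT by (intro mult_mono add_mono mult_left_mono mult_right_mono) auto
      finally show ?thesis by (simp add: reach_def)
    qed
    have reach_diss: "reach s" if s: "T \<le> s" "s \<le> t" "l * (1 + s) \<le> 1" for s
    proof -
      have "d s + l\<^sup>2 * a s \<le> C5 * (q\<^sup>2 * exp (- I s) * (d T + a T) + 6 * (q * (1 + \<kappa>) * (1 + s))\<^sup>2 * (N s - N T))"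
        using dissipative_zone[OF E s] by (simp add: C5_def \<kappa>_def q_def)
      also have "\<dots> \<le> C5 * (q\<^sup>2 * (exp (- I s) * X) + q\<^sup>2 * (k t * (N s - N T)))"
      proof (intro mult_left_mono[OF _ C5] add_mono)
        show "q\<^sup>2 * exp (- I s) * (d T + a T) \<le> q\<^sup>2 * (exp (- I s) * X)"
          unfolding mult.assoc using X by (intro mult_left_mono) auto
        have "(q * (1 + \<kappa>) * (1 + s))\<^sup>2 \<le> (q * (1 + \<kappa>) * (1 + t))\<^sup>2"
          using q1 \<kappa>0 s T by (intro power_mono mult_left_mono) auto
        then have "6 * (q * (1 + \<kappa>) * (1 + s))\<^sup>2 \<le> k t" by (simp add: k_def)
        then have "6 * (q * (1 + \<kappa>) * (1 + s))\<^sup>2 * (N s - N T) \<le> k t * (N s - N T)"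
          using N[OF s(1,2)] by (intro mult_right_mono) auto
        moreover have "1 * (k t * (N s - N T)) \<le> q\<^sup>2 * (k t * (N s - N T))"
          using q2 k0 N[OF s(1,2)] by (intro mult_right_mono) auto
        ultimately show "6 * (q * (1 + \<kappa>) * (1 + s))\<^sup>2 * (N s - N T) \<le> q\<^sup>2 * (k t * (N s - N T))" by simp
      qed
      also have "\<dots> = C5 * q\<^sup>2 * (exp (- I s) * X + k t * (N s - N T))" by (simp add: algebra_simps)
      also have "\<dots> \<le> A * (exp (- I s) * X + k t * (N s - N T))"
        using A X N[OF s(1,2)] k0 by (intro mult_right_mono) auto
      finally show ?thesis by (simp add: reach_def)
    qed
    \<comment> \<open>The switching time. If l >= n \<Theta>(T), it is where n \<Theta>(s) = l, and
      \<mu>(s) <= 1 <= l there. Otherwise l / \<Theta> <= n from T on, and one only stays in the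
      dissipative zone until l (1 + s) >= 1, which yields \<mu>(s) <= l. If t comes earlier, s = t
      and no second zone is entered.\<close>
    obtain s where s: "T \<le> s" "s \<le> t" "reach s" "s = t \<or> 0 < l \<and> \<mu> s \<le> l \<and> l / \<Theta> s \<le> n"
    proof (cases "n * \<Theta> T \<le> l")
      case True
      show thesis
      proof (cases "n * \<Theta> t \<le> l")
        case True
        then show thesis using that[of t] reach_hyp[of t] t by auto
      next
        case False
        have "\<exists>s. T \<le> s \<and> s \<le> t \<and> n * \<Theta> s = l"
          using True False t T by (intro IVT' continuous_on_mult_left continuous_on_subset[OF \<Theta>(3)]) auto
        then obtain s where s: "T \<le> s" "s \<le> t" "n * \<Theta> s = l" by blast
        have l1: "1 \<le> l" using True n by simp
        have "0 < \<mu> s" "(1 + s) * \<mu> s \<le> \<mu>0" "0 \<le> s" using \<mu>_pos \<mu>_le s T by auto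
        then have "0 \<le> s * \<mu> s" "\<mu> s + s * \<mu> s \<le> \<mu>0" by (simp_all add: algebra_simps)
        then have "\<mu> s \<le> 1" using \<mu>0 by linarith
        moreover have "l / \<Theta> s = n" using s \<Theta>(1)[of s] T by auto
        ultimately show thesis using that[of s] reach_hyp[of s] s l1 by auto
      qed
    next
      case False
      have l\<Theta>: "l / \<Theta> s \<le> n" if "T \<le> s" for s
      proof -
        have "\<Theta> T \<le> \<Theta> s" using \<Theta>(2) that T by (auto simp: mono_on_def)
        then have "n * \<Theta> T \<le> n * \<Theta> s" using n by (intro mult_left_mono) auto
        then show ?thesis using False \<Theta>(1)[of s] that T by (simp add: field_simps)
      qed
      have \<mu>l: "\<mu> s \<le> l" if "T \<le> s" "1 \<le> l * (1 + s)" for s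
      proof -
        have "(1 + s) * \<mu> s \<le> (1 + s) * l" using \<mu>_le[OF that(1)] \<mu>0 that(2) by (simp add: mult.commute)
        then show ?thesis using that T by simp
      qed
      show thesis
      proof (cases "1 \<le> l * (1 + T)")
        case True
        then have "0 < l" using E.l T by (cases "l = 0") auto
        then show thesis using that[of T] reach_T l\<Theta>[of T] \<mu>l[of T] True t by auto
      next
        case T1: False
        show thesis
        proof (cases "l * (1 + t) \<le> 1")
          case True
          then show thesis using that[of t] reach_diss[of t] t by auto
        next
          case False
          then have l: "0 < l" using E.l by (cases "l = 0") auto
          define s where "s = 1 / l - 1"
          have ls: "l * (1 + s) = 1" using l by (simp add: s_def)
          have "T \<le> s" "s \<le> t" using False T1 l by (auto simp: s_def field_simps)
          then show thesis using that[of s] reach_diss[of s] l\<Theta>[of s] \<mu>l[of s] ls l by auto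
        qed
      qed
    qed
    have r0: "0 \<le> exp (- I t) * X + k t * (N t - N T)" using X k0 N[of t] t by simp
    show ?thesis
    proof (cases "s = t")
      case True
      have "A * (exp (- I t) * X + k t * (N t - N T)) \<le> D1 * (A * (exp (- I t) * X + k t * (N t - N T)))"
        using D1 A r0 mult_right_mono[of 1 D1 "A * (exp (- I t) * X + k t * (N t - N T))"] by simp
      then show ?thesis using s True by (simp add: reach_def X_def mult.assoc)
    next
      case False
      then have l: "0 < l" "\<mu> s \<le> l" "l / \<Theta> s \<le> n" using s by auto
      have "d t + l\<^sup>2 * a t \<le> D1 * (exp (I s - I t) * (d s + l\<^sup>2 * a s) + 2 * (N t - N s))"
        using stabilized_zone[OF E l(1) s(1,2) order_refl l(2,3)] by (simp add: D1_def q_def)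
      also have "\<dots> \<le> D1 * (A * (exp (- I t) * X + k t * (N t - N T)))"
      proof (rule mult_left_mono)
        have Nst: "0 \<le> N t - N s" using E.N_mono[of s t] s T by simp
        have "exp (I s - I t) * (d s + l\<^sup>2 * a s) \<le> exp (I s - I t) * (A * (exp (- I s) * X + k t * (N s - N T)))"
          using s by (intro mult_left_mono) (auto simp: reach_def)
        also have "\<dots> = A * ((exp (I s - I t) * exp (- I s)) * X) + exp (I s - I t) * (A * (k t * (N s - N T)))"
          by (simp only: distrib_left mult_ac)
        also have "exp (I s - I t) * exp (- I s) = exp (- I t)" by (simp add: exp_add[symmetric])
        also have "exp (I s - I t) * (A * (k t * (N s - N T))) \<le> 1 * (A * (k t * (N s - N T)))"
          using I_mono[OF s(1,2)] A k0 N[OF s(1,2)] by (intro mult_right_mono) auto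
        finally have 1: "exp (I s - I t) * (d s + l\<^sup>2 * a s) \<le> A * (exp (- I t) * X) + A * (k t * (N s - N T))" by simp
        have "2 * (N t - N s) \<le> k t * (N t - N s)" using k2[of t] Nst by (rule mult_right_mono)
        also have "\<dots> = 1 * (k t * (N t - N s))" by simp
        also have "\<dots> \<le> A * (k t * (N t - N s))" using A k0 Nst by (intro mult_right_mono) auto
        finally show "exp (I s - I t) * (d s + l\<^sup>2 * a s) + 2 * (N t - N s) \<le> A * (exp (- I t) * X + k t * (N t - N T))"
          using 1 by (simp add: algebra_simps)
      qed (use D1 in auto)
      finally show ?thesis by (simp add: X_def mult.assoc)
    qed
  qed
  have early: "d t + (1 + l\<^sup>2) * a t \<le> A0 * (d 0 + (1 + l\<^sup>2) * a 0 + 2 * (N t - N 0))"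
    if E: "energy_triple b a c d f g \<eta> N l \<tau>" and t: "0 \<le> t" "t \<le> \<tau>" "t \<le> T" for a c d f g \<eta> N l t \<tau>
  proof -
    interpret E: energy_triple b a c d f g \<eta> N l \<tau> by (rule E)
    have pos: "0 \<le> d 0 + (1 + l\<^sup>2) * a 0 + 2 * (N t - N 0)"
      using E.N_mono[of 0 t] E.a[of 0] E.d[of 0] E.\<tau> t by simp
    have "d t + (1 + l\<^sup>2) * a t \<le> exp ((2 * B + 1) * (t - 0)) * (d 0 + (1 + l\<^sup>2) * a 0 + 2 * (N t - N 0))"
      using E.crude_bound[of 0 t B] B t by auto
    also have "\<dots> \<le> A0 * (d 0 + (1 + l\<^sup>2) * a 0 + 2 * (N t - N 0))"
      using B0 t pos by (intro mult_right_mono) (auto simp: A0_def intro!: mult_left_mono)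
    finally show ?thesis .
  qed
  show thesis
  proof (rule that[of "D1 * A * A0" "\<lambda>t. D1 * A * A0 * (k t + 2)"])
    show "0 < D1 * A * A0" using D1 A A0 by simp
    show "0 \<le> D1 * A * A0 * (k t + 2)" for t using D1 A A0 k2[of t] by simp
    fix a c d f g \<eta> N l t assume E: "energy_triple b a c d f g \<eta> N l t"
    interpret E: energy_triple b a c d f g \<eta> N l t by (rule E)
    have DA: "1 \<le> D1 * A" using mult_mono[of 1 D1 1 A] D1 A by simp
    have Y0: "0 \<le> d 0 + (1 + l\<^sup>2) * a 0" using E.a[of 0] E.d[of 0] E.\<tau> by simp
    show "d t + l\<^sup>2 * a t \<le> D1 * A * A0 * exp (- I (max T t)) * (d 0 + (1 + l\<^sup>2) * a 0) + D1 * A * A0 * (k t + 2) * (N t - N 0)"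
    \<comment> \<open>For t <= T the exponent is I(T) = 0, so no decay is claimed and the crude
      bound is enough.\<close>
    proof (cases "t \<le> T")
      case True
      have N: "0 \<le> N t - N 0" using E.N_mono[of 0 t] E.\<tau> by simp
      have "d t + l\<^sup>2 * a t \<le> d t + (1 + l\<^sup>2) * a t" using E.a[of t] E.\<tau> by (simp add: algebra_simps)
      also have "\<dots> \<le> 1 * (A0 * (d 0 + (1 + l\<^sup>2) * a 0 + 2 * (N t - N 0)))"
        using early[OF E E.\<tau> order_refl True] by simp
      also have "\<dots> \<le> D1 * A * (A0 * (d 0 + (1 + l\<^sup>2) * a 0 + (k t + 2) * (N t - N 0)))"
      proof (intro mult_mono[OF DA] mult_left_mono add_left_mono mult_right_mono)
        show "0 \<le> A0 * (d 0 + (1 + l\<^sup>2) * a 0 + 2 * (N t - N 0))" using A0 Y0 N by simp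
      qed (use A0 N k2[of t] DA in auto)
      finally show ?thesis using True by (simp add: max_def algebra_simps)
    next
      case False
      then have t: "T \<le> t" by simp
      have e: "0 < exp (- I t)" "exp (- I t) \<le> 1" using I_mono[of T t] t by auto
      have NT: "0 \<le> N T - N 0" "0 \<le> N t - N T" using E.N_mono[of 0 T] E.N_mono[of T t] T t by auto
      have "d T + (1 + l\<^sup>2) * a T \<le> A0 * (d 0 + (1 + l\<^sup>2) * a 0 + 2 * (N T - N 0))"
        using early[OF E T t order_refl] .
      then have "exp (- I t) * (d T + (1 + l\<^sup>2) * a T) \<le> exp (- I t) * (A0 * (d 0 + (1 + l\<^sup>2) * a 0 + 2 * (N T - N 0)))"
        using e by (intro mult_left_mono) auto
      also have "\<dots> = A0 * (exp (- I t) * (d 0 + (1 + l\<^sup>2) * a 0)) + exp (- I t) * (A0 * (2 * (N T - N 0)))"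
        by (simp add: algebra_simps)
      also have "exp (- I t) * (A0 * (2 * (N T - N 0))) \<le> 1 * (A0 * (2 * (N T - N 0)))"
        using e NT A0 by (intro mult_right_mono) auto
      finally have 1: "exp (- I t) * (d T + (1 + l\<^sup>2) * a T) \<le> A0 * (exp (- I t) * (d 0 + (1 + l\<^sup>2) * a 0)) + A0 * (2 * (N T - N 0))"
        by simp
      have 2: "k t * (N t - N T) \<le> A0 * (k t * (N t - N T))"
        using A0 k2[of t] NT mult_right_mono[of 1 A0 "k t * (N t - N T)"] by simp
      have 3: "A0 * (2 * (N T - N 0)) + A0 * (k t * (N t - N T)) \<le> A0 * ((k t + 2) * (N t - N 0))"
      proof -
        have "2 * (N T - N 0) \<le> 2 * (N t - N 0)" "k t * (N t - N T) \<le> k t * (N t - N 0)"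
          using NT k2[of t] by (auto intro!: mult_left_mono)
        then have "2 * (N T - N 0) + k t * (N t - N T) \<le> (k t + 2) * (N t - N 0)" by (simp add: algebra_simps)
        then have "A0 * (2 * (N T - N 0) + k t * (N t - N T)) \<le> A0 * ((k t + 2) * (N t - N 0))"
          using A0 by (intro mult_left_mono) auto
        then show ?thesis by (simp add: distrib_left)
      qed
      have "d t + l\<^sup>2 * a t \<le> D1 * A * (exp (- I t) * (d T + (1 + l\<^sup>2) * a T) + k t * (N t - N T))"
        by (rule late[OF E t])
      also have "\<dots> \<le> D1 * A * (A0 * (exp (- I t) * (d 0 + (1 + l\<^sup>2) * a 0)) + A0 * ((k t + 2) * (N t - N 0)))"
        using 1 2 3 DA by (intro mult_left_mono) auto
      finally show ?thesis using t by (simp add: max_def algebra_simps)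
    qed
  qed
qed

end

section \<open>Polynomials of a symmetric operator\<close>

definition op_poly :: "('a::real_vector \<Rightarrow> 'a) \<Rightarrow> real poly \<Rightarrow> 'a \<Rightarrow> 'a" where
  "op_poly H p x = (\<Sum>i\<le>degree p. coeff p i *\<^sub>R (H ^^ i) x)"

lemma op_poly_altdef: "degree p \<le> n \<Longrightarrow> op_poly H p x = (\<Sum>i\<le>n. coeff p i *\<^sub>R (H ^^ i) x)"
  unfolding op_poly_def by (rule sum.mono_neutral_left) (auto simp: coeff_eq_0)

lemma op_poly_0 [simp]: "op_poly H 0 x = 0"
  by (simp add: op_poly_def)

lemma op_poly_1 [simp]: "op_poly H 1 x = x"
  by (simp add: op_poly_def)

lemma op_poly_add: "op_poly H (p + q) x = op_poly H p x + op_poly H q x"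
  using op_poly_altdef[of "p + q" "max (degree p) (degree q)" H x] degree_add_le_max[of p q]
    op_poly_altdef[of p "max (degree p) (degree q)" H x] op_poly_altdef[of q "max (degree p) (degree q)" H x]
  by (simp add: sum.distrib scaleR_add_left)

lemma op_poly_smult: "op_poly H (smult c p) x = c *\<^sub>R op_poly H p x"
  using op_poly_altdef[of "smult c p" "degree p" H x] by (simp add: op_poly_def scaleR_sum_right)

lemma op_poly_sum: "op_poly H (\<Sum>i\<in>I. p i) x = (\<Sum>i\<in>I. op_poly H (p i) x)"
  by (induction I rule: infinite_finite_induct) (simp_all add: op_poly_add)

lemma op_poly_pCons:
  assumes "linear H"
  shows "op_poly H (pCons c p) x = c *\<^sub>R x + H (op_poly H p x)"
proof -
  have "op_poly H (pCons c p) x = (\<Sum>i\<le>Suc (degree p). coeff (pCons c p) i *\<^sub>R (H ^^ i) x)"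
    by (rule op_poly_altdef) (simp add: degree_pCons_le)
  also have "\<dots> = c *\<^sub>R x + H (op_poly H p x)"
    by (simp add: sum.atMost_Suc_shift op_poly_def linear_sum[OF assms] linear_cmul[OF assms] del: sum.atMost_Suc)
  finally show ?thesis .
qed

lemma op_poly_mult:
  assumes "linear H"
  shows "op_poly H (p * q) x = op_poly H p (op_poly H q x)"
proof (induction p)
  case (pCons c p)
  then show ?case by (simp add: op_poly_pCons[OF assms] op_poly_add op_poly_smult)
qed simp

lemma bounded_linear_op_poly:
  assumes "bounded_linear H"
  shows "bounded_linear (op_poly H p)"
proof (induction p)
  case 0
  have "op_poly H 0 = (\<lambda>x. 0)" by (rule ext) simp
  then show ?case by (simp add: bounded_linear_zero)
next
  case (pCons c p)
  have "op_poly H (pCons c p) = (\<lambda>x. c *\<^sub>R x + H (op_poly H p x))"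
    by (rule ext) (rule op_poly_pCons[OF bounded_linear.linear[OF assms]])
  then show ?case
    by (simp add: bounded_linear_add bounded_linear_scaleR_right bounded_linear_compose[OF assms pCons.IH])
qed

locale positive_contraction =
  fixes H :: "'a::real_inner \<Rightarrow> 'a"
  assumes bounded_linear: "bounded_linear H"
    and symmetric: "H x \<bullet> y = x \<bullet> H y"
    and nonneg: "0 \<le> H x \<bullet> x" and le_one: "H x \<bullet> x \<le> x \<bullet> x"
begin

lemma linear: "linear H"
  by (rule bounded_linear.linear[OF bounded_linear])

lemma op_poly_commute: "op_poly H p (op_poly H q x) = op_poly H q (op_poly H p x)"
  by (metis op_poly_mult[OF linear] mult.commute)

lemma op_poly_X: "op_poly H [:0, 1:] x = H x"
  by (simp add: op_poly_pCons[OF linear] linear_0[OF linear])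

lemma op_poly_symmetric: "op_poly H p x \<bullet> y = x \<bullet> op_poly H p y"
proof (induction p arbitrary: x y)
  case (pCons c p)
  have "op_poly H p (H y) = H (op_poly H p y)" for y
    using op_poly_commute[of p "[:0, 1:]" y] by (simp add: op_poly_X)
  then show ?case using pCons by (simp add: op_poly_pCons[OF linear] inner_add_left inner_add_right symmetric)
qed simp

definition "op_nonneg p \<longleftrightarrow> (\<forall>x. 0 \<le> op_poly H p x \<bullet> x)"

lemma inner_op_poly_square: "op_poly H (p * (q * q)) x \<bullet> x = op_poly H p (op_poly H q x) \<bullet> op_poly H q x"
proof -
  have "op_poly H (p * (q * q)) x = op_poly H q (op_poly H p (op_poly H q x))"
    by (simp only: op_poly_mult[OF linear] op_poly_commute[of q p])
  then show ?thesis by (simp only: op_poly_symmetric[of q])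
qed

lemma op_nonneg_square: "op_nonneg p \<Longrightarrow> op_nonneg (q * q * p)"
  by (simp add: op_nonneg_def inner_op_poly_square mult.commute[of "q * q" p])

lemma op_nonneg_add: "op_nonneg p \<Longrightarrow> op_nonneg q \<Longrightarrow> op_nonneg (p + q)"
  by (simp add: op_nonneg_def op_poly_add inner_add_left)

text \<open>Squares of polynomials in H can be moved to both sides of the scalar product, so only
  the exponents 0 and 1 remain. For the product of both factors the identity x (1 - x) = x^2 (1 - x)
  + (1 - x)^2 x takes the place of a square root of H.\<close>

lemma op_nonneg_monomials: "op_nonneg ([:0, 1:] ^ k * [:1, -1:] ^ j)"
proof -
  have 0: "op_nonneg 1" by (simp add: op_nonneg_def)
  have 1: "op_nonneg [:0, 1:]" by (simp add: op_nonneg_def op_poly_X nonneg)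
  have 2: "op_nonneg [:1, -1:]"
    using le_one by (simp add: op_nonneg_def op_poly_pCons[OF linear] inner_diff_left linear_0[OF linear] linear_neg[OF linear])
  have "[:0, 1:] * [:1, -1:] = [:0, 1:] * [:0, 1:] * [:1, -1:] + [:1, -1:] * [:1, -1:] * [:0, 1::real:]"
    by simp
  then have 3: "op_nonneg ([:0, 1:] * [:1, -1:])"
    using op_nonneg_add[OF op_nonneg_square[OF 2, of "[:0, 1:]"] op_nonneg_square[OF 1, of "[:1, -1:]"]] by metis
  have "op_nonneg ([:0, 1:] ^ (k mod 2) * [:1, -1:] ^ (j mod 2))"
    using 0 1 2 3 by (cases "k mod 2 = 0"; cases "j mod 2 = 0") (auto simp: mod_2_eq_odd)
  from op_nonneg_square[OF this, of "[:0, 1:] ^ (k div 2) * [:1, -1:] ^ (j div 2)"]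
  have "op_nonneg (([:0, 1:] ^ (k div 2) * [:0, 1:] ^ (k div 2) * [:0, 1:] ^ (k mod 2)) *
      ([:1, -1:] ^ (j div 2) * [:1, -1:] ^ (j div 2) * [:1, -1:] ^ (j mod 2)))"
    by (simp only: mult_ac)
  then show ?thesis
    by (simp only: power_add[symmetric] mult_2[symmetric] mult_div_mod_eq)
qed

definition bern :: "nat \<Rightarrow> nat \<Rightarrow> real poly" where
  "bern n k = smult (real (n choose k)) ([:0, 1:] ^ k * [:1, -1:] ^ (n - k))"

lemma poly_bern: "poly (bern n k) x = Bernstein n k x"
  by (simp add: bern_def Bernstein_def poly_power)

lemma op_nonneg_bern: "op_nonneg (bern n k)"
  using op_nonneg_monomials[of k "n - k"] by (simp add: bern_def op_nonneg_def op_poly_smult)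

lemma sum_bern: "(\<Sum>k\<le>n. bern n k) = 1"
  by (simp add: poly_eq_poly_eq_iff[symmetric] fun_eq_iff poly_sum poly_bern)

lemma sum_k_bern: "(\<Sum>k\<le>n. smult (real k / real n) (bern n k)) = [:0, 1:]" if "0 < n"
proof -
  have "(\<Sum>k\<le>n. real k * Bernstein n k x / real n) = x" for x
    using that unfolding sum_divide_distrib[symmetric] sum_k_Bernstein by simp
  then show ?thesis by (simp add: poly_eq_poly_eq_iff[symmetric] fun_eq_iff poly_sum poly_bern)
qed

text \<open>The variance x (1 - x) / n of the relative frequency in n trials, as an identity of
  polynomials so that H can be inserted for x.\<close>

lemma sum_variance_bern:
  "(\<Sum>k\<le>n. bern n k * ([:- (real k / real n), 1:] * [:- (real k / real n), 1:])) = smult (1 / real n) ([:0, 1:] * [:1, -1:])"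
  if "0 < n"
proof -
  have "(\<Sum>k\<le>n. Bernstein n k x * ((x - real k / real n) * (x - real k / real n))) = x * (1 - x) / real n" for x
  proof -
    have "(\<Sum>k\<le>n. Bernstein n k x * ((x - real k / real n) * (x - real k / real n))) =
      (\<Sum>k\<le>n. x\<^sup>2 * Bernstein n k x - 2 * x / n * (real k * Bernstein n k x)
        + (real k * (real k - 1) * Bernstein n k x + real k * Bernstein n k x) / (real n)\<^sup>2)"
      using that by (intro sum.cong) (auto simp: field_simps power2_eq_square)
    also have "\<dots> = x\<^sup>2 * (\<Sum>k\<le>n. Bernstein n k x) - 2 * x / n * (\<Sum>k\<le>n. real k * Bernstein n k x)
        + ((\<Sum>k\<le>n. real k * (real k - 1) * Bernstein n k x) + (\<Sum>k\<le>n. real k * Bernstein n k x)) / (real n)\<^sup>2"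
      by (simp only: sum.distrib sum_subtractf sum_distrib_left[symmetric] sum_divide_distrib[symmetric])
    also have "\<dots> = x * (1 - x) / real n"
      using that unfolding sum_Bernstein sum_k_Bernstein sum_kk_Bernstein by (simp add: field_simps power2_eq_square)
    finally show ?thesis .
  qed
  note * = this
  show ?thesis
  proof (rule poly_eq_poly_eq_iff[THEN iffD1], rule ext)
    fix x
    have "poly (\<Sum>k\<le>n. bern n k * ([:- (real k / real n), 1:] * [:- (real k / real n), 1:])) x
      = (\<Sum>k\<le>n. Bernstein n k x * ((x - real k / real n) * (x - real k / real n)))"
      unfolding poly_sum poly_mult poly_bern by (rule sum.cong) simp_all
    also have "\<dots> = poly (smult (1 / real n) ([:0, 1:] * [:1, -1:])) x"
      unfolding * by (simp add: diff_divide_distrib algebra_simps)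
    finally show "poly (\<Sum>k\<le>n. bern n k * ([:- (real k / real n), 1:] * [:- (real k / real n), 1:])) x
      = poly (smult (1 / real n) ([:0, 1:] * [:1, -1:])) x" .
  qed
qed

text \<open>A substitute for the spectral measure of \<open>H\<close> near \<open>k / n\<close>.\<close>

definition "cell n k x y = op_poly H (bern n k) x \<bullet> y"

lemma cell_commute: "cell n k x y = cell n k y x"
  unfolding cell_def by (subst op_poly_symmetric) (rule inner_commute)

lemma cell_nonneg: "0 \<le> cell n k x x"
  using op_nonneg_bern by (simp add: cell_def op_nonneg_def)

lemma bounded_bilinear_cell: "bounded_bilinear (cell n k)"
  unfolding cell_def[abs_def]
  by (rule bounded_bilinear.comp1[OF bounded_bilinear_inner bounded_linear_op_poly[OF bounded_linear]])

lemmas cell_simps =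
  bounded_bilinear.add_left[OF bounded_bilinear_cell] bounded_bilinear.add_right[OF bounded_bilinear_cell]
  bounded_bilinear.diff_left[OF bounded_bilinear_cell] bounded_bilinear.diff_right[OF bounded_bilinear_cell]
  bounded_bilinear.scaleR_left[OF bounded_bilinear_cell] bounded_bilinear.scaleR_right[OF bounded_bilinear_cell]

text \<open>A cell may be degenerate. If both squares vanish, evaluating the form at x + y and x - y
  forces the mixed term to vanish; otherwise the usual projection applies to one of the two
  vectors.\<close>

lemma cell_Cauchy_Schwarz: "(cell n k x y)\<^sup>2 \<le> cell n k x x * cell n k y y"
proof (cases "cell n k x x = 0 \<and> cell n k y y = 0")
  case True
  have "cell n k (x + y) (x + y) = 2 * cell n k x y" "cell n k (x - y) (x - y) = - 2 * cell n k x y"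
    using True by (simp_all add: cell_simps cell_commute[of n k y x])
  then have "cell n k x y = 0" using cell_nonneg[of n k "x + y"] cell_nonneg[of n k "x - y"] by linarith
  then show ?thesis using True by simp
next
  case False
  have *: "(cell n k x y)\<^sup>2 \<le> cell n k x x * cell n k y y" if "cell n k x x \<noteq> 0" for x y
  proof -
    let ?s = "cell n k x y / cell n k x x"
    have "0 < cell n k x x" using cell_nonneg[of n k x] that by simp
    have "0 \<le> cell n k (y - ?s *\<^sub>R x) (y - ?s *\<^sub>R x)" by (rule cell_nonneg)
    also have "\<dots> = cell n k y y - (cell n k x y)\<^sup>2 / cell n k x x"
      using that by (simp add: cell_simps cell_commute[of n k y x] power2_eq_square field_simps)
    finally show ?thesis using \<open>0 < cell n k x x\<close> by (simp add: field_simps)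
  qed
  show ?thesis
  proof (cases "cell n k x x = 0")
    case True
    then show ?thesis using *[of y x] False by (simp add: cell_commute mult.commute)
  qed (rule *)
qed

lemma sum_cell: "(\<Sum>k\<le>n. cell n k x y) = x \<bullet> y"
  by (simp add: cell_def inner_sum_left[symmetric] op_poly_sum[symmetric] sum_bern)

lemma sum_k_cell: "(\<Sum>k\<le>n. real k / real n * cell n k x y) = H x \<bullet> y" if "0 < n"
proof -
  have "(\<Sum>k\<le>n. real k / real n * cell n k x y) = op_poly H (\<Sum>k\<le>n. smult (real k / real n) (bern n k)) x \<bullet> y"
    by (simp add: cell_def op_poly_sum op_poly_smult inner_sum_left)
  then show ?thesis using that by (simp add: sum_k_bern op_poly_X)
qed

text \<open>On the k-th cell H acts approximately as multiplication by k / n; the total squared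
  defect is the Bernstein variance and hence of order 1 / n.\<close>

lemma sum_variance_cell:
  assumes "0 < n"
  shows "(\<Sum>k\<le>n. cell n k ((real k / real n) *\<^sub>R x - H x) ((real k / real n) *\<^sub>R x - H x)) \<le> x \<bullet> x / real n"
proof -
  let ?q = "\<lambda>k. [:- (real k / real n), 1:]"
  have "op_poly H (?q k) x = H x - (real k / real n) *\<^sub>R x" for k
    by (simp add: op_poly_pCons[OF linear] linear_0[OF linear])
  then have v: "(real k / real n) *\<^sub>R x - H x = - op_poly H (?q k) x" for k by simp
  have "cell n k ((real k / real n) *\<^sub>R x - H x) ((real k / real n) *\<^sub>R x - H x) = op_poly H (bern n k * (?q k * ?q k)) x \<bullet> x" for k
    unfolding v cell_def inner_op_poly_square
    by (simp add: linear_neg[OF bounded_linear.linear[OF bounded_linear_op_poly[OF bounded_linear]]])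
  then have "(\<Sum>k\<le>n. cell n k ((real k / real n) *\<^sub>R x - H x) ((real k / real n) *\<^sub>R x - H x)) = op_poly H (\<Sum>k\<le>n. bern n k * (?q k * ?q k)) x \<bullet> x"
    by (simp add: op_poly_sum inner_sum_left)
  also have "\<dots> = (H x \<bullet> x - H x \<bullet> H x) / real n"
    unfolding sum_variance_bern[OF assms]
    by (simp add: op_poly_smult op_poly_mult[OF linear] op_poly_pCons[OF linear] linear_0[OF linear] linear_neg[OF linear]
        linear_diff[OF linear] inner_diff_left symmetric del: mult_pCons_left mult_pCons_right)
  also have "\<dots> \<le> x \<bullet> x / real n"
  proof (rule divide_right_mono)
    show "H x \<bullet> x - H x \<bullet> H x \<le> x \<bullet> x" using le_one[of x] inner_ge_zero[of "H x"] by linarith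
  qed simp
  finally show ?thesis .
qed

end

section \<open>Second order equations with a bounded operator\<close>

context oscillating_damping
begin

text \<open>The bound \<Lambda> of the operator only determines the degree of the Bernstein
  polynomials and is absent from the conclusion; this makes the later passage to - \<Delta>
  possible. The a priori bound \<open>B\<close> is multiplied by \<epsilon>, so any bound that stays
  fixed as \<epsilon> tends to zero will do.\<close>

lemma bounded_operator_estimate:
  obtains C K where "0 < C" "\<And>t. 0 \<le> K t"
    "\<And>(A :: 'a::real_inner \<Rightarrow> 'a) \<Lambda> U W r \<tau> \<epsilon> B.
      bounded_linear A \<Longrightarrow> (\<And>x y. A x \<bullet> y = x \<bullet> A y) \<Longrightarrow> (\<And>x. 0 \<le> A x \<bullet> x) \<Longrightarrow> (\<And>x. A x \<bullet> x \<le> \<Lambda> * (x \<bullet> x)) \<Longrightarrow>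
      0 < \<Lambda> \<Longrightarrow> 0 \<le> \<tau> \<Longrightarrow> 0 < \<epsilon> \<Longrightarrow>
      (\<And>t. t \<in> {0..\<tau>} \<Longrightarrow> (U has_vector_derivative W t) (at t within {0..\<tau>})) \<Longrightarrow>
      (\<And>t. t \<in> {0..\<tau>} \<Longrightarrow> (W has_vector_derivative - b t *\<^sub>R W t - A (U t) + r t) (at t within {0..\<tau>})) \<Longrightarrow>
      continuous_on {0..\<tau>} r \<Longrightarrow> (\<And>t. t \<in> {0..\<tau>} \<Longrightarrow> norm (r t) \<le> \<epsilon>) \<Longrightarrow>
      (\<And>t. t \<in> {0..\<tau>} \<Longrightarrow> U t \<bullet> U t + A (U t) \<bullet> U t + W t \<bullet> W t \<le> B) \<Longrightarrow>
      W \<tau> \<bullet> W \<tau> + A (U \<tau>) \<bullet> U \<tau> \<le> C * exp (- I (max T \<tau>)) * (W 0 \<bullet> W 0 + U 0 \<bullet> U 0 + A (U 0) \<bullet> U 0)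
        + K \<tau> * (\<tau> * (\<epsilon> * (3 + B)))"
proof -
  obtain C K where C: "0 < C" "\<And>t. 0 \<le> K t" and est:
    "\<And>a c d f g \<eta> N l t. energy_triple b a c d f g \<eta> N l t \<Longrightarrow>
      d t + l\<^sup>2 * a t \<le> C * exp (- I (max T t)) * (d 0 + (1 + l\<^sup>2) * a 0) + K t * (N t - N 0)"
    using energy_estimate by blast
  show thesis
  proof (rule that[OF C])
    fix A :: "'a \<Rightarrow> 'a" and U W r :: "real \<Rightarrow> 'a" and \<Lambda> \<tau> \<epsilon> B :: real
    assume A: "bounded_linear A" "\<And>x y. A x \<bullet> y = x \<bullet> A y" "\<And>x. 0 \<le> A x \<bullet> x" "\<And>x. A x \<bullet> x \<le> \<Lambda> * (x \<bullet> x)"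
      and \<Lambda>: "0 < \<Lambda>" and \<tau>: "0 \<le> \<tau>" and \<epsilon>: "0 < \<epsilon>"
      and dU: "\<And>t. t \<in> {0..\<tau>} \<Longrightarrow> (U has_vector_derivative W t) (at t within {0..\<tau>})"
      and dW: "\<And>t. t \<in> {0..\<tau>} \<Longrightarrow> (W has_vector_derivative - b t *\<^sub>R W t - A (U t) + r t) (at t within {0..\<tau>})"
      and r: "continuous_on {0..\<tau>} r" "\<And>t. t \<in> {0..\<tau>} \<Longrightarrow> norm (r t) \<le> \<epsilon>"
      and B: "\<And>t. t \<in> {0..\<tau>} \<Longrightarrow> U t \<bullet> U t + A (U t) \<bullet> U t + W t \<bullet> W t \<le> B"
    define H where "H x = (1 / \<Lambda>) *\<^sub>R A x" for x
    interpret positive_contraction H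
    proof (rule positive_contraction.intro)
      show "bounded_linear H" unfolding H_def[abs_def]
        by (rule bounded_linear_compose[OF bounded_linear_scaleR_right A(1)])
      show "H x \<bullet> y = x \<bullet> H y" for x y by (simp add: H_def A(2))
      show "0 \<le> H x \<bullet> x" for x using A(3)[of x] \<Lambda> by (simp add: H_def)
      show "H x \<bullet> x \<le> x \<bullet> x" for x using A(4)[of x] \<Lambda> by (simp add: H_def field_simps)
    qed
    have AH: "A x = \<Lambda> *\<^sub>R H x" for x using \<Lambda> by (simp add: H_def)
    \<comment> \<open>For this degree the variance, multiplied by 2 \<Lambda>^2, contributes at most
      \<epsilon>^2 to the sum over all cells.\<close>
    obtain n0 :: nat where n0: "2 * \<Lambda>\<^sup>2 * B / \<epsilon>\<^sup>2 < real n0" using reals_Archimedean2 by blast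
    define n where "n = Suc n0"
    have n: "0 < n" "2 * \<Lambda>\<^sup>2 * B / real n \<le> \<epsilon>\<^sup>2"
    proof -
      have "2 * \<Lambda>\<^sup>2 * B / \<epsilon>\<^sup>2 \<le> real n" using n0 by (simp add: n_def)
      then show "2 * \<Lambda>\<^sup>2 * B / real n \<le> \<epsilon>\<^sup>2" using \<epsilon> by (simp add: n_def field_simps)
    qed (simp add: n_def)
    define l where "l k = sqrt (\<Lambda> * (real k / real n))" for k
    have l: "0 \<le> l k" "(l k)\<^sup>2 = \<Lambda> * (real k / real n)" for k using \<Lambda> by (auto simp: l_def)
    \<comment> \<open>In the k-th cell A U is replaced by (l k)^2 U; the difference joins the given
      remainder r.\<close>
    define e where "e k t = (l k)\<^sup>2 *\<^sub>R U t - A (U t) + r t" for k t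
    \<comment> \<open>Young's inequality with weight \<epsilon>: the squares of the errors sum up to
      at most 3 \<epsilon>^2, so division by \<epsilon> leaves order \<epsilon>, and the second part
      is \<epsilon> times the energy.\<close>
    define \<eta> where "\<eta> k t = 1 / \<epsilon> * cell n k (e k t) (e k t)
      + \<epsilon> * ((1 + (l k)\<^sup>2) * cell n k (U t) (U t) + cell n k (W t) (W t))" for k t
    define N where "N k t = integral {0..t} (\<eta> k)" for k t
    have contU: "continuous_on {0..\<tau>} U" and contW: "continuous_on {0..\<tau>} W"
      by (auto simp only: continuous_on_eq_continuous_within
        intro!: has_vector_derivative_continuous[OF dU] has_vector_derivative_continuous[OF dW])
    have cont_cell: "continuous_on {0..\<tau>} (\<lambda>t. cell n k (x t) (y t))"
      if "continuous_on {0..\<tau>} x" "continuous_on {0..\<tau>} y" for k x y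
      using that by (rule bounded_bilinear.continuous_on[OF bounded_bilinear_cell])
    have cont_e: "continuous_on {0..\<tau>} (e k)" for k
      unfolding e_def[abs_def]
      by (intro continuous_intros contU r(1) bounded_linear.continuous_on[OF A(1)])
    have cont_\<eta>: "continuous_on {0..\<tau>} (\<eta> k)" for k
      unfolding \<eta>_def[abs_def] by (intro continuous_intros cont_cell contU contW cont_e)
    have triple: "energy_triple b (\<lambda>t. cell n k (U t) (U t)) (\<lambda>t. cell n k (U t) (W t)) (\<lambda>t. cell n k (W t) (W t))
        (\<lambda>t. cell n k (U t) (e k t)) (\<lambda>t. cell n k (W t) (e k t)) (\<eta> k) (N k) (l k) \<tau>" for k
    proof
      fix t assume t: "t \<in> {0..\<tau>}"
      note D = bounded_bilinear.has_vector_derivative[OF bounded_bilinear_cell]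
      have W': "- b t *\<^sub>R W t - A (U t) + r t = - b t *\<^sub>R W t - (l k)\<^sup>2 *\<^sub>R U t + e k t"
        by (simp add: e_def)
      note dW' = dW[OF t, unfolded W']
      show "((\<lambda>t. cell n k (U t) (U t)) has_real_derivative 2 * cell n k (U t) (W t)) (at t within {0..\<tau>})"
        using D[OF dU[OF t] dU[OF t], of n k] cell_commute[of n k "W t" "U t"]
        by (simp add: has_real_derivative_iff_has_vector_derivative)
      show "((\<lambda>t. cell n k (U t) (W t)) has_real_derivative
          cell n k (W t) (W t) - b t * cell n k (U t) (W t) - (l k)\<^sup>2 * cell n k (U t) (U t) + cell n k (U t) (e k t)) (at t within {0..\<tau>})"
        using D[OF dU[OF t] dW', of n k]
        by (simp add: has_real_derivative_iff_has_vector_derivative cell_simps algebra_simps)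
      show "((\<lambda>t. cell n k (W t) (W t)) has_real_derivative
          - 2 * b t * cell n k (W t) (W t) - 2 * (l k)\<^sup>2 * cell n k (U t) (W t) + 2 * cell n k (W t) (e k t)) (at t within {0..\<tau>})"
        using D[OF dW' dW', of n k] cell_commute[of n k "W t" "U t"] cell_commute[of n k "e k t" "W t"]
        by (simp add: has_real_derivative_iff_has_vector_derivative cell_simps algebra_simps)
      show "(N k has_real_derivative \<eta> k t) (at t within {0..\<tau>})"
        unfolding N_def[abs_def] by (rule integral_has_real_derivative[OF cont_\<eta> t])
      have pos: "0 \<le> cell n k x x" for x by (rule cell_nonneg)
      have cs: "2 * \<kappa> * \<bar>cell n k x (e k t)\<bar> \<le> cell n k (e k t) (e k t) + \<kappa>\<^sup>2 * cell n k x x" if "0 \<le> \<kappa>" for x \<kappa>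
        using two_mult_le_of_square_le[OF cell_Cauchy_Schwarz pos pos that] .
      have "2 * ((1 + l k) * \<epsilon>) * \<bar>cell n k (U t) (e k t)\<bar> \<le> cell n k (e k t) (e k t) + ((1 + l k) * \<epsilon>)\<^sup>2 * cell n k (U t) (U t)"
        using l[of k] \<epsilon> by (intro cs) auto
      also have "\<dots> \<le> cell n k (e k t) (e k t) + (2 * (1 + (l k)\<^sup>2) * \<epsilon>\<^sup>2) * cell n k (U t) (U t)"
      proof (intro add_left_mono mult_right_mono[OF _ pos])
        have "(1 + l k)\<^sup>2 \<le> 2 * (1 + (l k)\<^sup>2)" using zero_le_power2[of "1 - l k"] by (simp add: power2_eq_square algebra_simps)
        then show "((1 + l k) * \<epsilon>)\<^sup>2 \<le> 2 * (1 + (l k)\<^sup>2) * \<epsilon>\<^sup>2" unfolding power_mult_distrib by (intro mult_right_mono) auto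
      qed
      finally have "2 * \<epsilon> * ((1 + l k) * \<bar>cell n k (U t) (e k t)\<bar>) \<le> 2 * \<epsilon> * (1 / \<epsilon> * cell n k (e k t) (e k t) + \<epsilon> * ((1 + (l k)\<^sup>2) * cell n k (U t) (U t)))"
        using \<epsilon> pos[of "e k t"] by (simp add: power2_eq_square algebra_simps)
      then have "(1 + l k) * \<bar>cell n k (U t) (e k t)\<bar> \<le> 1 / \<epsilon> * cell n k (e k t) (e k t) + \<epsilon> * ((1 + (l k)\<^sup>2) * cell n k (U t) (U t))"
        using \<epsilon> by (simp only: mult_le_cancel_left_pos mult_pos_pos zero_less_numeral)
      moreover have "0 \<le> \<epsilon> * cell n k (W t) (W t)" using pos[of "W t"] \<epsilon> by simp
      ultimately show "(1 + l k) * \<bar>cell n k (U t) (e k t)\<bar> \<le> \<eta> k t" by (simp add: \<eta>_def distrib_left)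
      have "2 * \<epsilon> * \<bar>cell n k (W t) (e k t)\<bar> \<le> cell n k (e k t) (e k t) + \<epsilon>\<^sup>2 * cell n k (W t) (W t)"
        using \<epsilon> by (intro cs) auto
      also have "\<dots> \<le> 2 * \<epsilon> * (1 / \<epsilon> * cell n k (e k t) (e k t) + \<epsilon> * cell n k (W t) (W t))"
        using \<epsilon> pos[of "e k t"] pos[of "W t"] by (simp add: power2_eq_square algebra_simps)
      finally have "\<bar>cell n k (W t) (e k t)\<bar> \<le> 1 / \<epsilon> * cell n k (e k t) (e k t) + \<epsilon> * cell n k (W t) (W t)"
        using \<epsilon> by (simp only: mult_le_cancel_left_pos mult_pos_pos zero_less_numeral)
      moreover have "0 \<le> \<epsilon> * ((1 + (l k)\<^sup>2) * cell n k (U t) (U t))" using pos[of "U t"] \<epsilon> by simp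
      ultimately show "\<bar>cell n k (W t) (e k t)\<bar> \<le> \<eta> k t" by (simp add: \<eta>_def distrib_left)
    qed (use l \<tau> cell_nonneg cell_Cauchy_Schwarz in auto)
    have B0: "U t \<bullet> U t \<le> B" "0 \<le> B" if "t \<in> {0..\<tau>}" for t
      using B[OF that] A(3)[of "U t"] inner_ge_zero[of "W t"] inner_ge_zero[of "U t"] by linarith+
    have sum_\<eta>: "(\<Sum>k\<le>n. \<eta> k t) \<le> \<epsilon> * (3 + B)" if t: "t \<in> {0..\<tau>}" for t
    proof -
      have "(\<Sum>k\<le>n. cell n k (e k t) (e k t)) \<le>
          (\<Sum>k\<le>n. 2 * \<Lambda>\<^sup>2 * cell n k ((real k / real n) *\<^sub>R U t - H (U t)) ((real k / real n) *\<^sub>R U t - H (U t)) + 2 * cell n k (r t) (r t))"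
      proof (rule sum_mono)
        fix k
        define v where "v = (real k / real n) *\<^sub>R U t - H (U t)"
        have e: "e k t = \<Lambda> *\<^sub>R v + r t" by (simp add: e_def v_def AH l scaleR_diff_right)
        \<comment> \<open>The parallelogram identity separates the variance from the remainder
          r.\<close>
        have "cell n k (e k t) (e k t) + cell n k (\<Lambda> *\<^sub>R v - r t) (\<Lambda> *\<^sub>R v - r t) = 2 * \<Lambda>\<^sup>2 * cell n k v v + 2 * cell n k (r t) (r t)"
          unfolding e by (simp add: cell_simps power2_eq_square algebra_simps)
        then show "cell n k (e k t) (e k t) \<le> 2 * \<Lambda>\<^sup>2 * cell n k ((real k / real n) *\<^sub>R U t - H (U t)) ((real k / real n) *\<^sub>R U t - H (U t)) + 2 * cell n k (r t) (r t)"
          using cell_nonneg[of n k "\<Lambda> *\<^sub>R v - r t"] by (simp add: v_def)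
      qed
      also have "\<dots> = 2 * \<Lambda>\<^sup>2 * (\<Sum>k\<le>n. cell n k ((real k / real n) *\<^sub>R U t - H (U t)) ((real k / real n) *\<^sub>R U t - H (U t))) + 2 * (r t \<bullet> r t)"
        by (simp only: sum.distrib sum_distrib_left[symmetric] sum_cell)
      also have "\<dots> \<le> 2 * \<Lambda>\<^sup>2 * (U t \<bullet> U t / real n) + 2 * \<epsilon>\<^sup>2"
      proof (intro add_mono mult_left_mono sum_variance_cell[OF n(1)])
        show "r t \<bullet> r t \<le> \<epsilon>\<^sup>2" using r(2)[OF t] by (simp add: dot_square_norm power_mono)
      qed auto
      also have "\<dots> \<le> 2 * \<Lambda>\<^sup>2 * (B / real n) + 2 * \<epsilon>\<^sup>2"
        using B0[OF t] by (intro add_right_mono mult_left_mono divide_right_mono) auto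
      also have "\<dots> \<le> 3 * \<epsilon>\<^sup>2" using n(2) by simp
      finally have 1: "1 / \<epsilon> * (\<Sum>k\<le>n. cell n k (e k t) (e k t)) \<le> 3 * \<epsilon>"
        using \<epsilon> by (simp add: field_simps power2_eq_square)
      have "(\<Sum>k\<le>n. (1 + (l k)\<^sup>2) * cell n k (U t) (U t) + cell n k (W t) (W t))
          = (\<Sum>k\<le>n. cell n k (U t) (U t) + \<Lambda> * (real k / real n * cell n k (U t) (U t)) + cell n k (W t) (W t))"
        by (simp add: l algebra_simps)
      also have "\<dots> = U t \<bullet> U t + \<Lambda> * (H (U t) \<bullet> U t) + W t \<bullet> W t"
        by (simp only: sum.distrib sum_distrib_left[symmetric] sum_cell sum_k_cell[OF n(1)])
      also have "\<dots> \<le> B" using B[OF t] by (simp add: AH)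
      finally have 2: "\<epsilon> * (\<Sum>k\<le>n. (1 + (l k)\<^sup>2) * cell n k (U t) (U t) + cell n k (W t) (W t)) \<le> \<epsilon> * B"
        using \<epsilon> by (intro mult_left_mono) auto
      have "(\<Sum>k\<le>n. \<eta> k t) = 1 / \<epsilon> * (\<Sum>k\<le>n. cell n k (e k t) (e k t))
          + \<epsilon> * (\<Sum>k\<le>n. (1 + (l k)\<^sup>2) * cell n k (U t) (U t) + cell n k (W t) (W t))"
        by (subst sum_distrib_left, subst sum_distrib_left, subst sum.distrib[symmetric]) (simp only: \<eta>_def)
      with 1 2 show ?thesis by (simp add: algebra_simps)
    qed
    have int\<eta>: "\<eta> k integrable_on {0..\<tau>}" for k by (rule integrable_continuous_real[OF cont_\<eta>])
    have "(\<Sum>k\<le>n. N k \<tau>) = integral {0..\<tau>} (\<lambda>t. \<Sum>k\<le>n. \<eta> k t)"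
      unfolding N_def using int\<eta> by (subst integral_sum) auto
    also have "\<dots> \<le> integral {0..\<tau>} (\<lambda>t. \<epsilon> * (3 + B))"
      using int\<eta> sum_\<eta> by (intro integral_le integrable_sum) auto
    also have "\<dots> = \<tau> * (\<epsilon> * (3 + B))" using \<tau> by simp
    finally have sum_N: "(\<Sum>k\<le>n. N k \<tau> - N k 0) \<le> \<tau> * (\<epsilon> * (3 + B))" by (simp add: N_def)
    have "(\<Sum>k\<le>n. cell n k (W \<tau>) (W \<tau>) + (l k)\<^sup>2 * cell n k (U \<tau>) (U \<tau>)) \<le>
       (\<Sum>k\<le>n. C * exp (- I (max T \<tau>)) * (cell n k (W 0) (W 0) + (1 + (l k)\<^sup>2) * cell n k (U 0) (U 0)) + K \<tau> * (N k \<tau> - N k 0))"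
      by (intro sum_mono est[OF triple])
    also have "\<dots> = C * exp (- I (max T \<tau>)) * (\<Sum>k\<le>n. cell n k (W 0) (W 0) + (1 + (l k)\<^sup>2) * cell n k (U 0) (U 0)) + K \<tau> * (\<Sum>k\<le>n. N k \<tau> - N k 0)"
      by (subst sum_distrib_left, subst sum_distrib_left, subst sum.distrib[symmetric]) (rule refl)
    also have "\<dots> \<le> C * exp (- I (max T \<tau>)) * (\<Sum>k\<le>n. cell n k (W 0) (W 0) + (1 + (l k)\<^sup>2) * cell n k (U 0) (U 0)) + K \<tau> * (\<tau> * (\<epsilon> * (3 + B)))"
      by (intro add_left_mono mult_left_mono[OF sum_N] C)
    also have "(\<Sum>k\<le>n. cell n k (W 0) (W 0) + (1 + (l k)\<^sup>2) * cell n k (U 0) (U 0))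
        = (\<Sum>k\<le>n. cell n k (W 0) (W 0) + cell n k (U 0) (U 0) + \<Lambda> * (real k / real n * cell n k (U 0) (U 0)))"
      by (simp add: l algebra_simps)
    also have "\<dots> = W 0 \<bullet> W 0 + U 0 \<bullet> U 0 + A (U 0) \<bullet> U 0"
      by (simp only: sum.distrib sum_distrib_left[symmetric] sum_cell sum_k_cell[OF n(1)] AH inner_scaleR_left)
    also have "(\<Sum>k\<le>n. cell n k (W \<tau>) (W \<tau>) + (l k)\<^sup>2 * cell n k (U \<tau>) (U \<tau>)) = W \<tau> \<bullet> W \<tau> + A (U \<tau>) \<bullet> U \<tau>"
      by (simp only: sum.distrib l mult.assoc sum_distrib_left[symmetric] sum_cell sum_k_cell[OF n(1)] AH inner_scaleR_left)
    finally show "W \<tau> \<bullet> W \<tau> + A (U \<tau>) \<bullet> U \<tau> \<le> C * exp (- I (max T \<tau>)) * (W 0 \<bullet> W 0 + U 0 \<bullet> U 0 + A (U 0) \<bullet> U 0)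
        + K \<tau> * (\<tau> * (\<epsilon> * (3 + B)))" .
  qed
qed

end

section \<open>The space \<open>L\<^sup>2\<close> of equivalence classes\<close>

lemma L2_measurable [measurable_dest]: "f \<in> L2 \<Longrightarrow> f \<in> borel_measurable lborel"
  and L2_integrable: "f \<in> L2 \<Longrightarrow> integrable lborel (\<lambda>x. (cmod (f x))\<^sup>2)"
  by (auto simp: L2_def)

lemma cmod_mult_le: "cmod (z * w) \<le> (cmod z)\<^sup>2 + (cmod w)\<^sup>2"
proof -
  have "0 \<le> cmod z * cmod w" by simp
  moreover have "2 * (cmod z * cmod w) \<le> (cmod z)\<^sup>2 + (cmod w)\<^sup>2"
    using sum_squares_bound[of "cmod z" "cmod w"] by (simp add: mult.assoc)
  ultimately show ?thesis unfolding norm_mult by linarith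
qed

lemma borel_measurable_cnj [measurable (raw)]:
  "f \<in> borel_measurable M \<Longrightarrow> (\<lambda>x. cnj (f x)) \<in> borel_measurable M"
  by (rule borel_measurable_continuous_on[of cnj]) (auto intro: continuous_intros)

lemma L2_mult_integrable:
  assumes "f \<in> L2" "g \<in> L2"
  shows "integrable lborel (\<lambda>x. f x * cnj (g x))"
proof (rule Bochner_Integration.integrable_bound)
  show "integrable lborel (\<lambda>x. (cmod (f x))\<^sup>2 + (cmod (g x))\<^sup>2)"
    using assms by (intro Bochner_Integration.integrable_add L2_integrable)
  show "(\<lambda>x. f x * cnj (g x)) \<in> borel_measurable lborel"
    using L2_measurable[OF assms(1)] L2_measurable[OF assms(2)] by measurable
  show "AE x in lborel. norm (f x * cnj (g x)) \<le> norm ((cmod (f x))\<^sup>2 + (cmod (g x))\<^sup>2)"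
    using cmod_mult_le[of "f _" "cnj (g _)"] by auto
qed

lemma L2_inner_self: "L2_inner f f = of_real (LINT x|lborel. (cmod (f x))\<^sup>2)"
proof -
  have "L2_inner f f = (LINT x|lborel. complex_of_real ((cmod (f x))\<^sup>2))"
    unfolding L2_inner_def by (simp only: complex_norm_square)
  then show ?thesis by (simp only: integral_complex_of_real)
qed

lemma L2_bound:
  assumes g: "integrable lborel g" and f: "f \<in> borel_measurable lborel"
    and le: "AE x in lborel. (cmod (f x))\<^sup>2 \<le> g x"
  shows "f \<in> L2"
proof -
  have "integrable lborel (\<lambda>x. (cmod (f x))\<^sup>2)"
  proof (rule Bochner_Integration.integrable_bound[OF g])
    show "(\<lambda>x. (cmod (f x))\<^sup>2) \<in> borel_measurable lborel" using f by measurable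
    show "AE x in lborel. norm ((cmod (f x))\<^sup>2) \<le> norm (g x)" using le by eventually_elim auto
  qed
  with f show ?thesis by (simp add: L2_def)
qed

lemma L2_add: "f \<in> L2 \<Longrightarrow> g \<in> L2 \<Longrightarrow> (\<lambda>x. f x + g x) \<in> L2"
proof (rule L2_bound)
  assume fg: "f \<in> L2" "g \<in> L2"
  show "integrable lborel (\<lambda>x. 2 * (cmod (f x))\<^sup>2 + 2 * (cmod (g x))\<^sup>2)"
    using fg by (intro Bochner_Integration.integrable_add integrable_mult_right L2_integrable)
  show "(\<lambda>x. f x + g x) \<in> borel_measurable lborel"
    using L2_measurable[OF fg(1)] L2_measurable[OF fg(2)] by measurable
  have "(cmod (z + w))\<^sup>2 \<le> 2 * (cmod z)\<^sup>2 + 2 * (cmod w)\<^sup>2" for z w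
  proof -
    have "(cmod (z + w))\<^sup>2 \<le> (cmod z + cmod w)\<^sup>2" by (intro power_mono norm_triangle_ineq) auto
    moreover have "0 \<le> (cmod z - cmod w)\<^sup>2" by simp
    ultimately show ?thesis by (simp add: power2_eq_square algebra_simps)
  qed
  then show "AE x in lborel. (cmod (f x + g x))\<^sup>2 \<le> 2 * (cmod (f x))\<^sup>2 + 2 * (cmod (g x))\<^sup>2" by simp
qed

lemma L2_scaleR: "f \<in> L2 \<Longrightarrow> (\<lambda>x. c *\<^sub>R f x) \<in> L2"
  by (auto simp: L2_def power_mult_distrib)

lemma L2_zero: "(\<lambda>x. 0) \<in> L2"
  by (simp add: L2_def)

lemma L2_uminus: "f \<in> L2 \<Longrightarrow> (\<lambda>x. - f x) \<in> L2"
  using L2_scaleR[of f "- 1"] by simp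

lemma L2_diff: "f \<in> L2 \<Longrightarrow> g \<in> L2 \<Longrightarrow> (\<lambda>x. f x - g x) \<in> L2"
  using L2_add[OF _ L2_uminus, of f g] by simp

text \<open>A partial equivalence: membership in \<open>L2\<close> is part of the relation, so that
  only square integrable functions acquire a class.\<close>

definition l2_rel :: "((real ^ 'n::finite) \<Rightarrow> complex) \<Rightarrow> ((real ^ 'n) \<Rightarrow> complex) \<Rightarrow> bool" where
  "l2_rel f g \<longleftrightarrow> f \<in> L2 \<and> g \<in> L2 \<and> (AE x in lborel. f x = g x)"

quotient_type (overloaded) 'n l2 = "(real ^ 'n::finite) \<Rightarrow> complex" / partial: l2_rel
proof (rule part_equivpI)
  show "\<exists>x. l2_rel x x" using L2_zero by (auto simp: l2_rel_def)
  show "symp l2_rel" by (auto simp: symp_def l2_rel_def elim: eventually_mono)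
  show "transp l2_rel"
  proof (rule transpI)
    fix f g h assume "l2_rel f g" "l2_rel g h"
    then have "f \<in> L2" "h \<in> L2" "AE x in lborel. f x = g x" "AE x in lborel. g x = h x" by (auto simp: l2_rel_def)
    moreover from this(3,4) have "AE x in lborel. f x = h x" by eventually_elim simp
    ultimately show "l2_rel f h" by (simp add: l2_rel_def)
  qed
qed

lemma integral_eq_AE:
  fixes f g :: "real ^ 'n::finite \<Rightarrow> 'b::{banach, second_countable_topology}"
  assumes "AE x in lborel. f x = g x" "f \<in> borel_measurable lborel" "g \<in> borel_measurable lborel"
  shows "(LINT x|lborel. f x) = (LINT x|lborel. g x)"
  using assms by (intro integral_cong_AE) auto

instantiation l2 :: (finite) real_inner
begin

lift_definition zero_l2 :: "'a l2" is "\<lambda>x. 0" by (simp add: l2_rel_def L2_zero)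

lift_definition plus_l2 :: "'a l2 \<Rightarrow> 'a l2 \<Rightarrow> 'a l2" is "\<lambda>f g x. f x + g x"
  by (auto simp: l2_rel_def intro: L2_add)

lift_definition uminus_l2 :: "'a l2 \<Rightarrow> 'a l2" is "\<lambda>f x. - f x"
  by (auto simp: l2_rel_def intro: L2_uminus)

lift_definition minus_l2 :: "'a l2 \<Rightarrow> 'a l2 \<Rightarrow> 'a l2" is "\<lambda>f g x. f x - g x"
  by (auto simp: l2_rel_def intro: L2_diff)

lift_definition scaleR_l2 :: "real \<Rightarrow> 'a l2 \<Rightarrow> 'a l2" is "\<lambda>c f x. c *\<^sub>R f x"
  by (auto simp: l2_rel_def intro: L2_scaleR)

text \<open>The real part gives the same norm as the complex scalar product, and a real inner
  product space is what the operator estimate works with.\<close>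

lift_definition inner_l2 :: "'a l2 \<Rightarrow> 'a l2 \<Rightarrow> real" is "\<lambda>f g. Re (L2_inner f g)"
proof -
  fix f f' g g' :: "(real ^ 'a) \<Rightarrow> complex"
  assume "l2_rel f f'" "l2_rel g g'"
  then have L: "f \<in> L2" "f' \<in> L2" "g \<in> L2" "g' \<in> L2" and "AE x in lborel. f x = f' x" "AE x in lborel. g x = g' x"
    by (auto simp: l2_rel_def)
  from this(5,6) have "AE x in lborel. f x * cnj (g x) = f' x * cnj (g' x)" by eventually_elim simp
  then have "L2_inner f g = L2_inner f' g'"
    unfolding L2_inner_def using L by (intro integral_eq_AE borel_measurable_integrable L2_mult_integrable)
  then show "Re (L2_inner f g) = Re (L2_inner f' g')" by simp
qed

definition norm_l2 :: "'a l2 \<Rightarrow> real" where "norm_l2 x = sqrt (inner x x)"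
definition dist_l2 :: "'a l2 \<Rightarrow> 'a l2 \<Rightarrow> real" where "dist_l2 x y = norm (x - y)"
definition sgn_l2 :: "'a l2 \<Rightarrow> 'a l2" where "sgn_l2 x = scaleR (inverse (norm x)) x"
definition uniformity_l2 :: "('a l2 \<times> 'a l2) filter" where
  "uniformity_l2 = (INF e\<in>{0<..}. principal {(x, y). dist x y < e})"
definition open_l2 :: "'a l2 set \<Rightarrow> bool" where
  "open_l2 U \<longleftrightarrow> (\<forall>x\<in>U. eventually (\<lambda>(x', y). x' = x \<longrightarrow> y \<in> U) uniformity)"

instance
proof
  fix x y z :: "'a l2" and r s :: real and U :: "'a l2 set"
  have [simp]: "l2_rel f f \<longleftrightarrow> f \<in> L2" for f :: "(real ^ 'a) \<Rightarrow> complex" by (simp add: l2_rel_def)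
  have rel: "f \<in> L2 \<Longrightarrow> g \<in> L2 \<Longrightarrow> (\<And>x. f x = g x) \<Longrightarrow> l2_rel f g" for f g :: "(real ^ 'a) \<Rightarrow> complex"
    by (simp add: l2_rel_def)
  note closed = L2_add L2_diff L2_uminus L2_scaleR L2_zero
  show "x + y + z = x + (y + z)" by transfer (auto intro!: rel closed)
  show "x + y = y + x" by transfer (auto intro!: rel closed)
  show "0 + x = x" by transfer (auto intro!: rel closed)
  show "- x + x = 0" by transfer (auto intro!: rel closed)
  show "x - y = x + - y" by transfer (auto intro!: rel closed)
  show "r *\<^sub>R (x + y) = r *\<^sub>R x + r *\<^sub>R y" by transfer (auto intro!: rel closed simp: scaleR_add_right)
  show "(r + s) *\<^sub>R x = r *\<^sub>R x + s *\<^sub>R x" by transfer (auto intro!: rel closed simp: scaleR_add_left)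
  show "r *\<^sub>R s *\<^sub>R x = (r * s) *\<^sub>R x" by transfer (auto intro!: rel closed)
  show "1 *\<^sub>R x = x" by transfer (auto intro!: rel closed)
  show "inner x y = inner y x"
  proof transfer
    fix f g :: "(real ^ 'a) \<Rightarrow> complex"
    have "L2_inner f g = cnj (L2_inner g f)"
      unfolding L2_inner_def by (simp add: mult.commute flip: Bochner_Integration.integral_cnj)
    then show "Re (L2_inner f g) = Re (L2_inner g f)" by simp
  qed
  show "inner (x + y) z = inner x z + inner y z"
  proof (transfer, simp)
    fix f g h :: "(real ^ 'a) \<Rightarrow> complex" assume "f \<in> L2" "g \<in> L2" "h \<in> L2"
    then have "L2_inner (\<lambda>x. f x + g x) h = L2_inner f h + L2_inner g h"
      unfolding L2_inner_def distrib_right by (intro Bochner_Integration.integral_add L2_mult_integrable)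
    then show "Re (L2_inner (\<lambda>x. f x + g x) h) = Re (L2_inner f h) + Re (L2_inner g h)" by simp
  qed
  show "inner (r *\<^sub>R x) y = r * inner x y"
    by transfer (simp add: L2_inner_def)
  show "0 \<le> inner x x" by transfer (simp add: L2_inner_self)
  show "inner x x = 0 \<longleftrightarrow> x = 0"
  proof (transfer, simp)
    fix f :: "(real ^ 'a) \<Rightarrow> complex" assume f: "f \<in> L2"
    have "Re (L2_inner f f) = 0 \<longleftrightarrow> (AE x in lborel. (cmod (f x))\<^sup>2 = 0)"
      unfolding L2_inner_self Re_complex_of_real by (rule integral_nonneg_eq_0_iff_AE[OF L2_integrable[OF f]]) simp
    then show "Re (L2_inner f f) = 0 \<longleftrightarrow> l2_rel f (\<lambda>x. 0)"
      using f by (simp add: l2_rel_def L2_zero)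
  qed
  show "norm x = sqrt (inner x x)" by (rule norm_l2_def)
  show "dist x y = norm (x - y)" by (rule dist_l2_def)
  show "sgn x = inverse (norm x) *\<^sub>R x" by (rule sgn_l2_def)
  show "uniformity = (INF e\<in>{0<..}. principal {(x, y). dist (x::'a l2) y < e})" by (rule uniformity_l2_def)
  show "open U \<longleftrightarrow> (\<forall>x\<in>U. eventually (\<lambda>(x', y). x' = x \<longrightarrow> y \<in> U) uniformity)" by (rule open_l2_def)
qed

end

definition cls :: "((real ^ 'n::finite) \<Rightarrow> complex) \<Rightarrow> 'n l2" where "cls = abs_l2"

lemma cls_eq_iff: "f \<in> L2 \<Longrightarrow> g \<in> L2 \<Longrightarrow> cls f = cls g \<longleftrightarrow> (AE x in lborel. f x = g x)"
  using Quotient_rel[OF Quotient_l2, of f g] by (simp add: cls_def l2_rel_def)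

lemma cls_cases: obtains f where "x = cls f" "f \<in> L2"
  using Quotient_abs_rep[OF Quotient_l2, of x] Quotient_rep_reflp[OF Quotient_l2, of x]
  by (metis cls_def l2_rel_def)

lemma cls_add: "f \<in> L2 \<Longrightarrow> g \<in> L2 \<Longrightarrow> cls (\<lambda>x. f x + g x) = cls f + cls g"
  by (simp add: cls_def plus_l2.abs_eq l2_rel_def)

lemma cls_diff: "f \<in> L2 \<Longrightarrow> g \<in> L2 \<Longrightarrow> cls (\<lambda>x. f x - g x) = cls f - cls g"
  by (simp add: cls_def minus_l2.abs_eq l2_rel_def)

lemma cls_scaleR: "f \<in> L2 \<Longrightarrow> cls (\<lambda>x. c *\<^sub>R f x) = c *\<^sub>R cls f"
  by (simp add: cls_def scaleR_l2.abs_eq l2_rel_def)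

lemma inner_cls: "f \<in> L2 \<Longrightarrow> g \<in> L2 \<Longrightarrow> inner (cls f) (cls g) = Re (L2_inner f g)"
  by (simp add: cls_def inner_l2.abs_eq l2_rel_def)

lemma norm_cls: "norm (cls f) = L2_norm f" if "f \<in> L2"
  using that by (simp add: norm_eq_sqrt_inner inner_cls L2_norm_def L2_inner_self)

section \<open>Convolution with continuous kernels of compact support\<close>

lemma lborel_distr_uminus_euclidean: "distr lborel borel uminus = (lborel :: 'a::euclidean_space measure)"
  using lborel_affine[of "- 1" "0::'a"] by (simp add: density_1 o_def)

lemma integral_shift:
  fixes f :: "'a::euclidean_space \<Rightarrow> 'b::{banach, second_countable_topology}"
  assumes [measurable]: "f \<in> borel_measurable borel"
  shows "(LINT x|lborel. f (x + a)) = (LINT x|lborel. f x)"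
proof -
  have "(LINT x|lborel. f x) = (LINT x|distr lborel borel ((+) a). f x)" by (simp add: lborel_distr_plus)
  also have "\<dots> = (LINT x|lborel. f (a + x))" by (rule integral_distr) simp_all
  finally show ?thesis by (simp add: add.commute)
qed

lemma integrable_shift:
  fixes f :: "'a::euclidean_space \<Rightarrow> 'b::{banach, second_countable_topology}"
  assumes "integrable lborel f"
  shows "integrable lborel (\<lambda>x. f (x + a))"
proof -
  have "integrable (distr lborel borel ((+) a)) f" using assms by (simp add: lborel_distr_plus)
  then show ?thesis by (subst (asm) integrable_distr_eq) (use assms in \<open>auto simp: add.commute\<close>)
qed

lemma integral_reflect:
  fixes f :: "'a::euclidean_space \<Rightarrow> 'b::{banach, second_countable_topology}"
  assumes [measurable]: "f \<in> borel_measurable borel"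
  shows "(LINT x|lborel. f (- x)) = (LINT x|lborel. f x)"
proof -
  have "(LINT x|lborel. f x) = (LINT x|distr lborel borel uminus. f x)" by (simp add: lborel_distr_uminus_euclidean)
  also have "\<dots> = (LINT x|lborel. f (- x))" by (rule integral_distr) simp_all
  finally show ?thesis by simp
qed

definition kernel :: "((real ^ 'n) \<Rightarrow> real) \<Rightarrow> bool" where
  "kernel k \<longleftrightarrow> continuous_on UNIV k \<and> (\<exists>R. \<forall>x. R < norm x \<longrightarrow> k x = 0)"

lemma kernel_measurable [measurable_dest]: "kernel k \<Longrightarrow> k \<in> borel_measurable borel"
  by (auto simp: kernel_def intro: borel_measurable_continuous_onI)

lemma kernel_bounded:
  assumes "kernel k" obtains B where "0 \<le> B" "\<And>x. \<bar>k x\<bar> \<le> B"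
proof -
  from assms obtain R where R: "\<And>x. R < norm x \<Longrightarrow> k x = 0" and c: "continuous_on UNIV k" by (auto simp: kernel_def)
  have "compact (k ` cball 0 R)" by (intro compact_continuous_image continuous_on_subset[OF c]) auto
  then have "bounded (k ` cball 0 R)" by (rule compact_imp_bounded)
  then obtain B where B: "\<forall>x\<in>k ` cball 0 R. norm x \<le> B" unfolding bounded_iff by blast
  have "\<bar>k x\<bar> \<le> max B 0" for x
  proof (cases "norm x \<le> R")
    case True
    then have "k x \<in> k ` cball 0 R" by simp
    then have "norm (k x) \<le> B" using B by blast
    then show ?thesis by simp
  qed (use R in simp)
  then show thesis using that[of "max B 0"] by simp
qed

lemma kernel_integrable:
  assumes "kernel k" shows "integrable lborel k"
proof -
  from assms obtain R where R: "\<And>x. R < norm x \<Longrightarrow> k x = 0" and c: "continuous_on UNIV k" by (auto simp: kernel_def)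
  have "integrable lborel (\<lambda>x. indicator (cball 0 R) x *\<^sub>R k x)"
    by (intro borel_integrable_compact continuous_on_subset[OF c]) auto
  moreover have "(\<lambda>x. indicator (cball 0 R) x *\<^sub>R k x) = k"
    using R by (auto simp: indicator_def fun_eq_iff not_le)
  ultimately show ?thesis by simp
qed

lemma kernel_compose:
  assumes "kernel k" "kernel h" "continuous_on UNIV (\<lambda>(x, y). F x y)" "F 0 0 = 0"
  shows "kernel (\<lambda>x. F (k x) (h x))"
proof -
  from assms(1) obtain R where R: "\<And>x. R < norm x \<Longrightarrow> k x = 0" and ck: "continuous_on UNIV k" by (auto simp: kernel_def)
  from assms(2) obtain R' where R': "\<And>x. R' < norm x \<Longrightarrow> h x = 0" and ch: "continuous_on UNIV h" by (auto simp: kernel_def)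
  have "continuous_on UNIV ((\<lambda>(x, y). F x y) \<circ> (\<lambda>x. (k x, h x)))"
    by (rule continuous_on_compose[OF continuous_on_Pair[OF ck ch] continuous_on_subset[OF assms(3)]]) simp
  moreover have "F (k x) (h x) = 0" if "max R R' < norm x" for x
    using R[of x] R'[of x] that assms(4) by simp
  ultimately show ?thesis unfolding kernel_def o_def case_prod_conv by blast
qed

lemma kernel_add: "kernel k \<Longrightarrow> kernel h \<Longrightarrow> kernel (\<lambda>x. k x + h x)"
  and kernel_diff: "kernel k \<Longrightarrow> kernel h \<Longrightarrow> kernel (\<lambda>x. k x - h x)"
  by (rule kernel_compose[where F = "(+)"] kernel_compose[where F = "(-)"];
      auto simp: case_prod_beta intro!: continuous_intros)+

lemma kernel_mult: "kernel k \<Longrightarrow> kernel (\<lambda>x. c * k x)"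
  and kernel_abs: "kernel k \<Longrightarrow> kernel (\<lambda>x. \<bar>k x\<bar>)"
  and kernel_uminus: "kernel k \<Longrightarrow> kernel (\<lambda>x. - k x)"
  by (rule kernel_compose[where F = "\<lambda>x y. c * x"] kernel_compose[where F = "\<lambda>x y. \<bar>x\<bar>"] kernel_compose[where F = "\<lambda>x y. - x"];
      auto simp: case_prod_beta intro!: continuous_intros)+

lemma kernel_zero: "kernel (\<lambda>x. 0)"
  by (simp add: kernel_def)

lemma kernel_sum: "(\<And>i. i \<in> I \<Longrightarrow> kernel (k i)) \<Longrightarrow> kernel (\<lambda>x. \<Sum>i\<in>I. k i x)"
  by (induction I rule: infinite_finite_induct) (auto intro: kernel_zero kernel_add)

lemma kernel_shift:
  assumes "kernel k" shows "kernel (\<lambda>x. k (x + a))"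
proof -
  from assms obtain R where R: "\<And>x. R < norm x \<Longrightarrow> k x = 0" and c: "continuous_on UNIV k" by (auto simp: kernel_def)
  have "continuous_on UNIV (\<lambda>x. k (x + a))"
    by (rule continuous_on_compose2[OF c]) (auto intro!: continuous_intros)
  moreover have "k (x + a) = 0" if "R + norm a < norm x" for x
    using R[of "x + a"] norm_triangle_ineq2[of x "- a"] that by simp
  ultimately show ?thesis unfolding kernel_def by blast
qed

lemma kernel_reflect:
  assumes "kernel k" shows "kernel (\<lambda>x. k (- x))"
proof -
  from assms obtain R where R: "\<And>x. R < norm x \<Longrightarrow> k x = 0" and c: "continuous_on UNIV k" by (auto simp: kernel_def)
  have "continuous_on UNIV (\<lambda>x. k (- x))"
    by (rule continuous_on_compose2[OF c]) (auto intro!: continuous_intros)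
  with R show ?thesis unfolding kernel_def by (intro conjI exI[of _ R]) auto
qed

text \<open>Convolution with the reflected kernel; this form avoids reflections in the test functions
  \<open>k(\<cdot> - x)\<close>.\<close>

definition corr :: "((real ^ 'n::finite) \<Rightarrow> real) \<Rightarrow> ((real ^ 'n) \<Rightarrow> complex) \<Rightarrow> (real ^ 'n) \<Rightarrow> complex" where
  "corr k f x = (LINT y|lborel. k (y - x) *\<^sub>R f y)"

lemma kernel_L2_integrable:
  assumes k: "kernel k" and f: "f \<in> L2"
  shows "integrable lborel (\<lambda>y. k y *\<^sub>R f y)" "integrable lborel (\<lambda>y. \<bar>k y\<bar> * (cmod (f y))\<^sup>2)"
proof -
  obtain B where B: "0 \<le> B" "\<And>x. \<bar>k x\<bar> \<le> B" using kernel_bounded[OF k] by blast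
  note [measurable] = kernel_measurable[OF k] L2_measurable[OF f]
  show "integrable lborel (\<lambda>y. \<bar>k y\<bar> * (cmod (f y))\<^sup>2)"
  proof (rule Bochner_Integration.integrable_bound[OF integrable_mult_right[OF L2_integrable[OF f], of B]])
    show "AE x in lborel. norm (\<bar>k x\<bar> * (cmod (f x))\<^sup>2) \<le> norm (B * (cmod (f x))\<^sup>2)"
      using B by (auto simp: abs_mult intro!: mult_right_mono)
  qed simp
  then have "integrable lborel (\<lambda>y. \<bar>k y\<bar> + \<bar>k y\<bar> * (cmod (f y))\<^sup>2)"
    using kernel_integrable[OF k] by (intro Bochner_Integration.integrable_add) auto
  then show "integrable lborel (\<lambda>y. k y *\<^sub>R f y)"
  proof (rule Bochner_Integration.integrable_bound)
    show "AE x in lborel. norm (k x *\<^sub>R f x) \<le> norm (\<bar>k x\<bar> + \<bar>k x\<bar> * (cmod (f x))\<^sup>2)"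
    proof (rule AE_I2)
      fix x
      have "2 * cmod (f x) \<le> 1 + (cmod (f x))\<^sup>2" using sum_squares_bound[of 1 "cmod (f x)"] by simp
      then have "cmod (f x) \<le> 1 + (cmod (f x))\<^sup>2" using norm_ge_zero[of "f x"] by linarith
      then have "\<bar>k x\<bar> * cmod (f x) \<le> \<bar>k x\<bar> * (1 + (cmod (f x))\<^sup>2)" by (intro mult_left_mono) auto
      then show "norm (k x *\<^sub>R f x) \<le> norm (\<bar>k x\<bar> + \<bar>k x\<bar> * (cmod (f x))\<^sup>2)" by (simp add: algebra_simps)
    qed
  qed simp
qed

lemma kernel_diff_shift: "kernel k \<Longrightarrow> kernel (\<lambda>y. k (y - x))"
  using kernel_shift[of k "- x"] by simp

lemma corr_integrable:
  assumes "kernel k" "f \<in> L2"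
  shows "integrable lborel (\<lambda>y. k (y - x) *\<^sub>R f y)" "integrable lborel (\<lambda>y. \<bar>k (y - x)\<bar> * (cmod (f y))\<^sup>2)"
  using kernel_L2_integrable[OF kernel_diff_shift[OF assms(1)] assms(2)] by auto

lemma L1_shift: "(LINT y|lborel. \<bar>k (y - x)\<bar>) = (LINT y|lborel. \<bar>k y\<bar>)"
  and L1_shift': "(LINT x|lborel. \<bar>k (y - x)\<bar>) = (LINT y|lborel. \<bar>k y\<bar>)"
  if "kernel k"
proof -
  note [measurable] = kernel_measurable[OF that]
  show "(LINT y|lborel. \<bar>k (y - x)\<bar>) = (LINT y|lborel. \<bar>k y\<bar>)" for x
    using integral_shift[of "\<lambda>y. \<bar>k y\<bar>" "- x"] by simp
  show "(LINT x|lborel. \<bar>k (y - x)\<bar>) = (LINT y|lborel. \<bar>k y\<bar>)"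
    using integral_reflect[of "\<lambda>x. \<bar>k (y + x)\<bar>"] integral_shift[of "\<lambda>y. \<bar>k y\<bar>" y] by (simp add: add.commute)
qed

text \<open>These majorants justify the exchanges of integrals for Young's inequality and for the
  adjoint. The second one is the first for the reflected kernel with the variables swapped.\<close>

lemma kernel_pair_integrable:
  assumes k: "kernel k" and f: "f \<in> L2"
  shows "integrable (lborel \<Otimes>\<^sub>M lborel) (\<lambda>(x, y). \<bar>k (y - x)\<bar> * (cmod (f x))\<^sup>2)"
    and "integrable (lborel \<Otimes>\<^sub>M lborel) (\<lambda>(x, y). \<bar>k (y - x)\<bar> * (cmod (f y))\<^sup>2)"
proof -
  note [measurable] = kernel_measurable[OF k] L2_measurable[OF f]
  have *: "integrable (lborel \<Otimes>\<^sub>M lborel) (\<lambda>(x, y). \<bar>h (y - x)\<bar> * (cmod (f x))\<^sup>2)" if h: "kernel h" for h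
  proof (rule lborel_pair.Fubini_integrable)
    note [measurable] = kernel_measurable[OF h]
    show "(\<lambda>(x, y). \<bar>h (y - x)\<bar> * (cmod (f x))\<^sup>2) \<in> borel_measurable (lborel \<Otimes>\<^sub>M lborel)" by measurable
    show "integrable lborel (\<lambda>x. LINT y|lborel. norm (case (x, y) of (x, y) \<Rightarrow> \<bar>h (y - x)\<bar> * (cmod (f x))\<^sup>2))"
      using L2_integrable[OF f] by (simp add: abs_mult L1_shift[OF h])
    show "AE x in lborel. integrable lborel (\<lambda>y. case (x, y) of (x, y) \<Rightarrow> \<bar>h (y - x)\<bar> * (cmod (f x))\<^sup>2)"
      using kernel_integrable[OF kernel_diff_shift[OF h]] by auto
  qed
  from *[OF k] show "integrable (lborel \<Otimes>\<^sub>M lborel) (\<lambda>(x, y). \<bar>k (y - x)\<bar> * (cmod (f x))\<^sup>2)" .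
  from lborel_pair.integrable_product_swap[OF *[OF kernel_reflect[OF k]]]
  show "integrable (lborel \<Otimes>\<^sub>M lborel) (\<lambda>(x, y). \<bar>k (y - x)\<bar> * (cmod (f y))\<^sup>2)"
    by (simp add: case_prod_beta)
qed

lemma corr_measurable:
  assumes "kernel k" "f \<in> L2" shows "corr k f \<in> borel_measurable lborel"
proof -
  note [measurable] = kernel_measurable[OF assms(1)] L2_measurable[OF assms(2)]
  show ?thesis unfolding corr_def[abs_def] by measurable
qed

text \<open>Cauchy-Schwarz for the weight |k(. - x)|: the integral of |k| (|f| - s)^2 is a
  nonnegative quadratic polynomial in s, so its discriminant is not positive.\<close>

lemma cmod_corr_square_le:
  assumes k: "kernel k" and f: "f \<in> L2"
  shows "(cmod (corr k f x))\<^sup>2 \<le> (LINT y|lborel. \<bar>k y\<bar>) * (LINT y|lborel. \<bar>k (y - x)\<bar> * (cmod (f y))\<^sup>2)"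
proof -
  define a where "a = (LINT y|lborel. \<bar>k y\<bar>)"
  define c where "c = (LINT y|lborel. \<bar>k (y - x)\<bar> * cmod (f y))"
  define d where "d = (LINT y|lborel. \<bar>k (y - x)\<bar> * (cmod (f y))\<^sup>2)"
  have int: "integrable lborel (\<lambda>y. \<bar>k (y - x)\<bar>)" "integrable lborel (\<lambda>y. \<bar>k (y - x)\<bar> * cmod (f y))"
    "integrable lborel (\<lambda>y. \<bar>k (y - x)\<bar> * (cmod (f y))\<^sup>2)"
    using kernel_integrable[OF kernel_diff_shift[OF k]] corr_integrable[OF k f, of x]
      integrable_norm[OF corr_integrable(1)[OF k f, of x]] by auto
  have quad: "0 \<le> a * s\<^sup>2 - 2 * c * s + d" for s
  proof -
    have "0 \<le> (LINT y|lborel. \<bar>k (y - x)\<bar> * (cmod (f y) - s)\<^sup>2)" by (intro integral_nonneg_AE) auto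
    also have "\<dots> = (LINT y|lborel. s\<^sup>2 * \<bar>k (y - x)\<bar> - 2 * s * (\<bar>k (y - x)\<bar> * cmod (f y)) + \<bar>k (y - x)\<bar> * (cmod (f y))\<^sup>2)"
      by (intro Bochner_Integration.integral_cong) (auto simp: power2_eq_square algebra_simps)
    also have "\<dots> = s\<^sup>2 * a - 2 * s * c + d"
      using int by (simp add: a_def c_def d_def L1_shift[OF k])
    finally show ?thesis by (simp add: mult_ac)
  qed
  have "0 \<le> a" by (simp add: a_def)
  have "c\<^sup>2 \<le> a * d"
  proof (cases "a = 0")
    case True
    have "c = 0"
    proof (rule ccontr)
      assume "c \<noteq> 0"
      \<comment> \<open>For a = 0 the polynomial is linear in s, and this value of s makes it equal
        to -1.\<close>
      then show False using quad[of "(d + 1) / (2 * c)"] True by simp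
    qed
    with True show ?thesis by simp
  next
    case False
    then have "0 < a" using \<open>0 \<le> a\<close> by simp
    with quad[of "c / a"] show ?thesis by (simp add: power2_eq_square field_simps)
  qed
  moreover have "cmod (corr k f x) \<le> c"
    unfolding corr_def c_def using integral_norm_bound[of lborel "\<lambda>y. k (y - x) *\<^sub>R f y"] by simp
  then have "(cmod (corr k f x))\<^sup>2 \<le> c\<^sup>2" by (intro power_mono) auto
  ultimately show ?thesis unfolding a_def d_def by linarith
qed

text \<open>Young's inequality: integrating the pointwise bound over x and exchanging the integrals
  yields a second factor, the integral of |k|.\<close>

lemma corr_L2: "corr k f \<in> L2"
  and L2_norm_corr_le: "L2_norm (corr k f) \<le> (LINT y|lborel. \<bar>k y\<bar>) * L2_norm f"
  if k: "kernel k" and f: "f \<in> L2"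
proof -
  let ?a = "LINT y|lborel. \<bar>k y\<bar>"
  let ?g = "\<lambda>x. LINT y|lborel. \<bar>k (y - x)\<bar> * (cmod (f y))\<^sup>2"
  note P = kernel_pair_integrable(2)[OF k f]
  have g: "integrable lborel ?g" using lborel_pair.integrable_fst'[OF P] by simp
  have "(LINT x|lborel. ?g x) = (LINT y|lborel. LINT x|lborel. \<bar>k (y - x)\<bar> * (cmod (f y))\<^sup>2)"
    by (rule lborel_pair.Fubini_integral[OF P, symmetric])
  then have int_g: "(LINT x|lborel. ?g x) = ?a * (LINT y|lborel. (cmod (f y))\<^sup>2)"
    by (simp add: L1_shift'[OF k])
  show L: "corr k f \<in> L2"
    by (rule L2_bound[OF integrable_mult_right[OF g, of ?a] corr_measurable[OF k f]])
      (use cmod_corr_square_le[OF k f] in auto)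
  have "(LINT x|lborel. (cmod (corr k f x))\<^sup>2) \<le> (LINT x|lborel. ?a * ?g x)"
    by (intro integral_mono L2_integrable[OF L] integrable_mult_right g cmod_corr_square_le[OF k f])
  also have "\<dots> = ?a\<^sup>2 * (LINT y|lborel. (cmod (f y))\<^sup>2)" by (simp only: integral_mult_right_zero int_g) (simp only: power2_eq_square mult.assoc)
  finally have "L2_norm (corr k f) \<le> sqrt (?a\<^sup>2 * (LINT y|lborel. (cmod (f y))\<^sup>2))"
    unfolding L2_norm_def by (rule real_sqrt_le_mono)
  also have "\<dots> = ?a * L2_norm f"
    by (simp add: L2_norm_def real_sqrt_mult)
  finally show "L2_norm (corr k f) \<le> ?a * L2_norm f" .
qed

lemma corr_adjoint:
  assumes k: "kernel k" and f: "f \<in> L2" and g: "g \<in> L2"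
  shows "L2_inner (corr k f) g = L2_inner f (corr (\<lambda>x. k (- x)) g)"
proof -
  note [measurable] = kernel_measurable[OF k] L2_measurable[OF f] L2_measurable[OF g]
  have P: "integrable (lborel \<Otimes>\<^sub>M lborel) (\<lambda>(x, y). k (y - x) *\<^sub>R f y * cnj (g x))"
  proof (rule Bochner_Integration.integrable_bound[OF Bochner_Integration.integrable_add[OF
          kernel_pair_integrable(2)[OF k f] kernel_pair_integrable(1)[OF k g]]])
    show "AE p in lborel \<Otimes>\<^sub>M lborel. norm (case p of (x, y) \<Rightarrow> k (y - x) *\<^sub>R f y * cnj (g x))
        \<le> norm ((case p of (x, y) \<Rightarrow> \<bar>k (y - x)\<bar> * (cmod (f y))\<^sup>2) + (case p of (x, y) \<Rightarrow> \<bar>k (y - x)\<bar> * (cmod (g x))\<^sup>2))"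
    proof (rule AE_I2, clarify)
      fix x y :: "real ^ 'a"
      have "\<bar>k (y - x)\<bar> * cmod (f y * cnj (g x)) \<le> \<bar>k (y - x)\<bar> * ((cmod (f y))\<^sup>2 + (cmod (cnj (g x)))\<^sup>2)"
        by (intro mult_left_mono cmod_mult_le) auto
      then show "norm (k (y - x) *\<^sub>R f y * cnj (g x)) \<le> norm (\<bar>k (y - x)\<bar> * (cmod (f y))\<^sup>2 + \<bar>k (y - x)\<bar> * (cmod (g x))\<^sup>2)"
        by (simp add: norm_mult algebra_simps)
    qed
  qed measurable
  have "L2_inner (corr k f) g = (LINT x|lborel. LINT y|lborel. k (y - x) *\<^sub>R f y * cnj (g x))"
    unfolding L2_inner_def corr_def
    by (intro Bochner_Integration.integral_cong refl) (rule integral_mult_left_zero[symmetric])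
  also have "\<dots> = (LINT y|lborel. LINT x|lborel. k (y - x) *\<^sub>R f y * cnj (g x))"
    by (rule lborel_pair.Fubini_integral[OF P, symmetric])
  also have "\<dots> = L2_inner f (corr (\<lambda>x. k (- x)) g)"
    unfolding L2_inner_def corr_def
  proof (intro Bochner_Integration.integral_cong refl)
    fix y
    have "(LINT x|lborel. k (y - x) *\<^sub>R f y * cnj (g x)) = (LINT x|lborel. f y * cnj (k (- (x - y)) *\<^sub>R g x))"
      by (intro Bochner_Integration.integral_cong refl) (simp add: scaleR_conv_of_real)
    also have "\<dots> = f y * cnj (LINT x|lborel. k (- (x - y)) *\<^sub>R g x)"
      by (simp only: integral_mult_right_zero Bochner_Integration.integral_cnj)
    finally show "(LINT x|lborel. k (y - x) *\<^sub>R f y * cnj (g x)) = f y * cnj (LINT x|lborel. k (- (x - y)) *\<^sub>R g x)" .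
  qed
  finally show ?thesis .
qed

lemma corr_cong_AE:
  assumes "kernel k" "f \<in> L2" "g \<in> L2" "AE x in lborel. f x = g x"
  shows "corr k f = corr k g"
proof
  fix x
  show "corr k f x = corr k g x" unfolding corr_def
  proof (rule integral_cong_AE)
    show "AE y in lborel. k (y - x) *\<^sub>R f y = k (y - x) *\<^sub>R g y" using assms(4) by eventually_elim simp
  qed (use corr_integrable(1)[OF assms(1,2)] corr_integrable(1)[OF assms(1,3)] in auto)
qed

text \<open>The default value zero makes the lifted map respect \<open>l2_rel\<close> for every
  function k, as lifting demands.\<close>

lift_definition conv :: "((real ^ 'n::finite) \<Rightarrow> real) \<Rightarrow> 'n l2 \<Rightarrow> 'n l2"
  is "\<lambda>k f. if kernel k then corr k f else (\<lambda>x. 0)"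
proof -
  fix k :: "(real ^ 'n) \<Rightarrow> real" and f g :: "(real ^ 'n) \<Rightarrow> complex"
  assume "l2_rel f g"
  then show "l2_rel (if kernel k then corr k f else (\<lambda>x. 0)) (if kernel k then corr k g else (\<lambda>x. 0))"
    using corr_cong_AE[of k f g] by (simp add: l2_rel_def L2_zero corr_L2)
qed

lemma conv_cls: "kernel k \<Longrightarrow> f \<in> L2 \<Longrightarrow> conv k (cls f) = cls (corr k f)"
  by (simp add: cls_def conv.abs_eq l2_rel_def)

lemma norm_conv_le: "kernel k \<Longrightarrow> norm (conv k x) \<le> (LINT y|lborel. \<bar>k y\<bar>) * norm x"
  by (cases x rule: cls_cases) (simp add: conv_cls norm_cls corr_L2 L2_norm_corr_le)

lemma bounded_linear_conv: "bounded_linear (conv k)" if k: "kernel k"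
proof (rule bounded_linear_intro[where K = "LINT y|lborel. \<bar>k y\<bar>"])
  fix x y :: "'a l2" and c :: real
  obtain f where f: "x = cls f" "f \<in> L2" by (rule cls_cases)
  obtain g where g: "y = cls g" "g \<in> L2" by (rule cls_cases)
  have "corr k (\<lambda>x. f x + g x) = (\<lambda>x. corr k f x + corr k g x)"
    unfolding corr_def[abs_def] using corr_integrable(1)[OF k f(2)] corr_integrable(1)[OF k g(2)]
    by (simp add: scaleR_add_right)
  then show "conv k (x + y) = conv k x + conv k y"
    using f g k by (simp add: conv_cls cls_add[symmetric] L2_add corr_L2)
  have "corr k (\<lambda>x. c *\<^sub>R f x) = (\<lambda>x. c *\<^sub>R corr k f x)"
    unfolding corr_def[abs_def] by (simp only: scaleR_left_commute[of _ c] integral_scaleR_right)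
  then show "conv k (c *\<^sub>R x) = c *\<^sub>R conv k x"
    using f k by (simp add: conv_cls cls_scaleR[symmetric] L2_scaleR corr_L2)
  show "norm (conv k x) \<le> norm x * (LINT y|lborel. \<bar>k y\<bar>)"
    using norm_conv_le[OF k, of x] by (simp add: mult.commute)
qed

lemma conv_diff: "conv (\<lambda>y. k y - h y) x = conv k x - conv h x" if "kernel k" "kernel h"
proof (cases x rule: cls_cases)
  case (1 f)
  have "corr (\<lambda>y. k y - h y) f = (\<lambda>x. corr k f x - corr h f x)"
    unfolding corr_def[abs_def] using corr_integrable(1)[OF that(1) 1(2)] corr_integrable(1)[OF that(2) 1(2)]
    by (simp add: scaleR_diff_left)
  then show ?thesis using 1 that by (simp add: conv_cls cls_diff[symmetric] kernel_diff corr_L2)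
qed

lemma conv_mult: "conv (\<lambda>y. c * k y) x = c *\<^sub>R conv k x" if "kernel k"
proof (cases x rule: cls_cases)
  case (1 f)
  have "corr (\<lambda>y. c * k y) f = (\<lambda>x. c *\<^sub>R corr k f x)"
    unfolding corr_def[abs_def] by (simp add: scaleR_scaleR[symmetric] del: scaleR_scaleR)
  then show ?thesis using 1 that by (simp add: conv_cls cls_scaleR[symmetric] kernel_mult corr_L2)
qed

lemma conv_zero: "conv (\<lambda>y. 0) x = 0"
  using conv_diff[OF kernel_zero kernel_zero, of x] by simp

lemma conv_uminus: "conv (\<lambda>y. - k y) x = - conv k x" if "kernel k"
  using conv_mult[OF that, of "- 1" x] by simp

lemma conv_add: "conv (\<lambda>y. k y + h y) x = conv k x + conv h x" if "kernel k" "kernel h"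
  using conv_diff[OF that(1) kernel_uminus[OF that(2)], of x] that(2) by (simp add: conv_uminus)

lemma conv_sum:
  assumes "\<And>i. i \<in> I \<Longrightarrow> kernel (k i)"
  shows "conv (\<lambda>y. \<Sum>i\<in>I. k i y) x = (\<Sum>i\<in>I. conv (k i) x)"
  using assms
  by (induction I rule: infinite_finite_induct) (simp_all add: conv_zero conv_add kernel_sum)

lemma conv_adjoint: "conv k x \<bullet> y = x \<bullet> conv (\<lambda>z. k (- z)) y" if "kernel k"
proof (cases x rule: cls_cases)
  case f: (1 f)
  obtain g where g: "y = cls g" "g \<in> L2" by (rule cls_cases)
  show ?thesis
    using f g that by (simp add: conv_cls inner_cls corr_L2 kernel_reflect corr_adjoint)
qed

section \<open>Translations\<close>

lemma AE_shift:
  fixes P :: "'a::euclidean_space \<Rightarrow> bool"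
  assumes "AE x in lborel. P x"
  shows "AE x in lborel. P (x + a)"
proof -
  from AE_E3[OF assms] obtain N where N: "\<And>x. x \<in> space lborel - N \<Longrightarrow> P x" "N \<in> null_sets lborel" by blast
  then have "{x. x + a \<in> N} \<in> null_sets lborel"
    using null_sets_translation[of N "- a"] by simp
  then show ?thesis by (rule AE_I') (use N(1) in auto)
qed

lemma L2_shift: "f \<in> L2 \<Longrightarrow> (\<lambda>x. f (x + a)) \<in> L2"
  using integrable_shift[of "\<lambda>x. (cmod (f x))\<^sup>2" a] by (auto simp: L2_def)

lift_definition shift :: "(real ^ 'n) \<Rightarrow> 'n::finite l2 \<Rightarrow> 'n l2" is "\<lambda>a f x. f (x + a)"
proof -
  fix a :: "real ^ 'n" and f g :: "(real ^ 'n) \<Rightarrow> complex"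
  assume "l2_rel f g"
  then show "l2_rel (\<lambda>x. f (x + a)) (\<lambda>x. g (x + a))"
    using AE_shift[of "\<lambda>x. f x = g x" a] by (simp add: l2_rel_def L2_shift)
qed

lemma shift_cls: "f \<in> L2 \<Longrightarrow> shift a (cls f) = cls (\<lambda>x. f (x + a))"
  by (simp add: cls_def shift.abs_eq l2_rel_def)

lemma shift_shift: "shift a (shift c x) = shift (a + c) x"
  by (cases x rule: cls_cases) (simp add: shift_cls L2_shift add.assoc)

lemma shift_0: "shift 0 x = x"
  by (cases x rule: cls_cases) (simp add: shift_cls)

lemma shift_adjoint: "shift a x \<bullet> y = x \<bullet> shift (- a) y"
proof (cases x rule: cls_cases)
  case f: (1 f)
  obtain g where g: "y = cls g" "g \<in> L2" by (rule cls_cases)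
  have "(\<lambda>x. f (x + a) * cnj (g x)) \<in> borel_measurable borel"
    using L2_mult_integrable[OF L2_shift[OF f(2), of a] g(2)] by simp
  from integral_shift[OF this, of "- a"]
  have "L2_inner (\<lambda>x. f (x + a)) g = L2_inner f (\<lambda>x. g (x + - a))" by (simp add: L2_inner_def)
  then show ?thesis using f g L2_shift[of f a] L2_shift[of g "- a"] by (simp add: shift_cls inner_cls)
qed

lemma shift_isometry: "shift a x \<bullet> shift a y = x \<bullet> y"
  by (simp add: shift_adjoint shift_shift shift_0)

lemma bounded_linear_shift: "bounded_linear (shift a)"
proof (rule bounded_linear_intro[where K = 1])
  fix x y :: "'a l2" and c :: real
  obtain f where f: "x = cls f" "f \<in> L2" by (rule cls_cases)
  obtain g where g: "y = cls g" "g \<in> L2" by (rule cls_cases)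
  show "shift a (x + y) = shift a x + shift a y"
    using f g L2_shift[of f a] L2_shift[of g a] by (simp add: shift_cls cls_add[symmetric] L2_add)
  show "shift a (c *\<^sub>R x) = c *\<^sub>R shift a x"
    using f L2_shift[of f a] by (simp add: shift_cls cls_scaleR[symmetric] L2_scaleR)
  show "norm (shift a x) \<le> norm x * 1" by (simp add: norm_eq_sqrt_inner shift_isometry)
qed

text \<open>Translating a mollified function amounts to translating the kernel, so difference
  quotients of the function become difference quotients of the smooth kernel.\<close>

lemma shift_conv: "shift a (conv k x) = conv (\<lambda>y. k (y - a)) x" if "kernel k"
proof (cases x rule: cls_cases)
  case (1 f)
  have "(\<lambda>x. corr k f (x + a)) = corr (\<lambda>y. k (y - a)) f"
    unfolding corr_def[abs_def] by (simp add: diff_diff_eq)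
  then show ?thesis
    using 1 that kernel_diff_shift[OF that, of a] by (simp add: conv_cls shift_cls corr_L2)
qed

section \<open>The discrete Laplacian\<close>

text \<open>The sign is that of - \<Delta>, which makes the operator nonnegative.\<close>

definition discrete_laplacian :: "real \<Rightarrow> 'n::finite l2 \<Rightarrow> 'n l2" where
  "discrete_laplacian h x = (\<Sum>i\<in>UNIV. (1 / h\<^sup>2) *\<^sub>R (2 *\<^sub>R x - shift (h *\<^sub>R axis i 1) x - shift (- (h *\<^sub>R axis i 1)) x))"

lemma bounded_linear_discrete_laplacian: "bounded_linear (discrete_laplacian h)"
  unfolding discrete_laplacian_def[abs_def]
proof (rule bounded_linear_sum)
  fix i :: 'a
  show "bounded_linear (\<lambda>x. (1 / h\<^sup>2) *\<^sub>R (2 *\<^sub>R x - shift (h *\<^sub>R axis i 1) x - shift (- (h *\<^sub>R axis i 1)) x))"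
    by (rule bounded_linear_compose[OF bounded_linear_scaleR_right bounded_linear_sub[OF bounded_linear_sub[OF
      bounded_linear_scaleR_right bounded_linear_shift] bounded_linear_shift]])
qed

lemma discrete_laplacian_symmetric: "discrete_laplacian h x \<bullet> y = x \<bullet> discrete_laplacian h y"
  by (simp add: discrete_laplacian_def inner_sum_left inner_sum_right inner_diff_left inner_diff_right shift_adjoint algebra_simps)

text \<open>Summation by parts, in the form of the isometry of translations. It gives positivity and
  exhibits the quantity that converges to the squared norm of the gradient.\<close>

lemma discrete_laplacian_inner:
  "discrete_laplacian h x \<bullet> x = (\<Sum>i\<in>UNIV. (norm ((1 / h) *\<^sub>R (shift (h *\<^sub>R axis i 1) x - x)))\<^sup>2)"
proof -
  have "(norm ((1 / h) *\<^sub>R (shift a x - x)))\<^sup>2 = (1 / h\<^sup>2) *\<^sub>R (2 *\<^sub>R x - shift a x - shift (- a) x) \<bullet> x" for a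
  proof -
    have "shift a x \<bullet> shift a x = x \<bullet> x" by (rule shift_isometry)
    moreover have "x \<bullet> shift a x = shift a x \<bullet> x" by (rule inner_commute)
    moreover have "shift (- a) x \<bullet> x = x \<bullet> shift a x" using shift_adjoint[of "- a" x x] by simp
    ultimately have "(shift a x - x) \<bullet> (shift a x - x) = (2 *\<^sub>R x - shift a x - shift (- a) x) \<bullet> x"
      unfolding inner_diff_left inner_diff_right inner_scaleR_left by linarith
    then show ?thesis by (simp add: power2_norm_eq_inner[symmetric] power_mult_distrib power_divide)
  qed
  then show ?thesis by (simp add: discrete_laplacian_def inner_sum_left)
qed

text \<open>A difference of two isometric images has at most twice the norm. The bound blows up with
  the mesh, which is harmless because it does not enter the constants of the operator
  estimate.\<close>

lemma discrete_laplacian_le: "discrete_laplacian h x \<bullet> x \<le> (4 * real CARD('n) / h\<^sup>2) * (x \<bullet> x)" for x :: "'n::finite l2"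
proof -
  have "(norm ((1 / h) *\<^sub>R (shift a x - x)))\<^sup>2 \<le> 4 / h\<^sup>2 * (x \<bullet> x)" for a
  proof -
    have "norm (shift a x) = norm x" by (simp add: norm_eq_sqrt_inner shift_isometry)
    then have "norm (shift a x - x) \<le> 2 * norm x" using norm_triangle_ineq4[of "shift a x" x] by simp
    then have "(norm (shift a x - x))\<^sup>2 \<le> (2 * norm x)\<^sup>2" by (intro power_mono) auto
    then have "(norm (shift a x - x))\<^sup>2 \<le> 4 * (x \<bullet> x)" by (simp add: power_mult_distrib power2_norm_eq_inner)
    then show ?thesis by (simp add: power_mult_distrib power_divide divide_right_mono)
  qed
  then have "discrete_laplacian h x \<bullet> x \<le> (\<Sum>i\<in>(UNIV :: 'n set). 4 / h\<^sup>2 * (x \<bullet> x))"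
    unfolding discrete_laplacian_inner by (intro sum_mono) auto
  then show ?thesis by (simp add: mult_ac)
qed

section \<open>Test functions\<close>

lemma iter_partial_deriv_append: "iter_partial_deriv (is @ js) \<phi> = iter_partial_deriv is (iter_partial_deriv js \<phi>)"
  by (induction "is") simp_all

lemma test_function_has_partial_deriv:
  assumes "test_function \<phi>"
  shows "((\<lambda>s. \<phi> (x + s *\<^sub>R axis i 1)) has_real_derivative partial_deriv i \<phi> (x + s *\<^sub>R axis i 1)) (at s)"
proof -
  have d: "\<phi> differentiable (at z)" for z
    using assms unfolding test_function_def by (metis iter_partial_deriv.simps(1))
  have 0: "((\<lambda>h. \<phi> (z + h *\<^sub>R axis i 1)) has_real_derivative partial_deriv i \<phi> z) (at 0)" for z
  proof -
    have "(\<lambda>h. \<phi> (z + h *\<^sub>R axis i 1)) differentiable (at 0)"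
      using d[of z] by (intro differentiable_compose[of \<phi> "\<lambda>h. z + h *\<^sub>R axis i 1"]) simp_all
    then show ?thesis
      unfolding partial_deriv_def by (simp add: DERIV_deriv_iff_real_differentiable)
  qed
  have "((\<lambda>t. \<phi> (x + s *\<^sub>R axis i 1 + (t - s) *\<^sub>R axis i 1)) has_real_derivative partial_deriv i \<phi> (x + s *\<^sub>R axis i 1)) (at s)"
    using DERIV_shift[of "\<lambda>h. \<phi> (x + s *\<^sub>R axis i 1 + h *\<^sub>R axis i 1)" "partial_deriv i \<phi> (x + s *\<^sub>R axis i 1)" s "- s"]
      0[of "x + s *\<^sub>R axis i 1"] by simp
  then show ?thesis by (simp add: algebra_simps)
qed

lemma test_function_kernel: "kernel \<phi>" if "test_function \<phi>"
proof -
  have "\<phi> differentiable (at z)" for z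
    using that unfolding test_function_def by (metis iter_partial_deriv.simps(1))
  then have c: "continuous_on UNIV \<phi>"
    by (simp add: continuous_on_eq_continuous_within differentiable_imp_continuous_within)
  have "bounded {x. \<phi> x \<noteq> 0}"
    using that closure_subset[of "{x. \<phi> x \<noteq> 0}"] unfolding test_function_def
    by (blast intro: bounded_subset compact_imp_bounded)
  then obtain R where "\<forall>x\<in>{x. \<phi> x \<noteq> 0}. norm x \<le> R" unfolding bounded_iff by blast
  then have "\<forall>x. R < norm x \<longrightarrow> \<phi> x = 0" by force
  with c show ?thesis unfolding kernel_def by blast
qed

lemma test_function_partial_deriv: "test_function (partial_deriv i \<phi>)" if t: "test_function \<phi>"
proof -
  have "iter_partial_deriv is (partial_deriv i \<phi>) = iter_partial_deriv (is @ [i]) \<phi>" for "is"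
    by (simp add: iter_partial_deriv_append)
  then have 1: "\<forall>is x. iter_partial_deriv is (partial_deriv i \<phi>) differentiable (at x)"
    using t unfolding test_function_def by simp
  have "partial_deriv i \<phi> x = 0" if x: "x \<notin> closure {x. \<phi> x \<noteq> 0}" for x
  proof -
    have "open ((\<lambda>h::real. x + h *\<^sub>R axis i 1) -` (- closure {x. \<phi> x \<noteq> 0}))"
      by (intro open_vimage open_Compl closed_closure continuous_intros)
    then have "eventually (\<lambda>h. h \<in> (\<lambda>h. x + h *\<^sub>R axis i 1) -` (- closure {x. \<phi> x \<noteq> 0})) (nhds (0::real))"
      using x by (intro eventually_nhds_in_open) auto
    then have "eventually (\<lambda>h. \<phi> (x + h *\<^sub>R axis i 1) = 0) (nhds (0::real))"
    proof eventually_elim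
      case (elim h)
      then have "x + h *\<^sub>R axis i 1 \<notin> {x. \<phi> x \<noteq> 0}" using closure_subset[of "{x. \<phi> x \<noteq> 0}"] by auto
      then show ?case by simp
    qed
    then have "((\<lambda>h. \<phi> (x + h *\<^sub>R axis i 1)) has_real_derivative 0) (at 0)"
      by (subst DERIV_cong_ev[OF refl _ refl, of _ "\<lambda>_. 0"]) auto
    then show ?thesis unfolding partial_deriv_def by (rule DERIV_imp_deriv)
  qed
  then have "{x. partial_deriv i \<phi> x \<noteq> 0} \<subseteq> closure {x. \<phi> x \<noteq> 0}" by blast
  then have "bounded {x. partial_deriv i \<phi> x \<noteq> 0}"
    using t compact_imp_bounded bounded_subset unfolding test_function_def by blast
  then have "compact (closure {x. partial_deriv i \<phi> x \<noteq> 0})" by simp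
  with 1 show ?thesis by (simp add: test_function_def)
qed

lemma compact_closure_translation:
  fixes S :: "'a::euclidean_space set"
  assumes "compact (closure S)" "\<And>x. x \<in> T \<Longrightarrow> x - a \<in> S"
  shows "compact (closure T)"
proof -
  have "T \<subseteq> (+) a ` closure S" using assms(2) closure_subset[of S] by (force intro!: image_eqI[where x = "_ - a"])
  then have "bounded T" using compact_translation[OF assms(1), of a] bounded_subset compact_imp_bounded by blast
  then show ?thesis by simp
qed

lemma test_function_shift: "test_function (\<lambda>x. \<phi> (x - a))"
  and partial_deriv_shift: "partial_deriv i (\<lambda>x. \<phi> (x - a)) x = partial_deriv i \<phi> (x - a)"
  if t: "test_function \<phi>"
proof -
  have p: "partial_deriv i (\<lambda>x. \<phi> (x - a)) = (\<lambda>x. partial_deriv i \<phi> (x - a))" for i \<phi>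
    by (rule ext) (simp add: partial_deriv_def algebra_simps)
  then show "partial_deriv i (\<lambda>x. \<phi> (x - a)) x = partial_deriv i \<phi> (x - a)" by simp
  have "iter_partial_deriv is (\<lambda>x. \<phi> (x - a)) = (\<lambda>x. iter_partial_deriv is \<phi> (x - a))" for "is"
    by (induction "is") (simp_all add: p)
  moreover have "(\<lambda>x. iter_partial_deriv is \<phi> (x - a)) differentiable (at x)" for "is" x
    using t unfolding test_function_def by (intro differentiable_compose[of "iter_partial_deriv is \<phi>" "\<lambda>x. x - a"]) simp_all
  moreover have "compact (closure {x. \<phi> (x - a) \<noteq> 0})"
    by (rule compact_closure_translation[of "{x. \<phi> x \<noteq> 0}" _ a]) (use t in \<open>simp_all add: test_function_def\<close>)
  ultimately show "test_function (\<lambda>x. \<phi> (x - a))" by (simp add: test_function_def)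
qed

lemma test_function_mult: "test_function (\<lambda>x. c * \<phi> x)" if t: "test_function \<phi>"
proof -
  have *: "iter_partial_deriv is (\<lambda>x. c * \<phi> x) = (\<lambda>x. c * iter_partial_deriv is \<phi> x)" for "is"
  proof (induction "is")
    case (Cons i "is")
    have "((\<lambda>h. c * iter_partial_deriv is \<phi> (x + h *\<^sub>R axis i 1)) has_real_derivative
        c * partial_deriv i (iter_partial_deriv is \<phi>) x) (at 0)" for x
    proof (rule DERIV_cmult)
      have "iter_partial_deriv is \<phi> differentiable (at x)" using t unfolding test_function_def by blast
      then have "(\<lambda>h. iter_partial_deriv is \<phi> (x + h *\<^sub>R axis i 1)) differentiable (at 0)"
        by (intro differentiable_compose[of "iter_partial_deriv is \<phi>" "\<lambda>h. x + h *\<^sub>R axis i 1"]) simp_all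
      then show "((\<lambda>h. iter_partial_deriv is \<phi> (x + h *\<^sub>R axis i 1)) has_real_derivative
        partial_deriv i (iter_partial_deriv is \<phi>) x) (at 0)"
        unfolding partial_deriv_def by (simp add: DERIV_deriv_iff_real_differentiable)
    qed
    then have "partial_deriv i (\<lambda>x. c * iter_partial_deriv is \<phi> x) x = c * partial_deriv i (iter_partial_deriv is \<phi>) x" for x
      unfolding partial_deriv_def[of i "\<lambda>x. c * iter_partial_deriv is \<phi> x"] by (rule DERIV_imp_deriv)
    then show ?case by (simp add: fun_eq_iff Cons.IH)
  qed simp
  have "compact (closure {x. c * \<phi> x \<noteq> 0})"
    by (rule compact_closure_translation[of "{x. \<phi> x \<noteq> 0}" _ 0]) (use t in \<open>simp_all add: test_function_def\<close>)
  moreover have "(\<lambda>x. c * iter_partial_deriv is \<phi> x) differentiable (at x)" for "is" x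
    using t unfolding test_function_def by (intro differentiable_mult) auto
  ultimately show ?thesis unfolding test_function_def * by simp
qed

subsection \<open>A smooth bump\<close>

text \<open>With y = 1 / x the derivative of p(y) exp(- y) with respect to x is y^2 (p(y) - p'(y))
  exp(- y).\<close>

primrec flat_poly :: "nat \<Rightarrow> real poly" where
  "flat_poly 0 = 1"
| "flat_poly (Suc n) = [:0, 0, 1:] * (flat_poly n - pderiv (flat_poly n))"

text \<open>The \<open>n\<close>-th derivative of \<open>exp(-1/x)\<close> for \<open>x > 0\<close>, extended by zero.\<close>

definition flat :: "nat \<Rightarrow> real \<Rightarrow> real" where
  "flat n x = (if x > 0 then poly (flat_poly n) (1 / x) * exp (- (1 / x)) else 0)"

lemma poly_div_exp_tendsto_0: "((\<lambda>y. poly p y * exp (- y)) \<longlongrightarrow> (0::real)) at_top"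
proof -
  have "((\<lambda>y. \<Sum>i\<le>degree p. coeff p i * (y ^ i / exp y)) \<longlongrightarrow> (\<Sum>i\<le>degree p. coeff p i * 0)) at_top"
    by (intro tendsto_intros tendsto_power_div_exp_0)
  then show ?thesis by (simp add: poly_altdef sum_distrib_right exp_minus divide_inverse mult.assoc)
qed

lemma flat_deriv: "(flat n has_real_derivative flat (Suc n) x) (at x)"
proof -
  consider "x > 0" | "x < 0" | "x = 0" by linarith
  then show ?thesis
  proof cases
    case 1
    have "eventually (\<lambda>y. y \<in> {0<..}) (nhds x)" using 1 by (intro eventually_nhds_in_open) auto
    then have "eventually (\<lambda>y. flat n y = poly (flat_poly n) (1 / y) * exp (- (1 / y))) (nhds x)"
      by eventually_elim (simp add: flat_def)
    moreover have "((\<lambda>y. poly (flat_poly n) (1 / y) * exp (- (1 / y))) has_real_derivative flat (Suc n) x) (at x)"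
      using 1 by (auto intro!: derivative_eq_intros DERIV_chain2[of "poly (flat_poly n)"] poly_DERIV
          simp: flat_def power2_eq_square field_simps)
    ultimately show ?thesis by (subst DERIV_cong_ev[OF refl _ refl]) auto
  next
    case 2
    have "eventually (\<lambda>y. y \<in> {..<0}) (nhds x)" using 2 by (intro eventually_nhds_in_open) auto
    then have "eventually (\<lambda>y. flat n y = 0) (nhds x)" by eventually_elim (simp add: flat_def)
    then show ?thesis using 2 by (subst DERIV_cong_ev[OF refl _ refl, of _ "\<lambda>_. 0"]) (auto simp: flat_def)
  next
    case 3
    have "((\<lambda>h. flat n h / h) \<longlongrightarrow> 0) (at_right 0)"
    proof -
      have "((\<lambda>y. poly ([:0, 1:] * flat_poly n) y * exp (- y)) \<longlongrightarrow> 0) at_top" by (rule poly_div_exp_tendsto_0)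
      then have "((\<lambda>h. poly ([:0, 1:] * flat_poly n) (inverse h) * exp (- inverse h)) \<longlongrightarrow> 0) (at_right 0)"
        by (rule filterlim_compose[OF _ filterlim_inverse_at_top_right])
      moreover have "eventually (\<lambda>h::real. h > 0) (at_right 0)" by (simp add: eventually_at_right_less)
      then have "eventually (\<lambda>h. poly ([:0, 1:] * flat_poly n) (inverse h) * exp (- inverse h) = flat n h / h) (at_right 0)"
        by eventually_elim (simp add: flat_def field_simps)
      ultimately show ?thesis by (rule Lim_transform_eventually)
    qed
    moreover have "((\<lambda>h. flat n h / h) \<longlongrightarrow> 0) (at_left 0)"
    proof (rule Lim_transform_eventually[OF tendsto_const])
      have "eventually (\<lambda>h::real. h < 0) (at_left 0)" by (auto simp: eventually_at_left_field intro!: exI[of _ "- 1"])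
      then show "eventually (\<lambda>h. 0 = flat n h / h) (at_left 0)" by eventually_elim (simp add: flat_def)
    qed
    ultimately have "((\<lambda>h. flat n h / h) \<longlongrightarrow> 0) (at 0)" by (simp add: filterlim_split_at)
    then show ?thesis using 3 by (simp add: DERIV_def flat_def[of _ 0])
  qed
qed

text \<open>This algebra is closed under differentiation, so membership alone provides derivatives
  of every order.\<close>

inductive_set flat_algebra :: "(real \<Rightarrow> real) set" where
  flat: "(\<lambda>x. flat n (a + s * x)) \<in> flat_algebra"
| const: "(\<lambda>x. c) \<in> flat_algebra"
| add: "f \<in> flat_algebra \<Longrightarrow> g \<in> flat_algebra \<Longrightarrow> (\<lambda>x. f x + g x) \<in> flat_algebra"
| mult: "f \<in> flat_algebra \<Longrightarrow> g \<in> flat_algebra \<Longrightarrow> (\<lambda>x. f x * g x) \<in> flat_algebra"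

lemma flat_algebra_deriv:
  "f \<in> flat_algebra \<Longrightarrow> \<exists>f'\<in>flat_algebra. \<forall>x. (f has_real_derivative f' x) (at x)"
proof (induction rule: flat_algebra.induct)
  case (flat n a s)
  have "((\<lambda>x. flat n (a + s * x)) has_real_derivative s * flat (Suc n) (a + s * x)) (at x)" for x
  proof -
    have "((\<lambda>x. a + s * x) has_real_derivative s) (at x)" by (auto intro!: derivative_eq_intros)
    from DERIV_chain2[OF flat_deriv this, of n] show ?thesis by (simp add: mult.commute)
  qed
  moreover have "(\<lambda>x. s * flat (Suc n) (a + s * x)) \<in> flat_algebra" by (intro flat_algebra.intros)
  ultimately show ?case by (intro bexI[of _ "\<lambda>x. s * flat (Suc n) (a + s * x)"]) auto
next
  case (const c)
  have "(\<lambda>x. 0) \<in> flat_algebra" by (rule flat_algebra.const)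
  then show ?case by (rule bexI[rotated]) auto
next
  case (add f g)
  then obtain f' g' where fg: "f' \<in> flat_algebra" "g' \<in> flat_algebra"
    "\<And>x. (f has_real_derivative f' x) (at x)" "\<And>x. (g has_real_derivative g' x) (at x)" by blast
  then have "\<forall>x. ((\<lambda>x. f x + g x) has_real_derivative f' x + g' x) (at x)" by (auto intro: DERIV_add)
  then show ?case using flat_algebra.add[OF fg(1,2)] by (intro bexI[of _ "\<lambda>x. f' x + g' x"])
next
  case (mult f g)
  then obtain f' g' where fg: "f' \<in> flat_algebra" "g' \<in> flat_algebra"
    "\<And>x. (f has_real_derivative f' x) (at x)" "\<And>x. (g has_real_derivative g' x) (at x)" by blast
  then have "\<forall>x. ((\<lambda>x. f x * g x) has_real_derivative f' x * g x + g' x * f x) (at x)"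
    by (auto intro: DERIV_mult)
  moreover have "(\<lambda>x. f' x * g x + g' x * f x) \<in> flat_algebra"
    using fg mult by (intro flat_algebra.add flat_algebra.mult)
  ultimately show ?case by (intro bexI[of _ "\<lambda>x. f' x * g x + g' x * f x"])
qed

text \<open>A partial derivative of a product of functions of single coordinates changes one factor
  only. For this reason the bump is such a product and not a radial function.\<close>

lemma flat_algebra_product_iter:
  fixes f :: "'n::finite \<Rightarrow> real \<Rightarrow> real"
  assumes "\<And>i. f i \<in> flat_algebra"
  shows "\<exists>g. (\<forall>i. g i \<in> flat_algebra) \<and> iter_partial_deriv is (\<lambda>x. \<Prod>i\<in>UNIV. f i (x $ i)) = (\<lambda>x. \<Prod>i\<in>UNIV. g i (x $ i))"
proof (induction "is")
  case Nil
  then show ?case using assms by auto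
next
  case (Cons j "is")
  then obtain g where g: "\<And>i. g i \<in> flat_algebra" "iter_partial_deriv is (\<lambda>x. \<Prod>i\<in>UNIV. f i (x $ i)) = (\<lambda>x. \<Prod>i\<in>UNIV. g i (x $ i))"
    by blast
  obtain g' where g': "g' \<in> flat_algebra" "\<And>x. (g j has_real_derivative g' x) (at x)"
    using flat_algebra_deriv[OF g(1)] by blast
  have "partial_deriv j (\<lambda>x. \<Prod>i\<in>UNIV. g i (x $ i)) x = (\<Prod>i\<in>UNIV. (g(j := g')) i (x $ i))" for x
  proof -
    have eq: "(\<Prod>i\<in>UNIV. g i ((x + h *\<^sub>R axis j 1) $ i)) = g j (x $ j + h) * (\<Prod>i\<in>UNIV - {j}. g i (x $ i))" for h
      by (subst prod.remove[of UNIV j]) (auto simp: axis_def intro!: prod.cong)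
    have "((\<lambda>h. g j (x $ j + h)) has_real_derivative g' (x $ j)) (at 0)"
      using DERIV_shift[of "g j" "g' (x $ j)" 0 "x $ j"] g'(2)[of "x $ j"] by (simp add: add.commute)
    then have "((\<lambda>h. g j (x $ j + h) * (\<Prod>i\<in>UNIV - {j}. g i (x $ i))) has_real_derivative g' (x $ j) * (\<Prod>i\<in>UNIV - {j}. g i (x $ i))) (at 0)"
      by (rule DERIV_cmult_right)
    then have "partial_deriv j (\<lambda>x. \<Prod>i\<in>UNIV. g i (x $ i)) x = g' (x $ j) * (\<Prod>i\<in>UNIV - {j}. g i (x $ i))"
      unfolding partial_deriv_def eq by (rule DERIV_imp_deriv)
    also have "\<dots> = (\<Prod>i\<in>UNIV. (g(j := g')) i (x $ i))"
      by (subst prod.remove[of UNIV j]) (auto intro!: prod.cong)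
    finally show ?thesis .
  qed
  then have "iter_partial_deriv (j # is) (\<lambda>x. \<Prod>i\<in>UNIV. f i (x $ i)) = (\<lambda>x. \<Prod>i\<in>UNIV. (g(j := g')) i (x $ i))"
    by (simp add: g(2) fun_eq_iff)
  moreover have "\<forall>i. (g(j := g')) i \<in> flat_algebra" using g(1) g'(1) by simp
  ultimately show ?case by blast
qed

lemma flat_algebra_product_differentiable:
  fixes g :: "'n::finite \<Rightarrow> real \<Rightarrow> real"
  assumes "\<And>i. g i \<in> flat_algebra"
  shows "(\<lambda>x :: real ^ 'n. \<Prod>i\<in>UNIV. g i (x $ i)) differentiable (at x)"
proof -
  have "(\<lambda>x :: real ^ 'n. g i (x $ i)) differentiable (at x)" for i
  proof (rule differentiable_compose[of "g i" "\<lambda>x. x $ i"])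
    show "g i differentiable at (x $ i)"
      using flat_algebra_deriv[OF assms[of i]] by (auto simp: real_differentiable_def)
    show "(\<lambda>x :: real ^ 'n. x $ i) differentiable (at x)"
      by (rule bounded_linear_imp_differentiable[OF bounded_linear_vec_nth])
  qed
  then have "\<forall>i. \<exists>D. ((\<lambda>x :: real ^ 'n. g i (x $ i)) has_derivative D) (at x)"
    by (simp add: differentiable_def)
  then obtain D where "\<And>i. ((\<lambda>x :: real ^ 'n. g i (x $ i)) has_derivative D i) (at x)" by metis
  from has_derivative_prod[of UNIV "\<lambda>i x. g i (x $ i)", OF this]
  show ?thesis by (auto simp: differentiable_def)
qed

lemma bump_exists:
  assumes "0 < r"
  obtains \<rho> :: "real ^ 'n::finite \<Rightarrow> real" where "test_function \<rho>" "\<And>x. 0 \<le> \<rho> x" "\<And>x. \<rho> (- x) = \<rho> x"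
    "\<And>x. r < norm x \<Longrightarrow> \<rho> x = 0" "(LINT x|lborel. \<rho> x) = 1"
proof -
  \<comment> \<open>The Euclidean norm is at most the sum of the moduli of the coordinates; so a
    cube of this half-width lies in the ball of radius r.\<close>
  define \<epsilon> where "\<epsilon> = r / real CARD('n)"
  have \<epsilon>: "0 < \<epsilon>" using assms by (simp add: \<epsilon>_def)
  define \<beta> where "\<beta> t = flat 0 (\<epsilon> + 1 * t) * flat 0 (\<epsilon> + (- 1) * t)" for t
  define \<rho> where "\<rho> x = (\<Prod>i\<in>UNIV. \<beta> (x $ i))" for x :: "real ^ 'n"
  have \<beta>: "\<beta> \<in> flat_algebra" unfolding \<beta>_def[abs_def] by (intro flat_algebra.intros)
  have \<beta>0: "0 \<le> \<beta> t" "\<beta> (- t) = \<beta> t" "\<epsilon> < \<bar>t\<bar> \<Longrightarrow> \<beta> t = 0" "0 < \<beta> 0" for t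
    using \<epsilon> by (auto simp: \<beta>_def flat_def)
  have supp: "\<rho> x = 0" if "r < norm x" for x
  proof -
    have "\<exists>i. \<epsilon> < \<bar>x $ i\<bar>"
    proof (rule ccontr)
      assume "\<nexists>i. \<epsilon> < \<bar>x $ i\<bar>"
      then have "(\<Sum>i\<in>UNIV. \<bar>x $ i\<bar>) \<le> (\<Sum>i\<in>(UNIV :: 'n set). \<epsilon>)" by (intro sum_mono) (auto simp: not_less)
      then show False using norm_le_l1_cart[of x] that by (simp add: \<epsilon>_def)
    qed
    then show ?thesis using \<beta>0(3) by (auto simp: \<rho>_def)
  qed
  have t: "test_function \<rho>"
    unfolding test_function_def
  proof (intro conjI allI)
    show "iter_partial_deriv is \<rho> differentiable (at x)" for "is" x
      using flat_algebra_product_iter[of "\<lambda>_::'n. \<beta>" "is"] \<beta> flat_algebra_product_differentiable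
      unfolding \<rho>_def[abs_def] by metis
    have "bounded {x. \<rho> x \<noteq> 0}" unfolding bounded_iff using supp by (intro exI[of _ r]) force
    then show "compact (closure {x. \<rho> x \<noteq> 0})" by simp
  qed
  have \<rho>0: "0 \<le> \<rho> x" for x unfolding \<rho>_def using \<beta>0 by (intro prod_nonneg) auto
  define c where "c = (LINT x|lborel. \<rho> x)"
  \<comment> \<open>If the integral were zero, the nonnegative continuous function would vanish
    almost everywhere, but it is nonzero on an open set containing 0.\<close>
  have "c \<noteq> 0"
  proof
    assume "c = 0"
    then have "AE x in lborel. \<rho> x = 0"
      unfolding c_def using integral_nonneg_eq_0_iff_AE[OF kernel_integrable[OF test_function_kernel[OF t]]] \<rho>0 by simp
    moreover have op: "open {x. \<rho> x \<noteq> 0}"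
      using test_function_kernel[OF t] unfolding kernel_def
      by (intro open_Collect_neq) (auto intro: continuous_intros)
    ultimately have "{x. \<rho> x \<noteq> 0} \<in> null_sets lborel"
      using AE_iff_null[of lborel "\<lambda>x. \<rho> x = 0"] by simp
    then have "negligible {x. \<rho> x \<noteq> 0}"
      unfolding negligible_iff_null_sets by (rule null_sets_completionI)
    moreover have "0 \<in> {x. \<rho> x \<noteq> 0}" using \<beta>0(4) by (simp add: \<rho>_def)
    ultimately show False using open_not_negligible[OF op] by blast
  qed
  moreover have "0 \<le> c" unfolding c_def using \<rho>0 by simp
  ultimately have c: "0 < c" by simp
  show thesis
  proof (rule that[of "\<lambda>x. (1 / c) * \<rho> x"])
    show "test_function (\<lambda>x. (1 / c) * \<rho> x)" by (rule test_function_mult[OF t])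
    show "(LINT x|lborel. (1 / c) * \<rho> x) = 1" using c by (simp add: c_def)
    show "(1 / c) * \<rho> (- x) = (1 / c) * \<rho> x" for x by (simp add: \<rho>_def \<beta>0)
  qed (use \<rho>0 c supp in auto)
qed

section \<open>Difference quotients and weak derivatives\<close>

text \<open>A uniform bound and a common bounded support give the integrable majorant for dominated
  convergence.\<close>

lemma kernel_L1_tendsto:
  fixes k :: "nat \<Rightarrow> (real ^ 'n::finite) \<Rightarrow> real"
  assumes k: "\<And>j. kernel (k j)" and h: "kernel h" and lim: "\<And>x. (\<lambda>j. k j x) \<longlonglongrightarrow> h x"
    and B: "\<And>j x. \<bar>k j x\<bar> \<le> B" and R: "\<And>j x. R < norm x \<Longrightarrow> k j x = 0"
  shows "(\<lambda>j. LINT x|lborel. \<bar>k j x - h x\<bar>) \<longlonglongrightarrow> 0"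
proof -
  have "(\<lambda>j. LINT x|lborel. \<bar>k j x - h x\<bar>) \<longlonglongrightarrow> (LINT x|(lborel :: (real ^ 'n) measure). (0::real))"
  proof (rule integral_dominated_convergence[where w = "\<lambda>x. indicator (cball 0 R) x *\<^sub>R (B + B)"])
    show "integrable lborel (\<lambda>x. indicator (cball (0 :: real ^ 'n) R) x *\<^sub>R (B + B))"
      by (intro borel_integrable_compact) auto
    show "AE x in lborel. (\<lambda>j. \<bar>k j x - h x\<bar>) \<longlonglongrightarrow> (0::real)"
      using tendsto_rabs_zero[OF LIM_zero[OF lim]] by simp
    show "AE x in lborel. norm \<bar>k j x - h x\<bar> \<le> indicator (cball 0 R) x *\<^sub>R (B + B)" for j
    proof (rule AE_I2)
      fix x
      have hB: "\<bar>h x\<bar> \<le> B" by (rule LIMSEQ_le_const2[OF tendsto_rabs[OF lim]]) (use B in auto)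
      show "norm \<bar>k j x - h x\<bar> \<le> indicator (cball 0 R) x *\<^sub>R (B + B)"
      proof (cases "norm x \<le> R")
        case True
        then show ?thesis using B[of j x] hB abs_triangle_ineq4[of "k j x" "h x"] by simp
      next
        case False
        then have "k j x = 0" for j using R[of x] by simp
        then have "h x = 0" using lim[of x] LIMSEQ_const_iff by (simp add: LIMSEQ_const_iff)
        then show ?thesis using False \<open>\<And>j. k j x = 0\<close> by simp
      qed
    qed
    show "(\<lambda>x. \<bar>k j x - h x\<bar>) \<in> borel_measurable lborel" for j
      using kernel_measurable[OF k[of j]] kernel_measurable[OF h] by simp
  qed simp
  then show ?thesis by simp
qed

lemma conv_tendsto:
  assumes k: "\<And>j. kernel (k j)" and h: "kernel h"
    and lim: "(\<lambda>j. LINT x|lborel. \<bar>k j x - h x\<bar>) \<longlonglongrightarrow> 0"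
  shows "(\<lambda>j. conv (k j) x) \<longlonglongrightarrow> conv h x"
proof (rule LIM_zero_cancel, rule tendsto_norm_zero_cancel, rule tendsto_sandwich[of "\<lambda>_. 0"])
  show "(\<lambda>j. (LINT x|lborel. \<bar>k j x - h x\<bar>) * norm x) \<longlonglongrightarrow> 0" using tendsto_mult_left_zero[OF lim] .
  show "\<forall>\<^sub>F j in sequentially. norm (conv (k j) x - conv h x) \<le> (LINT x|lborel. \<bar>k j x - h x\<bar>) * norm x"
    using norm_conv_le[OF kernel_diff[OF k h]] by (auto simp: conv_diff[OF k h, symmetric])
qed auto

lemma conv_eq_difference_quotient:
  assumes "kernel k"
  shows "(1 / h) *\<^sub>R (shift a (conv k x) - conv k x) = conv (\<lambda>y. (1 / h) * (k (y - a) - k y)) x"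
  unfolding conv_mult[OF kernel_diff[OF kernel_diff_shift[OF assms] assms]]
    conv_diff[OF kernel_diff_shift[OF assms] assms] shift_conv[OF assms] by (rule refl)

text \<open>The mean value theorem bounds the quotients by the supremum of the partial derivative,
  and |h| <= 1 confines their supports to one ball.\<close>

lemma difference_quotient_L1:
  fixes \<phi> :: "(real ^ 'n::finite) \<Rightarrow> real" and h :: "nat \<Rightarrow> real"
  assumes t: "test_function \<phi>" and h: "h \<longlonglongrightarrow> 0" "\<And>j. h j \<noteq> 0" "\<And>j. \<bar>h j\<bar> \<le> 1"
  shows "(\<lambda>j. LINT x|lborel. \<bar>(1 / h j) * (\<phi> (x + h j *\<^sub>R axis i 1) - \<phi> x) - partial_deriv i \<phi> x\<bar>) \<longlonglongrightarrow> 0"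
proof -
  note k = test_function_kernel[OF t] and k' = test_function_kernel[OF test_function_partial_deriv[OF t]]
  obtain B where B: "0 \<le> B" "\<And>x. \<bar>partial_deriv i \<phi> x\<bar> \<le> B" using kernel_bounded[OF k'] by blast
  obtain R where R: "\<And>x. R < norm x \<Longrightarrow> \<phi> x = 0" using k by (auto simp: kernel_def)
  show ?thesis
  proof (rule kernel_L1_tendsto[where B = B and R = "R + 1", OF _ k'])
    show "kernel (\<lambda>x. (1 / h j) * (\<phi> (x + h j *\<^sub>R axis i 1) - \<phi> x))" for j
      by (intro kernel_mult kernel_diff kernel_shift k)
    show "(\<lambda>j. (1 / h j) * (\<phi> (x + h j *\<^sub>R axis i 1) - \<phi> x)) \<longlonglongrightarrow> partial_deriv i \<phi> x" for x
    proof -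
      have "((\<lambda>s. (\<phi> (x + s *\<^sub>R axis i 1) - \<phi> x) / s) \<longlongrightarrow> partial_deriv i \<phi> x) (at 0)"
        using test_function_has_partial_deriv[OF t, of x i 0] by (simp add: DERIV_def)
      moreover have "filterlim h (at 0) sequentially" using h by (simp add: filterlim_at)
      ultimately have "(\<lambda>j. (\<phi> (x + h j *\<^sub>R axis i 1) - \<phi> x) / h j) \<longlonglongrightarrow> partial_deriv i \<phi> x"
        by (rule filterlim_compose)
      then show ?thesis by simp
    qed
    show "\<bar>(1 / h j) * (\<phi> (x + h j *\<^sub>R axis i 1) - \<phi> x)\<bar> \<le> B" for j x
    proof -
      have "norm (\<phi> (x + h j *\<^sub>R axis i 1) - \<phi> (x + 0 *\<^sub>R axis i 1)) \<le> B * norm (h j - 0)"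
        by (rule field_differentiable_bound[where S = UNIV and f' = "\<lambda>s. partial_deriv i \<phi> (x + s *\<^sub>R axis i 1)"])
          (use test_function_has_partial_deriv[OF t] B in auto)
      then show ?thesis using h(2)[of j] by (simp add: abs_mult field_simps)
    qed
    show "(1 / h j) * (\<phi> (x + h j *\<^sub>R axis i 1) - \<phi> x) = 0" if "R + 1 < norm x" for j x
    proof -
      have "norm x - norm (- (h j *\<^sub>R axis i 1 :: real ^ 'n)) \<le> norm (x - - (h j *\<^sub>R axis i 1))" by (rule norm_triangle_ineq2)
      then have "R < norm (x + h j *\<^sub>R axis i 1)" using that h(3)[of j] by (simp add: norm_axis_1)
      then show ?thesis using R[of x] R[of "x + h j *\<^sub>R axis i 1"] that by simp
    qed
  qed
qed

text \<open>Cauchy's mean value theorem compares g(s) + g(- s) with s^2, and the ordinary one then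
  turns g'(c) - g'(- c) into 2 c g''. The intermediate point yields both the uniform bound and the
  pointwise limit.\<close>

lemma second_difference:
  fixes g g' g'' :: "real \<Rightarrow> real"
  assumes g: "\<And>s. (g has_real_derivative g' s) (at s)" "\<And>s. (g' has_real_derivative g'' s) (at s)" and h: "0 < h"
  obtains \<theta> where "\<bar>\<theta>\<bar> < h" "g h + g (- h) - 2 * g 0 = h\<^sup>2 * g'' \<theta>"
proof -
  define w where "w s = g s + g (- s)" for s
  have dgm: "((\<lambda>s. g (- s)) has_real_derivative - g' (- s)) (at s)" for s
    using DERIV_chain2[OF g(1), of uminus "- 1" s] by (simp add: DERIV_minus)
  have dw: "(w has_real_derivative g' s - g' (- s)) (at s)" for s
    unfolding w_def[abs_def] using DERIV_add[OF g(1) dgm, of s] by simp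
  obtain c where c: "0 < c" "c < h" "(w h - w 0) * (2 * c) = (h\<^sup>2 - 0\<^sup>2) * (g' c - g' (- c))"
  proof -
    have "\<exists>c. 0 < c \<and> c < h \<and> (w h - w 0) * (2 * c) = (h\<^sup>2 - 0\<^sup>2) * (g' c - g' (- c))"
    proof (rule GMVT'[where f = w and g = "\<lambda>s. s\<^sup>2"])
      show "isCont w z" for z using dw DERIV_isCont by blast
      show "((\<lambda>s::real. s\<^sup>2) has_real_derivative 2 * z) (at z)" for z by (auto intro!: derivative_eq_intros)
    qed (use h dw in auto)
    then show thesis using that by blast
  qed
  obtain \<theta> where \<theta>: "- c < \<theta>" "\<theta> < c" "g' c - g' (- c) = (c - - c) * g'' \<theta>"
    using MVT2[of "- c" c g' g''] g(2) c(1) by auto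
  have "(w h - w 0) * (2 * c) = (h\<^sup>2 * g'' \<theta>) * (2 * c)" using c(3) \<theta>(3) by simp
  then have "w h - w 0 = h\<^sup>2 * g'' \<theta>" using c(1) by simp
  then show thesis using that[of \<theta>] \<theta> c by (simp add: w_def)
qed

lemma second_difference_L1:
  fixes \<phi> :: "(real ^ 'n::finite) \<Rightarrow> real" and h :: "nat \<Rightarrow> real"
  assumes t: "test_function \<phi>" and h: "h \<longlonglongrightarrow> 0" "\<And>j. 0 < h j" "\<And>j. h j \<le> 1"
  shows "(\<lambda>j. LINT x|lborel. \<bar>(1 / (h j)\<^sup>2) * (\<phi> (x + h j *\<^sub>R axis i 1) + \<phi> (x - h j *\<^sub>R axis i 1) - 2 * \<phi> x)
     - partial_deriv i (partial_deriv i \<phi>) x\<bar>) \<longlonglongrightarrow> 0"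
proof -
  note t' = test_function_partial_deriv[OF t, of i]
  note k = test_function_kernel[OF t] and k'' = test_function_kernel[OF test_function_partial_deriv[OF t', of i]]
  obtain B where B: "0 \<le> B" "\<And>x. \<bar>partial_deriv i (partial_deriv i \<phi>) x\<bar> \<le> B" using kernel_bounded[OF k''] by blast
  obtain R where R: "\<And>x. R < norm x \<Longrightarrow> \<phi> x = 0" using k by (auto simp: kernel_def)
  have ex: "\<exists>\<theta>. \<bar>\<theta>\<bar> < h j \<and> (1 / (h j)\<^sup>2) * (\<phi> (x + h j *\<^sub>R axis i 1) + \<phi> (x - h j *\<^sub>R axis i 1) - 2 * \<phi> x)
      = partial_deriv i (partial_deriv i \<phi>) (x + \<theta> *\<^sub>R axis i 1)" for j x
  proof -
    obtain \<theta> where "\<bar>\<theta>\<bar> < h j" "\<phi> (x + h j *\<^sub>R axis i 1) + \<phi> (x + (- h j) *\<^sub>R axis i 1) - 2 * \<phi> (x + 0 *\<^sub>R axis i 1)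
      = (h j)\<^sup>2 * partial_deriv i (partial_deriv i \<phi>) (x + \<theta> *\<^sub>R axis i 1)"
      using second_difference[of "\<lambda>s. \<phi> (x + s *\<^sub>R axis i 1)", OF test_function_has_partial_deriv[OF t] test_function_has_partial_deriv[OF t'] h(2)]
      by blast
    then show ?thesis using h(2)[of j] by (intro exI[of _ \<theta>]) simp
  qed
  show ?thesis
  proof (rule kernel_L1_tendsto[where B = B and R = "R + 1", OF _ k''])
    show "kernel (\<lambda>x. (1 / (h j)\<^sup>2) * (\<phi> (x + h j *\<^sub>R axis i 1) + \<phi> (x - h j *\<^sub>R axis i 1) - 2 * \<phi> x))" for j
      by (intro kernel_mult kernel_diff kernel_add kernel_shift kernel_diff_shift k)
    show "\<bar>(1 / (h j)\<^sup>2) * (\<phi> (x + h j *\<^sub>R axis i 1) + \<phi> (x - h j *\<^sub>R axis i 1) - 2 * \<phi> x)\<bar> \<le> B" for j x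
    proof -
      from ex[of j x] obtain \<theta> where "(1 / (h j)\<^sup>2) * (\<phi> (x + h j *\<^sub>R axis i 1) + \<phi> (x - h j *\<^sub>R axis i 1) - 2 * \<phi> x)
          = partial_deriv i (partial_deriv i \<phi>) (x + \<theta> *\<^sub>R axis i 1)" by blast
      then show ?thesis using B(2) by simp
    qed
    show "(\<lambda>j. (1 / (h j)\<^sup>2) * (\<phi> (x + h j *\<^sub>R axis i 1) + \<phi> (x - h j *\<^sub>R axis i 1) - 2 * \<phi> x))
        \<longlonglongrightarrow> partial_deriv i (partial_deriv i \<phi>) x" for x
    proof -
      have "\<forall>j. \<exists>\<theta>. \<bar>\<theta>\<bar> < h j \<and> (1 / (h j)\<^sup>2) * (\<phi> (x + h j *\<^sub>R axis i 1) + \<phi> (x - h j *\<^sub>R axis i 1) - 2 * \<phi> x)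
          = partial_deriv i (partial_deriv i \<phi>) (x + \<theta> *\<^sub>R axis i 1)"
        using ex by blast
      from choice[OF this] obtain \<theta> where \<theta>: "\<And>j. \<bar>\<theta> j\<bar> < h j"
        "\<And>j. (1 / (h j)\<^sup>2) * (\<phi> (x + h j *\<^sub>R axis i 1) + \<phi> (x - h j *\<^sub>R axis i 1) - 2 * \<phi> x)
          = partial_deriv i (partial_deriv i \<phi>) (x + \<theta> j *\<^sub>R axis i 1)" by blast
      have "\<theta> \<longlonglongrightarrow> 0"
        by (rule tendsto_rabs_zero_cancel, rule tendsto_sandwich[OF _ _ tendsto_const h(1)])
          (simp_all add: less_imp_le[OF \<theta>(1)])
      then have "(\<lambda>j. x + \<theta> j *\<^sub>R axis i 1) \<longlonglongrightarrow> x + 0 *\<^sub>R axis i 1" by (intro tendsto_intros)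
      moreover have "isCont (partial_deriv i (partial_deriv i \<phi>)) x"
        using k'' by (simp add: kernel_def continuous_on_eq_continuous_at)
      ultimately show ?thesis unfolding \<theta>(2) using isCont_tendsto_compose by fastforce
    qed
    show "(1 / (h j)\<^sup>2) * (\<phi> (x + h j *\<^sub>R axis i 1) + \<phi> (x - h j *\<^sub>R axis i 1) - 2 * \<phi> x) = 0" if "R + 1 < norm x" for j x
    proof -
      have "R < norm (x + s *\<^sub>R axis i 1)" if "\<bar>s\<bar> \<le> 1" for s
      proof -
        have "norm x - norm (- (s *\<^sub>R axis i 1 :: real ^ 'n)) \<le> norm (x - - (s *\<^sub>R axis i 1))" by (rule norm_triangle_ineq2)
        then show ?thesis using that \<open>R + 1 < norm x\<close> by (simp add: norm_axis_1)
      qed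
      from this[of "h j"] this[of "- h j"] show ?thesis
        using R[of x] R[of "x + h j *\<^sub>R axis i 1"] R[of "x - h j *\<^sub>R axis i 1"] that h(2,3)[of j] by simp
    qed
  qed
qed

section \<open>Approximation in \<open>L\<^sup>2\<close>\<close>

lemma L2_norm_tendsto_0:
  fixes f :: "nat \<Rightarrow> (real ^ 'n::finite) \<Rightarrow> complex"
  assumes [measurable]: "\<And>j. f j \<in> borel_measurable lborel"
    and lim: "AE x in lborel. (\<lambda>j. f j x) \<longlonglongrightarrow> 0"
    and w: "integrable lborel w" "\<And>j. AE x in lborel. (cmod (f j x))\<^sup>2 \<le> w x"
  shows "(\<lambda>j. L2_norm (f j)) \<longlonglongrightarrow> 0"
proof -
  have "(\<lambda>j. LINT x|lborel. (cmod (f j x))\<^sup>2) \<longlonglongrightarrow> (LINT x|(lborel :: (real ^ 'n) measure). (0::real))"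
  proof (rule integral_dominated_convergence[OF _ _ w(1)])
    show "AE x in lborel. (\<lambda>j. (cmod (f j x))\<^sup>2) \<longlonglongrightarrow> 0"
      using lim
    proof eventually_elim
      case (elim x)
      from tendsto_power[OF tendsto_norm_zero[OF elim], of 2] show ?case by simp
    qed
    show "AE x in lborel. norm ((cmod (f j x))\<^sup>2) \<le> w x" for j using w(2)[of j] by simp
    show "(\<lambda>x. (cmod (f j x))\<^sup>2) \<in> borel_measurable lborel" for j by measurable
  qed simp
  then show ?thesis unfolding L2_norm_def using tendsto_real_sqrt by fastforce
qed

text \<open>Truncation of the argument and of the value; \<open>closest_point\<close> is the radial
  retraction onto the disc of radius M. In contrast to an indicator function it maps continuous
  functions to continuous functions.\<close>

definition cutoff :: "real \<Rightarrow> (real ^ 'n::finite) \<Rightarrow> complex \<Rightarrow> complex" where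
  "cutoff M x z = max 0 (min 1 (M + 1 - norm x)) *\<^sub>R closest_point (cball 0 M) z"

lemma cutoff_props:
  assumes M: "0 \<le> M"
  shows "continuous_on UNIV g \<Longrightarrow> continuous_on UNIV (\<lambda>x. cutoff M x (g x))"
    and "cmod (cutoff M x z) \<le> M" and "M + 1 < norm x \<Longrightarrow> cutoff M x z = 0"
    and "norm x \<le> M \<Longrightarrow> cmod z \<le> M \<Longrightarrow> cutoff M x z = z"
    and "cmod (z - cutoff M x z) \<le> 3 * cmod z"
proof -
  let ?c = "closest_point (cball 0 M) :: complex \<Rightarrow> complex"
  have c: "continuous_on UNIV ?c" using M by (intro continuous_on_closest_point) auto
  show "continuous_on UNIV (\<lambda>x. cutoff M x (g x))" if "continuous_on UNIV g"
    unfolding cutoff_def by (intro continuous_intros continuous_on_compose2[OF c that]) auto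
  have "?c z \<in> cball 0 M" using M by (intro closest_point_in_set) auto
  then have cM: "cmod (?c z) \<le> M" by simp
  have \<chi>: "0 \<le> max 0 (min 1 (M + 1 - norm x))" "max 0 (min 1 (M + 1 - norm x)) \<le> 1" by auto
  have le: "cmod (cutoff M x z) \<le> cmod (?c z)"
    unfolding cutoff_def using mult_right_mono[OF \<chi>(2) norm_ge_zero[of "?c z"]] \<chi>(1) by simp
  then show "cmod (cutoff M x z) \<le> M" using cM by simp
  show "M + 1 < norm x \<Longrightarrow> cutoff M x z = 0" by (simp add: cutoff_def)
  show "norm x \<le> M \<Longrightarrow> cmod z \<le> M \<Longrightarrow> cutoff M x z = z" by (simp add: cutoff_def closest_point_self)
  have "dist z (?c z) \<le> dist z 0" using M by (intro closest_point_le) auto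
  then have "cmod (?c z) \<le> 2 * cmod z" using norm_triangle_ineq2[of "?c z" z] by (simp add: dist_norm norm_minus_commute)
  then show "cmod (z - cutoff M x z) \<le> 3 * cmod z" using le norm_triangle_ineq4[of z "cutoff M x z"] by simp
qed

lemma L2_bounded_support:
  fixes f :: "(real ^ 'n::finite) \<Rightarrow> complex"
  assumes "f \<in> borel_measurable lborel" "\<And>x. cmod (f x) \<le> B" "\<And>x. R < norm x \<Longrightarrow> f x = 0"
  shows "f \<in> L2" "L2_norm f \<le> sqrt (B\<^sup>2 * measure lborel (cball (0 :: real ^ 'n) R))"
proof -
  have le: "(cmod (f x))\<^sup>2 \<le> indicator (cball 0 R) x *\<^sub>R B\<^sup>2" for x
  proof (cases "norm x \<le> R")
    case True
    then show ?thesis using assms(2)[of x] by (simp add: power_mono)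
  qed (use assms(3)[of x] in simp)
  have int: "integrable lborel (\<lambda>x. indicator (cball (0 :: real ^ 'n) R) x *\<^sub>R B\<^sup>2)"
    by (intro borel_integrable_compact) auto
  show L: "f \<in> L2" by (rule L2_bound[OF int assms(1)]) (use le in auto)
  have "(LINT x|lborel. (cmod (f x))\<^sup>2) \<le> (LINT x|lborel. indicator (cball (0 :: real ^ 'n) R) x *\<^sub>R B\<^sup>2)"
    by (intro integral_mono L2_integrable[OF L] int le)
  also have "\<dots> = B\<^sup>2 * measure lborel (cball (0 :: real ^ 'n) R)" by (simp add: mult.commute)
  finally show "L2_norm f \<le> sqrt (B\<^sup>2 * measure lborel (cball (0 :: real ^ 'n) R))"
    unfolding L2_norm_def by (rule real_sqrt_le_mono)
qed

text \<open>A measurable function is an almost everywhere limit of continuous functions, but these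
  come without a bound. Applying the same continuous cutoff to the function and to its
  approximations supplies a majorant, and the cutoff itself converges in \<open>L2\<close>.\<close>

lemma L2_dense:
  fixes f :: "(real ^ 'n::finite) \<Rightarrow> complex"
  assumes f: "f \<in> L2" and e: "0 < e"
  obtains g R where "continuous_on UNIV g" "\<And>x. R < norm x \<Longrightarrow> g x = 0" "0 \<le> R" "g \<in> L2" "L2_norm (\<lambda>x. f x - g x) < e"
proof -
  note fm [measurable] = L2_measurable[OF f]
  have "f \<in> borel_measurable lebesgue" using fm by (simp add: measurable_completion)
  then have "f measurable_on UNIV"
    using lebesgue_measurable_imp_measurable_on[of f UNIV] by simp
  then obtain N g where N: "negligible N" and g: "\<And>n. continuous_on UNIV (g n)" "\<And>x. x \<notin> N \<Longrightarrow> (\<lambda>n. g n x) \<longlonglongrightarrow> f x"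
    unfolding measurable_on_def by auto
  have cm: "continuous_on UNIV (\<lambda>p :: (real ^ 'n) \<times> complex. cutoff M (fst p) (snd p))" if "0 \<le> M" for M
  proof -
    have c: "continuous_on UNIV (closest_point (cball 0 M) :: complex \<Rightarrow> complex)" using that by (intro continuous_on_closest_point) auto
    have "continuous_on UNIV (\<lambda>p :: (real ^ 'n) \<times> complex. closest_point (cball 0 M) (snd p))"
      by (rule continuous_on_compose2[OF c continuous_on_snd[OF continuous_on_id]]) simp
    then show ?thesis unfolding cutoff_def by (intro continuous_intros)
  qed
  have meas: "(\<lambda>x. cutoff M x (f x)) \<in> borel_measurable lborel" if "0 \<le> M" for M
    using borel_measurable_continuous_on[OF cm[OF that], of "\<lambda>x. (x, f x)" lborel] fm by simp
  have "(\<lambda>j. L2_norm (\<lambda>x. f x - cutoff (real j) x (f x))) \<longlonglongrightarrow> 0"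
  proof (rule L2_norm_tendsto_0)
    show "(\<lambda>x. f x - cutoff (real j) x (f x)) \<in> borel_measurable lborel" for j using meas[of "real j"] fm by simp
    show "AE x in lborel. (\<lambda>j. f x - cutoff (real j) x (f x)) \<longlonglongrightarrow> 0"
    proof (rule AE_I2)
      fix x
      obtain n :: nat where n: "max (norm x) (cmod (f x)) \<le> real n" using real_arch_simple by blast
      have "eventually (\<lambda>j. 0 = f x - cutoff (real j) x (f x)) sequentially"
        using eventually_ge_at_top[of n] by eventually_elim (use n in \<open>auto simp: cutoff_props(4)\<close>)
      then show "(\<lambda>j. f x - cutoff (real j) x (f x)) \<longlonglongrightarrow> 0" by (rule Lim_transform_eventually[OF tendsto_const])
    qed
    show "integrable lborel (\<lambda>x. 9 * (cmod (f x))\<^sup>2)" by (intro integrable_mult_right L2_integrable f)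
    show "AE x in lborel. (cmod (f x - cutoff (real j) x (f x)))\<^sup>2 \<le> 9 * (cmod (f x))\<^sup>2" for j
    proof (rule AE_I2)
      fix x
      have "cmod (f x - cutoff (real j) x (f x)) \<le> 3 * cmod (f x)" by (rule cutoff_props(5)) simp
      from power_mono[OF this norm_ge_zero, of 2]
      show "(cmod (f x - cutoff (real j) x (f x)))\<^sup>2 \<le> 9 * (cmod (f x))\<^sup>2" by (simp add: power_mult_distrib)
    qed
  qed
  then have "eventually (\<lambda>j. L2_norm (\<lambda>x. f x - cutoff (real j) x (f x)) < e / 2) sequentially"
    using e by (intro order_tendstoD) auto
  then obtain M where M: "L2_norm (\<lambda>x. f x - cutoff (real M) x (f x)) < e / 2"
    using eventually_happens'[OF sequentially_bot] by blast
  define h where "h n x = cutoff (real M) x (g n x)" for n x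
  have hc: "continuous_on UNIV (h n)" for n unfolding h_def[abs_def] by (intro cutoff_props(1) g) simp
  have hB: "cmod (h n x) \<le> real M" "real M + 1 < norm x \<Longrightarrow> h n x = 0" for n x
    by (auto simp: h_def cutoff_props(2,3))
  have hm: "h n \<in> borel_measurable lborel" for n using borel_measurable_continuous_onI[OF hc] by simp
  have hL: "h n \<in> L2" for n by (rule L2_bounded_support(1)[OF hm hB(1) hB(2)])
  have fL: "(\<lambda>x. cutoff (real M) x (f x)) \<in> L2"
    by (rule L2_bounded_support(1)[OF meas, of _ "real M" "real M + 1"]) (auto simp: cutoff_props)
  have "(\<lambda>n. L2_norm (\<lambda>x. cutoff (real M) x (f x) - h n x)) \<longlonglongrightarrow> 0"
  proof (rule L2_norm_tendsto_0)
    show "(\<lambda>x. cutoff (real M) x (f x) - h n x) \<in> borel_measurable lborel" for n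
      using meas[of "real M"] hm[of n] by simp
    have "AE x in lebesgue. x \<notin> N" using N by (simp add: negligible_iff_null_sets AE_not_in)
    then have "AE x in lebesgue. (\<lambda>n. cutoff (real M) x (f x) - h n x) \<longlonglongrightarrow> 0"
    proof eventually_elim
      case (elim x)
      have lim: "(\<lambda>n. (x, g n x)) \<longlonglongrightarrow> (x, f x)" using g(2)[OF elim] by (intro tendsto_intros)
      have c: "isCont (\<lambda>p. cutoff (real M) (fst p) (snd p)) (x, f x)"
        using cm[of "real M"] by (simp add: continuous_on_eq_continuous_at)
      have "(\<lambda>n. cutoff (real M) x (g n x)) \<longlonglongrightarrow> cutoff (real M) x (f x)"
        using isCont_tendsto_compose[OF c lim] by simp
      then have "(\<lambda>n. cutoff (real M) x (f x) - h n x) \<longlonglongrightarrow> cutoff (real M) x (f x) - cutoff (real M) x (f x)"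
        unfolding h_def by (intro tendsto_diff tendsto_const)
      then show ?case by simp
    qed
    then show "AE x in lborel. (\<lambda>n. cutoff (real M) x (f x) - h n x) \<longlonglongrightarrow> 0"
      by (simp add: AE_completion_iff)
    show "integrable lborel (\<lambda>x. indicator (cball (0 :: real ^ 'n) (real M + 1)) x *\<^sub>R (2 * real M)\<^sup>2)"
      by (intro borel_integrable_compact) auto
    show "AE x in lborel. (cmod (cutoff (real M) x (f x) - h n x))\<^sup>2 \<le> indicator (cball 0 (real M + 1)) x *\<^sub>R (2 * real M)\<^sup>2" for n
    proof (rule AE_I2)
      fix x
      show "(cmod (cutoff (real M) x (f x) - h n x))\<^sup>2 \<le> indicator (cball 0 (real M + 1)) x *\<^sub>R (2 * real M)\<^sup>2"
      proof (cases "norm x \<le> real M + 1")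
        case True
        have "cmod (cutoff (real M) x (f x) - h n x) \<le> 2 * real M"
          using norm_triangle_ineq4[of "cutoff (real M) x (f x)" "h n x"] hB(1)[of n x] cutoff_props(2)[of "real M" x "f x"] by simp
        then show ?thesis using True power_mono[of _ "2 * real M" 2] by simp
      qed (simp add: cutoff_props h_def)
    qed
  qed
  then have "eventually (\<lambda>n. L2_norm (\<lambda>x. cutoff (real M) x (f x) - h n x) < e / 2) sequentially"
    using e by (intro order_tendstoD) auto
  then obtain n where n: "L2_norm (\<lambda>x. cutoff (real M) x (f x) - h n x) < e / 2"
    using eventually_happens'[OF sequentially_bot] by blast
  have "norm (cls f - cls (h n)) \<le> norm (cls f - cls (\<lambda>x. cutoff (real M) x (f x))) + norm (cls (\<lambda>x. cutoff (real M) x (f x)) - cls (h n))"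
    using norm_triangle_ineq[of "cls f - cls (\<lambda>x. cutoff (real M) x (f x))" "cls (\<lambda>x. cutoff (real M) x (f x)) - cls (h n)"] by simp
  then have "L2_norm (\<lambda>x. f x - h n x) < e"
    using M n f hL fL by (simp add: cls_diff[symmetric] norm_cls L2_diff)
  then show thesis using that[of "h n" "real M + 1"] hc hB(2) hL by simp
qed

lemma mollify_continuous:
  fixes g :: "(real ^ 'n::finite) \<Rightarrow> complex"
  assumes g: "continuous_on UNIV g" "\<And>x. R < norm x \<Longrightarrow> g x = 0" "g \<in> L2"
    and \<rho>: "\<And>j. kernel (\<rho> j)" "\<And>j x. 0 \<le> \<rho> j x" "\<And>j x. 1 / real (Suc j) < norm x \<Longrightarrow> \<rho> j x = 0" "\<And>j. (LINT x|lborel. \<rho> j x) = 1"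
  shows "(\<lambda>j. conv (\<rho> j) (cls g)) \<longlonglongrightarrow> cls g"
proof (rule LIM_zero_cancel, rule tendsto_norm_zero_cancel, rule LIMSEQ_I)
  fix e :: real assume e: "0 < e"
  define V where "V = measure lborel (cball (0 :: real ^ 'n) (R + 1))"
  \<comment> \<open>An error of at most \<delta> on a set of measure V has norm at most \<delta>
    sqrt V < \<delta> (1 + V) = e; adding 1 also covers V = 0.\<close>
  define \<delta> where "\<delta> = e / (1 + V)"
  have V: "0 \<le> V" by (simp add: V_def)
  have \<delta>: "0 < \<delta>" using e V by (simp add: \<delta>_def)
  \<comment> \<open>The mollified function vanishes outside radius R + 1, and the averages taken
    there involve points at distance at most 1, hence the radius R + 2.\<close>
  have "uniformly_continuous_on (cball 0 (R + 2)) g"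
    by (intro compact_uniformly_continuous continuous_on_subset[OF g(1)]) auto
  then obtain d where d: "0 < d" "\<And>x y. x \<in> cball 0 (R + 2) \<Longrightarrow> y \<in> cball 0 (R + 2) \<Longrightarrow> dist y x < d \<Longrightarrow> dist (g y) (g x) < \<delta>"
    unfolding uniformly_continuous_on_def using \<delta> by blast
  obtain j0 where j0: "1 / real (Suc j0) < d" using d(1) nat_approx_posE by blast
  show "\<exists>j0. \<forall>j\<ge>j0. norm (norm (conv (\<rho> j) (cls g) - cls g) - 0) < e"
  proof (intro exI[of _ j0] allI impI)
    fix j assume j: "j0 \<le> j"
    have rj: "1 / real (Suc j) < d" "1 / real (Suc j) \<le> 1"
      using j j0 frac_le[of 1 1 "real (Suc j0)" "real (Suc j)"] by auto
    have diff: "corr (\<rho> j) g x - g x = (LINT y|lborel. \<rho> j (y - x) *\<^sub>R (g y - g x))"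
      and int: "integrable lborel (\<lambda>y. \<rho> j (y - x) *\<^sub>R (g y - g x))" for x
    proof -
      have i: "integrable lborel (\<lambda>y. \<rho> j (y - x) *\<^sub>R g x)"
        using kernel_integrable[OF kernel_diff_shift[OF \<rho>(1)]] by simp
      have 1: "(LINT y|lborel. \<rho> j (y - x)) = 1"
        using integral_shift[of "\<rho> j" "- x"] kernel_measurable[OF \<rho>(1)] \<rho>(4) by simp
      show "integrable lborel (\<lambda>y. \<rho> j (y - x) *\<^sub>R (g y - g x))"
        using Bochner_Integration.integrable_diff[OF corr_integrable(1)[OF \<rho>(1) g(3), of j x] i] by (simp add: scaleR_diff_right)
      have "(LINT y|lborel. \<rho> j (y - x) *\<^sub>R (g y - g x)) = corr (\<rho> j) g x - (LINT y|lborel. \<rho> j (y - x) *\<^sub>R g x)"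
        unfolding corr_def scaleR_diff_right by (rule Bochner_Integration.integral_diff[OF corr_integrable(1)[OF \<rho>(1) g(3)] i])
      also have "(LINT y|lborel. \<rho> j (y - x) *\<^sub>R g x) = g x"
        using 1 kernel_integrable[OF kernel_diff_shift[OF \<rho>(1)], of j x] by simp
      finally show "corr (\<rho> j) g x - g x = (LINT y|lborel. \<rho> j (y - x) *\<^sub>R (g y - g x))" by simp
    qed
    have small: "cmod (corr (\<rho> j) g x - g x) \<le> \<delta>" and zero: "R + 1 < norm x \<Longrightarrow> corr (\<rho> j) g x - g x = 0" for x
    proof -
      have near: "norm (y - x) \<le> 1 / real (Suc j)" if "\<rho> j (y - x) \<noteq> 0" for y
        using \<rho>(3)[of j "y - x"] that by force
      have z: "g y - g x = 0" if "R + 1 < norm x" "\<rho> j (y - x) \<noteq> 0" for y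
      proof -
        have "norm x \<le> norm y + norm (y - x)" using norm_triangle_ineq4[of y "y - x"] by simp
        then have "R < norm y" using that near[OF that(2)] rj by linarith
        then show ?thesis using g(2)[of x] g(2)[of y] that by simp
      qed
      show zero: "corr (\<rho> j) g x - g x = 0" if "R + 1 < norm x"
      proof -
        have "(\<lambda>y. \<rho> j (y - x) *\<^sub>R (g y - g x)) = (\<lambda>y. 0)"
        proof
          show "\<rho> j (y - x) *\<^sub>R (g y - g x) = 0" for y using z[OF that, of y] by (cases "\<rho> j (y - x) = 0") auto
        qed
        then show ?thesis unfolding diff by simp
      qed
      show "cmod (corr (\<rho> j) g x - g x) \<le> \<delta>"
      proof (cases "norm x \<le> R + 1")
        case True
        have "cmod (LINT y|lborel. \<rho> j (y - x) *\<^sub>R (g y - g x)) \<le> (LINT y|lborel. norm (\<rho> j (y - x) *\<^sub>R (g y - g x)))"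
          by (rule integral_norm_bound)
        also have "\<dots> \<le> (LINT y|lborel. \<rho> j (y - x) * \<delta>)"
        proof (rule integral_mono)
          show "integrable lborel (\<lambda>y. norm (\<rho> j (y - x) *\<^sub>R (g y - g x)))" by (rule integrable_norm[OF int])
          show "integrable lborel (\<lambda>y. \<rho> j (y - x) * \<delta>)" using kernel_integrable[OF kernel_diff_shift[OF \<rho>(1)]] by simp
          fix y
          show "norm (\<rho> j (y - x) *\<^sub>R (g y - g x)) \<le> \<rho> j (y - x) * \<delta>"
          proof (cases "\<rho> j (y - x) = 0")
            case False
            have "norm y \<le> norm x + norm (y - x)" using norm_triangle_ineq[of x "y - x"] by simp
            then have "norm y \<le> R + 2" "norm x \<le> R + 2" "norm (y - x) < d" using True near[OF False] rj by linarith+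
            then have "dist (g y) (g x) < \<delta>" by (intro d(2)) (auto simp: dist_norm)
            then show ?thesis using \<rho>(2)[of j "y - x"] by (simp add: dist_norm mult_left_mono)
          qed simp
        qed
        also have "\<dots> = \<delta>"
          using integral_shift[of "\<rho> j" "- x"] kernel_measurable[OF \<rho>(1)] \<rho>(4)
            kernel_integrable[OF kernel_diff_shift[OF \<rho>(1)], of j x] by simp
        finally show ?thesis unfolding diff .
      qed (use zero \<delta> in simp)
    qed
    have L: "corr (\<rho> j) g \<in> L2" by (rule corr_L2[OF \<rho>(1) g(3)])
    have "L2_norm (\<lambda>x. corr (\<rho> j) g x - g x) \<le> sqrt (\<delta>\<^sup>2 * V)"
      unfolding V_def
      by (rule L2_bounded_support(2)[OF _ small zero]) (use L2_measurable[OF L2_diff[OF L g(3)]] in auto)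
    also have "\<dots> < e"
    proof (rule real_less_lsqrt)
      have "0 \<le> V * V" by simp
      then have "V < (1 + V)\<^sup>2" using V unfolding power2_eq_square distrib_left distrib_right by linarith
      then have "\<delta>\<^sup>2 * V < \<delta>\<^sup>2 * (1 + V)\<^sup>2" using \<delta> by (intro mult_strict_left_mono) auto
      also have "\<dots> = e\<^sup>2" using V by (simp add: \<delta>_def power_divide)
      finally show "\<delta>\<^sup>2 * V < e\<^sup>2" .
    qed (use e V in auto)
    finally have "norm (conv (\<rho> j) (cls g) - cls g) < e"
      using L g(3) \<rho>(1) by (simp add: conv_cls cls_diff[symmetric] norm_cls L2_diff)
    then show "norm (norm (conv (\<rho> j) (cls g) - cls g) - 0) < e" by simp
  qed
qed

text \<open>Total mass one makes each \<open>conv\<close> a contraction, so convergence on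
  continuous functions of compact support carries over to all of \<open>L2\<close>. Evenness of the
  kernels makes these operators symmetric.\<close>

lemma mollifiers:
  "\<exists>\<rho> :: nat \<Rightarrow> (real ^ 'n::finite) \<Rightarrow> real. (\<forall>j. test_function (\<rho> j)) \<and> (\<forall>j x. \<rho> j (- x) = \<rho> j x) \<and>
     (\<forall>j. (LINT x|lborel. \<bar>\<rho> j x\<bar>) = 1) \<and> (\<forall>x. (\<lambda>j. conv (\<rho> j) x) \<longlonglongrightarrow> x)"
proof -
  have "\<forall>j. \<exists>\<rho> :: (real ^ 'n) \<Rightarrow> real. test_function \<rho> \<and> (\<forall>x. 0 \<le> \<rho> x) \<and> (\<forall>x. \<rho> (- x) = \<rho> x) \<and>
      (\<forall>x. 1 / real (Suc j) < norm x \<longrightarrow> \<rho> x = 0) \<and> (LINT x|lborel. \<rho> x) = 1"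
  proof
    fix j
    have "0 < 1 / real (Suc j)" by simp
    from bump_exists[OF this] obtain \<rho> :: "(real ^ 'n) \<Rightarrow> real" where "test_function \<rho>" "\<And>x. 0 \<le> \<rho> x" "\<And>x. \<rho> (- x) = \<rho> x"
      "\<And>x. 1 / real (Suc j) < norm x \<Longrightarrow> \<rho> x = 0" "(LINT x|lborel. \<rho> x) = 1" by blast
    then show "\<exists>\<rho> :: (real ^ 'n) \<Rightarrow> real. test_function \<rho> \<and> (\<forall>x. 0 \<le> \<rho> x) \<and> (\<forall>x. \<rho> (- x) = \<rho> x) \<and>
      (\<forall>x. 1 / real (Suc j) < norm x \<longrightarrow> \<rho> x = 0) \<and> (LINT x|lborel. \<rho> x) = 1" by blast
  qed
  from choice[OF this] obtain \<rho> :: "nat \<Rightarrow> (real ^ 'n) \<Rightarrow> real" where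
    \<rho>: "\<And>j. test_function (\<rho> j)" "\<And>j x. 0 \<le> \<rho> j x" "\<And>j x. \<rho> j (- x) = \<rho> j x"
      "\<And>j x. 1 / real (Suc j) < norm x \<Longrightarrow> \<rho> j x = 0" "\<And>j. (LINT x|lborel. \<rho> j x) = 1" by blast
  note k = test_function_kernel[OF \<rho>(1)]
  have L1: "(LINT x|lborel. \<bar>\<rho> j x\<bar>) = 1" for j using \<rho>(2,5) by simp
  show ?thesis
  proof (rule exI[of _ \<rho>], intro conjI allI \<rho>(1,3) L1)
    fix x :: "'n l2"
    show "(\<lambda>j. conv (\<rho> j) x) \<longlonglongrightarrow> x"
    proof (rule LIM_zero_cancel, rule tendsto_norm_zero_cancel, rule LIMSEQ_I)
      fix e :: real assume e: "0 < e"
      obtain f where f: "x = cls f" "f \<in> L2" by (rule cls_cases)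
      obtain g R where g: "continuous_on UNIV g" "\<And>x. R < norm x \<Longrightarrow> g x = 0" "g \<in> L2" "L2_norm (\<lambda>x. f x - g x) < e / 3"
      proof -
        have "0 < e / 3" using e by simp
        from L2_dense[OF f(2) this] show thesis using that by blast
      qed
      have xg: "norm (x - cls g) < e / 3" using f g by (simp add: cls_diff[symmetric] norm_cls L2_diff)
      have "(\<lambda>j. conv (\<rho> j) (cls g)) \<longlonglongrightarrow> cls g"
        by (rule mollify_continuous[OF g(1,2,3) k \<rho>(2,4,5)])
      from LIMSEQ_D[OF this, of "e / 3"] e obtain j0 where
        j0: "\<And>j. j0 \<le> j \<Longrightarrow> norm (conv (\<rho> j) (cls g) - cls g) < e / 3" by auto
      show "\<exists>j0. \<forall>j\<ge>j0. norm (norm (conv (\<rho> j) x - x) - 0) < e"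
      proof (intro exI[of _ j0] allI impI)
        fix j assume "j0 \<le> j"
        have eq: "conv (\<rho> j) x - x = conv (\<rho> j) (x - cls g) + (conv (\<rho> j) (cls g) - cls g) + (cls g - x)"
          by (simp add: linear_diff[OF bounded_linear.linear[OF bounded_linear_conv[OF k]]])
        have "norm (conv (\<rho> j) (x - cls g)) \<le> norm (x - cls g)" using norm_conv_le[OF k, of j "x - cls g"] L1 by simp
        then have "norm (conv (\<rho> j) x - x) < e"
          unfolding eq using xg j0[OF \<open>j0 \<le> j\<close>] norm_minus_commute[of x "cls g"]
            norm_triangle_ineq[of "conv (\<rho> j) (x - cls g) + (conv (\<rho> j) (cls g) - cls g)" "cls g - x"]
            norm_triangle_ineq[of "conv (\<rho> j) (x - cls g)" "conv (\<rho> j) (cls g) - cls g"] by linarith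
        then show "norm (norm (conv (\<rho> j) x - x) - 0) < e" by simp
      qed
    qed
  qed
qed

section \<open>Convolution and weak derivatives\<close>

lemma kernel_integral_tendsto:
  fixes k :: "nat \<Rightarrow> (real ^ 'n::finite) \<Rightarrow> real"
  assumes k: "\<And>j. kernel (k j)" and h: "kernel h" and g: "kernel g"
    and lim: "(\<lambda>j. LINT x|lborel. \<bar>k j x - h x\<bar>) \<longlonglongrightarrow> 0"
  shows "(\<lambda>j. LINT x|lborel. k j x * g x) \<longlonglongrightarrow> (LINT x|lborel. h x * g x)"
proof -
  obtain B where B: "0 \<le> B" "\<And>x. \<bar>g x\<bar> \<le> B" using kernel_bounded[OF g] by blast
  have int: "integrable lborel (\<lambda>x. u x * g x)" if u: "kernel u" for u
  proof (rule Bochner_Integration.integrable_bound[OF integrable_mult_right[OF kernel_integrable[OF kernel_abs[OF u]], of B]])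
    show "AE x in lborel. norm (u x * g x) \<le> norm (B * \<bar>u x\<bar>)"
      using B by (auto simp: abs_mult mult.commute[of B] intro!: mult_left_mono)
    show "(\<lambda>x. u x * g x) \<in> borel_measurable lborel" using kernel_measurable[OF u] kernel_measurable[OF g] by simp
  qed
  show ?thesis
  proof (rule LIM_zero_cancel, rule tendsto_rabs_zero_cancel, rule tendsto_sandwich[of "\<lambda>_. 0"])
    show "(\<lambda>j. (LINT x|lborel. \<bar>k j x - h x\<bar>) * B) \<longlonglongrightarrow> 0" using tendsto_mult_left_zero[OF lim] .
    have "\<bar>(LINT x|lborel. k j x * g x) - (LINT x|lborel. h x * g x)\<bar> \<le> (LINT x|lborel. \<bar>k j x - h x\<bar>) * B" for j
    proof -
      have "(LINT x|lborel. k j x * g x) - (LINT x|lborel. h x * g x) = (LINT x|lborel. (k j x - h x) * g x)"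
        using Bochner_Integration.integral_diff[OF int[OF k[of j]] int[OF h]] by (simp add: left_diff_distrib)
      also have "\<bar>\<dots>\<bar> \<le> (LINT x|lborel. \<bar>(k j x - h x) * g x\<bar>)"
        using integral_norm_bound[of lborel "\<lambda>x. (k j x - h x) * g x"] by simp
      also have "\<dots> \<le> (LINT x|lborel. \<bar>k j x - h x\<bar> * B)"
      proof (rule integral_mono)
        show "integrable lborel (\<lambda>x. \<bar>(k j x - h x) * g x\<bar>)" using int[OF kernel_diff[OF k[of j] h]] by simp
        show "integrable lborel (\<lambda>x. \<bar>k j x - h x\<bar> * B)" using kernel_integrable[OF kernel_abs[OF kernel_diff[OF k[of j] h]]] by simp
        show "\<bar>(k j x - h x) * g x\<bar> \<le> \<bar>k j x - h x\<bar> * B" for x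
          unfolding abs_mult using B(2)[of x] by (intro mult_left_mono) auto
      qed
      finally show ?thesis by simp
    qed
    then show "\<forall>\<^sub>F j in sequentially. \<bar>(LINT x|lborel. k j x * g x) - (LINT x|lborel. h x * g x)\<bar> \<le> (LINT x|lborel. \<bar>k j x - h x\<bar>) * B"
      by simp
  qed auto
qed

text \<open>For difference quotients this is translation invariance of the integral;
  \<open>L1\<close> convergence of the quotients then gives the derivatives.\<close>

lemma integration_by_parts_test:
  assumes \<rho>: "test_function \<rho>" and \<phi>: "test_function \<phi>"
  shows "(LINT y|lborel. \<rho> (x - y) * partial_deriv i \<phi> y) = (LINT y|lborel. partial_deriv i \<rho> (x - y) * \<phi> y)"
proof -
  define h where "h j = 1 / real (Suc j)" for j
  have h: "h \<longlonglongrightarrow> 0" "\<And>j. h j \<noteq> 0" "\<And>j. \<bar>h j\<bar> \<le> 1"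
    using LIMSEQ_inverse_real_of_nat unfolding h_def[abs_def] by (auto simp: inverse_eq_divide)
  note k\<rho> = test_function_kernel[OF \<rho>] and k\<phi> = test_function_kernel[OF \<phi>]
  have refl: "kernel (\<lambda>y. k (x - y))" if "kernel k" for k
    using kernel_reflect[OF kernel_shift[OF that, of x]] by simp
  have quot: "kernel (\<lambda>x. (1 / h j) * (k (x + h j *\<^sub>R axis i 1) - k x))" if "kernel k" for k j
    by (intro kernel_mult kernel_diff kernel_shift that)
  have subst: "(LINT y|lborel. f (x - y)) = (LINT y|lborel. f y)" if "f \<in> borel_measurable borel" for f :: "_ \<Rightarrow> real"
    using integral_reflect[of "\<lambda>y. f (y + x)"] integral_shift[OF that, of x] that by simp
  define a where "a j = (LINT y|lborel. (1 / h j) * (\<phi> (y + h j *\<^sub>R axis i 1) - \<phi> y) * \<rho> (x - y))" for j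
  have 1: "a \<longlonglongrightarrow> (LINT y|lborel. partial_deriv i \<phi> y * \<rho> (x - y))"
    unfolding a_def
    by (rule kernel_integral_tendsto[OF quot[OF k\<phi>] test_function_kernel[OF test_function_partial_deriv[OF \<phi>]] refl[OF k\<rho>]
          difference_quotient_L1[OF \<phi> h]])
  have 2: "(\<lambda>j. LINT z|lborel. (1 / h j) * (\<rho> (z + h j *\<^sub>R axis i 1) - \<rho> z) * \<phi> (x - z)) \<longlonglongrightarrow> (LINT z|lborel. partial_deriv i \<rho> z * \<phi> (x - z))"
    by (rule kernel_integral_tendsto[OF quot[OF k\<rho>] test_function_kernel[OF test_function_partial_deriv[OF \<rho>]] refl[OF k\<phi>]
          difference_quotient_L1[OF \<rho> h]])
  have eq: "a j = (LINT z|lborel. (1 / h j) * (\<rho> (z + h j *\<^sub>R axis i 1) - \<rho> z) * \<phi> (x - z))" for j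
  proof -
    let ?e = "h j *\<^sub>R axis i 1 :: real ^ _"
    have m [measurable]: "\<rho> \<in> borel_measurable borel" "\<phi> \<in> borel_measurable borel"
      using kernel_measurable k\<rho> k\<phi> by auto
    have int: "integrable lborel (\<lambda>z. u z * v z)" if u: "kernel u" and v: "kernel v" for u v :: "_ \<Rightarrow> real"
    proof -
      obtain B where B: "\<And>x. \<bar>v x\<bar> \<le> B" using kernel_bounded[OF v] by blast
      show ?thesis
      proof (rule Bochner_Integration.integrable_bound[OF integrable_mult_right[OF kernel_integrable[OF kernel_abs[OF u]], of B]])
        show "AE x in lborel. norm (u x * v x) \<le> norm (B * \<bar>u x\<bar>)"
        proof (rule AE_I2)
          fix x
          have "\<bar>u x\<bar> * \<bar>v x\<bar> \<le> \<bar>u x\<bar> * B" using B[of x] by (intro mult_left_mono) auto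
          then show "norm (u x * v x) \<le> norm (B * \<bar>u x\<bar>)" using abs_ge_self[of "B * \<bar>u x\<bar>"] by (simp add: abs_mult mult.commute)
        qed
        show "(\<lambda>x. u x * v x) \<in> borel_measurable lborel" using kernel_measurable[OF u] kernel_measurable[OF v] by simp
      qed
    qed
    have "a j = (LINT z|lborel. (1 / h j) * (\<phi> (x - z + ?e) - \<phi> (x - z)) * \<rho> z)"
      unfolding a_def using subst[of "\<lambda>y. (1 / h j) * (\<phi> (x - y + ?e) - \<phi> (x - y)) * \<rho> y"] by simp
    also have "\<dots> = (1 / h j) * ((LINT z|lborel. \<rho> z * \<phi> (x + ?e - z)) - (LINT z|lborel. \<rho> z * \<phi> (x - z)))"
    proof -
      have "kernel (\<lambda>z. \<phi> (x + ?e - z))" using kernel_reflect[OF kernel_shift[OF k\<phi>, of "x + ?e"]] by (simp add: algebra_simps)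
      from int[OF k\<rho> this] int[OF k\<rho> refl[OF k\<phi>]] show ?thesis
        by (subst Bochner_Integration.integral_diff[symmetric]) (simp_all add: algebra_simps flip: integral_mult_right_zero)
    qed
    also have "(LINT z|lborel. \<rho> z * \<phi> (x + ?e - z)) = (LINT z|lborel. \<rho> (z + ?e) * \<phi> (x - z))"
      using integral_shift[of "\<lambda>z. \<rho> z * \<phi> (x + ?e - z)" ?e] by simp
    also have "(1 / h j) * ((LINT z|lborel. \<rho> (z + ?e) * \<phi> (x - z)) - (LINT z|lborel. \<rho> z * \<phi> (x - z)))
        = (LINT z|lborel. (1 / h j) * (\<rho> (z + ?e) - \<rho> z) * \<phi> (x - z))"
      using int[OF kernel_shift[OF k\<rho>, of ?e] refl[OF k\<phi>]] int[OF k\<rho> refl[OF k\<phi>]]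
      by (subst Bochner_Integration.integral_diff[symmetric]) (simp_all add: algebra_simps flip: integral_mult_right_zero)
    finally show ?thesis .
  qed
  have "a \<longlonglongrightarrow> (LINT z|lborel. partial_deriv i \<rho> z * \<phi> (x - z))"
    using 2 unfolding eq[symmetric] .
  from LIMSEQ_unique[OF 1 this]
  have "(LINT y|lborel. partial_deriv i \<phi> y * \<rho> (x - y)) = (LINT z|lborel. partial_deriv i \<rho> z * \<phi> (x - z))" .
  also have "\<dots> = (LINT y|lborel. partial_deriv i \<rho> (x - y) * \<phi> y)"
  proof -
    note [measurable] = kernel_measurable[OF test_function_kernel[OF test_function_partial_deriv[OF \<rho>]]] kernel_measurable[OF k\<phi>]
    show ?thesis using subst[of "\<lambda>z. partial_deriv i \<rho> z * \<phi> (x - z)"] by simp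
  qed
  finally show ?thesis by (simp add: mult.commute)
qed

lemma kernel_L2: "kernel k \<Longrightarrow> (\<lambda>x. complex_of_real (k x)) \<in> L2"
proof -
  assume k: "kernel k"
  obtain B where B: "0 \<le> B" "\<And>x. \<bar>k x\<bar> \<le> B" using kernel_bounded[OF k] by blast
  obtain R where R: "\<And>x. R < norm x \<Longrightarrow> k x = 0" using k by (auto simp: kernel_def)
  show ?thesis
    by (rule L2_bounded_support(1)[of _ B R]) (use kernel_measurable[OF k] B R in auto)
qed

text \<open>The minus sign comes from differentiating \<rho>(y - x) with respect to x. The
  convolution is moved to the test function by the adjoint, where integration by parts is
  available.\<close>

lemma has_weak_partial_corr:
  assumes \<rho>: "test_function \<rho>" and f: "f \<in> L2"
  shows "has_weak_partial (corr \<rho> f) i (\<lambda>x. - corr (partial_deriv i \<rho>) f x)"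
  unfolding has_weak_partial_def
proof (intro allI impI)
  fix \<phi> :: "real ^ 'a \<Rightarrow> real" assume \<phi>: "test_function \<phi>"
  have test: "(LINT x|lborel. \<psi> x *\<^sub>R corr k f x) = L2_inner f (corr (\<lambda>x. k (- x)) (\<lambda>x. complex_of_real (\<psi> x)))"
    if "kernel k" "kernel \<psi>" for k \<psi>
    unfolding corr_adjoint[OF that(1) f kernel_L2[OF that(2)], symmetric]
    by (simp add: L2_inner_def scaleR_conv_of_real mult.commute)
  have "corr (\<lambda>x. \<rho> (- x)) (\<lambda>x. complex_of_real (partial_deriv i \<phi> x)) = corr (\<lambda>x. partial_deriv i \<rho> (- x)) (\<lambda>x. complex_of_real (\<phi> x))"
  proof
    fix x
    have "corr (\<lambda>x. \<rho> (- x)) (\<lambda>x. complex_of_real (partial_deriv i \<phi> x)) x = complex_of_real (LINT y|lborel. \<rho> (x - y) * partial_deriv i \<phi> y)"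
      by (simp add: corr_def scaleR_conv_of_real flip: of_real_mult)
    also have "\<dots> = corr (\<lambda>x. partial_deriv i \<rho> (- x)) (\<lambda>x. complex_of_real (\<phi> x)) x"
      unfolding integration_by_parts_test[OF \<rho> \<phi>] by (simp add: corr_def scaleR_conv_of_real flip: of_real_mult)
    finally show "corr (\<lambda>x. \<rho> (- x)) (\<lambda>x. complex_of_real (partial_deriv i \<phi> x)) x = corr (\<lambda>x. partial_deriv i \<rho> (- x)) (\<lambda>x. complex_of_real (\<phi> x)) x" .
  qed
  then have "(LINT x|lborel. partial_deriv i \<phi> x *\<^sub>R corr \<rho> f x) = (LINT x|lborel. \<phi> x *\<^sub>R corr (partial_deriv i \<rho>) f x)"
    using \<rho> \<phi> by (simp add: test test_function_kernel test_function_partial_deriv)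
  then show "(LINT x|lborel. partial_deriv i \<phi> x *\<^sub>R corr \<rho> f x) = - (LINT x|lborel. \<phi> x *\<^sub>R - corr (partial_deriv i \<rho>) f x)"
    by simp
qed

lemma corr_H1: "test_function \<rho> \<Longrightarrow> f \<in> L2 \<Longrightarrow> corr \<rho> f \<in> H1"
  using has_weak_partial_corr corr_L2[OF test_function_kernel] L2_uminus[OF corr_L2[OF test_function_kernel[OF test_function_partial_deriv]]]
  unfolding H1_def by blast

text \<open>For fixed x the function y -> \<rho>(y - x) is itself a test function, so the definition
  of the weak derivative applies pointwise in x.\<close>

lemma corr_partial_deriv:
  assumes \<rho>: "test_function \<rho>" and g: "has_weak_partial f i g"
  shows "corr (partial_deriv i \<rho>) f x = - corr \<rho> g x"
proof -
  have "(LINT y|lborel. partial_deriv i (\<lambda>y. \<rho> (y - x)) y *\<^sub>R f y) = - (LINT y|lborel. \<rho> (y - x) *\<^sub>R g y)"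
    using g test_function_shift[OF \<rho>, of x] unfolding has_weak_partial_def by blast
  then show ?thesis unfolding corr_def by (simp only: partial_deriv_shift[OF \<rho>])
qed

text \<open>Mollifying a weak derivative gives, up to sign, the convolution of f with the derivative
  of the mollifier, which depends on f alone; now let the mollifier shrink.\<close>

lemma has_weak_partial_unique:
  fixes f :: "(real ^ 'n::finite) \<Rightarrow> complex"
  assumes "has_weak_partial f i g" "has_weak_partial f i h" "g \<in> L2" "h \<in> L2"
  shows "cls g = cls h"
proof -
  obtain \<rho> :: "nat \<Rightarrow> (real ^ 'n) \<Rightarrow> real" where "(\<forall>j. test_function (\<rho> j)) \<and> (\<forall>j x. \<rho> j (- x) = \<rho> j x) \<and>
     (\<forall>j. (LINT x|lborel. \<bar>\<rho> j x\<bar>) = 1) \<and> (\<forall>x. (\<lambda>j. conv (\<rho> j) x) \<longlonglongrightarrow> x)"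
    using mollifiers ..
  then have \<rho>: "test_function (\<rho> j)" "(\<lambda>j. conv (\<rho> j) x) \<longlonglongrightarrow> x" for j x by simp_all
  have "corr (\<rho> j) g = corr (\<rho> j) h" for j
    using corr_partial_deriv[OF \<rho>(1) assms(1)] corr_partial_deriv[OF \<rho>(1) assms(2)] by (simp add: fun_eq_iff)
  then have "conv (\<rho> j) (cls g) = conv (\<rho> j) (cls h)" for j
    using assms by (simp add: conv_cls test_function_kernel[OF \<rho>(1)])
  then show ?thesis using LIMSEQ_unique[OF \<rho>(2)[of "cls g"]] \<rho>(2)[of "cls h"] by simp
qed

lemma H1_L2: "f \<in> H1 \<Longrightarrow> f \<in> L2"
  by (simp add: H1_def)

lemma weak_partial:
  assumes "f \<in> H1"
  shows "weak_partial i f \<in> L2" "has_weak_partial f i (weak_partial i f)"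
proof -
  have "\<exists>g. g \<in> L2 \<and> has_weak_partial f i g" using assms by (auto simp: H1_def)
  from someI_ex[OF this] show "weak_partial i f \<in> L2" "has_weak_partial f i (weak_partial i f)"
    unfolding weak_partial_def by auto
qed

lemma conv_weak_partial:
  assumes \<rho>: "test_function \<rho>" and f: "f \<in> H1"
  shows "conv (partial_deriv i \<rho>) (cls f) = - conv \<rho> (cls (weak_partial i f))"
proof -
  note k = test_function_kernel[OF \<rho>] test_function_kernel[OF test_function_partial_deriv[OF \<rho>]]
  have "corr (partial_deriv i \<rho>) f = (\<lambda>x. - 1 *\<^sub>R corr \<rho> (weak_partial i f) x)"
    using corr_partial_deriv[OF \<rho> weak_partial(2)[OF f]] by (simp add: fun_eq_iff)
  then have "cls (corr (partial_deriv i \<rho>) f) = - 1 *\<^sub>R cls (corr \<rho> (weak_partial i f))"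
    using cls_scaleR[OF corr_L2[OF k(1) weak_partial(1)[OF f]], of "- 1" i] by simp
  then show ?thesis using conv_cls[OF k(2) H1_L2[OF f]] conv_cls[OF k(1) weak_partial(1)[OF f]] by simp
qed

lemma weak_partial_corr:
  assumes \<rho>: "test_function \<rho>" and f: "f \<in> L2"
  shows "cls (weak_partial i (corr \<rho> f)) = - conv (partial_deriv i \<rho>) (cls f)"
proof -
  note k = test_function_kernel[OF test_function_partial_deriv[OF \<rho>]]
  note L = corr_L2[OF k f]
  have "cls (weak_partial i (corr \<rho> f)) = cls (\<lambda>x. - corr (partial_deriv i \<rho>) f x)"
    by (rule has_weak_partial_unique[OF weak_partial(2)[OF corr_H1[OF \<rho> f]] has_weak_partial_corr[OF \<rho> f]
        weak_partial(1)[OF corr_H1[OF \<rho> f]] L2_uminus[OF L]])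
  also have "\<dots> = - 1 *\<^sub>R cls (corr (partial_deriv i \<rho>) f)" using cls_scaleR[OF L, of "- 1"] by simp
  finally show ?thesis using conv_cls[OF k f] by simp
qed

section \<open>Energy solutions as curves in \<open>L\<^sup>2\<close>\<close>

text \<open>A continuous weak derivative is a strong one: apply the mean value theorem to the scalar
  product with the remainder z itself and cancel one factor |z|. Continuity of W and k extends the
  conclusion from t > 0 to the one-sided derivative at 0.\<close>

lemma weak_derivative_imp_has_vector_derivative:
  fixes W k :: "real \<Rightarrow> 'a::real_inner"
  assumes W: "continuous_on {0..} W" and k: "continuous_on {0..} k"
    and d: "\<And>z t. 0 < t \<Longrightarrow> ((\<lambda>s. W s \<bullet> z) has_real_derivative k t \<bullet> z) (at t)" and t: "0 \<le> t"
  shows "(W has_vector_derivative k t) (at t within {0..})"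
  unfolding has_vector_derivative_def has_derivative_within_alt
proof (intro conjI allI impI)
  show "bounded_linear (\<lambda>x. x *\<^sub>R k t)" by (rule bounded_linear_scaleR_left)
  fix e :: real assume e: "0 < e"
  from k t e obtain \<delta> where \<delta>: "0 < \<delta>" "\<And>r. r \<in> {0..} \<Longrightarrow> dist r t < \<delta> \<Longrightarrow> dist (k r) (k t) < e"
    unfolding continuous_on_iff by (meson atLeast_iff)
  have main: "norm (W y - W x - (y - x) *\<^sub>R k t) \<le> e * (y - x)"
    if xy: "0 \<le> x" "x < y" "dist x t < \<delta>" "dist y t < \<delta>" for x y
  proof -
    define z where "z = W y - W x - (y - x) *\<^sub>R k t"
    define \<phi> where "\<phi> r = W r \<bullet> z - r * (k t \<bullet> z)" for r
    have c: "continuous_on {x..y} \<phi>"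
      unfolding \<phi>_def[abs_def] using xy by (intro continuous_intros continuous_on_subset[OF W]) auto
    have "\<exists>\<xi>. x < \<xi> \<and> \<xi> < y \<and> \<phi> y - \<phi> x = (y - x) * (k \<xi> \<bullet> z - k t \<bullet> z)"
    proof -
      have D: "(\<phi> has_real_derivative k r \<bullet> z - k t \<bullet> z) (at r)" if "x < r" for r
        unfolding \<phi>_def[abs_def] using d[of r z] that xy(1) by (auto intro!: derivative_eq_intros)
      have "\<exists>\<xi>\<in>{x<..<y}. \<phi> y - \<phi> x = (\<lambda>v. (k \<xi> \<bullet> z - k t \<bullet> z) * v) (y - x)"
        by (rule mvt[OF xy(2) c]) (use D in \<open>auto simp: has_field_derivative_def\<close>)
      then show ?thesis by (auto simp: mult.commute)
    qed
    then obtain \<xi> where \<xi>: "x < \<xi>" "\<xi> < y" "\<phi> y - \<phi> x = (y - x) * (k \<xi> \<bullet> z - k t \<bullet> z)" by blast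
    have "\<phi> y - \<phi> x = z \<bullet> z"
      unfolding \<phi>_def by (simp add: z_def inner_diff_left algebra_simps)
    then have "norm z * norm z = (y - x) * ((k \<xi> - k t) \<bullet> z)"
      using \<xi>(3) by (simp add: inner_diff_left dot_square_norm power2_eq_square)
    also have "\<dots> \<le> (y - x) * (norm (k \<xi> - k t) * norm z)"
      using xy norm_cauchy_schwarz[of "k \<xi> - k t" z] by (intro mult_left_mono) auto
    also have "\<dots> \<le> (y - x) * (e * norm z)"
    proof (intro mult_left_mono mult_right_mono)
      have "dist \<xi> t < \<delta>" using xy \<xi> by (auto simp: dist_real_def)
      then show "norm (k \<xi> - k t) \<le> e" using \<delta>(2)[of \<xi>] \<xi> xy by (simp add: dist_norm)
    qed (use xy in auto)
    finally have "norm z * norm z \<le> (e * (y - x)) * norm z" by (simp add: mult_ac)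
    then have "norm z \<le> e * (y - x)" using e xy by (cases "norm z = 0") auto
    then show ?thesis by (simp add: z_def)
  qed
  show "\<exists>d>0. \<forall>y\<in>{0..}. norm (y - t) < d \<longrightarrow> norm (W y - W t - (y - t) *\<^sub>R k t) \<le> e * norm (y - t)"
  proof (intro exI[of _ \<delta>] conjI ballI impI \<delta>(1))
    fix y assume y: "y \<in> {0..}" "norm (y - t) < \<delta>"
    consider "y = t" | "t < y" | "y < t" by linarith
    then show "norm (W y - W t - (y - t) *\<^sub>R k t) \<le> e * norm (y - t)"
    proof cases
      case 2
      then show ?thesis using main[of t y] y t \<delta>(1) by (simp add: dist_norm)
    next
      case 3
      have "norm (W t - W y - (t - y) *\<^sub>R k t) \<le> e * (t - y)"
        using main[of y t] 3 y t \<delta>(1) by (simp add: dist_norm)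
      moreover have "W t - W y - (t - y) *\<^sub>R k t = - (W y - W t - (y - t) *\<^sub>R k t)" by (simp add: algebra_simps)
      ultimately show ?thesis using 3 by (simp only: norm_minus_cancel) simp
    qed simp
  qed
qed

lemma L2_continuous_cls: "continuous_on {0..} (\<lambda>t. cls (f t))" if f: "L2_continuous f"
  unfolding continuous_on_def
proof
  fix t :: real assume t: "t \<in> {0..}"
  have L: "f s \<in> L2" if "0 \<le> s" for s using f that by (simp add: L2_continuous_def)
  have "((\<lambda>s. L2_norm (\<lambda>x. f s x - f t x)) \<longlongrightarrow> 0) (at t within {0..})"
    using f t by (simp add: L2_continuous_def)
  moreover have "eventually (\<lambda>s. L2_norm (\<lambda>x. f s x - f t x) = norm (cls (f s) - cls (f t))) (at t within {0..})"
    unfolding eventually_at_filter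
    using L t by (intro always_eventually) (simp add: cls_diff[symmetric] norm_cls L2_diff)
  ultimately have "((\<lambda>s. norm (cls (f s) - cls (f t))) \<longlongrightarrow> 0) (at t within {0..})"
    by (rule Lim_transform_eventually)
  then show "((\<lambda>t. cls (f t)) \<longlongrightarrow> cls (f t)) (at t within {0..})"
    by (rule LIM_zero_cancel[OF tendsto_norm_zero_cancel])
qed

lemma has_time_deriv_cls:
  assumes u: "\<And>s. 0 \<le> s \<Longrightarrow> u s \<in> L2" and w: "w \<in> L2" and d: "has_time_deriv u w t" and t: "0 \<le> t"
  shows "((\<lambda>t. cls (u t)) has_vector_derivative cls w) (at t within {0..})"
  unfolding has_vector_derivative_def has_derivative_iff_norm
proof (intro conjI bounded_linear_scaleR_left)
  have "((\<lambda>s. L2_norm (\<lambda>x. (u s x - u t x) /\<^sub>R (s - t) - w x)) \<longlongrightarrow> 0) (at t within {0..})"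
    using d by (simp add: has_time_deriv_def)
  moreover have "L2_norm (\<lambda>x. (u s x - u t x) /\<^sub>R (s - t) - w x) = norm (cls (u s) - cls (u t) - (s - t) *\<^sub>R cls w) / norm (s - t)"
    if s: "0 \<le> s" "s \<noteq> t" for s
  proof -
    have L: "(\<lambda>x. u s x - u t x) \<in> L2" by (intro L2_diff u s t)
    have "L2_norm (\<lambda>x. (u s x - u t x) /\<^sub>R (s - t) - w x) = norm ((cls (u s) - cls (u t)) /\<^sub>R (s - t) - cls w)"
      using norm_cls[OF L2_diff[OF L2_scaleR[OF L, of "inverse (s - t)"] w]] cls_diff[OF L2_scaleR[OF L, of "inverse (s - t)"] w]
        cls_scaleR[OF L, of "inverse (s - t)"] cls_diff[OF u[OF s(1)] u[OF t]] by simp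
    also have "(cls (u s) - cls (u t)) /\<^sub>R (s - t) - cls w = (cls (u s) - cls (u t) - (s - t) *\<^sub>R cls w) /\<^sub>R (s - t)"
      using s by (simp add: scaleR_diff_right)
    also have "norm \<dots> = norm (cls (u s) - cls (u t) - (s - t) *\<^sub>R cls w) / norm (s - t)"
      by (simp add: divide_inverse mult.commute)
    finally show ?thesis .
  qed
  then have "eventually (\<lambda>s. L2_norm (\<lambda>x. (u s x - u t x) /\<^sub>R (s - t) - w x) = norm (cls (u s) - cls (u t) - (s - t) *\<^sub>R cls w) / norm (s - t)) (at t within {0..})"
    unfolding eventually_at_filter by (intro always_eventually) simp
  ultimately show "((\<lambda>s. norm (cls (u s) - cls (u t) - (s - t) *\<^sub>R cls w) / norm (s - t)) \<longlongrightarrow> 0) (at t within {0..})"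
    by (rule Lim_transform_eventually)
qed

lemma partial_deriv_even:
  assumes t: "test_function \<rho>" and e: "\<And>x. \<rho> (- x) = \<rho> x"
  shows "partial_deriv i \<rho> (- x) = - partial_deriv i \<rho> x"
proof -
  have "((\<lambda>s. \<rho> (x + s *\<^sub>R axis i 1)) has_real_derivative partial_deriv i \<rho> x) (at (- 0))"
    using test_function_has_partial_deriv[OF t, of x i 0] by simp
  from DERIV_chain2[OF this DERIV_minus[OF DERIV_ident]]
  have "((\<lambda>s. \<rho> (x + (- s) *\<^sub>R axis i 1)) has_real_derivative - partial_deriv i \<rho> x) (at 0)" by simp
  moreover have "\<rho> (x + (- s) *\<^sub>R axis i 1) = \<rho> (- x + s *\<^sub>R axis i 1)" for s
    using e[of "- x + s *\<^sub>R axis i 1"] by (simp add: algebra_simps)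
  ultimately have "((\<lambda>s. \<rho> (- x + s *\<^sub>R axis i 1)) has_real_derivative - partial_deriv i \<rho> x) (at 0)" by simp
  then show ?thesis unfolding partial_deriv_def[of i \<rho> "- x"] by (rule DERIV_imp_deriv)
qed

locale wave_solution =
  fixes b :: "real \<Rightarrow> real" and u0 u1 :: "(real ^ 'n::finite) \<Rightarrow> complex" and u :: "real \<Rightarrow> (real ^ 'n) \<Rightarrow> complex"
  assumes sol: "energy_solution b u0 u1 u" and u0: "u0 \<in> H1" and b: "continuous_on {0..} b"
begin

definition "v t = cls (u t)"
definition "w t = cls (time_deriv u t)"
definition "p i t = cls (weak_partial i (u t))"

lemma u_H1: "0 \<le> t \<Longrightarrow> u t \<in> H1"
  using sol by (simp add: energy_solution_def H1_continuous_def)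

lemma time_deriv: "0 \<le> t \<Longrightarrow> time_deriv u t \<in> L2" "0 \<le> t \<Longrightarrow> has_time_deriv u (time_deriv u t) t"
proof -
  assume "0 \<le> t"
  then have "\<exists>w. w \<in> L2 \<and> has_time_deriv u w t" using sol by (auto simp: energy_solution_def L2_C1_def)
  from someI_ex[OF this] show "time_deriv u t \<in> L2" "has_time_deriv u (time_deriv u t) t"
    unfolding time_deriv_def by auto
qed

lemma continuous_v: "continuous_on {0..} v" and continuous_w: "continuous_on {0..} w"
proof -
  have "L2_continuous u" "L2_continuous (time_deriv u)"
    using sol by (simp_all add: energy_solution_def H1_continuous_def L2_C1_def)
  from this[THEN L2_continuous_cls] show "continuous_on {0..} v" "continuous_on {0..} w"
    by (simp_all add: v_def[abs_def] w_def[abs_def])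
qed

lemma deriv_v: "0 \<le> t \<Longrightarrow> (v has_vector_derivative w t) (at t within {0..})"
  unfolding v_def[abs_def] w_def using has_time_deriv_cls[of u] time_deriv H1_L2[OF u_H1] by blast

text \<open>The equation is available against \<open>H1\<close> only, so \<open>w\<close> has to be
  mollified before it can be differentiated in \<open>L2\<close>.\<close>

lemma deriv_w:
  assumes t: "0 < t" and g: "g \<in> H1"
  shows "((\<lambda>s. w s \<bullet> cls g) has_real_derivative - (\<Sum>i\<in>UNIV. p i t \<bullet> cls (weak_partial i g)) - b t * (w t \<bullet> cls g)) (at t)"
proof -
  have D: "((\<lambda>s. L2_inner (time_deriv u s) g) has_vector_derivative
          (- (\<Sum>i\<in>UNIV. L2_inner (weak_partial i (u t)) (weak_partial i g)) - b t *\<^sub>R L2_inner (time_deriv u t) g)) (at t)"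
    using sol t g by (simp add: energy_solution_def)
  have Re: "Re (L2_inner (time_deriv u s) g) = w s \<bullet> cls g" if "s \<in> {0<..}" for s
    using that time_deriv(1)[of s] H1_L2[OF g] by (simp add: w_def inner_cls)
  from bounded_linear.has_vector_derivative[OF bounded_linear_Re D]
  have "((\<lambda>s. Re (L2_inner (time_deriv u s) g)) has_vector_derivative
     - (\<Sum>i\<in>UNIV. p i t \<bullet> cls (weak_partial i g)) - b t * (w t \<bullet> cls g)) (at t)"
    using t g H1_L2[OF g] time_deriv(1)[of t] weak_partial(1)[OF u_H1[of t]] weak_partial(1)[OF g]
    by (simp add: p_def w_def inner_cls)
  then have "((\<lambda>s. w s \<bullet> cls g) has_vector_derivative
     - (\<Sum>i\<in>UNIV. p i t \<bullet> cls (weak_partial i g)) - b t * (w t \<bullet> cls g)) (at t)"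
    by (rule has_vector_derivative_transform_within_open[where S = "{0<..}"]) (use t Re in auto)
  then show ?thesis by (simp add: has_real_derivative_iff_has_vector_derivative)
qed

lemma energy_eq: "0 \<le> t \<Longrightarrow> energy u t = 1 / 2 * ((\<Sum>i\<in>UNIV. (norm (p i t))\<^sup>2) + (norm (w t))\<^sup>2)"
  using weak_partial(1)[OF u_H1[of t]] time_deriv(1)[of t] by (simp add: energy_def p_def w_def norm_cls)

lemma norm_v0: "norm (v 0) = L2_norm u0"
proof -
  have "AE x in lborel. u 0 x = u0 x" using sol by (simp add: energy_solution_def)
  then have "cls (u 0) = cls u0" using cls_eq_iff[OF H1_L2[OF u_H1[of 0]] H1_L2[OF u0]] by simp
  then show ?thesis by (simp add: v_def norm_cls H1_L2[OF u0])
qed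

end

section \<open>The mollified equation and its discretization\<close>

locale mollified_wave = wave_solution b u0 u1 u
  for b u0 u1 and u :: "real \<Rightarrow> (real ^ 'n::finite) \<Rightarrow> complex" +
  fixes \<rho> :: "(real ^ 'n) \<Rightarrow> real"
  assumes \<rho>: "test_function \<rho>" and even: "\<And>x. \<rho> (- x) = \<rho> x"
begin

definition "U t = conv \<rho> (v t)"
definition "W t = conv \<rho> (w t)"
definition "laplacian_\<rho> x = (\<Sum>i\<in>UNIV. partial_deriv i (partial_deriv i \<rho>) x)"

lemma kernels: "kernel \<rho>" "kernel (partial_deriv i \<rho>)" "kernel (partial_deriv i (partial_deriv i \<rho>))" "kernel laplacian_\<rho>"
  unfolding laplacian_\<rho>_def[abs_def]
  by (intro kernel_sum test_function_kernel test_function_partial_deriv \<rho>)+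

lemma conv_continuous_on: "continuous_on S f \<Longrightarrow> kernel k \<Longrightarrow> continuous_on S (\<lambda>t. conv k (f t))"
  by (rule bounded_linear.continuous_on[OF bounded_linear_conv])

lemma deriv_U: "0 \<le> t \<Longrightarrow> (U has_vector_derivative W t) (at t within {0..})"
  unfolding U_def[abs_def] W_def
  by (rule bounded_linear.has_vector_derivative[OF bounded_linear_conv[OF kernels(1)] deriv_v])

lemma continuous_U: "continuous_on {0..} U" and continuous_W: "continuous_on {0..} W"
  unfolding U_def[abs_def] W_def[abs_def]
  by (intro conv_continuous_on continuous_v continuous_w kernels)+

text \<open>For any g in \<open>L2\<close> the function \<open>corr \<rho> g\<close> is an
  admissible test function. By symmetry of the mollifier both derivatives of the Laplacian fall on
  \<rho>, so the right-hand side is continuous in \<open>L2\<close> and the weak derivative in t is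
  a strong one.\<close>

lemma deriv_W: "(W has_vector_derivative conv laplacian_\<rho> (v t) - b t *\<^sub>R W t) (at t within {0..})" if "0 \<le> t"
proof (rule weak_derivative_imp_has_vector_derivative[where k = "\<lambda>t. conv laplacian_\<rho> (v t) - b t *\<^sub>R W t", OF continuous_W _ _ that])
  show "continuous_on {0..} (\<lambda>t. conv laplacian_\<rho> (v t) - b t *\<^sub>R W t)"
    by (intro continuous_intros conv_continuous_on continuous_v kernels b continuous_W)
  fix z :: "'n l2" and t :: real assume t: "0 < t"
  obtain g where g: "z = cls g" "g \<in> L2" by (rule cls_cases)
  have adj: "conv \<rho> x \<bullet> z = x \<bullet> cls (corr \<rho> g)" for x
    using conv_adjoint[OF kernels(1), of x z] g by (simp add: even conv_cls kernels)
  have "p i t \<bullet> cls (weak_partial i (corr \<rho> g)) = - (conv (partial_deriv i (partial_deriv i \<rho>)) (v t) \<bullet> z)" for i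
  proof -
    have eq: "conv (partial_deriv i (partial_deriv i \<rho>)) (v t) = - conv (partial_deriv i \<rho>) (p i t)"
      unfolding v_def p_def using t by (intro conv_weak_partial test_function_partial_deriv \<rho> u_H1) simp
    have "conv (partial_deriv i (partial_deriv i \<rho>)) (v t) \<bullet> z = - (p i t \<bullet> conv (\<lambda>x. partial_deriv i \<rho> (- x)) z)"
      unfolding eq using conv_adjoint[OF kernels(2), of i "p i t" z] by simp
    also have "\<dots> = p i t \<bullet> conv (partial_deriv i \<rho>) z"
    proof -
      have "(\<lambda>x. partial_deriv i \<rho> (- x)) = (\<lambda>x. - partial_deriv i \<rho> x)"
        by (rule ext) (rule partial_deriv_even[OF \<rho>, OF even])
      then show ?thesis by (simp only: conv_uminus[OF kernels(2)] inner_minus_right minus_minus)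
    qed
    finally show ?thesis using weak_partial_corr[OF \<rho> g(2), of i] g(1) by simp
  qed
  then have "(\<Sum>i\<in>UNIV. p i t \<bullet> cls (weak_partial i (corr \<rho> g))) = - (conv laplacian_\<rho> (v t) \<bullet> z)"
    unfolding laplacian_\<rho>_def[abs_def] by (simp add: conv_sum kernels inner_sum_left sum_negf)
  then show "((\<lambda>s. W s \<bullet> z) has_real_derivative (conv laplacian_\<rho> (v t) - b t *\<^sub>R W t) \<bullet> z) (at t)"
    using deriv_w[OF t corr_H1[OF \<rho> g(2)]] by (simp add: W_def adj inner_diff_left)
qed

definition "step j = 1 / real (Suc j)"

lemma step: "step \<longlonglongrightarrow> 0" "0 < step j" "step j \<le> 1"
  using LIMSEQ_inverse_real_of_nat by (auto simp: step_def[abs_def] inverse_eq_divide)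

text \<open>The consistency error of the second difference quotient of the mollifier.\<close>

definition "residue i j y = (1 / (step j)\<^sup>2) * (\<rho> (y + step j *\<^sub>R axis i 1) + \<rho> (y - step j *\<^sub>R axis i 1) - 2 * \<rho> y)
  - partial_deriv i (partial_deriv i \<rho>) y"

lemma residue_L1: "(\<lambda>j. LINT y|lborel. \<bar>residue i j y\<bar>) \<longlonglongrightarrow> 0"
  unfolding residue_def using second_difference_L1[OF \<rho> step] .

lemma kernel_residue: "kernel (residue i j)"
  unfolding residue_def[abs_def]
  by (intro kernel_diff kernel_mult kernel_add kernel_shift kernel_diff_shift kernels)

text \<open>The sum on the left is a difference, because \<open>discrete_laplacian\<close>
  approximates - \<Delta>; all difference quotients act on the kernel, and v itself need not be
  smooth.\<close>

lemma discrete_laplacian_residue: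
  "discrete_laplacian (step j) (U t) + conv laplacian_\<rho> (v t) = - (\<Sum>i\<in>UNIV. conv (residue i j) (v t))"
proof -
  have "(1 / (step j)\<^sup>2) *\<^sub>R (2 *\<^sub>R U t - shift (step j *\<^sub>R axis i 1) (U t) - shift (- (step j *\<^sub>R axis i 1)) (U t))
      + conv (partial_deriv i (partial_deriv i \<rho>)) (v t) = - conv (residue i j) (v t)" for i
  proof -
    let ?e = "step j *\<^sub>R axis i 1 :: real ^ 'n"
    have s: "shift ?e (U t) = conv (\<lambda>y. \<rho> (y - ?e)) (v t)" "shift (- ?e) (U t) = conv (\<lambda>y. \<rho> (y + ?e)) (v t)"
      using shift_conv[OF kernels(1), of ?e "v t"] shift_conv[OF kernels(1), of "- ?e" "v t"] by (simp_all add: U_def)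
    note s' = s[unfolded U_def]
    note k1 = kernel_shift[OF kernels(1), of ?e] and k2 = kernel_diff_shift[OF kernels(1), of ?e]
    note k3 = kernel_mult[OF kernels(1), of 2]
    have "conv (residue i j) (v t) = (1 / (step j)\<^sup>2) *\<^sub>R (shift (- ?e) (U t) + shift ?e (U t) - 2 *\<^sub>R U t)
        - conv (partial_deriv i (partial_deriv i \<rho>)) (v t)"
      unfolding residue_def[abs_def] conv_diff[OF kernel_mult[OF kernel_diff[OF kernel_add[OF k1 k2] k3]] kernels(3)]
        conv_mult[OF kernel_diff[OF kernel_add[OF k1 k2] k3]] conv_diff[OF kernel_add[OF k1 k2] k3] conv_add[OF k1 k2]
        conv_mult[OF kernels(1)] U_def s' by (rule refl)
    then show ?thesis by (simp add: algebra_simps)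
  qed note * = this
  have "discrete_laplacian (step j) (U t) + conv laplacian_\<rho> (v t)
      = (\<Sum>i\<in>UNIV. (1 / (step j)\<^sup>2) *\<^sub>R (2 *\<^sub>R U t - shift (step j *\<^sub>R axis i 1) (U t) - shift (- (step j *\<^sub>R axis i 1)) (U t))
      + conv (partial_deriv i (partial_deriv i \<rho>)) (v t))"
    unfolding discrete_laplacian_def laplacian_\<rho>_def[abs_def] conv_sum[OF kernels(3)] by (rule sum.distrib[symmetric])
  also have "\<dots> = (\<Sum>i\<in>UNIV. - conv (residue i j) (v t))" unfolding * by (rule refl)
  finally show ?thesis by (simp add: sum_negf)
qed

lemma discrete_energy_tendsto:
  assumes t: "0 \<le> t"
  shows "(\<lambda>j. discrete_laplacian (step j) (U t) \<bullet> U t) \<longlonglongrightarrow> (\<Sum>i\<in>UNIV. (norm (conv \<rho> (p i t)))\<^sup>2)"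
  unfolding discrete_laplacian_inner
proof (intro tendsto_sum tendsto_power tendsto_norm)
  fix i :: 'n
  \<comment> \<open>\<open>corr\<close> involves \<rho>(y - x), so translating the function by +h
    moves the argument of the kernel by -h; hence the negative steps.\<close>
  let ?k = "\<lambda>j y. (1 / - step j) * (\<rho> (y + (- step j) *\<^sub>R axis i 1) - \<rho> y)"
  have k: "kernel (?k j)" for j by (intro kernel_mult kernel_diff kernel_shift kernels)
  have "(\<lambda>j. - step j) \<longlonglongrightarrow> 0" using tendsto_minus[OF step(1)] by simp
  moreover have "- step j \<noteq> 0" "\<bar>- step j\<bar> \<le> 1" for j using step(2,3)[of j] by auto
  ultimately have "(\<lambda>j. LINT y|lborel. \<bar>?k j y - partial_deriv i \<rho> y\<bar>) \<longlonglongrightarrow> 0"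
    by (rule difference_quotient_L1[OF \<rho>])
  from tendsto_minus[OF conv_tendsto[OF k kernels(2) this, of "v t"]]
  have lim: "(\<lambda>j. - conv (?k j) (v t)) \<longlonglongrightarrow> - conv (partial_deriv i \<rho>) (v t)" .
  have "(1 / step j) *\<^sub>R (shift (step j *\<^sub>R axis i 1) (U t) - U t) = - conv (?k j) (v t)" for j
  proof -
    have "(1 / step j) *\<^sub>R (shift (step j *\<^sub>R axis i 1) (U t) - U t) = conv (\<lambda>y. (1 / step j) * (\<rho> (y - step j *\<^sub>R axis i 1) - \<rho> y)) (v t)"
      unfolding U_def by (rule conv_eq_difference_quotient[OF kernels(1)])
    also have "(\<lambda>y. (1 / step j) * (\<rho> (y - step j *\<^sub>R axis i 1) - \<rho> y)) = (\<lambda>y. - ?k j y)" by (rule ext) simp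
    also have "conv (\<lambda>y. - ?k j y) (v t) = - conv (?k j) (v t)" by (rule conv_uminus[OF k])
    finally show ?thesis .
  qed
  moreover have "- conv (partial_deriv i \<rho>) (v t) = conv \<rho> (p i t)"
    using conv_weak_partial[OF \<rho> u_H1[OF t], of i] by (simp add: v_def p_def)
  ultimately show "(\<lambda>j. (1 / step j) *\<^sub>R (shift (step j *\<^sub>R axis i 1) (U t) - U t)) \<longlonglongrightarrow> conv \<rho> (p i t)"
    using lim by simp
qed

text \<open>The order of limits matters: \<epsilon> is kept fixed while the mesh tends to zero, and
  tends to zero afterwards. The numbers \<open>L\<close> and \<open>B\<close> depend on neither of
  them.\<close>

lemma mollified_estimate:
  fixes D L \<tau> :: real
  assumes \<tau>: "0 \<le> \<tau>" and est: "\<And>A \<Lambda> r \<epsilon> B.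
      bounded_linear A \<Longrightarrow> (\<And>x y. A x \<bullet> y = x \<bullet> A y) \<Longrightarrow> (\<And>x. 0 \<le> A x \<bullet> x) \<Longrightarrow> (\<And>x. A x \<bullet> x \<le> \<Lambda> * (x \<bullet> x)) \<Longrightarrow>
      0 < \<Lambda> \<Longrightarrow> 0 < \<epsilon> \<Longrightarrow>
      (\<And>t. t \<in> {0..\<tau>} \<Longrightarrow> (U has_vector_derivative W t) (at t within {0..\<tau>})) \<Longrightarrow>
      (\<And>t. t \<in> {0..\<tau>} \<Longrightarrow> (W has_vector_derivative - b t *\<^sub>R W t - A (U t) + r t) (at t within {0..\<tau>})) \<Longrightarrow>
      continuous_on {0..\<tau>} r \<Longrightarrow> (\<And>t. t \<in> {0..\<tau>} \<Longrightarrow> norm (r t) \<le> \<epsilon>) \<Longrightarrow>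
      (\<And>t. t \<in> {0..\<tau>} \<Longrightarrow> U t \<bullet> U t + A (U t) \<bullet> U t + W t \<bullet> W t \<le> B) \<Longrightarrow>
      W \<tau> \<bullet> W \<tau> + A (U \<tau>) \<bullet> U \<tau> \<le> D * (W 0 \<bullet> W 0 + U 0 \<bullet> U 0 + A (U 0) \<bullet> U 0) + L * (\<epsilon> * (3 + B))"
  shows "W \<tau> \<bullet> W \<tau> + (\<Sum>i\<in>UNIV. (norm (conv \<rho> (p i \<tau>)))\<^sup>2)
    \<le> D * (W 0 \<bullet> W 0 + U 0 \<bullet> U 0 + (\<Sum>i\<in>UNIV. (norm (conv \<rho> (p i 0)))\<^sup>2))" (is "?X \<le> D * ?Y")
proof -
  have sub: "{0..\<tau>} \<subseteq> {0..}" by auto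
  have bounded: "\<exists>B. \<forall>t\<in>{0..\<tau>}. f t \<le> B" if "continuous_on {0..\<tau>} f" for f :: "real \<Rightarrow> real"
  proof -
    have "bounded (f ` {0..\<tau>})" by (intro compact_imp_bounded compact_continuous_image that) simp
    then obtain B where "\<forall>y\<in>f ` {0..\<tau>}. norm y \<le> B" unfolding bounded_iff by blast
    then have "\<forall>t\<in>{0..\<tau>}. f t \<le> B" by (auto simp: abs_le_iff)
    then show ?thesis by blast
  qed
  note cont = continuous_on_subset[OF continuous_U sub] continuous_on_subset[OF continuous_W sub] continuous_on_subset[OF continuous_v sub]
  \<comment> \<open>A bound for the discrete energy that is uniform in the mesh: the discrete
    Laplacian of U is r minus the convolution of v with \<open>laplacian_\<rho>\<close>, and |r| <=
    \<epsilon> <= 1. The operator norm could not be used, as it grows with the mesh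
    refinement.\<close>
  have "continuous_on {0..\<tau>} (\<lambda>t. U t \<bullet> U t + (1 + norm (conv laplacian_\<rho> (v t))) * norm (U t) + W t \<bullet> W t)"
    by (intro continuous_intros cont conv_continuous_on kernels)
  then obtain B where B: "\<And>t. t \<in> {0..\<tau>} \<Longrightarrow> U t \<bullet> U t + (1 + norm (conv laplacian_\<rho> (v t))) * norm (U t) + W t \<bullet> W t \<le> B"
    using bounded by blast
  obtain V where V: "\<And>t. t \<in> {0..\<tau>} \<Longrightarrow> norm (v t) \<le> V"
    using bounded[OF continuous_on_norm[OF cont(3)]] by blast
  have V0: "0 \<le> V" using V[of 0] \<tau> norm_ge_zero[of "v 0"] by (meson atLeastAtMost_iff order_refl order_trans)
  have upper: "?X \<le> D * ?Y + L * (\<epsilon> * (3 + B))" if \<epsilon>: "0 < \<epsilon>" "\<epsilon> \<le> 1" for \<epsilon>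
  proof (rule tendsto_le[OF sequentially_bot])
    let ?A = "\<lambda>j. discrete_laplacian (step j)"
    show "(\<lambda>j. W \<tau> \<bullet> W \<tau> + ?A j (U \<tau>) \<bullet> U \<tau>) \<longlonglongrightarrow> ?X"
      by (intro tendsto_intros discrete_energy_tendsto \<tau>)
    show "(\<lambda>j. D * (W 0 \<bullet> W 0 + U 0 \<bullet> U 0 + ?A j (U 0) \<bullet> U 0) + L * (\<epsilon> * (3 + B))) \<longlonglongrightarrow> D * ?Y + L * (\<epsilon> * (3 + B))"
      by (intro tendsto_intros discrete_energy_tendsto) simp
    have "(\<lambda>j. (\<Sum>i\<in>UNIV. LINT y|lborel. \<bar>residue i j y\<bar>) * V) \<longlonglongrightarrow> (\<Sum>i\<in>(UNIV :: 'n set). 0) * V"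
      by (intro tendsto_intros residue_L1)
    then have "eventually (\<lambda>j. (\<Sum>i\<in>UNIV. LINT y|lborel. \<bar>residue i j y\<bar>) * V < \<epsilon>) sequentially"
      using \<epsilon> by (intro order_tendstoD(2)) auto
    then show "eventually (\<lambda>j. W \<tau> \<bullet> W \<tau> + ?A j (U \<tau>) \<bullet> U \<tau> \<le> D * (W 0 \<bullet> W 0 + U 0 \<bullet> U 0 + ?A j (U 0) \<bullet> U 0) + L * (\<epsilon> * (3 + B))) sequentially"
    proof eventually_elim
      case (elim j)
      define r where "r t = ?A j (U t) + conv laplacian_\<rho> (v t)" for t
      have r: "norm (r t) \<le> \<epsilon>" if t: "t \<in> {0..\<tau>}" for t
      proof -
        have "norm (r t) \<le> (\<Sum>i\<in>UNIV. norm (conv (residue i j) (v t)))"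
          unfolding r_def discrete_laplacian_residue norm_minus_cancel by (rule norm_sum)
        also have "\<dots> \<le> (\<Sum>i\<in>UNIV. (LINT y|lborel. \<bar>residue i j y\<bar>) * norm (v t))"
          by (intro sum_mono norm_conv_le kernel_residue)
        also have "\<dots> \<le> (\<Sum>i\<in>UNIV. (LINT y|lborel. \<bar>residue i j y\<bar>) * V)"
          by (intro sum_mono mult_left_mono V t) simp
        also have "\<dots> \<le> \<epsilon>" using elim by (simp add: sum_distrib_right)
        finally show ?thesis .
      qed
      show ?case
      proof (rule est[where \<Lambda> = "4 * real CARD('n) / (step j)\<^sup>2" and r = r])
        show "?A j x \<bullet> y = x \<bullet> ?A j y" for x y by (rule discrete_laplacian_symmetric)
        show "0 \<le> ?A j x \<bullet> x" for x unfolding discrete_laplacian_inner by (intro sum_nonneg) simp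
        show "?A j x \<bullet> x \<le> 4 * real CARD('n) / (step j)\<^sup>2 * (x \<bullet> x)" for x :: "'n l2" by (rule discrete_laplacian_le)
        show "0 < 4 * real CARD('n) / (step j)\<^sup>2" using step(2)[of j] by simp
        show "continuous_on {0..\<tau>} r"
          unfolding r_def[abs_def]
          by (intro continuous_intros conv_continuous_on cont kernels bounded_linear.continuous_on[OF bounded_linear_discrete_laplacian])
        fix t assume t: "t \<in> {0..\<tau>}"
        show "(U has_vector_derivative W t) (at t within {0..\<tau>})"
          by (rule has_vector_derivative_within_subset[OF deriv_U sub]) (use t in simp)
        have "- b t *\<^sub>R W t - ?A j (U t) + r t = conv laplacian_\<rho> (v t) - b t *\<^sub>R W t" by (simp add: r_def)
        then show "(W has_vector_derivative - b t *\<^sub>R W t - ?A j (U t) + r t) (at t within {0..\<tau>})"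
          using has_vector_derivative_within_subset[OF deriv_W[of t] sub] t by (simp only: atLeastAtMost_iff)
        have "?A j (U t) \<bullet> U t = (r t - conv laplacian_\<rho> (v t)) \<bullet> U t" by (simp add: r_def)
        also have "\<dots> \<le> norm (r t - conv laplacian_\<rho> (v t)) * norm (U t)" by (rule norm_cauchy_schwarz)
        also have "\<dots> \<le> (1 + norm (conv laplacian_\<rho> (v t))) * norm (U t)"
          using norm_triangle_ineq4[of "r t" "conv laplacian_\<rho> (v t)"] r[OF t] \<epsilon>(2) by (intro mult_right_mono) auto
        finally show "U t \<bullet> U t + ?A j (U t) \<bullet> U t + W t \<bullet> W t \<le> B" using B[OF t] by linarith
      qed (use \<epsilon> r bounded_linear_discrete_laplacian in auto)
    qed
  qed
  \<comment> \<open>\<open>step n\<close> serves here as a sequence of values of \<epsilon> in (0,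
    1] that tends to zero.\<close>
  have "?X \<le> D * ?Y + L * (step n * (3 + B))" for n using upper step(2,3) .
  moreover have "(\<lambda>n. D * ?Y + L * (step n * (3 + B))) \<longlonglongrightarrow> D * ?Y + L * (0 * (3 + B))"
    by (intro tendsto_intros step)
  ultimately have "?X \<le> D * ?Y + L * (0 * (3 + B))" by (intro LIMSEQ_le_const) auto
  then show ?thesis by simp
qed

end

context oscillating_damping
begin

text \<open>The factor of the initial energy comes from the oscillators and sees neither the
  mollifier nor the mesh, so the mollified inequalities pass to the limit with the same
  constant.\<close>

lemma wave_estimate:
  obtains C where "0 < C" "\<And>u0 u1 (u :: real \<Rightarrow> (real ^ 'n::finite) \<Rightarrow> complex) t.
     energy_solution b u0 u1 u \<Longrightarrow> u0 \<in> H1 \<Longrightarrow> 0 \<le> t \<Longrightarrow>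
     energy u t \<le> C * (energy u 0 + (L2_norm u0)\<^sup>2) * exp (- I (max T t))"
proof (rule bounded_operator_estimate[where 'a = "'n l2"])
  fix C :: real and K :: "real \<Rightarrow> real"
  assume C: "0 < C" "\<And>t. 0 \<le> K t" and est:
    "\<And>(A :: 'n l2 \<Rightarrow> 'n l2) \<Lambda> U W r \<tau> \<epsilon> B.
      bounded_linear A \<Longrightarrow> (\<And>x y. A x \<bullet> y = x \<bullet> A y) \<Longrightarrow> (\<And>x. 0 \<le> A x \<bullet> x) \<Longrightarrow> (\<And>x. A x \<bullet> x \<le> \<Lambda> * (x \<bullet> x)) \<Longrightarrow>
      0 < \<Lambda> \<Longrightarrow> 0 \<le> \<tau> \<Longrightarrow> 0 < \<epsilon> \<Longrightarrow>
      (\<And>t. t \<in> {0..\<tau>} \<Longrightarrow> (U has_vector_derivative W t) (at t within {0..\<tau>})) \<Longrightarrow>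
      (\<And>t. t \<in> {0..\<tau>} \<Longrightarrow> (W has_vector_derivative - b t *\<^sub>R W t - A (U t) + r t) (at t within {0..\<tau>})) \<Longrightarrow>
      continuous_on {0..\<tau>} r \<Longrightarrow> (\<And>t. t \<in> {0..\<tau>} \<Longrightarrow> norm (r t) \<le> \<epsilon>) \<Longrightarrow>
      (\<And>t. t \<in> {0..\<tau>} \<Longrightarrow> U t \<bullet> U t + A (U t) \<bullet> U t + W t \<bullet> W t \<le> B) \<Longrightarrow>
      W \<tau> \<bullet> W \<tau> + A (U \<tau>) \<bullet> U \<tau> \<le> C * exp (- I (max T \<tau>)) * (W 0 \<bullet> W 0 + U 0 \<bullet> U 0 + A (U 0) \<bullet> U 0)
        + K \<tau> * (\<tau> * (\<epsilon> * (3 + B)))"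
  show thesis
  proof (rule that[OF C(1)])
    fix u0 u1 and u :: "real \<Rightarrow> (real ^ 'n) \<Rightarrow> complex" and \<tau> :: real
    assume sol: "energy_solution b u0 u1 u" and u0: "u0 \<in> H1" and \<tau>: "0 \<le> \<tau>"
    interpret wave_solution b u0 u1 u by (rule wave_solution.intro[OF sol u0 b])
    define D where "D = C * exp (- I (max T \<tau>))"
    obtain \<rho> :: "nat \<Rightarrow> (real ^ 'n) \<Rightarrow> real" where "(\<forall>j. test_function (\<rho> j)) \<and> (\<forall>j x. \<rho> j (- x) = \<rho> j x) \<and>
       (\<forall>j. (LINT x|lborel. \<bar>\<rho> j x\<bar>) = 1) \<and> (\<forall>x. (\<lambda>j. conv (\<rho> j) x) \<longlonglongrightarrow> x)"
      using mollifiers ..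
    then have \<rho>: "test_function (\<rho> j)" "\<rho> j (- x) = \<rho> j x" and lim: "(\<lambda>j. conv (\<rho> j) z) \<longlonglongrightarrow> z" for j x z by simp_all
    have *: "conv (\<rho> j) (w \<tau>) \<bullet> conv (\<rho> j) (w \<tau>) + (\<Sum>i\<in>UNIV. (norm (conv (\<rho> j) (p i \<tau>)))\<^sup>2)
      \<le> D * (conv (\<rho> j) (w 0) \<bullet> conv (\<rho> j) (w 0) + conv (\<rho> j) (v 0) \<bullet> conv (\<rho> j) (v 0) + (\<Sum>i\<in>UNIV. (norm (conv (\<rho> j) (p i 0)))\<^sup>2))" for j
    proof -
      interpret mollified_wave b u0 u1 u "\<rho> j"
        by (intro mollified_wave.intro mollified_wave_axioms.intro wave_solution_axioms \<rho>)
      show ?thesis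
        unfolding W_def[symmetric] U_def[symmetric]
      proof (rule mollified_estimate[OF \<tau>, where L = "K \<tau> * \<tau>"])
        fix A :: "'n l2 \<Rightarrow> 'n l2" and \<Lambda> \<epsilon> B :: real and r
        assume a: "bounded_linear A" "\<And>x y. A x \<bullet> y = x \<bullet> A y" "\<And>x. 0 \<le> A x \<bullet> x" "\<And>x. A x \<bullet> x \<le> \<Lambda> * (x \<bullet> x)"
          "0 < \<Lambda>" "0 < \<epsilon>" "\<And>t. t \<in> {0..\<tau>} \<Longrightarrow> (U has_vector_derivative W t) (at t within {0..\<tau>})"
          "\<And>t. t \<in> {0..\<tau>} \<Longrightarrow> (W has_vector_derivative - b t *\<^sub>R W t - A (U t) + r t) (at t within {0..\<tau>})"
          "continuous_on {0..\<tau>} r" "\<And>t. t \<in> {0..\<tau>} \<Longrightarrow> norm (r t) \<le> \<epsilon>"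
          "\<And>t. t \<in> {0..\<tau>} \<Longrightarrow> U t \<bullet> U t + A (U t) \<bullet> U t + W t \<bullet> W t \<le> B"
        have "W \<tau> \<bullet> W \<tau> + A (U \<tau>) \<bullet> U \<tau> \<le> C * exp (- I (max T \<tau>)) * (W 0 \<bullet> W 0 + U 0 \<bullet> U 0 + A (U 0) \<bullet> U 0)
          + K \<tau> * (\<tau> * (\<epsilon> * (3 + B)))"
          by (rule est[where U = U and W = W and A = A and r = r and \<Lambda> = \<Lambda> and \<epsilon> = \<epsilon> and B = B and \<tau> = \<tau>])
            (fact a \<tau>)+
        then show "W \<tau> \<bullet> W \<tau> + A (U \<tau>) \<bullet> U \<tau> \<le> D * (W 0 \<bullet> W 0 + U 0 \<bullet> U 0 + A (U 0) \<bullet> U 0) + K \<tau> * \<tau> * (\<epsilon> * (3 + B))"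
          by (simp only: D_def mult.assoc)
      qed
    qed
    have "w \<tau> \<bullet> w \<tau> + (\<Sum>i\<in>UNIV. (norm (p i \<tau>))\<^sup>2) \<le> D * (w 0 \<bullet> w 0 + v 0 \<bullet> v 0 + (\<Sum>i\<in>UNIV. (norm (p i 0))\<^sup>2))"
    proof (rule LIMSEQ_le)
      show "(\<lambda>j. conv (\<rho> j) (w \<tau>) \<bullet> conv (\<rho> j) (w \<tau>) + (\<Sum>i\<in>UNIV. (norm (conv (\<rho> j) (p i \<tau>)))\<^sup>2))
        \<longlonglongrightarrow> w \<tau> \<bullet> w \<tau> + (\<Sum>i\<in>UNIV. (norm (p i \<tau>))\<^sup>2)"
        by (intro tendsto_intros lim)
      show "(\<lambda>j. D * (conv (\<rho> j) (w 0) \<bullet> conv (\<rho> j) (w 0) + conv (\<rho> j) (v 0) \<bullet> conv (\<rho> j) (v 0) + (\<Sum>i\<in>UNIV. (norm (conv (\<rho> j) (p i 0)))\<^sup>2)))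
        \<longlonglongrightarrow> D * (w 0 \<bullet> w 0 + v 0 \<bullet> v 0 + (\<Sum>i\<in>UNIV. (norm (p i 0))\<^sup>2))"
        by (intro tendsto_intros lim)
    qed (use * in blast)
    then have "2 * energy u \<tau> \<le> D * (2 * energy u 0 + (L2_norm u0)\<^sup>2)"
      using energy_eq[OF \<tau>] energy_eq[of 0] by (simp add: dot_square_norm norm_v0 algebra_simps)
    moreover have "D * (2 * energy u 0 + (L2_norm u0)\<^sup>2) \<le> D * (2 * (energy u 0 + (L2_norm u0)\<^sup>2))"
      using C by (intro mult_left_mono) (auto simp: D_def)
    ultimately have "energy u \<tau> \<le> D * (energy u 0 + (L2_norm u0)\<^sup>2)" by (simp add: algebra_simps)
    then show "energy u \<tau> \<le> C * (energy u 0 + (L2_norm u0)\<^sup>2) * exp (- I (max T \<tau>))" by (simp add: D_def mult_ac)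
  qed
qed

end

section \<open>Improper integrals and the conclusion\<close>

lemma integral_tail:
  fixes f :: "real \<Rightarrow> real"
  assumes f: "f integrable_on {a..}" and t: "a \<le> t"
  shows "f integrable_on {a..t}" "f integrable_on {t..}" "integral {a..} f = integral {a..t} f + integral {t..} f"
proof -
  show i: "f integrable_on {a..t}" by (rule integrable_on_subinterval[OF f]) auto
  have d: "(f has_integral (integral {a..} f - integral {a..t} f)) ({a..} - {a..t})"
    by (rule has_integral_setdiff) (use f i in \<open>auto intro!: integrable_integral\<close>)
  have "(f has_integral (integral {a..} f - integral {a..t} f)) {t..}"
    by (rule has_integral_spike_set_eq[THEN iffD1, OF _ _ d]; rule negligible_subset[of "{t}"]) (use t in auto)
  then show "f integrable_on {t..}" "integral {a..} f = integral {a..t} f + integral {t..} f"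
    by (auto simp: has_integral_integrable_integral)
qed

text \<open>For large t the bound is the convergence of the improper integral with tolerance 1, on
  the remaining compact interval it is continuity of the indefinite integral.\<close>

lemma integral_initial_bounded:
  fixes f :: "real \<Rightarrow> real"
  assumes f: "f integrable_on {a..}"
  obtains B where "\<And>t. a \<le> t \<Longrightarrow> \<bar>integral {a..t} f\<bar> \<le> B"
proof -
  let ?g = "\<lambda>x. if x \<in> {a..} then f x else 0"
  have "(f has_integral integral {a..} f) {a..}" using f by (rule integrable_integral)
  then have "\<exists>B>0. \<forall>c d. ball 0 B \<subseteq> cbox c d \<longrightarrow>
      (\<exists>z. (?g has_integral z) (cbox c d) \<and> norm (z - integral {a..} f) < 1)"
    by (rule has_integral'[THEN iffD1, rule_format, OF _ zero_less_one])
  then obtain R where R: "0 < R" "\<And>c d. ball 0 R \<subseteq> cbox c d \<Longrightarrow>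
      \<exists>z. (?g has_integral z) (cbox c d) \<and> norm (z - integral {a..} f) < 1" by blast
  have far: "\<bar>integral {a..t} f\<bar> \<le> \<bar>integral {a..} f\<bar> + 1" if t: "max R a \<le> t" for t
  proof -
    \<comment> \<open>Convergence is expressed by intervals containing a ball about 0, so the left
      end point must be at most - R; f is extended by zero below a.\<close>
    have "ball 0 R \<subseteq> cbox (min (- R) a) t" using t by (auto simp: dist_real_def)
    from R(2)[OF this] obtain z where z: "(?g has_integral z) {min (- R) a..t}" "norm (z - integral {a..} f) < 1"
      by auto
    have "((\<lambda>x. if x \<in> {a..t} then f x else 0) has_integral z) {min (- R) a..t}"
      by (rule has_integral_eq[OF _ z(1)]) auto
    then have "(f has_integral z) ({a..t})"
      by (subst (asm) has_integral_restrict) auto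
    then show ?thesis using z(2) by (auto dest!: integral_unique)
  qed
  have "continuous_on {a..max R a} (\<lambda>t. integral {a..t} f)"
    by (rule indefinite_integral_continuous_1[OF integrable_on_subinterval[OF f]]) auto
  then have "bounded ((\<lambda>t. integral {a..t} f) ` {a..max R a})"
    by (intro compact_imp_bounded compact_continuous_image) auto
  then obtain B where "\<forall>y\<in>(\<lambda>t. integral {a..t} f) ` {a..max R a}. norm y \<le> B" unfolding bounded_iff by blast
  then have near: "\<bar>integral {a..t} f\<bar> \<le> B" if "a \<le> t" "t \<le> max R a" for t using that by auto
  have "\<bar>integral {a..t} f\<bar> \<le> max B (\<bar>integral {a..} f\<bar> + 1)" if "a \<le> t" for t
    using far[of t] near[OF that] by (cases "t \<le> max R a") linarith+
  then show thesis by (rule that)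
qed

lemma C_m_continuous:
  assumes "C_m m f" "0 < m" shows "continuous_on {0..} f"
proof -
  have "\<forall>t\<ge>0. f differentiable (at t within {0..})" using assms by (auto simp: C_m_def dest: spec[of _ 0])
  then show ?thesis by (auto simp: continuous_on_eq_continuous_within intro: differentiable_imp_continuous_within)
qed

theorem theorem2p1:
  fixes m :: nat and b \<mu> \<sigma> \<Theta> \<Xi> :: "real \<Rightarrow> real"
  assumes "m > 0"
    and A1: "principal_part b \<mu>"
    and \<sigma>: "\<sigma> = (\<lambda>t. b t - \<mu> t)"
    and A2: "abs_tail \<sigma> integrable_on {0..}"
    and A3: "C_m m b"
    and \<Theta>: "\<forall>t\<ge>0. \<Theta> t > 0" "strict_mono_on {0..} \<Theta>" "continuous_on {0..} \<Theta>"
    and \<Xi>: "\<forall>t\<ge>0. \<Xi> t > 0" "mono_on {0..} \<Xi> \<or> antimono_on {0..} \<Xi>" "continuous_on {0..} \<Xi>"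
    and stabilization: "\<forall>t\<ge>0. integral {t..} (abs_tail \<sigma>) \<le> 1 / \<Theta> t"
    and derivatives: "\<forall>t\<ge>0. \<forall>k\<le>m. \<bar>nth_deriv k b t\<bar> \<le> \<Xi> t ^ (k + 1)"
    and "bdd_above ((\<lambda>t. \<Xi> t / \<Theta> t) ` {0..})"
    and "bdd_above ((\<lambda>t. integral {0..t} (\<lambda>s. \<Xi> s ^ (m + 1)) / \<Theta> t ^ m) ` {0..})"
  shows "\<exists>C>0. \<forall>u0\<in>H1. \<forall>u1\<in>L2. \<forall>u :: real \<Rightarrow> (real ^ 'n) \<Rightarrow> complex.
           energy_solution b u0 u1 u \<longrightarrow>
           (\<forall>t\<ge>0. energy u t \<le> C * (energy u 0 + (L2_norm u0)\<^sup>2) * exp (- integral {0..t} \<mu>))"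
proof -
  from A1 obtain T where T: "0 \<le> T" and bdd: "bdd_above ((\<lambda>t. (1 + t) * \<mu> t) ` {T..})"
    and sup: "(SUP t\<in>{T..}. (1 + t) * \<mu> t) < 1" and \<mu>_pos: "\<And>t. T \<le> t \<Longrightarrow> 0 < \<mu> t"
    and \<mu>': "\<And>t. T \<le> t \<Longrightarrow> \<exists>d<0. (\<mu> has_real_derivative d) (at t within {0..})"
    unfolding principal_part_def by blast
  have int_\<sigma>: "\<sigma> integrable_on {0..}" using A1 by (simp add: principal_part_def \<sigma>)
  define \<mu>0 where "\<mu>0 = (SUP t\<in>{T..}. (1 + t) * \<mu> t)"
  have \<mu>_le: "(1 + t) * \<mu> t \<le> \<mu>0" if "T \<le> t" for t
    unfolding \<mu>0_def by (rule cSUP_upper[OF _ bdd]) (use that in simp)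
  have "0 \<le> \<mu>0" using \<mu>_le[of T] \<mu>_pos[of T] T by (smt (verit) mult_nonneg_nonneg)
  have cont_b: "continuous_on {0..} b" using C_m_continuous[OF A3 \<open>m > 0\<close>] .
  have cont_\<mu>: "continuous_on {T..} \<mu>"
    unfolding continuous_on_eq_continuous_within
  proof
    fix t assume "t \<in> {T..}"
    then obtain d where "(\<mu> has_real_derivative d) (at t within {0..})" using \<mu>' by auto
    then show "continuous (at t within {T..}) \<mu>"
      using T by (intro continuous_within_subset[OF DERIV_continuous, of \<mu> d t "{0..}"]) auto
  qed
  have cont_\<sigma>: "continuous_on {T..} \<sigma>"
    unfolding \<sigma> using T by (intro continuous_on_diff cont_\<mu> continuous_on_subset[OF cont_b]) auto
  define S where "S t = integral {t..} \<sigma>" for t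
  note tail_0 = integral_tail[OF int_\<sigma>]
  have S': "(S has_real_derivative \<mu> t - b t) (at t within {T..})" if t: "T \<le> t" for t
  proof -
    have "((\<lambda>x. integral {T..x} \<sigma>) has_real_derivative \<sigma> t) (at t within {T..t + 1})"
      by (rule integral_has_real_derivative) (use t in \<open>auto intro: continuous_on_subset[OF cont_\<sigma>]\<close>)
    \<comment> \<open>The half-line and {T..t + 1} coincide near t, hence the derivatives within
      them do.\<close>
    then have "((\<lambda>x. integral {T..x} \<sigma>) has_real_derivative \<sigma> t) (at t within {T..})"
      using at_within_nhd[of t "{..<t + 1}" "{T..t + 1}" "{T..}"] by (simp add: set_eq_iff) (smt (verit))
    then have "((\<lambda>x. integral {T..} \<sigma> - integral {T..x} \<sigma>) has_real_derivative 0 - \<sigma> t) (at t within {T..})"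
      by (rule DERIV_diff[OF DERIV_const])
    then have D: "((\<lambda>x. integral {T..} \<sigma> - integral {T..x} \<sigma>) has_real_derivative \<mu> t - b t) (at t within {T..})"
      by (simp add: \<sigma>)
    have "integral {T..} \<sigma> - integral {T..x} \<sigma> = S x" if "x \<in> {T..}" for x
      using integral_tail(3)[OF tail_0(2)[OF T], of x] that by (simp add: S_def)
    with t show ?thesis
      by (intro has_field_derivative_transform_within[OF D zero_less_one]) auto
  qed
  \<comment> \<open>As \<sigma> may fail to be absolutely integrable, S is bounded through the
    initial integrals of \<sigma> and not through its modulus.\<close>
  obtain B where B: "\<And>t. 0 \<le> t \<Longrightarrow> \<bar>integral {0..t} \<sigma>\<bar> \<le> B" using integral_initial_bounded[OF int_\<sigma>] by blast
  have S_eq: "S t = integral {0..} \<sigma> - integral {0..t} \<sigma>" if "0 \<le> t" for t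
    using tail_0(3)[OF that] by (simp add: S_def)
  have S: "\<bar>S t\<bar> \<le> \<bar>integral {0..} \<sigma>\<bar> + B" if "T \<le> t" for t
    using S_eq[of t] B[of t] T that by linarith
  have tail: "integral {s..t} (\<lambda>x. \<bar>S x\<bar>) \<le> 1 / \<Theta> s" if "T \<le> s" "s \<le> t" for s t
  proof -
    have s: "0 \<le> s" using T that by simp
    note i = integral_tail[OF integral_tail(2)[OF A2 s] that(2)]
    have "0 \<le> integral {t..} (abs_tail \<sigma>)" by (intro integral_nonneg i) (simp add: abs_tail_def)
    then have "integral {s..t} (abs_tail \<sigma>) \<le> 1 / \<Theta> s" using i(3) stabilization s by fastforce
    then show ?thesis by (simp add: abs_tail_def[abs_def] S_def)
  qed
  obtain K1 where K1: "\<And>t. 0 \<le> t \<Longrightarrow> \<Xi> t / \<Theta> t \<le> K1"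
    using assms(14) unfolding bdd_above_def by auto
  obtain K2 where K2: "\<And>t. 0 \<le> t \<Longrightarrow> integral {0..t} (\<lambda>s. \<Xi> s ^ (m + 1)) / \<Theta> t ^ m \<le> K2"
    using assms(15) unfolding bdd_above_def by auto
  interpret oscillating_damping T \<mu>0 "\<bar>integral {0..} \<sigma>\<bar> + B" b \<mu> S \<Theta> m \<Xi> K1 K2
  proof
    show "mono_on {0..} \<Theta>" using \<Theta>(2) by (rule strict_mono_on_imp_mono_on)
    show "\<Xi> t \<le> K1 * \<Theta> t" if "0 \<le> t" for t
      using K1[OF that] \<Theta>(1) that by (simp add: pos_divide_le_eq)
    show "integral {0..t} (\<lambda>s. \<Xi> s ^ (m + 1)) \<le> K2 * \<Theta> t ^ m" if "0 \<le> t" for t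
      using K2[OF that] \<Theta>(1) that by (simp add: pos_divide_le_eq)
    show "\<exists>d<0. (\<mu> has_real_derivative d) (at t within {0..})" if "T \<le> t" for t by (rule \<mu>'[OF that])
    show "0 < \<mu> t" if "T \<le> t" for t by (rule \<mu>_pos[OF that])
    show "(1 + t) * \<mu> t \<le> \<mu>0" if "T \<le> t" for t by (rule \<mu>_le[OF that])
    show "(S has_real_derivative \<mu> t - b t) (at t within {T..})" if "T \<le> t" for t by (rule S'[OF that])
    show "\<bar>S t\<bar> \<le> \<bar>integral {0..} \<sigma>\<bar> + B" if "T \<le> t" for t by (rule S[OF that])
    show "0 < \<Theta> t" if "0 \<le> t" for t using \<Theta>(1) that by blast
    show "integral {s..t} (\<lambda>x. \<bar>S x\<bar>) \<le> 1 / \<Theta> s" if "T \<le> s" "s \<le> t" for s t by (rule tail[OF that])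
    show "0 < \<Xi> t" if "0 \<le> t" for t using \<Xi>(1) that by blast
    show "\<bar>nth_deriv k b t\<bar> \<le> \<Xi> t ^ (k + 1)" if "0 \<le> t" "k \<le> m" for t k using derivatives that by blast
  qed (fact T \<open>0 \<le> \<mu>0\<close> sup[folded \<mu>0_def] cont_b A3 \<Theta>(3) \<Xi>(3))+
  obtain C where C: "0 < C" "\<And>u0 u1 (u :: real \<Rightarrow> (real ^ 'n) \<Rightarrow> complex) t.
     energy_solution b u0 u1 u \<Longrightarrow> u0 \<in> H1 \<Longrightarrow> 0 \<le> t \<Longrightarrow>
     energy u t \<le> C * (energy u 0 + (L2_norm u0)\<^sup>2) * exp (- I (max T t))"
    using wave_estimate by blast
  have int_b: "b integrable_on {0..t}" for t
    by (rule integrable_continuous_real[OF continuous_on_subset[OF cont_b]]) auto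
  \<comment> \<open>Before time T nothing is known pointwise about \<mu>; its integrability there
    comes from \<mu> = b - \<sigma>.\<close>
  have int_\<mu>: "\<mu> integrable_on {0..t}" "integral {0..t} \<mu> = integral {0..t} b - integral {0..t} \<sigma>" if "0 \<le> t" for t
  proof -
    have "(\<lambda>s. b s - \<sigma> s) = \<mu>" by (simp add: \<sigma>)
    with integrable_diff[OF int_b[of t] tail_0(1)[OF that]] integral_diff[OF int_b[of t] tail_0(1)[OF that]]
    show "\<mu> integrable_on {0..t}" "integral {0..t} \<mu> = integral {0..t} b - integral {0..t} \<sigma>" by simp_all
  qed
  have "continuous_on {0..T} (\<lambda>t. integral {0..t} b)" by (rule indefinite_integral_continuous_1[OF int_b])
  then have "bounded ((\<lambda>t. integral {0..t} b) ` {0..T})"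
    by (intro compact_imp_bounded compact_continuous_image) auto
  then obtain b0 where "\<forall>y\<in>(\<lambda>t. integral {0..t} b) ` {0..T}. norm y \<le> b0" unfolding bounded_iff by blast
  then have b0: "\<bar>integral {0..t} b\<bar> \<le> b0" if "0 \<le> t" "t \<le> T" for t using that by auto
  \<comment> \<open>\<open>I\<close> starts at T, the exponent of the claim at 0. They differ by an
    integral of \<mu> = b - \<sigma> over an interval from 0 to a point of [0, T], which is at most
    b0 + B in modulus and becomes a factor of the constant.\<close>
  have exponent: "- I (max T t) \<le> (b0 + B) - integral {0..t} \<mu>" if t: "0 \<le> t" for t
  proof (cases "t \<le> T")
    case True
    then show ?thesis using int_\<mu>(2)[OF t] b0[OF t True] B[OF t] by (simp add: I_def max_absorb1)
  next
    case False
    then have "integral {0..t} \<mu> = integral {0..T} \<mu> + I (max T t)"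
      using Henstock_Kurzweil_Integration.integral_combine[OF T _ int_\<mu>(1)[OF t], of ] by (simp add: I_def max_absorb2)
    then show ?thesis using int_\<mu>(2)[OF T] b0[OF T order_refl] B[OF T] by linarith
  qed
  show ?thesis
  proof (intro exI[of _ "C * exp (b0 + B)"] conjI ballI allI impI)
    show "0 < C * exp (b0 + B)" using C(1) by simp
    fix u0 u1 and u :: "real \<Rightarrow> (real ^ 'n) \<Rightarrow> complex" and t :: real
    assume u: "u0 \<in> H1" "energy_solution b u0 u1 u" and t: "0 \<le> t"
    have "0 \<le> energy u 0 + (L2_norm u0)\<^sup>2"
      unfolding energy_def by (intro add_nonneg_nonneg mult_nonneg_nonneg sum_nonneg) auto
    then have "C * (energy u 0 + (L2_norm u0)\<^sup>2) * exp (- I (max T t))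
        \<le> C * (energy u 0 + (L2_norm u0)\<^sup>2) * exp ((b0 + B) - integral {0..t} \<mu>)"
      using C(1) exponent[OF t] by (intro mult_left_mono) auto
    also have "\<dots> = C * exp (b0 + B) * (energy u 0 + (L2_norm u0)\<^sup>2) * exp (- integral {0..t} \<mu>)"
      by (simp add: exp_diff exp_minus divide_inverse)
    finally show "energy u t \<le> C * exp (b0 + B) * (energy u 0 + (L2_norm u0)\<^sup>2) * exp (- integral {0..t} \<mu>)"
      using C(2)[OF u(2,1) t] by linarith
  qed
qed

end
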